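(* Let $(M^{m+d},H,g_H)$ be a compact connected sub-Riemannian manifold with $g_H=g|_H$ for a Riemannian metric $g$ on $M$, let $(N^n,h)$ be a Riemannian manifold, and let $f:M\to N$ be a smooth map. Let $\{f_t\}_{|t|<\epsilon}$ be a one-parameter family of maps $M\to N$ such that $(x,t)\mapsto f_t(x)$ belongs to $C^\infty(M\times(-\epsilon,\epsilon),N)$, $f_0=f$, and the variation vector field $V=\frac{\partial f_t}{\partial t}\big|_{t=0}\in\Gamma(f^{-1}TN)$ has compact support. Then $$\frac{d}{dt}E(f_t)\Big|_{t=0}=-\int_M e^{\frac{|df_H|^2}{2}}\langle V,\tau_H(f)\rangle\,dv_g,$$ where $$\tau_H(f)=\sum_{i=1}^m\beta_H(f)(e_i,e_i)-df(\zeta)+df_H\Big(\nabla\tfrac{|df_H|^2}{2}\Big).$$ Consequently, $f$ is exponentially subelliptic harmonic if and only if $\tau_H(f)=0$.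
   Context: Manifolds are without boundary. Let $(M^{m+d},g)$ be a compact connected Riemannian manifold of dimension $m+d$, $H\subset TM$ a smooth subbundle of rank $m$, and $g_H=g|_H$; the triple $(M,H,g_H)$ is called a sub-Riemannian manifold (no further condition on $H$ is imposed). $TM=H\oplus H^\perp$ is the $g$-orthogonal decomposition, $\pi_H:TM\to H$ is the orthogonal projection, and $\nabla$ is the Levi-Civita connection of $(M,g)$; applied to a function, $\nabla$ denotes the $g$-gradient. $\{e_1,\dots,e_m,e_{m+1},\dots,e_{m+d}\}$ is a local $g$-orthonormal frame of $TM$ with $e_i\in\Gamma(H)$ for $1\le i\le m$ and $e_\alpha\in\Gamma(H^\perp)$ for $m+1\le\alpha\le m+d$. Set $\zeta=\pi_H\big(\sum_{\alpha}\nabla_{e_\alpha}e_\alpha\big)$, a globally defined vector field. $dv_g$ is the Riemannian volume element. For a smooth map $f:M\to N$ into a Riemannian manifold $(N,h)$, $\langle\cdot,\cdot\rangle$ on $f^{-1}TN$ is induced by $h$, $\tilde\nabla^f$ is the pull-back to $f^{-1}TN$ of the Levi-Civita connection of $(N,h)$, $df_H=df\circ\pi_H$, and $|df_H|^2=\sum_{i=1}^m\langle df(e_i),df(e_i)\rangle$. The (horizontal) second fundamental form is $\beta_H(f)(X,Y)=\tilde\nabla^f_Y(df_H(X))-df_H(\nabla_YX)$ for $X,Y\in\Gamma(TM)$. The horizontal exponential energy is $E(f)=\int_M e^{\frac{|df_H|^2}{2}}\,dv_g$. A smooth map $f$ is called exponentially subelliptic harmonic if it is a critical point of $E$, i.e.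 $\frac{d}{dt}E(f_t)|_{t=0}=0$ for every smooth one-parameter family $f_t$ with $f_0=f$ whose variation vector field has compact support. *)

theory Defs
  imports "HOL-Analysis.Analysis" "HOL-Library.Function_Algebras"
begin

section \<open>Smooth manifolds and smooth maps\<close>

primrec Ck_on :: "nat \<Rightarrow> ('e::real_normed_vector \<Rightarrow> 'f::real_normed_vector) \<Rightarrow> 'e set \<Rightarrow> bool" where
  "Ck_on 0 f S \<longleftrightarrow> continuous_on S f"
| "Ck_on (Suc k) f S \<longleftrightarrow>
     (\<forall>x\<in>S. f differentiable (at x)) \<and> (\<forall>v. Ck_on k (\<lambda>x. frechet_derivative f (at x) v) S)"

text \<open>Only ever used for open \<open>S\<close>.\<close>

definition smooth_on :: "'e::real_normed_vector set \<Rightarrow> ('e \<Rightarrow> 'f::real_normed_vector) \<Rightarrow> bool" where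
  "smooth_on S f \<longleftrightarrow> (\<forall>k. Ck_on k f S)"

text \<open>
  A chart is a pair \<open>(U, \<phi>)\<close>. A manifold is given by an atlas, its underlying space being the union
  of the chart domains inside an ambient topological type; atlases need not be maximal.
  Hausdorffness and second countability come from the type classes of the ambient type.
\<close>

type_synonym ('a, 'e) chart = "'a set \<times> ('a \<Rightarrow> 'e)"

abbreviation cinv :: "('a, 'e) chart \<Rightarrow> 'e \<Rightarrow> 'a" where
  "cinv c \<equiv> inv_into (fst c) (snd c)"

definition is_chart :: "('a::topological_space, 'e::euclidean_space) chart \<Rightarrow> bool" where
  "is_chart c \<longleftrightarrow> open (fst c) \<and> open (snd c ` fst c)
     \<and> homeomorphism (fst c) (snd c ` fst c) (snd c) (cinv c)"

definition smooth_atlas :: "('a::topological_space, 'e::euclidean_space) chart set \<Rightarrow> bool" where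
  "smooth_atlas A \<longleftrightarrow> (\<forall>c\<in>A. is_chart c)
     \<and> (\<forall>c\<in>A. \<forall>c'\<in>A. smooth_on (snd c ` (fst c \<inter> fst c')) (snd c' \<circ> cinv c))"

definition pts :: "('a, 'e) chart set \<Rightarrow> 'a set" where
  "pts A = \<Union> (fst ` A)"

definition smooth_map_on ::
  "('a::topological_space, 'e::euclidean_space) chart set \<Rightarrow>
   ('b::topological_space, 'f::euclidean_space) chart set \<Rightarrow> 'a set \<Rightarrow> ('a \<Rightarrow> 'b) \<Rightarrow> bool" where
  "smooth_map_on A B S f \<longleftrightarrow> open S \<and> S \<subseteq> pts A \<and> f ` S \<subseteq> pts B \<and> continuous_on S f
     \<and> (\<forall>c\<in>A. \<forall>k\<in>B. smooth_on (snd c ` (fst c \<inter> S \<inter> f -` fst k)) (snd k \<circ> f \<circ> cinv c))"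

definition real_atlas :: "(real, real) chart set" where
  "real_atlas = {(UNIV, \<lambda>t. t)}"

definition interval_atlas :: "real \<Rightarrow> (real, real) chart set" where
  "interval_atlas \<epsilon> = {({- \<epsilon><..<\<epsilon>}, \<lambda>t. t)}"

definition prod_atlas :: "('a, 'e) chart set \<Rightarrow> ('b, 'f) chart set \<Rightarrow> ('a \<times> 'b, 'e \<times> 'f) chart set" where
  "prod_atlas A B = {(fst c \<times> fst k, map_prod (snd c) (snd k)) | c k. c \<in> A \<and> k \<in> B}"

definition smooth_fun_on ::
  "('a::topological_space, 'e::euclidean_space) chart set \<Rightarrow> 'a set \<Rightarrow> ('a \<Rightarrow> real) \<Rightarrow> bool" where
  "smooth_fun_on A S h \<longleftrightarrow> smooth_map_on A real_atlas S h"

definition smooth_fun_near ::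
  "('a::topological_space, 'e::euclidean_space) chart set \<Rightarrow> 'a \<Rightarrow> ('a \<Rightarrow> real) \<Rightarrow> bool" where
  "smooth_fun_near A x h \<longleftrightarrow> (\<exists>S. x \<in> S \<and> smooth_fun_on A S h)"

section \<open>Tangent vectors and vector fields\<close>

text \<open>
  A tangent vector at \<open>x\<close> is the velocity of a smooth curve through \<open>x\<close>, acting on the
  functions that are smooth near \<open>x\<close>; on all other functions it is set to \<open>0\<close>, so that equality of
  tangent vectors is equality of HOL functions. Addition, subtraction and \<open>0\<close> are the pointwise ones.
\<close>

type_synonym 'a tvec = "('a \<Rightarrow> real) \<Rightarrow> real"

definition velocity ::
  "('a::topological_space, 'e::euclidean_space) chart set \<Rightarrow> (real \<Rightarrow> 'a) \<Rightarrow> 'a tvec" where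
  "velocity A \<gamma> = (\<lambda>h. if smooth_fun_near A (\<gamma> 0) h then deriv (\<lambda>t. h (\<gamma> t)) 0 else 0)"

definition tangent_space ::
  "('a::topological_space, 'e::euclidean_space) chart set \<Rightarrow> 'a \<Rightarrow> 'a tvec set" where
  "tangent_space A x = {velocity A \<gamma> | \<gamma> \<delta>. \<delta> > 0
     \<and> smooth_map_on (interval_atlas \<delta>) A {- \<delta><..<\<delta>} \<gamma> \<and> \<gamma> 0 = x}"

definition tscale :: "real \<Rightarrow> 'a tvec \<Rightarrow> 'a tvec" where
  "tscale r v = (\<lambda>h. r * v h)"

text \<open>The coordinate vector field \<open>\<partial>\<^sub>b\<close> of the chart \<open>c\<close>.\<close>

definition coord_field ::
  "('a::topological_space, 'e::euclidean_space) chart set \<Rightarrow> ('a, 'e) chart \<Rightarrow> 'e \<Rightarrow> 'a \<Rightarrow> 'a tvec" where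
  "coord_field A c b x = velocity A (\<lambda>t. cinv c (snd c x + t *\<^sub>R b))"

definition vfield_on ::
  "('a::topological_space, 'e::euclidean_space) chart set \<Rightarrow> 'a set \<Rightarrow> ('a \<Rightarrow> 'a tvec) \<Rightarrow> bool" where
  "vfield_on A S X \<longleftrightarrow> open S \<and> S \<subseteq> pts A \<and> (\<forall>x\<in>S. X x \<in> tangent_space A x)
     \<and> (\<forall>W h. W \<subseteq> S \<and> smooth_fun_on A W h \<longrightarrow> smooth_fun_on A W (\<lambda>x. X x h))"

definition vfield_near ::
  "('a::topological_space, 'e::euclidean_space) chart set \<Rightarrow> 'a \<Rightarrow> ('a \<Rightarrow> 'a tvec) \<Rightarrow> bool" where
  "vfield_near A x X \<longleftrightarrow> (\<exists>S. x \<in> S \<and> vfield_on A S X)"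

definition lie_bracket ::
  "('a::topological_space, 'e::euclidean_space) chart set \<Rightarrow>
   ('a \<Rightarrow> 'a tvec) \<Rightarrow> ('a \<Rightarrow> 'a tvec) \<Rightarrow> 'a \<Rightarrow> 'a tvec" where
  "lie_bracket A X Y x = (\<lambda>h. if smooth_fun_near A x h
     then X x (\<lambda>y. Y y h) - Y x (\<lambda>y. X y h) else 0)"

text \<open>The differential \<open>df\<^sub>x v\<close>; the case distinction keeps the convention that a tangent vector
  vanishes on functions not smooth near its base point.\<close>

definition tmap ::
  "('b::topological_space, 'f::euclidean_space) chart set \<Rightarrow> ('a \<Rightarrow> 'b) \<Rightarrow> 'a \<Rightarrow> 'a tvec \<Rightarrow> 'b tvec" where
  "tmap B f x v = (\<lambda>h. if smooth_fun_near B (f x) h then v (h \<circ> f) else 0)"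

section \<open>Riemannian and sub-Riemannian manifolds\<close>

record ('a, 'e) riem =
  atlas :: "('a, 'e) chart set"
  met :: "'a \<Rightarrow> 'a tvec \<Rightarrow> 'a tvec \<Rightarrow> real"

record ('a, 'e) sub_riem = "('a, 'e) riem" +
  hor :: "'a \<Rightarrow> 'a tvec set"
  hrank :: nat

definition riemannian_manifold ::
  "('a::{t2_space,second_countable_topology}, 'e::euclidean_space, 'z) riem_scheme \<Rightarrow> bool" where
  "riemannian_manifold M \<longleftrightarrow> smooth_atlas (atlas M)
     \<and> (\<forall>x\<in>pts (atlas M). \<forall>u\<in>tangent_space (atlas M) x.
          (\<forall>v\<in>tangent_space (atlas M) x.
             met M x u v = met M x v u
             \<and> (\<forall>r. met M x (tscale r u) v = r * met M x u v)
             \<and> (\<forall>w\<in>tangent_space (atlas M) x. met M x (u + v) w = met M x u w + met M x v w))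
          \<and> (u \<noteq> 0 \<longrightarrow> met M x u u > 0))
     \<and> (\<forall>S X Y. vfield_on (atlas M) S X \<and> vfield_on (atlas M) S Y \<longrightarrow>
          smooth_fun_on (atlas M) S (\<lambda>x. met M x (X x) (Y x)))"

definition smooth_subbundle ::
  "('a::topological_space, 'e::euclidean_space) chart set \<Rightarrow> nat \<Rightarrow> ('a \<Rightarrow> 'a tvec set) \<Rightarrow> bool" where
  "smooth_subbundle A m H \<longleftrightarrow> (\<forall>x\<in>pts A. \<exists>S E. x \<in> S \<and> open S \<and> S \<subseteq> pts A
     \<and> (\<forall>i<m. vfield_on A S (E i))
     \<and> (\<forall>y\<in>S. H y = {\<Sum>i<m. tscale (a i) (E i y) | a. True}
          \<and> (\<forall>a. (\<Sum>i<m. tscale (a i) (E i y)) = 0 \<longrightarrow> (\<forall>i<m. a i = 0))))"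

definition sub_riemannian_manifold ::
  "('a::{t2_space,second_countable_topology}, 'e::euclidean_space, 'z) sub_riem_scheme \<Rightarrow> bool" where
  "sub_riemannian_manifold M \<longleftrightarrow>
     riemannian_manifold M \<and> smooth_subbundle (atlas M) (hrank M) (hor M)"

text \<open>
  Covariant derivatives are written \<open>D x v X\<close> for \<open>\<nabla>\<^sub>v X\<close> at \<open>x\<close>, with \<open>v\<close> a tangent vector
  at \<open>x\<close> and \<open>X\<close> a vector field defined near \<open>x\<close>.
\<close>

type_synonym 'a conn = "'a \<Rightarrow> 'a tvec \<Rightarrow> ('a \<Rightarrow> 'a tvec) \<Rightarrow> 'a tvec"

definition affine_connection ::
  "('a::topological_space, 'e::euclidean_space) chart set \<Rightarrow> 'a conn \<Rightarrow> bool" where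
  "affine_connection A D \<longleftrightarrow>
     (\<forall>S X Y. vfield_on A S X \<and> vfield_on A S Y \<longrightarrow> vfield_on A S (\<lambda>x. D x (X x) Y))
   \<and> (\<forall>x\<in>pts A. \<forall>u\<in>tangent_space A x. \<forall>X. vfield_near A x X \<longrightarrow>
        D x u X \<in> tangent_space A x
        \<and> (\<forall>r. D x (tscale r u) X = tscale r (D x u X))
        \<and> (\<forall>v\<in>tangent_space A x. D x (u + v) X = D x u X + D x v X)
        \<and> (\<forall>Y. vfield_near A x Y \<longrightarrow> D x u (\<lambda>y. X y + Y y) = D x u X + D x u Y)
        \<and> (\<forall>\<phi>. smooth_fun_near A x \<phi> \<longrightarrow>
             D x u (\<lambda>y. tscale (\<phi> y) (X y)) = tscale (u \<phi>) (X x) + tscale (\<phi> x) (D x u X)))"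

definition is_levi_civita ::
  "('a::topological_space, 'e::euclidean_space, 'z) riem_scheme \<Rightarrow> 'a conn \<Rightarrow> bool" where
  "is_levi_civita M D \<longleftrightarrow> affine_connection (atlas M) D
     \<and> (\<forall>x\<in>pts (atlas M). \<forall>X Y. vfield_near (atlas M) x X \<and> vfield_near (atlas M) x Y \<longrightarrow>
          D x (X x) Y - D x (Y x) X = lie_bracket (atlas M) X Y x
          \<and> (\<forall>v\<in>tangent_space (atlas M) x.
               v (\<lambda>y. met M y (X y) (Y y)) = met M x (D x v X) (Y x) + met M x (X x) (D x v Y)))"

text \<open>Unique on the arguments constrained by \<^const>\<open>is_levi_civita\<close>, arbitrary on all
  others (hence \<open>SOME\<close> instead of \<open>THE\<close>).\<close>

definition levi_civita ::
  "('a::topological_space, 'e::euclidean_space, 'z) riem_scheme \<Rightarrow> 'a conn" where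
  "levi_civita M = (SOME D. is_levi_civita M D)"

definition gradient ::
  "('a::topological_space, 'e::euclidean_space, 'z) riem_scheme \<Rightarrow> ('a \<Rightarrow> real) \<Rightarrow> 'a \<Rightarrow> 'a tvec" where
  "gradient M u x = (THE w. w \<in> tangent_space (atlas M) x
     \<and> (\<forall>v\<in>tangent_space (atlas M) x. met M x w v = v u))"

text \<open>The Riemannian volume \<open>dv\<^sub>g\<close>: the Borel measure with density \<open>sqrt (det (g\<^sub>i\<^sub>j))\<close> with
  respect to Lebesgue measure in each chart.\<close>

definition gram ::
  "('a::topological_space, real^'n, 'z) riem_scheme \<Rightarrow> ('a, real^'n) chart \<Rightarrow> 'a \<Rightarrow> real^'n^'n" where
  "gram M c x = (\<chi> i j. met M x (coord_field (atlas M) c (axis i 1) x)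
                             (coord_field (atlas M) c (axis j 1) x))"

definition riem_volume :: "('a::topological_space, real^'n, 'z) riem_scheme \<Rightarrow> 'a measure" where
  "riem_volume M = (THE \<mu>. space \<mu> = pts (atlas M)
     \<and> sets \<mu> = sets (restrict_space borel (pts (atlas M)))
     \<and> (\<forall>c\<in>atlas M. \<forall>B\<in>sets borel. B \<subseteq> fst c \<longrightarrow>
          emeasure \<mu> B = (\<integral>\<^sup>+y\<in>snd c ` B. ennreal (sqrt (det (gram M c (cinv c y)))) \<partial>lborel)))"

definition hor_proj ::
  "('a, 'e, 'z) sub_riem_scheme \<Rightarrow> 'a \<Rightarrow> 'a tvec \<Rightarrow> 'a tvec" where
  "hor_proj M x v = (THE w. w \<in> hor M x \<and> (\<forall>z\<in>hor M x. met M x (v - w) z = 0))"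

text \<open>Frames are indexed from \<open>0\<close>: \<open>e i\<close> is horizontal for \<open>i < m\<close> and orthogonal to \<open>H\<close> for
  \<open>m \<le> i < dim M\<close>, where \<open>m = hrank M\<close>.\<close>

definition adapted_frame_on ::
  "('a::topological_space, 'e::euclidean_space, 'z) sub_riem_scheme \<Rightarrow> 'a set \<Rightarrow>
   (nat \<Rightarrow> 'a \<Rightarrow> 'a tvec) \<Rightarrow> bool" where
  "adapted_frame_on M S e \<longleftrightarrow>
     (\<forall>i<DIM('e). vfield_on (atlas M) S (e i))
   \<and> (\<forall>y\<in>S. (\<forall>i<DIM('e). \<forall>j<DIM('e). met M y (e i y) (e j y) = (if i = j then 1 else 0))
        \<and> (\<forall>i<hrank M. e i y \<in> hor M y)
        \<and> (\<forall>i\<in>{hrank M..<DIM('e)}. \<forall>z\<in>hor M y. met M y (e i y) z = 0))"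

text \<open>A choice of local adapted orthonormal frame around each point; the quantities below
  evaluated at \<open>x\<close> use this frame.\<close>

definition frame ::
  "('a::topological_space, 'e::euclidean_space, 'z) sub_riem_scheme \<Rightarrow> 'a \<Rightarrow> nat \<Rightarrow> 'a \<Rightarrow> 'a tvec" where
  "frame M x = (SOME e. \<exists>S. open S \<and> x \<in> S \<and> S \<subseteq> pts (atlas M) \<and> adapted_frame_on M S e)"

definition zeta ::
  "('a::topological_space, 'e::euclidean_space, 'z) sub_riem_scheme \<Rightarrow> 'a \<Rightarrow> 'a tvec" where
  "zeta M x = hor_proj M x
     (\<Sum>\<alpha>\<in>{hrank M..<DIM('e)}. levi_civita M x (frame M x \<alpha> x) (frame M x \<alpha>))"

section \<open>Maps from a sub-Riemannian into a Riemannian manifold\<close>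

definition dfH ::
  "('a, 'e, 'z) sub_riem_scheme \<Rightarrow> ('b::topological_space, 'f::euclidean_space, 'w) riem_scheme \<Rightarrow>
   ('a \<Rightarrow> 'b) \<Rightarrow> 'a \<Rightarrow> 'a tvec \<Rightarrow> 'b tvec" where
  "dfH M N f x v = tmap (atlas N) f x (hor_proj M x v)"

definition dfH_norm2 ::
  "('a::topological_space, 'e::euclidean_space, 'z) sub_riem_scheme \<Rightarrow>
   ('b::topological_space, 'f::euclidean_space, 'w) riem_scheme \<Rightarrow> ('a \<Rightarrow> 'b) \<Rightarrow> 'a \<Rightarrow> real" where
  "dfH_norm2 M N f x = (\<Sum>i<hrank M. met N (f x) (tmap (atlas N) f x (frame M x i x))
                                              (tmap (atlas N) f x (frame M x i x)))"

text \<open>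
  The pull-back connection at \<open>x\<close> in direction \<open>v\<close>, for a section \<open>W\<close> of \<open>f\<^sup>-\<^sup>1TN\<close> near \<open>x\<close>
  (that is, \<open>W y\<close> tangent to \<open>N\<close> at \<open>f y\<close>). In a chart \<open>k\<close> of \<open>N\<close> around \<open>f x\<close> write
  \<open>W = \<Sum>\<^sub>b W\<^sup>b (\<partial>\<^sub>b \<circ> f)\<close>, where \<open>W\<^sup>b y\<close> is \<open>W y\<close> applied to the \<open>b\<close>-th coordinate function;
  the value is \<open>\<Sum>\<^sub>b v(W\<^sup>b) \<partial>\<^sub>b + W\<^sup>b \<nabla>\<^sub>d\<^sub>f\<^sub>(\<^sub>v\<^sub>) \<partial>\<^sub>b\<close>.
\<close>

definition pullback_conn ::
  "('b::topological_space, 'f::euclidean_space, 'w) riem_scheme \<Rightarrow> ('a \<Rightarrow> 'b) \<Rightarrow>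
   'a \<Rightarrow> 'a tvec \<Rightarrow> ('a \<Rightarrow> 'b tvec) \<Rightarrow> 'b tvec" where
  "pullback_conn N f x v W =
     (let k = (SOME k. k \<in> atlas N \<and> f x \<in> fst k)
      in \<Sum>b\<in>Basis. tscale (v (\<lambda>y. W y (\<lambda>q. snd k q \<bullet> b))) (coord_field (atlas N) k b (f x))
         + tscale (W x (\<lambda>q. snd k q \<bullet> b))
             (levi_civita N (f x) (tmap (atlas N) f x v) (coord_field (atlas N) k b)))"

definition betaH ::
  "('a::topological_space, 'e::euclidean_space, 'z) sub_riem_scheme \<Rightarrow>
   ('b::topological_space, 'f::euclidean_space, 'w) riem_scheme \<Rightarrow> ('a \<Rightarrow> 'b) \<Rightarrow>
   ('a \<Rightarrow> 'a tvec) \<Rightarrow> ('a \<Rightarrow> 'a tvec) \<Rightarrow> 'a \<Rightarrow> 'b tvec" where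
  "betaH M N f X Y x = pullback_conn N f x (Y x) (\<lambda>y. dfH M N f y (X y))
                        - dfH M N f x (levi_civita M x (Y x) X)"

definition tauH ::
  "('a::topological_space, 'e::euclidean_space, 'z) sub_riem_scheme \<Rightarrow>
   ('b::topological_space, 'f::euclidean_space, 'w) riem_scheme \<Rightarrow> ('a \<Rightarrow> 'b) \<Rightarrow> 'a \<Rightarrow> 'b tvec" where
  "tauH M N f x = (\<Sum>i<hrank M. betaH M N f (frame M x i) (frame M x i) x)
     - tmap (atlas N) f x (zeta M x)
     + dfH M N f x (gradient M (\<lambda>y. dfH_norm2 M N f y / 2) x)"

definition hor_exp_energy ::
  "('a::topological_space, real^'n, 'z) sub_riem_scheme \<Rightarrow>
   ('b::topological_space, 'f::euclidean_space, 'w) riem_scheme \<Rightarrow> ('a \<Rightarrow> 'b) \<Rightarrow> real" where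
  "hor_exp_energy M N f = (\<integral>x. exp (dfH_norm2 M N f x / 2) \<partial>riem_volume M)"

definition smooth_map ::
  "('a::topological_space, 'e::euclidean_space, 'z) riem_scheme \<Rightarrow>
   ('b::topological_space, 'f::euclidean_space, 'w) riem_scheme \<Rightarrow> ('a \<Rightarrow> 'b) \<Rightarrow> bool" where
  "smooth_map M N f \<longleftrightarrow> smooth_map_on (atlas M) (atlas N) (pts (atlas M)) f"

definition variation_field ::
  "('b::topological_space, 'f::euclidean_space, 'w) riem_scheme \<Rightarrow> (real \<Rightarrow> 'a \<Rightarrow> 'b) \<Rightarrow> 'a \<Rightarrow> 'b tvec" where
  "variation_field N F x = velocity (atlas N) (\<lambda>t. F t x)"

definition smooth_variation ::
  "('a::topological_space, 'e::euclidean_space, 'z) riem_scheme \<Rightarrow>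
   ('b::topological_space, 'f::euclidean_space, 'w) riem_scheme \<Rightarrow> ('a \<Rightarrow> 'b) \<Rightarrow>
   real \<Rightarrow> (real \<Rightarrow> 'a \<Rightarrow> 'b) \<Rightarrow> bool" where
  "smooth_variation M N f \<epsilon> F \<longleftrightarrow> \<epsilon> > 0
     \<and> smooth_map_on (prod_atlas (atlas M) (interval_atlas \<epsilon>)) (atlas N)
         (pts (atlas M) \<times> {- \<epsilon><..<\<epsilon>}) (\<lambda>(x, t). F t x)
     \<and> (\<forall>x\<in>pts (atlas M). F 0 x = f x)
     \<and> (\<exists>K. compact K \<and> K \<subseteq> pts (atlas M) \<and> (\<forall>x\<in>pts (atlas M) - K. variation_field N F x = 0))"

definition exp_subelliptic_harmonic ::
  "('a::topological_space, real^'n, 'z) sub_riem_scheme \<Rightarrow>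
   ('b::topological_space, 'f::euclidean_space, 'w) riem_scheme \<Rightarrow> ('a \<Rightarrow> 'b) \<Rightarrow> bool" where
  "exp_subelliptic_harmonic M N f \<longleftrightarrow> smooth_map M N f
     \<and> (\<forall>\<epsilon> F. smooth_variation M N f \<epsilon> F \<longrightarrow>
          ((\<lambda>t. hor_exp_energy M N (F t)) has_real_derivative 0) (at 0))"

end

theory Submission
  imports Defs
begin

text \<open>
  For a variation with field \<open>V\<close>, let \<open>Z\<close> be the horizontal vector field with
  \<open>g(Z, X) = exp(|df\<^sub>H|\<^sup>2/2) \<langle>V, df\<^sub>H X\<rangle>\<close>. Pointwise, the \<open>t\<close>-derivative of the energy density at
  \<open>t = 0\<close> is \<open>exp(|df\<^sub>H|\<^sup>2/2) \<Sum>\<^sub>i \<langle>\<nabla>\<^sub>i V, df e\<^sub>i\<rangle>\<close> (by the symmetry of the connection of \<open>N\<close>), which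
  equals \<open>div Z - exp(|df\<^sub>H|\<^sup>2/2) \<langle>V, \<tau>\<^sub>H\<rangle>\<close>: the terms \<open>\<nabla>\<^sub>\<alpha> e\<^sub>\<alpha>\<close> of the divergence over the full
  frame produce \<open>\<zeta>\<close>. Integrating, the divergence theorem removes \<open>div Z\<close>; it is proved with cut-off
  functions, from Jacobi's formula for \<open>\<partial> sqrt (det G)\<close> in a chart. If \<open>\<tau>\<^sub>H\<close> does not vanish at
  some point, moving \<open>f\<close> in a chart of \<open>N\<close> along \<open>\<tau>\<^sub>H\<close>, cut off by bump functions, gives a variation
  with nonzero derivative.
\<close>


section \<open>Smooth functions on open subsets of normed spaces\<close>

text \<open>Three obstacles shape the proof. First, choices: \<open>frame\<close> and the chart in
  \<open>pullback_conn\<close> are picked anew at every point, and \<open>levi_civita\<close> and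
  \<open>riem_volume\<close> by \<open>SOME\<close> and \<open>THE\<close>, so nothing built from
  them is visibly smooth, local or even characterised. Independence of horizontal traces
  (\<open>hor_trace_indep\<close>) trades the frames for one smooth local frame; the Koszul formula
  pins down the chosen connection and makes it local (\<open>D_cong\<close>); the volume is glued
  from chart measures and shown to be the only candidate. Second, functions and fields are total HOL
  functions, so replacing one by another that agrees near a point takes an argument
  (\<open>TS_cong\<close>). Third, \<open>tauH\<close> is built from such pointwise choices, and its
  smoothness is bypassed: the weighted pairing of \<open>V\<close> with \<open>tauH\<close> is
  continuous because the pointwise formula writes it as a divergence minus a density derivative.
  Hence two variations in the converse: the first, along a constant coordinate vector, yields a
  continuous pairing that is positive at the point; the second multiplies it by a bump supported
  where that pairing is positive, so the integrand is nonnegative.\<close>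

abbreviation fd :: "('e::real_normed_vector \<Rightarrow> 'f::real_normed_vector) \<Rightarrow> 'e \<Rightarrow> 'e \<Rightarrow> 'f" where
  "fd f x \<equiv> frechet_derivative f (at x)"

lemma fd_eqI: "(f has_derivative f') (at x) \<Longrightarrow> fd f x = f'"
  using frechet_derivative_at by metis

text \<open>Openness of \<open>S\<close> is what lets equality on \<open>S\<close> pass to
  derivatives, which see a whole neighbourhood.\<close>

lemma Ck_on_cong_imp:
  assumes "open S" "\<And>x. x \<in> S \<Longrightarrow> f x = g x" "Ck_on k f S"
  shows "Ck_on k g S"
  using assms(2,3)
proof (induction k arbitrary: f g)
  case 0
  then show ?case by (simp cong: continuous_on_cong)
next
  case (Suc k)
  have d: "(g has_derivative fd f x) (at x)" if "x \<in> S" for x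
    using Suc.prems that assms(1)
    by (auto simp: frechet_derivative_works intro: has_derivative_transform_within_open[where f=f and s=S])
  have "fd f x = fd g x" if "x \<in> S" for x
    using fd_eqI[OF d[OF that]] by simp
  then have "Ck_on k (\<lambda>x. fd g x v) S" for v
    using Suc.prems(2) by (auto intro: Suc.IH[of "\<lambda>x. fd f x v"])
  then show ?case using d by (auto simp: differentiable_def)
qed

lemma smooth_on_cong:
  assumes "open S" "\<And>x. x \<in> S \<Longrightarrow> f x = g x"
  shows "smooth_on S f \<longleftrightarrow> smooth_on S g"
  unfolding smooth_on_def using Ck_on_cong_imp[OF assms(1), of f g] Ck_on_cong_imp[OF assms(1), of g f] assms(2)
  by metis

lemma Ck_on_subset: "Ck_on k f S \<Longrightarrow> T \<subseteq> S \<Longrightarrow> Ck_on k f T"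
  by (induction k arbitrary: f) (auto intro: continuous_on_subset)

lemma smooth_on_subset: "smooth_on S f \<Longrightarrow> T \<subseteq> S \<Longrightarrow> smooth_on T f"
  unfolding smooth_on_def using Ck_on_subset by metis

lemma Ck_on_SucD: "Ck_on (Suc k) f S \<Longrightarrow> Ck_on k f S"
proof (induction k arbitrary: f)
  case 0
  then show ?case
    by (auto intro!: continuous_at_imp_continuous_on differentiable_imp_continuous_within)
next
  case (Suc k)
  then show ?case by (metis Ck_on.simps(2))
qed

lemma smooth_on_imp_differentiable: "smooth_on S f \<Longrightarrow> x \<in> S \<Longrightarrow> f differentiable (at x)"
  unfolding smooth_on_def by (metis Ck_on.simps(2))

lemma smooth_on_has_derivative: "smooth_on S f \<Longrightarrow> x \<in> S \<Longrightarrow> (f has_derivative fd f x) (at x)"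
  using smooth_on_imp_differentiable frechet_derivative_works by blast

lemma smooth_on_fd: "smooth_on S f \<Longrightarrow> smooth_on S (\<lambda>x. fd f x v)"
  unfolding smooth_on_def by (metis Ck_on.simps(2))

lemma smooth_on_imp_continuous_on: "smooth_on S f \<Longrightarrow> continuous_on S f"
  unfolding smooth_on_def by (metis Ck_on.simps(1))

lemma smooth_on_linear_fd: "smooth_on S f \<Longrightarrow> x \<in> S \<Longrightarrow> linear (fd f x)"
  by (simp add: linear_frechet_derivative smooth_on_imp_differentiable)

lemma Ck_on_local:
  assumes "\<And>x. x \<in> S \<Longrightarrow> \<exists>T. open T \<and> x \<in> T \<and> Ck_on k f T"
  shows "Ck_on k f S"
  using assms
proof (induction k arbitrary: f)
  case 0
  have "continuous (at x) f" if "x \<in> S" for x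
    using 0[OF that] continuous_on_eq_continuous_at by (metis Ck_on.simps(1))
  then show ?case by (simp add: continuous_at_imp_continuous_on)
next
  case (Suc k)
  have "Ck_on k (\<lambda>x. fd f x v) S" for v
    by (rule Suc.IH) (metis Suc.prems Ck_on.simps(2))
  then show ?case using Suc.prems by (metis Ck_on.simps(2))
qed

lemma smooth_on_local:
  assumes "\<And>x. x \<in> S \<Longrightarrow> \<exists>T. open T \<and> x \<in> T \<and> smooth_on T f"
  shows "smooth_on S f"
  unfolding smooth_on_def
proof
  fix k show "Ck_on k f S"
    by (rule Ck_on_local) (metis assms smooth_on_def)
qed

text \<open>By induction on the order, a class \<open>P\<close> of differentiable functions that is
  closed under directional derivatives, up to equality on \<open>S\<close>, consists of smooth
  functions. Meant for functions whose derivatives stay in an explicit family.\<close>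

lemma smooth_on_coinduct:
  assumes "open S" "P f"
    and step: "\<And>f. P f \<Longrightarrow> (\<forall>x\<in>S. f differentiable (at x)) \<and> (\<forall>v. \<exists>g. P g \<and> (\<forall>x\<in>S. fd f x v = g x))"
  shows "smooth_on S f"
  unfolding smooth_on_def
proof
  fix k show "Ck_on k f S"
    using assms(2)
  proof (induction k arbitrary: f)
    case 0
    then show ?case using step[of f]
      by (auto intro!: continuous_at_imp_continuous_on differentiable_imp_continuous_within)
  next
    case (Suc k)
    have "Ck_on k (\<lambda>x. fd f x v) S" for v
    proof -
      obtain g where g: "P g" "\<forall>x\<in>S. fd f x v = g x" using step[OF Suc.prems] by blast
      show ?thesis by (rule Ck_on_cong_imp[OF assms(1) _ Suc.IH[OF g(1)]]) (use g(2) in auto)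
    qed
    then show ?case using step[OF Suc.prems] by simp
  qed
qed

lemma Ck_on_const [simp]: "Ck_on k (\<lambda>x. c) S"
  by (induction k arbitrary: c) auto

lemma smooth_on_const [simp]: "smooth_on S (\<lambda>x. c)"
  by (simp add: smooth_on_def)

lemma smooth_on_bounded_linear: "bounded_linear f \<Longrightarrow> smooth_on S f"
  unfolding smooth_on_def
proof
  fix k assume f: "bounded_linear f"
  have "(f has_derivative f) (at x)" for x using f by (rule bounded_linear_imp_has_derivative)
  then have "f differentiable (at x)" "fd f x = f" for x
    by (auto simp: differentiable_def dest: fd_eqI)
  then show "Ck_on k f S"
    by (cases k) (auto simp: linear_continuous_on f)
qed

lemma smooth_on_ident [simp]: "smooth_on S (\<lambda>x. x)"
  by (intro smooth_on_bounded_linear bounded_linear_ident)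

lemma smooth_on_fst [simp]: "smooth_on S fst"
  and smooth_on_snd [simp]: "smooth_on S snd"
  by (intro smooth_on_bounded_linear bounded_linear_fst bounded_linear_snd)+

lemma smooth_on_uminus [simp]: "smooth_on S uminus"
  using bounded_linear_minus[OF bounded_linear_ident] by (intro smooth_on_bounded_linear) simp

lemma Ck_on_add:
  assumes "open S" "Ck_on k f S" "Ck_on k g S"
  shows "Ck_on k (\<lambda>x. f x + g x) S"
  using assms(2,3)
proof (induction k arbitrary: f g)
  case 0
  then show ?case by (auto intro: continuous_intros)
next
  case (Suc k)
  have d: "((\<lambda>x. f x + g x) has_derivative (\<lambda>v. fd f x v + fd g x v)) (at x)" if "x \<in> S" for x
    using Suc.prems that by (auto simp: frechet_derivative_works intro: has_derivative_add)
  have "Ck_on k (\<lambda>x. fd (\<lambda>x. f x + g x) x v) S" for v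
    by (rule Ck_on_cong_imp[OF assms(1) _ Suc.IH[of "\<lambda>x. fd f x v" "\<lambda>x. fd g x v"]])
       (use Suc.prems fd_eqI[OF d] in auto)
  then show ?case using d by (auto simp: differentiable_def)
qed

lemma smooth_on_add:
  "open S \<Longrightarrow> smooth_on S f \<Longrightarrow> smooth_on S g \<Longrightarrow> smooth_on S (\<lambda>x. f x + g x)"
  unfolding smooth_on_def by (metis Ck_on_add)

lemma Ck_on_bilinear:
  assumes "bounded_bilinear B" "open S" "Ck_on k f S" "Ck_on k g S"
  shows "Ck_on k (\<lambda>x. B (f x) (g x)) S"
  using assms(3,4)
proof (induction k arbitrary: f g)
  case 0
  then show ?case using bounded_bilinear.continuous_on[OF assms(1)] by auto
next
  case (Suc k)
  have d: "((\<lambda>x. B (f x) (g x)) has_derivative (\<lambda>v. B (f x) (fd g x v) + B (fd f x v) (g x))) (at x)"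
    if "x \<in> S" for x
    using Suc.prems that
    by (auto simp: frechet_derivative_works intro: bounded_bilinear.FDERIV[OF assms(1)])
  have "Ck_on k (\<lambda>x. fd (\<lambda>x. B (f x) (g x)) x v) S" for v
  proof (rule Ck_on_cong_imp[OF assms(2)])
    show "Ck_on k (\<lambda>x. B (f x) (fd g x v) + B (fd f x v) (g x)) S"
      using Suc.prems by (intro Ck_on_add assms(2) Suc.IH) (auto intro: Ck_on_SucD)
  qed (use fd_eqI[OF d] in auto)
  then show ?case using d by (auto simp: differentiable_def)
qed

lemma smooth_on_bilinear:
  "bounded_bilinear B \<Longrightarrow> open S \<Longrightarrow> smooth_on S f \<Longrightarrow> smooth_on S g \<Longrightarrow> smooth_on S (\<lambda>x. B (f x) (g x))"
  unfolding smooth_on_def by (metis Ck_on_bilinear)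

lemmas smooth_on_mult = smooth_on_bilinear[OF bounded_bilinear_mult]
lemmas smooth_on_scaleR = smooth_on_bilinear[OF bounded_bilinear_scaleR]
lemmas smooth_on_inner = smooth_on_bilinear[OF bounded_bilinear_inner]

lemma Ck_on_sum:
  assumes "open S" "\<And>i. i \<in> I \<Longrightarrow> Ck_on k (f i) S"
  shows "Ck_on k (\<lambda>x. \<Sum>i\<in>I. f i x) S"
  using assms(2) by (induction I rule: infinite_finite_induct) (auto intro: Ck_on_add assms(1))

lemma smooth_on_sum:
  "open S \<Longrightarrow> (\<And>i. i \<in> I \<Longrightarrow> smooth_on S (f i)) \<Longrightarrow> smooth_on S (\<lambda>x. \<Sum>i\<in>I. f i x)"
  unfolding smooth_on_def by (metis Ck_on_sum)

text \<open>\<open>Ck_on\<close> controls derivatives in fixed directions, while the chain rule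
  applies the derivative of \<open>g\<close> to the moving direction \<open>f' v\<close>. Expanding
  that direction in the basis gives a finite sum of products, to which the induction in
  \<open>Ck_on_compose\<close> applies.\<close>

lemma fd_compose_basis:
  fixes f :: "'e::real_normed_vector \<Rightarrow> 'f::euclidean_space"
  assumes "(f has_derivative f') (at x)" "g differentiable (at (f x))"
  shows "((\<lambda>x. g (f x)) has_derivative (\<lambda>v. \<Sum>b\<in>Basis. (f' v \<bullet> b) *\<^sub>R fd g (f x) b)) (at x)"
proof -
  have g: "(g has_derivative fd g (f x)) (at (f x))"
    using assms(2) by (simp add: frechet_derivative_works)
  have lin: "linear (fd g (f x))" using assms(2) by (rule linear_frechet_derivative)
  have rep: "fd g (f x) w = (\<Sum>b\<in>Basis. (w \<bullet> b) *\<^sub>R fd g (f x) b)" for w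
  proof -
    have "fd g (f x) (\<Sum>b\<in>Basis. (w \<bullet> b) *\<^sub>R b) = (\<Sum>b\<in>Basis. (w \<bullet> b) *\<^sub>R fd g (f x) b)"
      by (simp only: linear_sum[OF lin] linear_scale[OF lin])
    then show ?thesis by (simp only: euclidean_representation)
  qed
  show ?thesis
    using diff_chain_at[OF assms(1) g] unfolding o_def
    by (rule has_derivative_eq_rhs) (rule ext, rule rep)
qed

lemma Ck_on_compose:
  fixes f :: "'e::real_normed_vector \<Rightarrow> 'f::euclidean_space"
  assumes "open S" "open T" "f ` S \<subseteq> T" "Ck_on k f S" "Ck_on k g T"
  shows "Ck_on k (\<lambda>x. g (f x)) S"
  using assms(4,5)
proof (induction k arbitrary: g)
  case 0
  then show ?case using continuous_on_compose2[of T g S f] assms(3) by auto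
next
  case (Suc k)
  have d: "((\<lambda>x. g (f x)) has_derivative (\<lambda>v. \<Sum>b\<in>Basis. (fd f x v \<bullet> b) *\<^sub>R fd g (f x) b)) (at x)"
    if "x \<in> S" for x
    using Suc.prems that assms(3)
    by (intro fd_compose_basis) (auto simp: frechet_derivative_works)
  have "Ck_on k (\<lambda>x. fd (\<lambda>x. g (f x)) x v) S" for v
  proof (rule Ck_on_cong_imp[OF assms(1)])
    show "Ck_on k (\<lambda>x. \<Sum>b\<in>Basis. (fd f x v \<bullet> b) *\<^sub>R fd g (f x) b) S"
      using Suc.prems Ck_on_SucD[OF Suc.prems(1)]
      by (intro Ck_on_sum assms(1) Ck_on_bilinear[OF bounded_bilinear_scaleR]
          Ck_on_bilinear[OF bounded_bilinear_inner] Suc.IH) auto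
  qed (use fd_eqI[OF d] in auto)
  then show ?case using d by (auto simp: differentiable_def)
qed

lemma smooth_on_compose:
  fixes f :: "'e::real_normed_vector \<Rightarrow> 'f::euclidean_space"
  assumes "open S" "open T" "f ` S \<subseteq> T" "smooth_on S f" "smooth_on T g"
  shows "smooth_on S (\<lambda>x. g (f x))"
  using assms unfolding smooth_on_def by (metis Ck_on_compose)

lemma smooth_on_componentwise:
  fixes f :: "'e::real_normed_vector \<Rightarrow> 'f::euclidean_space"
  assumes "open S" "\<And>b. b \<in> Basis \<Longrightarrow> smooth_on S (\<lambda>x. f x \<bullet> b)"
  shows "smooth_on S f"
proof -
  have "smooth_on S (\<lambda>x. \<Sum>b\<in>Basis. (f x \<bullet> b) *\<^sub>R b)"
    using assms by (intro smooth_on_sum smooth_on_scaleR) auto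
  then show ?thesis by (simp add: euclidean_representation)
qed

section \<open>Elementary smooth functions: exponential, reciprocal, square root\<close>

lemma smooth_on_exp: "smooth_on S (exp :: real \<Rightarrow> real)"
proof -
  have "smooth_on UNIV (exp :: real \<Rightarrow> real)"
  proof (rule smooth_on_coinduct[where P="\<lambda>f. \<exists>c. f = (\<lambda>x::real. c * exp x)"])
    fix f :: "real \<Rightarrow> real" assume "\<exists>c. f = (\<lambda>x. c * exp x)"
    then obtain c where f: "f = (\<lambda>x. c * exp x)" by blast
    have d: "(f has_derivative (\<lambda>v. c * exp x * v)) (at x)" for x
      unfolding f by (auto intro!: derivative_eq_intros)
    show "(\<forall>x\<in>UNIV. f differentiable (at x)) \<and>
      (\<forall>v. \<exists>g. (\<exists>c. g = (\<lambda>x. c * exp x)) \<and> (\<forall>x\<in>UNIV. fd f x v = g x))"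
    proof (intro conjI allI ballI)
      fix v
      show "\<exists>g. (\<exists>c. g = (\<lambda>x. c * exp x)) \<and> (\<forall>x\<in>UNIV. fd f x v = g x)"
        by (rule exI[of _ "\<lambda>x. (c * v) * exp x"]) (use fd_eqI[OF d] in auto)
    qed (use d in \<open>auto simp: differentiable_def\<close>)
  qed (auto intro: exI[of _ 1])
  then show ?thesis by (rule smooth_on_subset) auto
qed

text \<open>Differentiating \<open>c * inverse x ^ n\<close> raises the exponent by one and changes
  the constant, so these functions form a class for the coinduction.\<close>

lemma smooth_on_inverse:
  assumes S: "0 \<notin> S" "open S"
  shows "smooth_on S (inverse :: real \<Rightarrow> real)"
proof (rule smooth_on_coinduct[where P="\<lambda>f. \<exists>c n. f = (\<lambda>x::real. c * inverse x ^ n)"])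
  show "\<exists>c n. inverse = (\<lambda>x::real. c * inverse x ^ n)"
    by (intro exI[of _ 1]) auto
next
  fix f :: "real \<Rightarrow> real" assume "\<exists>c n. f = (\<lambda>x. c * inverse x ^ n)"
  then obtain c n where f: "f = (\<lambda>x. c * inverse x ^ n)" by blast
  have d: "(f has_derivative (\<lambda>v. (- c * n * v) * inverse x ^ (Suc n))) (at x)" if "x \<in> S" for x
  proof -
    have x: "x \<noteq> 0" using that S by auto
    have "((\<lambda>x. inverse x ^ n) has_real_derivative - (real n * inverse x ^ Suc n)) (at x)"
    proof (cases n)
      case (Suc m)
      show ?thesis
        unfolding Suc by (rule DERIV_cong[OF DERIV_power[OF DERIV_inverse[OF x], of "Suc m"]]) simp
    qed simp
    from DERIV_cmult[OF this, of c] show ?thesis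
      unfolding f has_field_derivative_def by (rule has_derivative_eq_rhs) (simp add: fun_eq_iff)
  qed
  show "(\<forall>x\<in>S. f differentiable (at x)) \<and>
      (\<forall>v. \<exists>g. (\<exists>c n. g = (\<lambda>x. c * inverse x ^ n)) \<and> (\<forall>x\<in>S. fd f x v = g x))"
  proof (intro conjI allI ballI)
    fix v
    show "\<exists>g. (\<exists>c n. g = (\<lambda>x. c * inverse x ^ n)) \<and> (\<forall>x\<in>S. fd f x v = g x)"
    proof (rule exI, rule conjI)
      show "\<exists>c' n'. (\<lambda>x. (- c * n * v) * inverse x ^ (Suc n)) = (\<lambda>x. c' * inverse x ^ n')" by blast
    qed (simp add: fd_eqI[OF d])
  qed (use d in \<open>auto simp: differentiable_def\<close>)
qed (use S in auto)

text \<open>The derivative is half the reciprocal of \<open>sqrt\<close> itself, so regularity of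
  order \<open>k\<close> feeds back into order \<open>k + 1\<close>.\<close>

lemma Ck_on_sqrt:
  assumes S: "open S" "S \<subseteq> {0<..}"
  shows "Ck_on k sqrt S"
proof (induction k)
  case 0
  then show ?case by (auto intro: continuous_intros)
next
  case (Suc k)
  have d: "(sqrt has_derivative (\<lambda>v. (v / 2) * inverse (sqrt x))) (at x)" if "x \<in> S" for x
    using that S(2) by (auto intro!: derivative_eq_intros simp: fun_eq_iff divide_simps)
  have inv: "Ck_on k (\<lambda>x. inverse (sqrt x)) S"
  proof (rule Ck_on_compose[OF S(1), where T="{0<..}" and f=sqrt and g=inverse])
    show "Ck_on k inverse {0::real<..}" using smooth_on_inverse[of "{0<..}"] by (simp add: smooth_on_def)
  qed (use S Suc in auto)
  have "Ck_on k (\<lambda>x. fd sqrt x v) S" for v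
    using Ck_on_bilinear[OF bounded_bilinear_mult S(1) Ck_on_const[of k "v / 2"] inv]
    by (rule Ck_on_cong_imp[OF S(1), rotated]) (use fd_eqI[OF d] in auto)
  then show ?case using d by (auto simp: differentiable_def)
qed

lemma smooth_on_sqrt: "open S \<Longrightarrow> S \<subseteq> {0<..} \<Longrightarrow> smooth_on S sqrt"
  by (simp add: smooth_on_def Ck_on_sqrt)

text \<open>Both iterated derivatives are limits of the same second difference quotient.\<close>

lemma fd_fd_mvt:
  fixes f :: "'e::real_normed_vector \<Rightarrow> real"
  assumes S: "open S" "ball x r \<subseteq> S" and f: "smooth_on S f"
    and h: "h > 0" "h * (norm v + norm w) < r"
  obtains s t where "0 < s" "s < h" "0 < t" "t < h"
    "f (x + h *\<^sub>R v + h *\<^sub>R w) - f (x + h *\<^sub>R v) - f (x + h *\<^sub>R w) + f x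
      = h * h * fd (\<lambda>y. fd f y v) (x + s *\<^sub>R v + t *\<^sub>R w) w"
proof -
  have inS: "x + s *\<^sub>R v + t *\<^sub>R w \<in> S" if "0 \<le> s" "s \<le> h" "0 \<le> t" "t \<le> h" for s t
  proof -
    have "norm (s *\<^sub>R v + t *\<^sub>R w) \<le> s * norm v + t * norm w"
      using norm_triangle_ineq[of "s *\<^sub>R v" "t *\<^sub>R w"] that by simp
    also have "\<dots> \<le> h * (norm v + norm w)"
      using that by (simp add: distrib_left add_mono mult_right_mono)
    finally have "dist x (x + s *\<^sub>R v + t *\<^sub>R w) < r"
      using h by (metis (no_types) add.assoc add_diff_cancel_left' dist_commute dist_norm order_le_less_trans)
    then show ?thesis using S(2) by auto
  qed
  \<comment> \<open>The mean value theorem is used twice: on \<open>g\<close> for the direction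
    \<open>v\<close>, then on the first derivative for the direction \<open>w\<close>.\<close>
  define g where "g s = f (x + s *\<^sub>R v + h *\<^sub>R w) - f (x + s *\<^sub>R v + 0 *\<^sub>R w)" for s
  have der1: "((\<lambda>s. F (x + s *\<^sub>R v + t *\<^sub>R w)) has_real_derivative fd F (x + s *\<^sub>R v + t *\<^sub>R w) v) (at s)"
    if "smooth_on S F" "0 \<le> s" "s \<le> h" "0 \<le> t" "t \<le> h" for F :: "'e \<Rightarrow> real" and s t
  proof -
    have F: "(F has_derivative fd F (x + s *\<^sub>R v + t *\<^sub>R w)) (at (x + s *\<^sub>R v + t *\<^sub>R w))"
      using smooth_on_has_derivative[OF that(1)] inS that by blast
    have "((\<lambda>s. x + s *\<^sub>R v + t *\<^sub>R w) has_derivative (\<lambda>d. d *\<^sub>R v)) (at s)"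
      by (auto intro!: derivative_eq_intros)
    from has_derivative_compose[OF this F] show ?thesis
      unfolding has_field_derivative_def
      by (rule has_derivative_eq_rhs)
         (simp add: fun_eq_iff linear_scale[OF smooth_on_linear_fd[OF that(1) inS[OF that(2-5)]]])
  qed
  have der2: "((\<lambda>t. F (x + s *\<^sub>R v + t *\<^sub>R w)) has_real_derivative fd F (x + s *\<^sub>R v + t *\<^sub>R w) w) (at t)"
    if "smooth_on S F" "0 \<le> s" "s \<le> h" "0 \<le> t" "t \<le> h" for F :: "'e \<Rightarrow> real" and s t
  proof -
    have F: "(F has_derivative fd F (x + s *\<^sub>R v + t *\<^sub>R w)) (at (x + s *\<^sub>R v + t *\<^sub>R w))"
      using smooth_on_has_derivative[OF that(1)] inS that by blast
    have "((\<lambda>t. x + s *\<^sub>R v + t *\<^sub>R w) has_derivative (\<lambda>d. d *\<^sub>R w)) (at t)"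
      by (auto intro!: derivative_eq_intros)
    from has_derivative_compose[OF this F] show ?thesis
      unfolding has_field_derivative_def
      by (rule has_derivative_eq_rhs)
         (simp add: fun_eq_iff linear_scale[OF smooth_on_linear_fd[OF that(1) inS[OF that(2-5)]]])
  qed
  have "\<exists>s. 0 < s \<and> s < h \<and> g h - g 0 = (h - 0) * (fd f (x + s *\<^sub>R v + h *\<^sub>R w) v - fd f (x + s *\<^sub>R v + 0 *\<^sub>R w) v)"
    using h by (intro MVT2) (auto simp: g_def intro!: DERIV_diff der1[OF f, of _ h] der1[OF f, of _ 0, simplified])
  then obtain s where s: "0 < s" "s < h"
    "g h - g 0 = h * (fd f (x + s *\<^sub>R v + h *\<^sub>R w) v - fd f (x + s *\<^sub>R v + 0 *\<^sub>R w) v)" by auto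
  have "\<exists>t. 0 < t \<and> t < h \<and> fd f (x + s *\<^sub>R v + h *\<^sub>R w) v - fd f (x + s *\<^sub>R v + 0 *\<^sub>R w) v
      = (h - 0) * fd (\<lambda>y. fd f y v) (x + s *\<^sub>R v + t *\<^sub>R w) w"
    using h s by (intro MVT2[where f="\<lambda>t. fd f (x + s *\<^sub>R v + t *\<^sub>R w) v"]) (auto intro!: der2 smooth_on_fd[OF f])
  then obtain t where t: "0 < t" "t < h" "fd f (x + s *\<^sub>R v + h *\<^sub>R w) v - fd f (x + s *\<^sub>R v + 0 *\<^sub>R w) v
      = h * fd (\<lambda>y. fd f y v) (x + s *\<^sub>R v + t *\<^sub>R w) w" by auto
  show ?thesis
    using that[OF s(1,2) t(1,2)] s(3) t(3) by (simp add: g_def algebra_simps)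
qed

lemma fd_fd_commute:
  fixes f :: "'e::real_normed_vector \<Rightarrow> real"
  assumes S: "open S" "x \<in> S" and f: "smooth_on S f"
  shows "fd (\<lambda>y. fd f y v) x w = fd (\<lambda>y. fd f y w) x v"
proof (rule ccontr)
  assume ne: "fd (\<lambda>y. fd f y v) x w \<noteq> fd (\<lambda>y. fd f y w) x v"
  define A where "A = (\<lambda>y. fd (\<lambda>y. fd f y v) y w)"
  define B where "B = (\<lambda>y. fd (\<lambda>y. fd f y w) y v)"
  define e where "e = \<bar>A x - B x\<bar> / 2"
  have e: "e > 0" using ne by (simp add: e_def A_def B_def)
  have "isCont A x" "isCont B x"
    unfolding A_def B_def
    using f S smooth_on_fd smooth_on_imp_continuous_on continuous_on_eq_continuous_at by metis+
  then obtain d1 d2 where d: "d1 > 0" "\<And>y. dist y x < d1 \<Longrightarrow> dist (A y) (A x) < e"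
      "d2 > 0" "\<And>y. dist y x < d2 \<Longrightarrow> dist (B y) (B x) < e"
    using e unfolding continuous_at_eps_delta by metis
  obtain r0 where r0: "r0 > 0" "ball x r0 \<subseteq> S" using S openE by blast
  define r where "r = min r0 (min d1 d2)"
  have r: "r > 0" "ball x r \<subseteq> S" using r0 d by (auto simp: r_def)
  \<comment> \<open>Small enough that the parallelogram spanned by \<open>h *\<^sub>R v\<close> and
    \<open>h *\<^sub>R w\<close> stays in the ball; the summand 1 keeps the denominator positive
    when both vectors vanish.\<close>
  define h where "h = r / (2 * (norm v + norm w + 1))"
  have pos: "norm v + norm w + 1 > 0" by (smt (verit) norm_ge_zero)
  have h: "h > 0" using r pos by (simp add: h_def)
  have hr: "h * (norm v + norm w) < r"
  proof -
    have "h * (norm v + norm w) \<le> h * (norm v + norm w + 1)" using h by (simp add: mult_left_mono)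
    also have "\<dots> = r / 2"
      using pos unfolding h_def by (metis less_irrefl mult.commute nonzero_eq_divide_eq times_divide_eq_right divide_divide_eq_left)
    finally show ?thesis using r by simp
  qed
  have close: "dist (x + s *\<^sub>R v + t *\<^sub>R w) x < r" if "0 < s" "s < h" "0 < t" "t < h" for s t
  proof -
    have "norm (s *\<^sub>R v + t *\<^sub>R w) \<le> s * norm v + t * norm w"
      using norm_triangle_ineq[of "s *\<^sub>R v" "t *\<^sub>R w"] that by simp
    also have "\<dots> \<le> h * (norm v + norm w)"
      using that by (simp add: distrib_left add_mono mult_right_mono)
    finally show ?thesis using hr by (simp add: dist_norm add.assoc)
  qed
  obtain s t where st: "0 < s" "s < h" "0 < t" "t < h"
    "f (x + h *\<^sub>R v + h *\<^sub>R w) - f (x + h *\<^sub>R v) - f (x + h *\<^sub>R w) + f x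
      = h * h * A (x + s *\<^sub>R v + t *\<^sub>R w)"
    using fd_fd_mvt[OF S(1) r(2) f h hr] unfolding A_def by metis
  obtain s' t' where st': "0 < s'" "s' < h" "0 < t'" "t' < h"
    "f (x + h *\<^sub>R w + h *\<^sub>R v) - f (x + h *\<^sub>R w) - f (x + h *\<^sub>R v) + f x
      = h * h * B (x + s' *\<^sub>R w + t' *\<^sub>R v)"
    using fd_fd_mvt[OF S(1) r(2) f h, of w v] hr unfolding B_def by (metis add.commute)
  \<comment> \<open>The second difference is symmetric in \<open>v\<close> and \<open>w\<close>, so
    \<open>A\<close> and \<open>B\<close> take a common value at two points near \<open>x\<close>.
    Each lies within \<open>e\<close> of its value at \<open>x\<close>, yet those values are
    \<open>2 * e\<close> apart.\<close>
  have "h * h * A (x + s *\<^sub>R v + t *\<^sub>R w) = h * h * B (x + t' *\<^sub>R v + s' *\<^sub>R w)"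
    using st(5) st'(5) by (simp add: algebra_simps)
  then have "A (x + s *\<^sub>R v + t *\<^sub>R w) = B (x + t' *\<^sub>R v + s' *\<^sub>R w)" using h by simp
  moreover have "dist (A (x + s *\<^sub>R v + t *\<^sub>R w)) (A x) < e"
    using close[OF st(1-4)] by (intro d) (auto simp: r_def)
  moreover have "dist (B (x + t' *\<^sub>R v + s' *\<^sub>R w)) (B x) < e"
    using close[OF st'(3,4,1,2)] by (intro d) (auto simp: r_def)
  ultimately show False unfolding e_def dist_real_def by (simp add: abs_if split: if_splits)
qed

section \<open>A flat function and Euclidean bump functions\<close>

lemma tendsto_poly_exp_minus_at_top: "((\<lambda>u. poly p u * exp (- u)) \<longlongrightarrow> (0::real)) at_top"
proof -
  have "((\<lambda>u. \<Sum>i\<le>degree p. coeff p i * (u ^ i / exp u)) \<longlongrightarrow> (\<Sum>i\<le>degree p. coeff p i * 0)) at_top"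
    by (intro tendsto_sum tendsto_mult tendsto_const tendsto_power_div_exp_0)
  then show ?thesis
    by (simp add: poly_altdef sum_distrib_right exp_minus divide_inverse mult.assoc)
qed

definition flat_exp :: "real \<Rightarrow> real" where
  "flat_exp x = (if x > 0 then exp (- inverse x) else 0)"

text \<open>The coinductive class consists of polynomials in \<open>1/x\<close> times
  \<open>exp (- 1/x)\<close>, extended by 0. Exponential decay beats every such polynomial, so every
  derivative vanishes at 0.\<close>

lemma smooth_on_flat_exp: "smooth_on UNIV flat_exp"
proof (rule smooth_on_coinduct[where
      P="\<lambda>f. \<exists>p. f = (\<lambda>x::real. if x > 0 then poly p (inverse x) * exp (- inverse x) else 0)"])
  show "\<exists>p. flat_exp = (\<lambda>x. if x > 0 then poly p (inverse x) * exp (- inverse x) else 0)"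
    by (intro exI[of _ "[:1:]"]) (auto simp: flat_exp_def)
next
  fix f :: "real \<Rightarrow> real"
  assume "\<exists>p. f = (\<lambda>x. if x > 0 then poly p (inverse x) * exp (- inverse x) else 0)"
  then obtain p where f: "f = (\<lambda>x. if x > 0 then poly p (inverse x) * exp (- inverse x) else 0)" by blast
  \<comment> \<open>With \<open>u = 1/x\<close>, hence \<open>u' = - u^2\<close>, the derivative of
    \<open>p(u) exp(-u)\<close> is \<open>(p - p')(u) u^2 exp(-u)\<close>; the list
    \<open>[:0, 0, 1:]\<close> is the factor \<open>u^2\<close>.\<close>
  define q where "q = (p - pderiv p) * [:0, 0, 1:]"
  define g where "g x = (if x > 0 then poly q (inverse x) * exp (- inverse x) else 0)" for x :: real
  have pos: "(f has_real_derivative g x) (at x)" if "x > 0" for x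
  proof -
    have "((\<lambda>x. poly p (inverse x) * exp (- inverse x)) has_real_derivative g x) (at x)"
      using that
      by (auto intro!: derivative_eq_intros DERIV_chain2[OF poly_DERIV] simp: g_def q_def algebra_simps power2_eq_square)
    then show ?thesis
      by (rule has_field_derivative_transform_within_open[where S="{0<..}"]) (use that in \<open>auto simp: f\<close>)
  qed
  have neg: "(f has_real_derivative g x) (at x)" if "x < 0" for x
  proof -
    have "((\<lambda>x. 0) has_real_derivative g x) (at x)" using that by (simp add: g_def)
    then show ?thesis
      by (rule has_field_derivative_transform_within_open[where S="{..<0}"]) (use that in \<open>auto simp: f\<close>)
  qed
  have zero: "(f has_real_derivative g 0) (at 0)"
  proof -
    \<comment> \<open>The polynomial \<open>pCons 0 p\<close> is \<open>u p(u)\<close>: the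
      difference quotient at 0 brings in one more factor \<open>1/x\<close>.\<close>
    have "((\<lambda>x. poly (pCons 0 p) (inverse x) * exp (- inverse x)) \<longlongrightarrow> 0) (at_right 0)"
      using filterlim_compose[OF tendsto_poly_exp_minus_at_top filterlim_inverse_at_top_right] .
    then have "((\<lambda>h. (f (0 + h) - f 0) / h) \<longlongrightarrow> 0) (at_right 0)"
      by (rule Lim_transform_eventually)
         (auto simp: f divide_inverse eventually_at_right_field intro!: exI[of _ 1])
    moreover have "((\<lambda>h. (f (0 + h) - f 0) / h) \<longlongrightarrow> 0) (at_left 0)"
      by (rule Lim_transform_eventually[OF tendsto_const])
         (auto simp: f eventually_at_left_field intro!: exI[of _ "-1"])
    ultimately show ?thesis
      unfolding DERIV_def by (simp add: g_def filterlim_split_at)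
  qed
  have d: "(f has_real_derivative g x) (at x)" for x
    using pos neg zero by (cases x "0::real" rule: linorder_cases) auto
  have d': "f differentiable (at x)" "fd f x v = g x * v" for x v
    using d[of x] fd_eqI[OF d[of x, unfolded has_field_derivative_def]]
    by (auto simp: has_field_derivative_def differentiable_def)
  show "(\<forall>x\<in>UNIV. f differentiable (at x)) \<and> (\<forall>v. \<exists>g.
    (\<exists>p. g = (\<lambda>x. if x > 0 then poly p (inverse x) * exp (- inverse x) else 0)) \<and> (\<forall>x\<in>UNIV. fd f x v = g x))"
  proof (intro conjI allI)
    fix v
    show "\<exists>g. (\<exists>p. g = (\<lambda>x. if x > 0 then poly p (inverse x) * exp (- inverse x) else 0)) \<and> (\<forall>x\<in>UNIV. fd f x v = g x)"
      by (rule exI[of _ "\<lambda>x. g x * v"]) (auto simp: d' g_def fun_eq_iff intro!: exI[of _ "smult v q"])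
  qed (use d' in auto)
qed auto

lemma smooth_bump_euclidean:
  fixes p :: "'e::euclidean_space"
  assumes "r > 0"
  obtains \<psi> :: "'e \<Rightarrow> real" where "smooth_on UNIV \<psi>" "\<And>y. \<psi> y \<ge> 0" "\<And>y. \<psi> y > 0 \<longleftrightarrow> dist p y < r"
proof
  \<comment> \<open>The squared distance is smooth also at \<open>p\<close>. The difference is
    spelled with sums and products so that the closure lemmas apply directly.\<close>
  let ?\<psi> = "\<lambda>y. flat_exp (r\<^sup>2 + (- 1) * ((y + (- p)) \<bullet> (y + (- p))))"

  have "smooth_on UNIV (\<lambda>y. r\<^sup>2 + (- 1) * ((y + (- p)) \<bullet> (y + (- p))))"
    by (intro smooth_on_add smooth_on_mult smooth_on_inner smooth_on_ident smooth_on_const open_UNIV)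
  then show "smooth_on UNIV ?\<psi>"
    by (rule smooth_on_compose[OF open_UNIV open_UNIV subset_UNIV _ smooth_on_flat_exp])
  show "?\<psi> y \<ge> 0" for y by (simp add: flat_exp_def)
  have "r\<^sup>2 + (- 1) * ((y + (- p)) \<bullet> (y + (- p))) > 0 \<longleftrightarrow> dist p y < r" for y
  proof -
    have "(y + (- p)) \<bullet> (y + (- p)) = (dist p y)\<^sup>2" by (subst dist_commute) (simp add: dist_norm power2_norm_eq_inner)
    moreover have "(dist p y)\<^sup>2 < r\<^sup>2 \<longleftrightarrow> dist p y < r"
      using assms by (metis abs_of_nonneg abs_of_pos abs_square_less_1 power2_less_imp_less power_strict_mono zero_le_dist pos2 less_imp_le)
    ultimately show ?thesis by simp
  qed
  then show "?\<psi> y > 0 \<longleftrightarrow> dist p y < r" for y by (simp add: flat_exp_def)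
qed

section \<open>Smooth functions and maps on manifolds\<close>

lemma pts_real_atlas [simp]: "pts real_atlas = UNIV"
  by (simp add: pts_def real_atlas_def)

lemma inv_into_ident [simp]: "x \<in> S \<Longrightarrow> inv_into S (\<lambda>t. t) x = x"
  by (metis (no_types) f_inv_into_f image_ident)

lemma smooth_fun_on_iff:
  "smooth_fun_on A S h \<longleftrightarrow> open S \<and> S \<subseteq> pts A \<and> continuous_on S h
     \<and> (\<forall>c\<in>A. smooth_on (snd c ` (fst c \<inter> S)) (\<lambda>y. h (cinv c y)))"
  by (auto simp: smooth_fun_on_def smooth_map_on_def real_atlas_def o_def pts_real_atlas[unfolded real_atlas_def])

locale smooth_mfd =
  fixes A :: "('a::t2_space, 'e::euclidean_space) chart set"
  assumes atlas: "smooth_atlas A"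
begin

lemma chart_homeo: "c \<in> A \<Longrightarrow> homeomorphism (fst c) (snd c ` fst c) (snd c) (cinv c)"
  and open_chart [simp]: "c \<in> A \<Longrightarrow> open (fst c)"
  and open_chart_image [simp]: "c \<in> A \<Longrightarrow> open (snd c ` fst c)"
  and smooth_transition: "c \<in> A \<Longrightarrow> c' \<in> A \<Longrightarrow> smooth_on (snd c ` (fst c \<inter> fst c')) (\<lambda>y. snd c' (cinv c y))"
  using atlas by (auto simp: smooth_atlas_def is_chart_def o_def)

lemma chart_subset_pts: "c \<in> A \<Longrightarrow> fst c \<subseteq> pts A"
  by (auto simp: pts_def)

lemma in_pts_chart: "x \<in> pts A \<Longrightarrow> \<exists>c\<in>A. x \<in> fst c"
  by (auto simp: pts_def)

lemma open_pts: "open (pts A)"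
  unfolding pts_def by (intro open_Union) auto

lemma cinv_chart [simp]: "c \<in> A \<Longrightarrow> x \<in> fst c \<Longrightarrow> cinv c (snd c x) = x"
  using homeomorphism_apply1[OF chart_homeo] .

lemma chart_cinv [simp]: "y \<in> snd c ` fst c \<Longrightarrow> snd c (cinv c y) = y"
  by (rule f_inv_into_f)

lemma cinv_in_chart [simp]: "y \<in> snd c ` fst c \<Longrightarrow> cinv c y \<in> fst c"
  by (rule inv_into_into)

lemma continuous_on_chart: "c \<in> A \<Longrightarrow> T \<subseteq> fst c \<Longrightarrow> continuous_on T (snd c)"
  using homeomorphism_cont1[OF chart_homeo] continuous_on_subset by blast

lemma continuous_on_cinv: "c \<in> A \<Longrightarrow> continuous_on (snd c ` fst c) (cinv c)"
  using homeomorphism_cont2[OF chart_homeo] .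

lemma image_eq_vimage_cinv:
  "c \<in> A \<Longrightarrow> T \<subseteq> fst c \<Longrightarrow> snd c ` T = snd c ` fst c \<inter> cinv c -` T"
  by force

lemma open_image_chart:
  assumes "c \<in> A" "open T" "T \<subseteq> fst c"
  shows "open (snd c ` T)"
  unfolding image_eq_vimage_cinv[OF assms(1,3)]
  using continuous_open_preimage[OF continuous_on_cinv[OF assms(1)] open_chart_image[OF assms(1)] assms(2)] .

lemma open_image_cinv:
  assumes "c \<in> A" "open V" "V \<subseteq> snd c ` fst c"
  shows "open (cinv c ` V)"
proof -
  have "cinv c ` V = fst c \<inter> snd c -` V" using assms by (auto simp: image_iff) (metis cinv_chart)
  then show ?thesis
    using continuous_open_preimage[OF continuous_on_chart[OF assms(1) order_refl] open_chart[OF assms(1)] assms(2)] by simp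
qed

text \<open>The definition tests every chart. Any other chart around the point differs from the
  given one by a smooth transition, so one chart per point is enough.\<close>

lemma smooth_fun_on_local_chart:
  assumes "open S" "S \<subseteq> pts A"
    and loc: "\<And>x. x \<in> S \<Longrightarrow> \<exists>c\<in>A. \<exists>T. open T \<and> x \<in> T \<and> T \<subseteq> fst c \<and> smooth_on (snd c ` T) (\<lambda>y. h (cinv c y))"
  shows "smooth_fun_on A S h"
  unfolding smooth_fun_on_iff
proof (intro conjI ballI assms(1,2))
  have "isCont h x" if "x \<in> S" for x
  proof -
    obtain c T where c: "c \<in> A" "open T" "x \<in> T" "T \<subseteq> fst c" "smooth_on (snd c ` T) (\<lambda>y. h (cinv c y))"
      using loc[OF \<open>x \<in> S\<close>] by blast
    have "continuous_on T (\<lambda>x. h (cinv c (snd c x)))"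
      using continuous_on_compose[OF continuous_on_chart[OF c(1,4)] smooth_on_imp_continuous_on[OF c(5)]]
      by (simp add: o_def)
    then have "continuous_on T h"
      by (rule continuous_on_eq) (use c in auto)
    then show ?thesis using c continuous_on_eq_continuous_at by blast
  qed
  then show "continuous_on S h" by (simp add: continuous_at_imp_continuous_on)
next
  fix c' assume c': "c' \<in> A"
  show "smooth_on (snd c' ` (fst c' \<inter> S)) (\<lambda>y. h (cinv c' y))"
  proof (rule smooth_on_local)
    fix y assume "y \<in> snd c' ` (fst c' \<inter> S)"
    then obtain x where x: "x \<in> fst c'" "x \<in> S" "y = snd c' x" by blast
    obtain c T where c: "c \<in> A" "open T" "x \<in> T" "T \<subseteq> fst c" "smooth_on (snd c ` T) (\<lambda>y. h (cinv c y))"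
      using loc[OF x(2)] by blast
    define V where "V = snd c' ` (T \<inter> fst c')"
    have V: "open V" unfolding V_def using c c' by (intro open_image_chart) auto
    have "smooth_on V (\<lambda>y. h (cinv c (snd c (cinv c' y))))"
    proof (rule smooth_on_compose[OF V open_image_chart[OF c(1,2,4)] _ _ c(5)])
      show "smooth_on V (\<lambda>y. snd c (cinv c' y))"
        by (rule smooth_on_subset[OF smooth_transition[OF c' c(1)]]) (use c in \<open>auto simp: V_def\<close>)
      show "(\<lambda>y. snd c (cinv c' y)) ` V \<subseteq> snd c ` T"
        using c' by (auto simp: V_def)
    qed
    then have "smooth_on V (\<lambda>y. h (cinv c' y))"
      by (subst smooth_on_cong[OF V, where g="\<lambda>y. h (cinv c (snd c (cinv c' y)))"]) (use c c' in \<open>auto simp: V_def\<close>)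
    moreover have "y \<in> V" using x c by (auto simp: V_def)
    ultimately show "\<exists>T. open T \<and> y \<in> T \<and> smooth_on T (\<lambda>y. h (cinv c' y))" using V by blast
  qed
qed

lemma smooth_fun_onD:
  assumes "smooth_fun_on A S h"
  shows "open S" "S \<subseteq> pts A" "continuous_on S h"
    "c \<in> A \<Longrightarrow> T \<subseteq> fst c \<inter> S \<Longrightarrow> smooth_on (snd c ` T) (\<lambda>y. h (cinv c y))"
proof -
  show "open S" "S \<subseteq> pts A" "continuous_on S h" using assms by (auto simp: smooth_fun_on_iff)
  assume c: "c \<in> A" "T \<subseteq> fst c \<inter> S"
  have "smooth_on (snd c ` (fst c \<inter> S)) (\<lambda>y. h (cinv c y))"
    using assms c by (auto simp: smooth_fun_on_iff)
  then show "smooth_on (snd c ` T) (\<lambda>y. h (cinv c y))"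
    by (rule smooth_on_subset) (use c in blast)
qed

lemma smooth_fun_on_chartI:
  assumes "c \<in> A" "open S" "S \<subseteq> fst c" "smooth_on (snd c ` S) (\<lambda>y. h (cinv c y))"
  shows "smooth_fun_on A S h"
  by (rule smooth_fun_on_local_chart) (use assms chart_subset_pts in blast)+

lemma smooth_fun_on_local:
  assumes "\<And>x. x \<in> S \<Longrightarrow> \<exists>T. x \<in> T \<and> T \<subseteq> S \<and> smooth_fun_on A T h"
  shows "smooth_fun_on A S h"
proof (rule smooth_fun_on_local_chart)
  show "open S" by (subst open_subopen) (metis assms smooth_fun_onD(1))
  show "S \<subseteq> pts A" using assms smooth_fun_onD(2) by blast
  fix x assume "x \<in> S"
  then obtain T where T: "x \<in> T" "T \<subseteq> S" "smooth_fun_on A T h" using assms by blast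
  obtain c where c: "c \<in> A" "x \<in> fst c" using in_pts_chart smooth_fun_onD(2)[OF T(3)] T(1) by blast
  show "\<exists>c\<in>A. \<exists>T. open T \<and> x \<in> T \<and> T \<subseteq> fst c \<and> smooth_on (snd c ` T) (\<lambda>y. h (cinv c y))"
    using c T smooth_fun_onD(1,4)[OF T(3)]
    by (intro bexI[of _ c] exI[of _ "T \<inter> fst c"]) (auto intro: open_Int)
qed

lemma smooth_fun_on_subset:
  "smooth_fun_on A S h \<Longrightarrow> open T \<Longrightarrow> T \<subseteq> S \<Longrightarrow> smooth_fun_on A T h"
  unfolding smooth_fun_on_iff
  by (auto intro: continuous_on_subset smooth_on_subset[OF _ image_mono])

lemma smooth_fun_on_cong:
  assumes "smooth_fun_on A S h" "\<And>x. x \<in> S \<Longrightarrow> h x = g x"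
  shows "smooth_fun_on A S g"
proof -
  note h = smooth_fun_onD[OF assms(1)]
  have "continuous_on S g" using continuous_on_eq[OF h(3)] assms(2) by blast
  moreover have "smooth_on (snd c ` (fst c \<inter> S)) (\<lambda>y. g (cinv c y))" if "c \<in> A" for c
  proof (subst smooth_on_cong[where g="\<lambda>y. h (cinv c y)"])
    show "open (snd c ` (fst c \<inter> S))" using that h by (intro open_image_chart) auto
  qed (use that assms h in auto)
  ultimately show ?thesis using h by (auto simp: smooth_fun_on_iff)
qed

text \<open>Vector-valued functions are treated through their components. Sums, products, quotients
  and changes of target chart are all compositions of this kind.\<close>

lemma smooth_fun_on_compose:
  fixes u :: "'a \<Rightarrow> 'f::euclidean_space"
  assumes u: "\<And>b. b \<in> Basis \<Longrightarrow> smooth_fun_on A S (\<lambda>x. u x \<bullet> b)"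
    and g: "smooth_on V g" "open V" "u ` S \<subseteq> V"
  shows "smooth_fun_on A S (\<lambda>x. g (u x))"
proof -
  obtain b :: 'f where b: "b \<in> Basis" using nonempty_Basis by blast
  note S = smooth_fun_onD(1,2)[OF u[OF b]]
  show ?thesis
  proof (rule smooth_fun_on_local_chart[OF S])
    fix x assume x: "x \<in> S"
    obtain c where c: "c \<in> A" "x \<in> fst c" using in_pts_chart S x by blast
    have op: "open (snd c ` (fst c \<inter> S))" using c S by (intro open_image_chart) auto
    have "smooth_on (snd c ` (fst c \<inter> S)) (\<lambda>y. u (cinv c y))"
      by (rule smooth_on_componentwise[OF op]) (rule smooth_fun_onD(4)[OF u c(1) order_refl])
    moreover have "(\<lambda>y. u (cinv c y)) ` snd c ` (fst c \<inter> S) \<subseteq> V"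
      using g(3) c by auto
    ultimately have "smooth_on (snd c ` (fst c \<inter> S)) (\<lambda>y. g (u (cinv c y)))"
      using smooth_on_compose[OF op g(2) _ _ g(1)] by blast
    then show "\<exists>c\<in>A. \<exists>T. open T \<and> x \<in> T \<and> T \<subseteq> fst c \<and> smooth_on (snd c ` T) (\<lambda>y. g (u (cinv c y)))"
      using c S x by (intro bexI[of _ c] exI[of _ "fst c \<inter> S"]) auto
  qed
qed

lemma smooth_fun_on_const: "open S \<Longrightarrow> S \<subseteq> pts A \<Longrightarrow> smooth_fun_on A S (\<lambda>x. k)"
  by (auto simp: smooth_fun_on_iff)

lemma smooth_fun_on_real_compose:
  "smooth_fun_on A S u \<Longrightarrow> smooth_on V g \<Longrightarrow> open V \<Longrightarrow> u ` S \<subseteq> V \<Longrightarrow> smooth_fun_on A S (\<lambda>x. g (u x))"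
  for u :: "'a \<Rightarrow> real"
  by (rule smooth_fun_on_compose) auto

lemma smooth_fun_on_Pair_compose:
  fixes u w :: "'a \<Rightarrow> real"
  assumes "smooth_fun_on A S u" "smooth_fun_on A S w" "smooth_on UNIV g"
  shows "smooth_fun_on A S (\<lambda>x. g (u x, w x))"
  by (rule smooth_fun_on_compose[OF _ assms(3)]) (use assms in \<open>auto simp: Basis_prod_def\<close>)

lemma smooth_fun_on_add:
  "smooth_fun_on A S u \<Longrightarrow> smooth_fun_on A S w \<Longrightarrow> smooth_fun_on A S (\<lambda>x. u x + w x)"
  using smooth_fun_on_Pair_compose[OF _ _ smooth_on_add[OF open_UNIV smooth_on_fst smooth_on_snd], of S u w] by simp

lemma smooth_fun_on_mult:
  "smooth_fun_on A S u \<Longrightarrow> smooth_fun_on A S w \<Longrightarrow> smooth_fun_on A S (\<lambda>x. u x * w x)"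
  using smooth_fun_on_Pair_compose[OF _ _ smooth_on_mult[OF open_UNIV smooth_on_fst smooth_on_snd], of S u w] by simp

lemma smooth_fun_on_minus: "smooth_fun_on A S u \<Longrightarrow> smooth_fun_on A S (\<lambda>x. - u x)"
  using smooth_fun_on_real_compose[of S u UNIV uminus] by auto

lemma smooth_fun_on_diff:
  "smooth_fun_on A S u \<Longrightarrow> smooth_fun_on A S w \<Longrightarrow> smooth_fun_on A S (\<lambda>x. u x - w x)"
  using smooth_fun_on_add[of S u "\<lambda>x. - w x"] smooth_fun_on_minus by simp

lemma smooth_fun_on_sum:
  assumes "open S" "S \<subseteq> pts A" "\<And>i. i \<in> I \<Longrightarrow> smooth_fun_on A S (u i)"
  shows "smooth_fun_on A S (\<lambda>x. \<Sum>i\<in>I. u i x)"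
  using assms(3)
  by (induction I rule: infinite_finite_induct)
     (use assms(1,2) in \<open>auto intro: smooth_fun_on_add smooth_fun_on_const\<close>)

lemma smooth_fun_on_divide:
  assumes "smooth_fun_on A S u" "smooth_fun_on A S w" "\<And>x. x \<in> S \<Longrightarrow> w x \<noteq> 0"
  shows "smooth_fun_on A S (\<lambda>x. u x / w x)"
proof -
  have "smooth_fun_on A S (\<lambda>x. inverse (w x))"
    by (rule smooth_fun_on_real_compose[OF assms(2), where V="- {0}"])
       (use assms(3) in \<open>auto intro: smooth_on_inverse\<close>)
  then show ?thesis unfolding divide_inverse by (rule smooth_fun_on_mult[OF assms(1)])
qed

lemma smooth_fun_on_coord: "c \<in> A \<Longrightarrow> smooth_fun_on A (fst c) (\<lambda>x. snd c x \<bullet> b)"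
  unfolding smooth_fun_on_iff
  by (intro conjI ballI open_chart chart_subset_pts continuous_on_inner continuous_on_const continuous_on_chart
      order_refl smooth_on_inner smooth_on_const smooth_transition open_image_chart open_Int) auto

lemma smooth_fun_nearI: "smooth_fun_on A S h \<Longrightarrow> x \<in> S \<Longrightarrow> smooth_fun_near A x h"
  by (auto simp: smooth_fun_near_def)

lemma smooth_fun_near_chart:
  assumes "smooth_fun_near A x h" "c \<in> A" "x \<in> fst c"
  obtains S where "open S" "x \<in> S" "S \<subseteq> fst c" "smooth_fun_on A S h"
    "open (snd c ` S)" "snd c x \<in> snd c ` S" "smooth_on (snd c ` S) (\<lambda>y. h (cinv c y))"
proof -
  obtain S where S: "x \<in> S" "smooth_fun_on A S h" using assms by (auto simp: smooth_fun_near_def)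
  show ?thesis
    by (rule that[of "S \<inter> fst c"])
       (use S assms smooth_fun_onD[OF S(2)] in \<open>auto intro!: open_image_chart smooth_fun_on_subset[OF S(2)]\<close>)
qed

lemma smooth_fun_near_differentiable:
  assumes "smooth_fun_near A x h" "c \<in> A" "x \<in> fst c"
  shows "((\<lambda>y. h (cinv c y)) has_derivative fd (\<lambda>y. h (cinv c y)) (snd c x)) (at (snd c x))"
  using smooth_fun_near_chart[OF assms] smooth_on_has_derivative by metis

lemma smooth_map_onD:
  assumes "smooth_map_on A B S f"
  shows "open S" "S \<subseteq> pts A" "f ` S \<subseteq> pts B" "continuous_on S f"
    "k \<in> B \<Longrightarrow> open (fst k) \<Longrightarrow> smooth_fun_on A (S \<inter> f -` fst k) (\<lambda>x. snd k (f x) \<bullet> b)"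
proof -
  show S: "open S" "S \<subseteq> pts A" "f ` S \<subseteq> pts B" "continuous_on S f"
    using assms by (auto simp: smooth_map_on_def)
  assume k: "k \<in> B" "open (fst k)"
  have op: "open (S \<inter> f -` fst k)" by (rule continuous_open_preimage[OF S(4,1) k(2)])
  have "smooth_on (snd c ` (fst c \<inter> (S \<inter> f -` fst k))) (\<lambda>y. snd k (f (cinv c y)) \<bullet> b)" if "c \<in> A" for c
    using assms that k op S by (auto simp: smooth_map_on_def o_def Int_assoc intro!: smooth_on_inner open_image_chart)
  then have "\<exists>c\<in>A. \<exists>T. open T \<and> x \<in> T \<and> T \<subseteq> fst c \<and> smooth_on (snd c ` T) (\<lambda>y. snd k (f (cinv c y)) \<bullet> b)"
    if x: "x \<in> S \<inter> f -` fst k" for x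
  proof -
    assume *: "\<And>c. c \<in> A \<Longrightarrow> smooth_on (snd c ` (fst c \<inter> (S \<inter> f -` fst k))) (\<lambda>y. snd k (f (cinv c y)) \<bullet> b)"
    have "x \<in> pts A" using S(2) x by auto
    then obtain c where c: "c \<in> A" "x \<in> fst c" using in_pts_chart by blast
    have "open (fst c \<inter> (S \<inter> f -` fst k))" using op c by auto
    then show ?thesis using *[OF c(1)] c x by (metis IntI Int_lower1)
  qed
  then show "smooth_fun_on A (S \<inter> f -` fst k) (\<lambda>x. snd k (f x) \<bullet> b)"
    using op S by (intro smooth_fun_on_local_chart) auto
qed

lemma smooth_fun_comp_map:
  assumes B: "smooth_mfd B" and f: "smooth_map_on A B S f" and h: "smooth_fun_on B U h"
  shows "smooth_fun_on A (S \<inter> f -` U) (\<lambda>x. h (f x))"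
proof -
  interpret B: smooth_mfd B by (rule B)
  have "\<exists>T. x \<in> T \<and> T \<subseteq> S \<inter> f -` U \<and> smooth_fun_on A T (\<lambda>x. h (f x))" if x: "x \<in> S \<inter> f -` U" for x
  proof -
  note U = B.smooth_fun_onD[OF h]
  obtain k where k: "k \<in> B" "f x \<in> fst k" using B.in_pts_chart U x by blast
  let ?T = "S \<inter> f -` (U \<inter> fst k)"
  have T: "open ?T" using smooth_map_onD(1,4)[OF f] U k B.open_chart by (intro continuous_open_preimage) auto
  have "smooth_fun_on A ?T (\<lambda>x. h (cinv k (snd k (f x))))"
  proof (rule smooth_fun_on_compose[where g="\<lambda>y. h (cinv k y)"])
    show "smooth_fun_on A ?T (\<lambda>x. snd k (f x) \<bullet> b)" for b
      using smooth_map_onD(5)[OF f k(1)] k T by (rule_tac smooth_fun_on_subset) (auto simp: B.open_chart)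
    show "smooth_on (snd k ` (U \<inter> fst k)) (\<lambda>y. h (cinv k y))" using U(4)[OF k(1)] by auto
    show "open (snd k ` (U \<inter> fst k))" using U k by (intro B.open_image_chart) (auto simp: B.open_chart)
  qed auto
  then have "smooth_fun_on A ?T (\<lambda>x. h (f x))"
    by (rule smooth_fun_on_cong) (use k in auto)
  then show ?thesis
    using x k by (intro exI[of _ ?T]) auto
  qed
  then show ?thesis by (rule smooth_fun_on_local)
qed

text \<open>A single target chart near each point yields both demands of the definition: continuity
  by applying the inverse chart, and the remaining target charts by transition maps.\<close>

lemma smooth_map_on_local:
  assumes B: "smooth_mfd B" and S: "open S" "S \<subseteq> pts A"
    and loc: "\<And>x. x \<in> S \<Longrightarrow> \<exists>k\<in>B. \<exists>T. x \<in> T \<and> f ` T \<subseteq> fst k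
        \<and> (\<forall>b\<in>Basis. smooth_fun_on A T (\<lambda>x. snd k (f x) \<bullet> b))"
  shows "smooth_map_on A B S f"
proof -
  interpret B: smooth_mfd B by (rule B)
  obtain b0 :: 'c where b0: "b0 \<in> Basis" using nonempty_Basis by blast
  have cont: "isCont f x" if "x \<in> S" for x
  proof -
    obtain k T where k: "k \<in> B" "x \<in> T" "f ` T \<subseteq> fst k"
        "\<And>b. b\<in>Basis \<Longrightarrow> smooth_fun_on A T (\<lambda>x. snd k (f x) \<bullet> b)"
      using loc[OF \<open>x \<in> S\<close>] by blast
    have "continuous_on T (\<lambda>x. \<Sum>b\<in>Basis. (snd k (f x) \<bullet> b) *\<^sub>R b)"
      using smooth_fun_onD(3)[OF k(4)] by (intro continuous_on_sum continuous_on_scaleR continuous_on_const) auto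
    then have "continuous_on T (\<lambda>x. snd k (f x))" by (simp add: euclidean_representation)
    then have "continuous_on T (\<lambda>x. cinv k (snd k (f x)))"
      using continuous_on_compose2[OF B.continuous_on_cinv[OF k(1)]] k(3) by blast
    then have "continuous_on T f"
      by (rule continuous_on_eq) (use k in auto)
    then show ?thesis using k smooth_fun_onD(1)[OF k(4)[OF b0]] continuous_on_eq_continuous_at by blast
  qed
  then have contS: "continuous_on S f" by (simp add: continuous_at_imp_continuous_on)
  show ?thesis
    unfolding smooth_map_on_def
  proof (intro conjI ballI S contS)
    show "f ` S \<subseteq> pts B" using loc B.chart_subset_pts by blast
  next
    fix c k' assume c: "c \<in> A" and k': "k' \<in> B"
    let ?S = "S \<inter> f -` fst k'"
    have opS: "open ?S" using continuous_open_preimage[OF contS S(1)] k' by auto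
    have sm: "smooth_fun_on A ?S (\<lambda>x. snd k' (f x) \<bullet> b)" for b
    proof (rule smooth_fun_on_local)
      fix x assume x: "x \<in> ?S"
      obtain k T where k: "k \<in> B" "x \<in> T" "f ` T \<subseteq> fst k"
          "\<And>b. b\<in>Basis \<Longrightarrow> smooth_fun_on A T (\<lambda>x. snd k (f x) \<bullet> b)"
        using loc[of x] x by blast
      let ?T = "T \<inter> ?S"
      have T: "open ?T" using smooth_fun_onD(1)[OF k(4)[OF b0]] opS by auto
      have V: "open (snd k ` (fst k \<inter> fst k'))" using k k' by (intro B.open_image_chart) auto
      have "smooth_fun_on A ?T (\<lambda>x. snd k' (cinv k (snd k (f x))) \<bullet> b)"
        by (rule smooth_fun_on_compose[where g="\<lambda>y. snd k' (cinv k y) \<bullet> b" and V="snd k ` (fst k \<inter> fst k')"])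
           (use smooth_fun_on_subset[OF k(4) T] k V in \<open>auto intro!: smooth_on_inner B.smooth_transition[OF k(1) k']\<close>)
      then have "smooth_fun_on A ?T (\<lambda>x. snd k' (f x) \<bullet> b)"
        by (rule smooth_fun_on_cong) (use k in auto)
      then show "\<exists>T. x \<in> T \<and> T \<subseteq> ?S \<and> smooth_fun_on A T (\<lambda>x. snd k' (f x) \<bullet> b)"
        using x k by (intro exI[of _ ?T]) auto
    qed
    show "smooth_on (snd c ` (fst c \<inter> S \<inter> f -` fst k')) (snd k' \<circ> f \<circ> cinv c)"
    proof (rule smooth_on_componentwise)
      show "open (snd c ` (fst c \<inter> S \<inter> f -` fst k'))"
        using c opS by (intro open_image_chart) (auto simp: Int_assoc)
      show "smooth_on (snd c ` (fst c \<inter> S \<inter> f -` fst k')) (\<lambda>x. (snd k' \<circ> f \<circ> cinv c) x \<bullet> b)" for b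
        using smooth_fun_onD(4)[OF sm[of b] c order_refl] by (simp add: Int_assoc o_def)
    qed
  qed
qed

end

lemma smooth_mfd_interval: "smooth_mfd (interval_atlas \<delta>)"
  and pts_interval_atlas [simp]: "pts (interval_atlas \<delta>) = {- \<delta><..<\<delta>}"
proof -
  have "homeomorphism {- \<delta><..<\<delta>} {- \<delta><..<\<delta>} (\<lambda>t. t) (inv_into {- \<delta><..<\<delta>} (\<lambda>t. t))"
    by (auto simp: homeomorphism_def image_iff intro!: continuous_on_eq[OF continuous_on_id])
  moreover have "smooth_on {- \<delta><..<\<delta>} (inv_into {- \<delta><..<\<delta>} (\<lambda>t. t))"
    by (subst smooth_on_cong[where g="\<lambda>t. t"])
       (auto intro!: smooth_on_bounded_linear bounded_linear_ident)
  ultimately show "smooth_mfd (interval_atlas \<delta>)"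
    by (auto simp: smooth_mfd_def smooth_atlas_def interval_atlas_def is_chart_def o_def)
  show "pts (interval_atlas \<delta>) = {- \<delta><..<\<delta>}" by (simp add: pts_def interval_atlas_def)
qed

lemma smooth_fun_on_interval_iff:
  "smooth_fun_on (interval_atlas \<delta>) S h \<longleftrightarrow> open S \<and> S \<subseteq> {- \<delta><..<\<delta>} \<and> smooth_on S h"
proof -
  have "smooth_on ({- \<delta><..<\<delta>} \<inter> S) (\<lambda>y. h (inv_into {- \<delta><..<\<delta>} (\<lambda>t. t) y)) = smooth_on S h"
    if "open S" "S \<subseteq> {- \<delta><..<\<delta>}"
  proof -
    have "{- \<delta><..<\<delta>} \<inter> S = S" using that by blast
    then show ?thesis using that by (auto intro!: smooth_on_cong)
  qed
  moreover have "smooth_on S h \<Longrightarrow> continuous_on S h" by (rule smooth_on_imp_continuous_on)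
  ultimately show ?thesis
    by (auto simp: smooth_fun_on_iff interval_atlas_def pts_interval_atlas[unfolded interval_atlas_def])
qed

section \<open>Tangent vectors and vector fields\<close>

lemma tscale_apply [simp]: "tscale r v h = r * v h"
  by (simp add: tscale_def)

lemma sum_tvec_apply [simp]: "(\<Sum>i\<in>I. F i) h = (\<Sum>i\<in>I. F i h)" for F :: "'i \<Rightarrow> 'a tvec"
  by (induction I rule: infinite_finite_induct) auto

interpretation tvs: vector_space tscale
  by unfold_locales (auto simp: fun_eq_iff algebra_simps)

context smooth_mfd
begin

abbreviation TS :: "'a \<Rightarrow> 'a tvec set" where
  "TS \<equiv> tangent_space A"

abbreviation near :: "'a \<Rightarrow> ('a \<Rightarrow> real) \<Rightarrow> bool" where
  "near \<equiv> smooth_fun_near A"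

text \<open>The tangent vector with coordinates \<open>w\<close> in the chart \<open>c\<close>,
  written as a directional derivative. It agrees with \<open>coord_field\<close> on the chart
  domain, but here linearity in \<open>w\<close> is visible.\<close>

definition cvec :: "('a, 'e) chart \<Rightarrow> 'a \<Rightarrow> 'e \<Rightarrow> 'a tvec" where
  "cvec c x w = (\<lambda>h. if near x h then fd (\<lambda>y. h (cinv c y)) (snd c x) w else 0)"

definition crd :: "('a, 'e) chart \<Rightarrow> 'a tvec \<Rightarrow> 'e" where
  "crd c v = (\<Sum>b\<in>Basis. v (\<lambda>q. snd c q \<bullet> b) *\<^sub>R b)"

lemma crd_inner [simp]: "b \<in> Basis \<Longrightarrow> crd c v \<bullet> b = v (\<lambda>q. snd c q \<bullet> b)"
  by (simp add: crd_def inner_sum_left inner_Basis if_distrib cong: if_cong)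

lemma cvec_add: "c \<in> A \<Longrightarrow> x \<in> fst c \<Longrightarrow> cvec c x (w + w') = cvec c x w + cvec c x w'"
  and cvec_scaleR: "c \<in> A \<Longrightarrow> x \<in> fst c \<Longrightarrow> cvec c x (r *\<^sub>R w) = tscale r (cvec c x w)"
proof -
  assume c: "c \<in> A" "x \<in> fst c"
  have lin: "linear (fd (\<lambda>y. h (cinv c y)) (snd c x))" if "near x h" for h
    using has_derivative_linear[OF smooth_fun_near_differentiable[OF that c]] .
  show "cvec c x (w + w') = cvec c x w + cvec c x w'" "cvec c x (r *\<^sub>R w) = tscale r (cvec c x w)"
    by (auto simp: cvec_def fun_eq_iff linear_add[OF lin] linear_scale[OF lin])
qed

lemma cvec_0: "c \<in> A \<Longrightarrow> x \<in> fst c \<Longrightarrow> cvec c x 0 = 0"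
  using cvec_scaleR[of c x 0 0] by (simp add: fun_eq_iff)

lemma cvec_sum: "c \<in> A \<Longrightarrow> x \<in> fst c \<Longrightarrow> cvec c x (\<Sum>i\<in>I. w i) = (\<Sum>i\<in>I. cvec c x (w i))"
  by (induction I rule: infinite_finite_induct) (simp_all add: cvec_0 cvec_add)

lemma cvec_basis_expand:
  "c \<in> A \<Longrightarrow> x \<in> fst c \<Longrightarrow> cvec c x w = (\<Sum>b\<in>Basis. tscale (w \<bullet> b) (cvec c x b))"
  using cvec_sum[of c x "\<lambda>b. (w \<bullet> b) *\<^sub>R b" Basis] by (simp add: cvec_scaleR euclidean_representation)

text \<open>The chain rule at time 0. The assumptions concern only the germ of the curve, so the
  lemma fits the straight chart lines as well as the curves of a variation, which live on a short
  interval.\<close>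

lemma velocity_eq_cvec:
  assumes c: "c \<in> A" and ev: "\<forall>\<^sub>F t in nhds 0. \<gamma> t \<in> fst c"
    and w: "((\<lambda>t. snd c (\<gamma> t)) has_vector_derivative w) (at 0)"
  shows "velocity A \<gamma> = cvec c (\<gamma> 0) w"
proof
  fix h
  have x: "\<gamma> 0 \<in> fst c" using ev eventually_nhds_x_imp_x by blast
  show "velocity A \<gamma> h = cvec c (\<gamma> 0) w h"
  proof (cases "near (\<gamma> 0) h")
    case True
    let ?D = "fd (\<lambda>y. h (cinv c y)) (snd c (\<gamma> 0))"
    have D: "((\<lambda>y. h (cinv c y)) has_derivative ?D) (at (snd c (\<gamma> 0)))"
      using smooth_fun_near_differentiable[OF True c x] .
    from has_derivative_compose[OF w[unfolded has_vector_derivative_def] D]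
    have "((\<lambda>t. h (cinv c (snd c (\<gamma> t)))) has_real_derivative ?D w) (at 0)"
      unfolding has_field_derivative_def
      by (rule has_derivative_eq_rhs) (simp add: fun_eq_iff linear_scale[OF has_derivative_linear[OF D]])
    moreover have "\<forall>\<^sub>F t in nhds 0. h (cinv c (snd c (\<gamma> t))) = h (\<gamma> t)"
      using ev by (rule eventually_mono) (use c in auto)
    note DERIV_cong_ev[OF refl this refl, of "?D w"]
    ultimately have "((\<lambda>t. h (\<gamma> t)) has_real_derivative ?D w) (at 0)" by simp
    then show ?thesis using True by (simp add: velocity_def cvec_def DERIV_imp_deriv)
  qed (simp add: velocity_def cvec_def)
qed

lemma chart_line:
  assumes c: "c \<in> A" "x \<in> fst c"
  obtains \<delta> where "\<delta> > 0" "\<And>t. \<bar>t\<bar> < \<delta> \<Longrightarrow> snd c x + t *\<^sub>R w \<in> snd c ` fst c"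
proof -
  obtain r where r: "r > 0" "ball (snd c x) r \<subseteq> snd c ` fst c"
    using open_chart_image[OF c(1)] c(2) openE by (metis imageI)
  have pos: "norm w + 1 > 0" by (smt (verit) norm_ge_zero)
  \<comment> \<open>The summand 1 in the radius below covers \<open>w = 0\<close>.\<close>
  show ?thesis
  proof (rule that[of "r / (norm w + 1)"])
    show "r / (norm w + 1) > 0" using r pos by simp
    fix t :: real assume "\<bar>t\<bar> < r / (norm w + 1)"
    then have "\<bar>t\<bar> * (norm w + 1) < r" using pos by (simp add: pos_less_divide_eq)
    moreover have "\<bar>t\<bar> * norm w \<le> \<bar>t\<bar> * (norm w + 1)" by (simp add: mult_left_mono)
    ultimately have "dist (snd c x) (snd c x + t *\<^sub>R w) < r" by (simp add: dist_norm)
    then show "snd c x + t *\<^sub>R w \<in> snd c ` fst c" using r(2) by auto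
  qed
qed

lemma velocity_line:
  assumes c: "c \<in> A" "x \<in> fst c"
  shows "velocity A (\<lambda>t. cinv c (snd c x + t *\<^sub>R w)) = cvec c x w"
proof -
  obtain \<delta> where \<delta>: "\<delta> > 0" "\<And>t. \<bar>t\<bar> < \<delta> \<Longrightarrow> snd c x + t *\<^sub>R w \<in> snd c ` fst c"
    using chart_line[OF c] by metis
  have ev: "\<forall>\<^sub>F t in nhds 0. \<bar>t\<bar> < \<delta>"
    using \<delta>(1) by (auto simp: eventually_nhds_metric)
  have "((\<lambda>t. snd c x + t *\<^sub>R w) has_vector_derivative w) (at 0)"
    by (auto intro!: derivative_eq_intros)
  then have "((\<lambda>t. snd c (cinv c (snd c x + t *\<^sub>R w))) has_vector_derivative w) (at 0)"
    by (rule has_vector_derivative_transform_within_open[where S="{-\<delta><..<\<delta>}"])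
       (use \<delta> in \<open>auto simp: abs_less_iff\<close>)
  moreover have "\<forall>\<^sub>F t in nhds 0. cinv c (snd c x + t *\<^sub>R w) \<in> fst c"
    using ev by (rule eventually_mono) (use \<delta> in auto)
  ultimately show ?thesis using velocity_eq_cvec[OF c(1)] c by simp
qed

lemma coord_field_eq_cvec: "c \<in> A \<Longrightarrow> x \<in> fst c \<Longrightarrow> coord_field A c w x = cvec c x w"
  by (simp add: coord_field_def velocity_line)

lemma cvec_in_TS:
  assumes c: "c \<in> A" "x \<in> fst c"
  shows "cvec c x w \<in> TS x"
proof -
  obtain \<delta> where \<delta>: "\<delta> > 0" "\<And>t. \<bar>t\<bar> < \<delta> \<Longrightarrow> snd c x + t *\<^sub>R w \<in> snd c ` fst c"
    using chart_line[OF c] by metis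
  let ?\<gamma> = "\<lambda>t. cinv c (snd c x + t *\<^sub>R w)"
  interpret I: smooth_mfd "interval_atlas \<delta>" by (rule smooth_mfd_interval)
  have "smooth_map_on (interval_atlas \<delta>) A {- \<delta><..<\<delta>} ?\<gamma>"
  proof (rule I.smooth_map_on_local[OF smooth_mfd_axioms])
    fix t assume t: "t \<in> {- \<delta><..<\<delta>}"
    have "smooth_on {- \<delta><..<\<delta>} (\<lambda>t. snd c (?\<gamma> t) \<bullet> b)" for b
    proof (subst smooth_on_cong[where g="\<lambda>t. (snd c x + t *\<^sub>R w) \<bullet> b"])
      show "smooth_on {- \<delta><..<\<delta>} (\<lambda>t. (snd c x + t *\<^sub>R w) \<bullet> b)"
        by (intro smooth_on_inner smooth_on_add smooth_on_scaleR smooth_on_ident smooth_on_const) auto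
    qed (use \<delta> in \<open>auto simp: abs_less_iff\<close>)
    then show "\<exists>k\<in>A. \<exists>T. t \<in> T \<and> ?\<gamma> ` T \<subseteq> fst k \<and>
        (\<forall>b\<in>Basis. smooth_fun_on (interval_atlas \<delta>) T (\<lambda>x. snd k (?\<gamma> x) \<bullet> b))"
      using c t \<delta> by (intro bexI[of _ c] exI[of _ "{- \<delta><..<\<delta>}"])
         (auto simp: smooth_fun_on_interval_iff abs_less_iff)
  qed auto
  then show ?thesis
    unfolding tangent_space_def mem_Collect_eq
    by (intro exI[of _ ?\<gamma>] exI[of _ \<delta>]) (use \<delta>(1) velocity_line[OF c] c in simp)
qed

text \<open>Together with \<open>cvec_in_TS\<close> this identifies \<open>TS x\<close> with the
  model space. Closure of velocities under addition rests on it, since curves on a manifold cannot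
  be added.\<close>

lemma TS_imp_cvec:
  assumes c: "c \<in> A" "x \<in> fst c" and v: "v \<in> TS x"
  obtains w where "v = cvec c x w"
proof -
  obtain \<gamma> \<delta> where \<gamma>: "v = velocity A \<gamma>" "\<delta> > 0" "smooth_map_on (interval_atlas \<delta>) A {- \<delta><..<\<delta>} \<gamma>" "\<gamma> 0 = x"
    using v by (auto simp: tangent_space_def)
  interpret I: smooth_mfd "interval_atlas \<delta>" by (rule smooth_mfd_interval)
  let ?S = "{- \<delta><..<\<delta>} \<inter> \<gamma> -` fst c"
  have S: "smooth_on ?S (\<lambda>t. snd c (\<gamma> t) \<bullet> b)" "open ?S" for b
    using I.smooth_map_onD(5)[OF \<gamma>(3) c(1)] c(1) by (auto simp: smooth_fun_on_interval_iff)
  have 0: "0 \<in> ?S" using \<gamma> c by auto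
  have "smooth_on ?S (\<lambda>t. snd c (\<gamma> t))"
    by (rule smooth_on_componentwise) (use S in auto)
  then have "(\<lambda>t. snd c (\<gamma> t)) differentiable (at 0)"
    using 0 smooth_on_imp_differentiable by blast
  then obtain w where w: "((\<lambda>t. snd c (\<gamma> t)) has_vector_derivative w) (at 0)"
    using vector_derivative_works by blast
  have "\<forall>\<^sub>F t in nhds 0. \<gamma> t \<in> fst c"
    using S(2) 0 eventually_nhds by blast
  from velocity_eq_cvec[OF c(1) this w] show ?thesis using that \<gamma> by simp
qed

lemma TS_add: "x \<in> pts A \<Longrightarrow> u \<in> TS x \<Longrightarrow> v \<in> TS x \<Longrightarrow> u + v \<in> TS x"
  and TS_scale: "x \<in> pts A \<Longrightarrow> u \<in> TS x \<Longrightarrow> tscale r u \<in> TS x"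
  and TS_0: "x \<in> pts A \<Longrightarrow> 0 \<in> TS x"
proof -
  assume "x \<in> pts A"
  then obtain c where c: "c \<in> A" "x \<in> fst c" using in_pts_chart by blast
  show "0 \<in> TS x" using c cvec_0 cvec_in_TS by metis
  assume u: "u \<in> TS x"
  then obtain w where w: "u = cvec c x w" using TS_imp_cvec[OF c] by blast
  then show "tscale r u \<in> TS x" using c cvec_scaleR cvec_in_TS by metis
  assume "v \<in> TS x"
  then obtain w' where "v = cvec c x w'" using TS_imp_cvec[OF c] by blast
  then show "u + v \<in> TS x" using c w cvec_add cvec_in_TS by metis
qed

lemma TS_diff: "x \<in> pts A \<Longrightarrow> u \<in> TS x \<Longrightarrow> v \<in> TS x \<Longrightarrow> u - v \<in> TS x"
proof -
  assume *: "x \<in> pts A" "u \<in> TS x" "v \<in> TS x"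
  have "u - v = u + tscale (-1) v" by (simp add: fun_eq_iff)
  then show ?thesis using * TS_add TS_scale by metis
qed

lemma TS_sum: "x \<in> pts A \<Longrightarrow> (\<And>i. i \<in> I \<Longrightarrow> F i \<in> TS x) \<Longrightarrow> (\<Sum>i\<in>I. F i) \<in> TS x"
  by (induction I rule: infinite_finite_induct) (auto intro: TS_add TS_0)

lemma near_coord: "c \<in> A \<Longrightarrow> x \<in> fst c \<Longrightarrow> near x (\<lambda>q. snd c q \<bullet> b)"
  using smooth_fun_on_coord smooth_fun_nearI by metis

lemma cvec_coord [simp]:
  assumes c: "c \<in> A" "x \<in> fst c"
  shows "cvec c x w (\<lambda>q. snd c q \<bullet> b) = w \<bullet> b"
proof -
  have "((\<lambda>y. y \<bullet> b) has_derivative (\<lambda>w. w \<bullet> b)) (at (snd c x))"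
    by (auto intro!: derivative_eq_intros)
  then have "((\<lambda>y. snd c (cinv c y) \<bullet> b) has_derivative (\<lambda>w. w \<bullet> b)) (at (snd c x))"
    by (rule has_derivative_transform_within_open[where s="snd c ` fst c"]) (use c in auto)
  then show ?thesis using near_coord[OF c] by (simp add: cvec_def fd_eqI)
qed

lemma crd_cvec [simp]: "c \<in> A \<Longrightarrow> x \<in> fst c \<Longrightarrow> crd c (cvec c x w) = w"
  by (rule euclidean_eqI) simp

lemma cvec_crd: "c \<in> A \<Longrightarrow> x \<in> fst c \<Longrightarrow> v \<in> TS x \<Longrightarrow> cvec c x (crd c v) = v"
  using TS_imp_cvec crd_cvec by metis

lemma TS_apply:
  assumes "c \<in> A" "x \<in> fst c" "v \<in> TS x" "near x h"
  shows "v h = fd (\<lambda>y. h (cinv c y)) (snd c x) (crd c v)"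
  using cvec_crd[OF assms(1-3)] assms(4) by (metis cvec_def)

lemma TS_coord_expand:
  "c \<in> A \<Longrightarrow> x \<in> fst c \<Longrightarrow> v \<in> TS x \<Longrightarrow> v = (\<Sum>b\<in>Basis. tscale (v (\<lambda>q. snd c q \<bullet> b)) (cvec c x b))"
  using cvec_basis_expand[of c x "crd c v"] cvec_crd[of c x v] by simp

lemma TS_eqI:
  assumes "c \<in> A" "x \<in> fst c" "u \<in> TS x" "v \<in> TS x"
    and "\<And>b. b \<in> Basis \<Longrightarrow> u (\<lambda>q. snd c q \<bullet> b) = v (\<lambda>q. snd c q \<bullet> b)"
  shows "u = v"
proof -
  have "crd c u = crd c v" by (rule euclidean_eqI) (simp add: assms(5))
  then show ?thesis using cvec_crd assms(1-4) by metis
qed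

lemma near_pts: "near x h \<Longrightarrow> x \<in> pts A"
  using smooth_fun_onD(2) by (auto simp: smooth_fun_near_def)

lemma near_cong:
  assumes "open S" "x \<in> S" "\<And>y. y \<in> S \<Longrightarrow> h y = g y"
  shows "near x h \<longleftrightarrow> near x g"
proof -
  have "near x g" if gh: "near x h" "\<And>y. y \<in> S \<Longrightarrow> h y = g y" for h g
  proof -
    obtain T where T: "x \<in> T" "smooth_fun_on A T h" using gh by (auto simp: smooth_fun_near_def)
    have "smooth_fun_on A (S \<inter> T) h"
      using smooth_fun_onD(1)[OF T(2)] assms(1) by (intro smooth_fun_on_subset[OF T(2)]) auto
    then have "smooth_fun_on A (S \<inter> T) g" by (rule smooth_fun_on_cong) (use gh in auto)
    then show ?thesis using T assms by (auto simp: smooth_fun_near_def)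
  qed
  then show ?thesis using assms(3) by (metis (full_types))
qed

lemma TS_not_near: "v \<in> TS x \<Longrightarrow> \<not> near x h \<Longrightarrow> v h = 0"
  by (auto simp: tangent_space_def velocity_def)

text \<open>A velocity sees only the germ of its argument. If the functions are not smooth near
  \<open>x\<close>, both values are the conventional 0.\<close>

lemma TS_cong:
  assumes "v \<in> TS x" "open S" "x \<in> S" "\<And>y. y \<in> S \<Longrightarrow> h y = g y"
  shows "v h = v g"
proof (cases "near x h")
  case True
  then obtain c where c: "c \<in> A" "x \<in> fst c" using near_pts in_pts_chart by blast
  have ng: "near x g" using near_cong[of S x h g] assms(2-4) True by blast
  have op: "open (snd c ` (S \<inter> fst c))" using c assms by (intro open_image_chart) auto
  have "((\<lambda>y. g (cinv c y)) has_derivative fd (\<lambda>y. h (cinv c y)) (snd c x)) (at (snd c x))"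
    using smooth_fun_near_differentiable[OF True c] op
    by (rule has_derivative_transform_within_open) (use c assms in auto)
  then show ?thesis using TS_apply[OF c assms(1)] ng True fd_eqI by metis
next
  case False
  then have "\<not> near x g" using near_cong[of S x h g] assms(2-4) by blast
  then show ?thesis using TS_not_near[OF assms(1)] False by metis
qed

lemma near_binary:
  assumes "\<And>S. smooth_fun_on A S u \<Longrightarrow> smooth_fun_on A S w \<Longrightarrow> smooth_fun_on A S z"
  shows "near x u \<Longrightarrow> near x w \<Longrightarrow> near x z"
proof -
  assume "near x u" "near x w"
  then obtain S T where S: "x \<in> S" "smooth_fun_on A S u" and T: "x \<in> T" "smooth_fun_on A T w"
    by (auto simp: smooth_fun_near_def)
  have "open (S \<inter> T)" using smooth_fun_onD(1) S T by blast
  then have "smooth_fun_on A (S \<inter> T) z"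
    using smooth_fun_on_subset S T by (intro assms) auto
  then show "near x z" using S T by (auto simp: smooth_fun_near_def)
qed

lemma near_add: "near x u \<Longrightarrow> near x w \<Longrightarrow> near x (\<lambda>y. u y + w y)"
  and near_mult: "near x u \<Longrightarrow> near x w \<Longrightarrow> near x (\<lambda>y. u y * w y)"
  and near_diff: "near x u \<Longrightarrow> near x w \<Longrightarrow> near x (\<lambda>y. u y - w y)"
  by (rule near_binary[OF smooth_fun_on_add] near_binary[OF smooth_fun_on_mult] near_binary[OF smooth_fun_on_diff];
      assumption)+

lemma near_const: "x \<in> pts A \<Longrightarrow> near x (\<lambda>y. k)"
  using smooth_fun_on_const[OF open_pts] smooth_fun_nearI by blast

lemma near_sum: "x \<in> pts A \<Longrightarrow> (\<And>i. i \<in> I \<Longrightarrow> near x (u i)) \<Longrightarrow> near x (\<lambda>y. \<Sum>i\<in>I. u i y)"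
  by (induction I rule: infinite_finite_induct) (simp_all add: near_const near_add)

lemma near_real_compose:
  fixes g :: "real \<Rightarrow> real"
  assumes u: "near x u" and g: "smooth_on V g" "open V" "u x \<in> V"
  shows "near x (\<lambda>y. g (u y))"
proof -
  obtain S where S: "x \<in> S" "smooth_fun_on A S u" using u by (auto simp: smooth_fun_near_def)
  have op: "open (S \<inter> u -` V)"
    using continuous_open_preimage[OF smooth_fun_onD(3,1)[OF S(2)] g(2)] .
  have "smooth_fun_on A (S \<inter> u -` V) (\<lambda>y. g (u y))"
    by (rule smooth_fun_on_real_compose[OF smooth_fun_on_subset[OF S(2) op] g(1,2)]) auto
  then show ?thesis using S g by (auto simp: smooth_fun_near_def intro: exI[of _ "S \<inter> u -` V"])
qed

lemma TS_const: "v \<in> TS x \<Longrightarrow> x \<in> pts A \<Longrightarrow> v (\<lambda>y. k) = 0"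
  using TS_apply[OF _ _ _ near_const] in_pts_chart by fastforce

lemma TS_plus:
  assumes v: "v \<in> TS x" and "near x u" "near x w"
  shows "v (\<lambda>y. u y + w y) = v u + v w"
proof -
  obtain c where c: "c \<in> A" "x \<in> fst c" using near_pts in_pts_chart assms(2) by blast
  show ?thesis
    using fd_eqI[OF has_derivative_add[OF smooth_fun_near_differentiable[OF assms(2) c]
          smooth_fun_near_differentiable[OF assms(3) c]]]
    by (simp add: TS_apply[OF c v] assms(2,3) near_add)
qed

lemma TS_times:
  assumes v: "v \<in> TS x" and "near x u" "near x w"
  shows "v (\<lambda>y. u y * w y) = v u * w x + u x * v w"
proof -
  obtain c where c: "c \<in> A" "x \<in> fst c" using near_pts in_pts_chart assms(2) by blast
  show ?thesis
    using fd_eqI[OF has_derivative_mult[OF smooth_fun_near_differentiable[OF assms(2) c]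
          smooth_fun_near_differentiable[OF assms(3) c]]] c
    by (simp add: TS_apply[OF c v] assms(2,3) near_mult)
qed

lemma TS_cmult: "v \<in> TS x \<Longrightarrow> near x u \<Longrightarrow> v (\<lambda>y. k * u y) = k * v u"
  using TS_times[of v x "\<lambda>y. k" u] near_const near_pts TS_const by simp

lemma TS_setsum:
  assumes "v \<in> TS x" "x \<in> pts A" "\<And>i. i \<in> I \<Longrightarrow> near x (u i)"
  shows "v (\<lambda>y. \<Sum>i\<in>I. u i y) = (\<Sum>i\<in>I. v (u i))"
  using assms(3)
  by (induction I rule: infinite_finite_induct)
     (simp_all add: TS_const[OF assms(1,2)] TS_plus[OF assms(1)] near_sum[OF assms(2)])

lemma TS_real_compose:
  fixes g :: "real \<Rightarrow> real"
  assumes v: "v \<in> TS x" and u: "near x u" and g: "smooth_on V g" "open V" "u x \<in> V"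
    and g': "(g has_real_derivative g') (at (u x))"
  shows "v (\<lambda>y. g (u y)) = g' * v u"
proof -
  obtain c where c: "c \<in> A" "x \<in> fst c" using near_pts in_pts_chart u by blast
  have "(g has_derivative (*) g') (at (u (cinv c (snd c x))))"
    using g' c by (simp add: has_field_derivative_def)
  from fd_eqI[OF has_derivative_compose[OF smooth_fun_near_differentiable[OF u c] this]]
  show ?thesis by (simp add: TS_apply[OF c v] u near_real_compose[OF u g])
qed

section \<open>Smooth vector fields and the Lie bracket\<close>

lemma vfield_onD:
  assumes "vfield_on A S X"
  shows "open S" "S \<subseteq> pts A" "x \<in> S \<Longrightarrow> X x \<in> TS x"
    "W \<subseteq> S \<Longrightarrow> smooth_fun_on A W h \<Longrightarrow> smooth_fun_on A W (\<lambda>x. X x h)"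
  using assms by (auto simp: vfield_on_def)

lemma vfield_on_near:
  assumes "vfield_on A S X" "x \<in> S" "near x h"
  shows "near x (\<lambda>y. X y h)"
proof -
  obtain T where T: "x \<in> T" "smooth_fun_on A T h" using assms by (auto simp: smooth_fun_near_def)
  have "smooth_fun_on A (S \<inter> T) h"
    using smooth_fun_onD(1)[OF T(2)] vfield_onD(1)[OF assms(1)] by (intro smooth_fun_on_subset[OF T(2)]) auto
  then have "smooth_fun_on A (S \<inter> T) (\<lambda>x. X x h)" using vfield_onD(4)[OF assms(1)] by auto
  then show ?thesis using T assms by (auto simp: smooth_fun_near_def)
qed

lemma vfield_on_subset: "vfield_on A S X \<Longrightarrow> open T \<Longrightarrow> T \<subseteq> S \<Longrightarrow> vfield_on A T X"
  unfolding vfield_on_def by blast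

lemma vfield_on_cong:
  assumes "vfield_on A S X" "\<And>x. x \<in> S \<Longrightarrow> X x = Y x"
  shows "vfield_on A S Y"
  unfolding vfield_on_def
proof (intro conjI allI impI ballI)
  fix W h assume W: "W \<subseteq> S \<and> smooth_fun_on A W h"
  then have "smooth_fun_on A W (\<lambda>x. X x h)" using vfield_onD(4)[OF assms(1)] by blast
  then show "smooth_fun_on A W (\<lambda>x. Y x h)" by (rule smooth_fun_on_cong) (use W assms in auto)
qed (use vfield_onD[OF assms(1)] assms(2) in auto)

lemma vfield_on_local:
  assumes "\<And>x. x \<in> S \<Longrightarrow> \<exists>T. x \<in> T \<and> T \<subseteq> S \<and> vfield_on A T X"
  shows "vfield_on A S X"
  unfolding vfield_on_def
proof (intro conjI allI impI ballI)
  show "open S" by (subst open_subopen) (metis assms vfield_onD(1))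
  show "S \<subseteq> pts A" using assms vfield_onD(2) by blast
  show "X x \<in> TS x" if "x \<in> S" for x using assms[OF that] vfield_onD(3) by blast
  fix W h assume W: "W \<subseteq> S \<and> smooth_fun_on A W h"
  show "smooth_fun_on A W (\<lambda>x. X x h)"
  proof (rule smooth_fun_on_local)
    fix x assume x: "x \<in> W"
    then obtain T where T: "x \<in> T" "vfield_on A T X" using assms W by blast
    have "open W" using smooth_fun_onD(1) W by blast
    then have "smooth_fun_on A (W \<inter> T) h"
      using vfield_onD(1)[OF T(2)] W by (rule_tac smooth_fun_on_subset[of W]) auto
    then have "smooth_fun_on A (W \<inter> T) (\<lambda>x. X x h)" using vfield_onD(4)[OF T(2)] by blast
    then show "\<exists>T. x \<in> T \<and> T \<subseteq> W \<and> smooth_fun_on A T (\<lambda>x. X x h)" using x T by blast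
  qed
qed

lemma vfield_on_chartI:
  assumes c: "c \<in> A" "open S" "S \<subseteq> fst c"
    and u: "\<And>b. b \<in> Basis \<Longrightarrow> smooth_fun_on A S (\<lambda>x. u x \<bullet> b)"
    and X: "\<And>x. x \<in> S \<Longrightarrow> X x = cvec c x (u x)"
  shows "vfield_on A S X"
  unfolding vfield_on_def
proof (intro conjI allI impI ballI c(2))
  show pts: "S \<subseteq> pts A" using c chart_subset_pts by blast
  show "X x \<in> TS x" if "x \<in> S" for x using X[OF that] that cvec_in_TS[OF c(1), of x "u x"] c(3) by auto
  fix W h assume "W \<subseteq> S \<and> smooth_fun_on A W h"
  then have W: "W \<subseteq> S" "smooth_fun_on A W h" by auto
  note W' = smooth_fun_onD[OF W(2)]
  have s: "smooth_on (snd c ` W) (\<lambda>y. h (cinv c y))" using W'(4)[OF c(1)] W c by auto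
  have "smooth_fun_on A W (\<lambda>x. fd (\<lambda>y. h (cinv c y)) (snd c x) b)" for b
  proof (rule smooth_fun_on_chartI[OF c(1) W'(1)])
    show "smooth_on (snd c ` W) (\<lambda>y. fd (\<lambda>y. h (cinv c y)) (snd c (cinv c y)) b)"
      by (subst smooth_on_cong[where g="\<lambda>y. fd (\<lambda>y. h (cinv c y)) y b"])
         (use W c W' in \<open>auto intro!: open_image_chart smooth_on_fd s\<close>)
  qed (use W c in auto)
  then have "smooth_fun_on A W (\<lambda>x. \<Sum>b\<in>Basis. (u x \<bullet> b) * fd (\<lambda>y. h (cinv c y)) (snd c x) b)"
    using smooth_fun_on_subset[OF u W'(1) W(1)]
    by (intro smooth_fun_on_sum smooth_fun_on_mult W') auto
  then show "smooth_fun_on A W (\<lambda>x. X x h)"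
  proof (rule smooth_fun_on_cong)
    fix x assume x: "x \<in> W"
    have n: "near x h" using W x smooth_fun_nearI by blast
    have xc: "x \<in> fst c" using x W c by auto
    show "(\<Sum>b\<in>Basis. (u x \<bullet> b) * fd (\<lambda>y. h (cinv c y)) (snd c x) b) = X x h"
      using cvec_basis_expand[OF c(1) xc, of "u x"] X[of x] x W n by (auto simp: cvec_def)
  qed
qed

lemma vfield_on_coord: "c \<in> A \<Longrightarrow> vfield_on A (fst c) (coord_field A c w)"
  by (rule vfield_on_chartI[where u="\<lambda>x. w"])
     (auto simp: coord_field_eq_cvec smooth_fun_on_const chart_subset_pts)

lemma vfield_on_add: "vfield_on A S X \<Longrightarrow> vfield_on A S Y \<Longrightarrow> vfield_on A S (\<lambda>x. X x + Y x)"
  unfolding vfield_on_def by (auto intro!: TS_add smooth_fun_on_add)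

lemma vfield_on_scale: "vfield_on A S X \<Longrightarrow> smooth_fun_on A S \<phi> \<Longrightarrow> vfield_on A S (\<lambda>x. tscale (\<phi> x) (X x))"
  unfolding vfield_on_def
  by (auto intro!: TS_scale smooth_fun_on_mult intro: smooth_fun_on_subset smooth_fun_onD(1))

lemma vfield_on_0: "open S \<Longrightarrow> S \<subseteq> pts A \<Longrightarrow> vfield_on A S (\<lambda>x. 0)"
  unfolding vfield_on_def by (auto intro!: TS_0 smooth_fun_on_const dest: smooth_fun_onD(1))

lemma vfield_on_sum:
  "open S \<Longrightarrow> S \<subseteq> pts A \<Longrightarrow> (\<And>i. i \<in> I \<Longrightarrow> vfield_on A S (X i)) \<Longrightarrow> vfield_on A S (\<lambda>x. \<Sum>i\<in>I. X i x)"
  by (induction I rule: infinite_finite_induct) (simp_all add: vfield_on_0 vfield_on_add)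

lemma vfield_near_common:
  assumes "vfield_near A x X" "vfield_near A x Y"
  obtains S where "x \<in> S" "vfield_on A S X" "vfield_on A S Y"
proof -
  obtain S T where S: "x \<in> S" "vfield_on A S X" and T: "x \<in> T" "vfield_on A T Y"
    using assms by (auto simp: vfield_near_def)
  have "open (S \<inter> T)" using vfield_onD(1) S T by blast
  then show ?thesis using that[of "S \<inter> T"] vfield_on_subset S T by auto
qed

lemma TS_fun_expand:
  "c \<in> A \<Longrightarrow> x \<in> fst c \<Longrightarrow> v \<in> TS x \<Longrightarrow> v h = (\<Sum>b\<in>Basis. v (\<lambda>q. snd c q \<bullet> b) * cvec c x b h)"
  by (subst TS_coord_expand[of c x v]) simp_all

lemma cvec_smooth:
  assumes "c \<in> A" "smooth_fun_on A S h" "S \<subseteq> fst c"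
  shows "smooth_fun_on A S (\<lambda>y. cvec c y b h)"
  by (rule smooth_fun_on_cong[OF vfield_onD(4)[OF vfield_on_coord[OF assms(1)] assms(3,2)]])
     (use assms in \<open>auto simp: coord_field_eq_cvec\<close>)

lemma cvec_commute:
  assumes c: "c \<in> A" "x \<in> fst c" and h: "near x h"
  shows "cvec c x a (\<lambda>y. cvec c y b h) = cvec c x b (\<lambda>y. cvec c y a h)"
proof -
  obtain S where S: "open S" "x \<in> S" "S \<subseteq> fst c" "smooth_fun_on A S h"
    "open (snd c ` S)" "snd c x \<in> snd c ` S" "smooth_on (snd c ` S) (\<lambda>y. h (cinv c y))"
    using smooth_fun_near_chart[OF h c] by blast
  have eq: "cvec c x a (\<lambda>y. cvec c y b h) = fd (\<lambda>q. fd (\<lambda>y. h (cinv c y)) q b) (snd c x) a" for a b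
  proof -
    have n: "near x (\<lambda>y. cvec c y b h)"
      using cvec_smooth[OF c(1) S(4,3)] S(2) smooth_fun_nearI by blast
    have "((\<lambda>q. fd (\<lambda>y. h (cinv c y)) q b) has_derivative
        fd (\<lambda>q. fd (\<lambda>y. h (cinv c y)) q b) (snd c x)) (at (snd c x))"
      using smooth_on_has_derivative[OF smooth_on_fd[OF S(7)] S(6)] .
    then have "((\<lambda>q. cvec c (cinv c q) b h) has_derivative
        fd (\<lambda>q. fd (\<lambda>y. h (cinv c y)) q b) (snd c x)) (at (snd c x))"
    proof (rule has_derivative_transform_within_open[OF _ S(5,6)])
      fix q assume "q \<in> snd c ` S"
      then obtain y where y: "y \<in> S" "q = snd c y" by blast
      have "near y h" using S y smooth_fun_nearI by blast
      then show "fd (\<lambda>y. h (cinv c y)) q b = cvec c (cinv c q) b h"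
        using y S c by (auto simp: cvec_def)
    qed
    then show ?thesis using n by (simp add: cvec_def[of c x] fd_eqI)
  qed
  show ?thesis unfolding eq by (rule fd_fd_commute[OF S(5-7)])
qed

text \<open>Splits the second-order operator \<open>v (Y h)\<close> into a first-order part and a
  second-order part with symmetric coefficients
  \<open>cvec c x a (\<lambda>y. cvec c y b h)\<close>, in preparation for the Lie bracket.\<close>

lemma TS_TS_expand:
  assumes c: "c \<in> A" "x \<in> fst c" and Y: "vfield_on A S Y" "x \<in> S" and v: "v \<in> TS x" and h: "near x h"
  shows "v (\<lambda>y. Y y h) = (\<Sum>b\<in>Basis. v (\<lambda>y. Y y (\<lambda>q. snd c q \<bullet> b)) * cvec c x b h)
    + (\<Sum>b\<in>Basis. \<Sum>a\<in>Basis. Y x (\<lambda>q. snd c q \<bullet> b) * v (\<lambda>q. snd c q \<bullet> a) * cvec c x a (\<lambda>y. cvec c y b h))"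
proof -
  obtain T where T: "open T" "x \<in> T" "T \<subseteq> fst c" "smooth_fun_on A T h"
    using smooth_fun_near_chart[OF h c] by metis
  have pts: "x \<in> pts A" using c chart_subset_pts by blast
  have n: "near x (\<lambda>y. Y y (\<lambda>q. snd c q \<bullet> b))" "near x (\<lambda>y. cvec c y b h)" for b
    using vfield_on_near[OF Y near_coord[OF c]] smooth_fun_nearI[OF cvec_smooth[OF c(1) T(4,3)] T(2)] by auto
  have "v (\<lambda>y. Y y h) = v (\<lambda>y. \<Sum>b\<in>Basis. Y y (\<lambda>q. snd c q \<bullet> b) * cvec c y b h)"
  proof (rule TS_cong[OF v])
    show "open (S \<inter> fst c)" using vfield_onD(1)[OF Y(1)] c by auto
    show "Y y h = (\<Sum>b\<in>Basis. Y y (\<lambda>q. snd c q \<bullet> b) * cvec c y b h)" if "y \<in> S \<inter> fst c" for y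
      using TS_fun_expand[OF c(1)] vfield_onD(3)[OF Y(1)] that by auto
  qed (use Y c in auto)
  also have "\<dots> = (\<Sum>b\<in>Basis. v (\<lambda>y. Y y (\<lambda>q. snd c q \<bullet> b)) * cvec c x b h
      + Y x (\<lambda>q. snd c q \<bullet> b) * v (\<lambda>y. cvec c y b h))"
    by (simp add: TS_setsum[OF v pts] TS_times[OF v] n near_mult)
  also have "\<dots> = (\<Sum>b\<in>Basis. v (\<lambda>y. Y y (\<lambda>q. snd c q \<bullet> b)) * cvec c x b h
      + (\<Sum>a\<in>Basis. Y x (\<lambda>q. snd c q \<bullet> b) * v (\<lambda>q. snd c q \<bullet> a) * cvec c x a (\<lambda>y. cvec c y b h)))"
    by (subst TS_fun_expand[OF c v, of "\<lambda>y. cvec c y _ h"]) (simp add: sum_distrib_left mult.assoc)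
  finally show ?thesis by (simp add: sum.distrib)
qed

text \<open>The bracket is defined as a bare functional on functions. Its second-order parts cancel
  because coordinate derivatives commute, and what remains is a combination of coordinate
  vectors.\<close>

lemma lie_bracket_in_TS:
  assumes X: "vfield_on A S X" and Y: "vfield_on A S Y" and x: "x \<in> S"
  shows "lie_bracket A X Y x \<in> TS x"
proof -
  obtain c where c: "c \<in> A" "x \<in> fst c" using in_pts_chart vfield_onD(2)[OF X] x by blast
  note XT = vfield_onD(3)[OF X x] and YT = vfield_onD(3)[OF Y x]
  define u where "u b = X x (\<lambda>y. Y y (\<lambda>q. snd c q \<bullet> b)) - Y x (\<lambda>y. X y (\<lambda>q. snd c q \<bullet> b))" for b
  have "lie_bracket A X Y x = (\<Sum>b\<in>Basis. tscale (u b) (cvec c x b))"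
  proof
    fix h
    show "lie_bracket A X Y x h = (\<Sum>b\<in>Basis. tscale (u b) (cvec c x b)) h"
    proof (cases "near x h")
      case True
      have "(\<Sum>b\<in>Basis. \<Sum>a\<in>Basis. Y x (\<lambda>q. snd c q \<bullet> b) * X x (\<lambda>q. snd c q \<bullet> a) * cvec c x a (\<lambda>y. cvec c y b h))
          = (\<Sum>b\<in>Basis. \<Sum>a\<in>Basis. X x (\<lambda>q. snd c q \<bullet> b) * Y x (\<lambda>q. snd c q \<bullet> a) * cvec c x a (\<lambda>y. cvec c y b h))"
        by (subst sum.swap, rule sum.cong[OF refl], rule sum.cong[OF refl])
           (simp add: cvec_commute[OF c True] mult.commute)
      then show ?thesis
        using True TS_TS_expand[OF c Y x XT True] TS_TS_expand[OF c X x YT True]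
        by (simp add: lie_bracket_def u_def left_diff_distrib sum_subtractf)
    next
      case False
      then show ?thesis by (simp add: lie_bracket_def cvec_def)
    qed
  qed
  also have "\<dots> \<in> TS x"
    using c chart_subset_pts[OF c(1)] by (intro TS_sum TS_scale cvec_in_TS) auto
  finally show ?thesis .
qed

lemma vfield_on_lie_bracket:
  assumes X: "vfield_on A S X" and Y: "vfield_on A S Y"
  shows "vfield_on A S (lie_bracket A X Y)"
  unfolding vfield_on_def
proof (intro conjI allI impI ballI)
  fix W h assume W: "W \<subseteq> S \<and> smooth_fun_on A W h"
  have "smooth_fun_on A W (\<lambda>x. X x (\<lambda>y. Y y h) - Y x (\<lambda>y. X y h))"
    using W vfield_onD(4)[OF X] vfield_onD(4)[OF Y] by (intro smooth_fun_on_diff) blast+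
  then show "smooth_fun_on A W (\<lambda>x. lie_bracket A X Y x h)"
    by (rule smooth_fun_on_cong) (use W smooth_fun_nearI in \<open>auto simp: lie_bracket_def\<close>)
qed (use vfield_onD[OF X] lie_bracket_in_TS[OF X Y] in auto)

lemma lie_bracket_coord:
  assumes c: "c \<in> A" "x \<in> fst c"
  shows "lie_bracket A (coord_field A c a) (coord_field A c b) x = 0"
proof
  fix h
  show "lie_bracket A (coord_field A c a) (coord_field A c b) x h = 0 h"
  proof (cases "near x h")
    case True
    have "cvec c x a (\<lambda>y. coord_field A c b y h) = cvec c x a (\<lambda>y. cvec c y b h)" for a b
      by (rule TS_cong[OF cvec_in_TS[OF c], where S="fst c"]) (use c in \<open>auto simp: coord_field_eq_cvec\<close>)
    then show ?thesis using True c cvec_commute[OF c True, of a b]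
      by (simp add: lie_bracket_def coord_field_eq_cvec)
  qed (simp add: lie_bracket_def)
qed

end

section \<open>Riemannian metrics and orthonormal frames\<close>

definition lin_comb :: "nat \<Rightarrow> (nat \<Rightarrow> 'a tvec) \<Rightarrow> 'a tvec set" where
  "lin_comb k F = {\<Sum>i<k. tscale (a i) (F i) | a. True}"

lemma lin_comb_add: "u \<in> lin_comb k F \<Longrightarrow> v \<in> lin_comb k F \<Longrightarrow> u + v \<in> lin_comb k F"
proof -
  assume "u \<in> lin_comb k F" "v \<in> lin_comb k F"
  then obtain a b where "u = (\<Sum>i<k. tscale (a i) (F i))" "v = (\<Sum>i<k. tscale (b i) (F i))"
    by (auto simp: lin_comb_def)
  then have "u + v = (\<Sum>i<k. tscale (a i + b i) (F i))"
    by (simp add: tvs.scale_left_distrib sum.distrib)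
  then show ?thesis unfolding lin_comb_def mem_Collect_eq by (intro exI[of _ "\<lambda>i. a i + b i"]) simp
qed

lemma lin_comb_scale: "u \<in> lin_comb k F \<Longrightarrow> tscale r u \<in> lin_comb k F"
proof -
  assume "u \<in> lin_comb k F"
  then obtain a where "u = (\<Sum>i<k. tscale (a i) (F i))" by (auto simp: lin_comb_def)
  then have "tscale r u = (\<Sum>i<k. tscale (r * a i) (F i))"
    by (simp add: tvs.scale_sum_right)
  then show ?thesis unfolding lin_comb_def mem_Collect_eq by (intro exI[of _ "\<lambda>i. r * a i"]) simp
qed

lemma lin_comb_0: "0 \<in> lin_comb k F"
  unfolding lin_comb_def mem_Collect_eq by (intro exI[of _ "\<lambda>i. 0"]) simp

lemma lin_comb_sum: "(\<And>i. i \<in> I \<Longrightarrow> G i \<in> lin_comb k F) \<Longrightarrow> (\<Sum>i\<in>I. G i) \<in> lin_comb k F"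
  by (induction I rule: infinite_finite_induct) (simp_all add: lin_comb_0 lin_comb_add)

lemma lin_comb_base: "j < k \<Longrightarrow> F j \<in> lin_comb k F"
proof -
  assume "j < k"
  then have "F j = (\<Sum>i<k. tscale (if i = j then 1 else 0) (F i))"
    by (simp add: if_distrib[of "\<lambda>r. tscale r _"] cong: if_cong)
  then show ?thesis unfolding lin_comb_def mem_Collect_eq by (intro exI[of _ "\<lambda>i. if i = j then 1 else 0"]) simp
qed

lemma lin_comb_diff: "u \<in> lin_comb k F \<Longrightarrow> v \<in> lin_comb k F \<Longrightarrow> u - v \<in> lin_comb k F"
  using lin_comb_add[of u k F "tscale (-1) v"] lin_comb_scale[of v k F "-1"] by (simp add: fun_eq_iff fun_diff_def plus_fun_def tscale_def)

lemma lin_comb_mono: "k \<le> l \<Longrightarrow> lin_comb k F \<subseteq> lin_comb l F"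
proof
  fix u assume "k \<le> l" "u \<in> lin_comb k F"
  then obtain a where u: "u = (\<Sum>i<k. tscale (a i) (F i))" by (auto simp: lin_comb_def)
  show "u \<in> lin_comb l F"
    unfolding u using \<open>k \<le> l\<close> by (intro lin_comb_sum lin_comb_scale lin_comb_base) auto
qed

locale riem_mfd = smooth_mfd "atlas M"
  for M :: "('a::{t2_space,second_countable_topology}, 'e::euclidean_space, 'z) riem_scheme" +
  assumes riem: "riemannian_manifold M"
begin

abbreviation "P \<equiv> pts (atlas M)"
abbreviation "g \<equiv> met M"

lemma met_sym: "x \<in> P \<Longrightarrow> u \<in> TS x \<Longrightarrow> v \<in> TS x \<Longrightarrow> g x u v = g x v u"
  and met_scale_left: "x \<in> P \<Longrightarrow> u \<in> TS x \<Longrightarrow> v \<in> TS x \<Longrightarrow> g x (tscale r u) v = r * g x u v"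
  and met_add_left: "x \<in> P \<Longrightarrow> u \<in> TS x \<Longrightarrow> v \<in> TS x \<Longrightarrow> w \<in> TS x \<Longrightarrow> g x (u + v) w = g x u w + g x v w"
  and met_pos: "x \<in> P \<Longrightarrow> u \<in> TS x \<Longrightarrow> u \<noteq> 0 \<Longrightarrow> g x u u > 0"
  and met_smooth: "vfield_on (atlas M) S X \<Longrightarrow> vfield_on (atlas M) S Y \<Longrightarrow> smooth_fun_on (atlas M) S (\<lambda>x. g x (X x) (Y x))"
proof -
  have 1: "\<forall>x\<in>P. \<forall>u\<in>TS x. (\<forall>v\<in>TS x. g x u v = g x v u \<and> (\<forall>r. g x (tscale r u) v = r * g x u v)
       \<and> (\<forall>w\<in>TS x. g x (u + v) w = g x u w + g x v w)) \<and> (u \<noteq> 0 \<longrightarrow> g x u u > 0)"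
    and 2: "\<forall>S X Y. vfield_on (atlas M) S X \<and> vfield_on (atlas M) S Y \<longrightarrow>
          smooth_fun_on (atlas M) S (\<lambda>x. g x (X x) (Y x))"
    using riem unfolding riemannian_manifold_def by (rule conjunct1[OF conjunct2], rule conjunct2[OF conjunct2])
  show "x \<in> P \<Longrightarrow> u \<in> TS x \<Longrightarrow> v \<in> TS x \<Longrightarrow> g x u v = g x v u"
    "x \<in> P \<Longrightarrow> u \<in> TS x \<Longrightarrow> v \<in> TS x \<Longrightarrow> g x (tscale r u) v = r * g x u v"
    "x \<in> P \<Longrightarrow> u \<in> TS x \<Longrightarrow> v \<in> TS x \<Longrightarrow> w \<in> TS x \<Longrightarrow> g x (u + v) w = g x u w + g x v w"
    "x \<in> P \<Longrightarrow> u \<in> TS x \<Longrightarrow> u \<noteq> 0 \<Longrightarrow> g x u u > 0"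
    using 1 by blast+
  show "vfield_on (atlas M) S X \<Longrightarrow> vfield_on (atlas M) S Y \<Longrightarrow> smooth_fun_on (atlas M) S (\<lambda>x. g x (X x) (Y x))"
    using 2[rule_format, of S X Y] by simp
qed

lemma met_scale_right: "x \<in> P \<Longrightarrow> u \<in> TS x \<Longrightarrow> v \<in> TS x \<Longrightarrow> g x u (tscale r v) = r * g x u v"
  by (simp add: met_sym[of x u] met_scale_left TS_scale)

lemma met_add_right: "x \<in> P \<Longrightarrow> u \<in> TS x \<Longrightarrow> v \<in> TS x \<Longrightarrow> w \<in> TS x \<Longrightarrow> g x w (u + v) = g x w u + g x w v"
  by (simp add: met_sym[of x w] met_add_left TS_add)

lemma met_0_left [simp]: "x \<in> P \<Longrightarrow> u \<in> TS x \<Longrightarrow> g x 0 u = 0"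
  using met_scale_left[of x 0 u 0] TS_0 by simp

lemma met_0_right [simp]: "x \<in> P \<Longrightarrow> u \<in> TS x \<Longrightarrow> g x u 0 = 0"
  using met_scale_right[of x u 0 0] TS_0 by simp

lemma met_sum_left: "x \<in> P \<Longrightarrow> (\<And>i. i \<in> I \<Longrightarrow> F i \<in> TS x) \<Longrightarrow> u \<in> TS x \<Longrightarrow> g x (\<Sum>i\<in>I. F i) u = (\<Sum>i\<in>I. g x (F i) u)"
  by (induction I rule: infinite_finite_induct) (simp_all add: met_add_left TS_sum)

lemma met_sum_right: "x \<in> P \<Longrightarrow> (\<And>i. i \<in> I \<Longrightarrow> F i \<in> TS x) \<Longrightarrow> u \<in> TS x \<Longrightarrow> g x u (\<Sum>i\<in>I. F i) = (\<Sum>i\<in>I. g x u (F i))"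
  by (induction I rule: infinite_finite_induct) (simp_all add: met_add_right TS_sum)

lemma met_diff_left:
  assumes "x \<in> P" "u \<in> TS x" "v \<in> TS x" "w \<in> TS x"
  shows "g x (u - v) w = g x u w - g x v w"
proof -
  have eq: "u - v = u + tscale (-1) v" by (simp add: fun_eq_iff)
  show ?thesis
    unfolding eq met_add_left[OF assms(1,2) TS_scale[OF assms(1,3)] assms(4)] met_scale_left[OF assms(1,3,4)] by simp
qed

lemma met_diff_right:
  assumes "x \<in> P" "u \<in> TS x" "v \<in> TS x" "w \<in> TS x"
  shows "g x w (u - v) = g x w u - g x w v"
  using assms by (simp add: met_sym[of x w] met_diff_left TS_diff)

lemma met_eq_0_iff: "x \<in> P \<Longrightarrow> u \<in> TS x \<Longrightarrow> g x u u = 0 \<longleftrightarrow> u = 0"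
  using met_pos[of x u] by (cases "u = 0") auto

lemma met_eqI:
  assumes "x \<in> P" "u \<in> TS x" "v \<in> TS x" "\<And>w. w \<in> TS x \<Longrightarrow> g x u w = g x v w"
  shows "u = v"
proof -
  have "g x (u - v) (u - v) = 0" using assms by (simp add: met_diff_left TS_diff)
  then have "u - v = 0" using met_eq_0_iff assms TS_diff by blast
  then show ?thesis by simp
qed

section \<open>Orthonormal systems and the Gram-Schmidt process\<close>

definition orthonormal :: "'a \<Rightarrow> nat \<Rightarrow> (nat \<Rightarrow> 'a tvec) \<Rightarrow> bool" where
  "orthonormal x n e \<longleftrightarrow> (\<forall>i<n. e i \<in> TS x) \<and> (\<forall>i<n. \<forall>j<n. g x (e i) (e j) = (if i = j then 1 else 0))"

lemma orthonormal_TS: "orthonormal x n e \<Longrightarrow> i < n \<Longrightarrow> e i \<in> TS x"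
  by (simp add: orthonormal_def)

lemma orthonormal_comb_TS: "x \<in> P \<Longrightarrow> orthonormal x n e \<Longrightarrow> (\<Sum>i<n. tscale (a i) (e i)) \<in> TS x"
  by (intro TS_sum TS_scale) (auto simp: orthonormal_def)

lemma orthonormal_coeff:
  assumes "x \<in> P" "orthonormal x n e" "j < n"
  shows "g x (\<Sum>i<n. tscale (a i) (e i)) (e j) = a j"
proof -
  have "g x (\<Sum>i<n. tscale (a i) (e i)) (e j) = (\<Sum>i<n. g x (tscale (a i) (e i)) (e j))"
    using assms by (intro met_sum_left) (auto intro: TS_scale orthonormal_TS)
  also have "\<dots> = (\<Sum>i<n. if i = j then a i else 0)"
    using assms by (intro sum.cong) (auto simp: met_scale_left orthonormal_def)
  also have "\<dots> = a j" using assms by simp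
  finally show ?thesis .
qed

text \<open>Dimension counts are reduced to one endomorphism \<open>L\<close> of the model space: it
  sends \<open>b i\<close> to the coordinates of \<open>e i\<close> for \<open>i < n\<close> and the
  other basis vectors to 0, so injectivity and surjectivity of \<open>L\<close> can be
  compared.\<close>

lemma orthonormal_linear:
  assumes x: "x \<in> P" and c: "c \<in> atlas M" "x \<in> fst c" and e: "orthonormal x n e"
    and n: "n \<le> DIM('e)"
  obtains L :: "'e \<Rightarrow> 'e" and b where "linear L" "\<And>a. cvec c x (L a) = (\<Sum>i<n. tscale (a \<bullet> b i) (e i))"
    "bij_betw b {..<DIM('e)} Basis"
proof -
  obtain b :: "nat \<Rightarrow> 'e" where b: "bij_betw b {..<DIM('e)} Basis"
    using ex_bij_betw_nat_finite[OF finite_Basis] by (auto simp: lessThan_atLeast0)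
  define L where "L a = (\<Sum>i<n. (a \<bullet> b i) *\<^sub>R crd c (e i))" for a
  have "linear L"
    unfolding L_def by (intro linear_compose_sum ballI bounded_linear.linear[OF bounded_linear_scaleR_const[OF bounded_linear_inner_left]])
  moreover have "cvec c x (L a) = (\<Sum>i<n. tscale (a \<bullet> b i) (e i))" for a
    unfolding L_def using c orthonormal_TS[OF e] by (simp add: cvec_sum cvec_scaleR cvec_crd)
  ultimately show ?thesis using that b by blast
qed

text \<open>Orthonormality makes \<open>L\<close> injective, hence surjective when the system has as
  many members as the dimension; so every tangent vector is a combination, and pairing with
  \<open>e j\<close> gives its coefficients.\<close>

lemma orthonormal_expand:
  assumes x: "x \<in> P" and e: "orthonormal x DIM('e) e" and v: "v \<in> TS x"
  shows "v = (\<Sum>i<DIM('e). tscale (g x v (e i)) (e i))"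
proof -
  obtain c where c: "c \<in> atlas M" "x \<in> fst c" using in_pts_chart x by blast
  obtain L b where L: "linear L" "\<And>a. cvec c x (L a) = (\<Sum>i<DIM('e). tscale (a \<bullet> b i) (e i))"
    and b: "bij_betw b {..<DIM('e)} (Basis :: 'e set)"
    using orthonormal_linear[OF x c e order_refl] by blast
  have "inj L"
    unfolding linear_injective_0[OF L(1)]
  proof (intro allI impI)
    fix a assume "L a = 0"
    then have "(\<Sum>i<DIM('e). tscale (a \<bullet> b i) (e i)) = 0" using L(2)[of a] cvec_0[OF c] by simp
    then have "a \<bullet> b j = 0" if "j < DIM('e)" for j
      using orthonormal_coeff[OF x e that, of "\<lambda>i. a \<bullet> b i"] x orthonormal_TS[OF e that] by simp
    then have "a \<bullet> b' = 0" if "b' \<in> Basis" for b'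
      using b that by (metis bij_betw_imp_surj_on imageE lessThan_iff)
    then show "a = 0" by (rule_tac euclidean_eqI) simp
  qed
  then have "surj L" using linear_injective_imp_surjective[OF L(1)] by blast
  then obtain a where "L a = crd c v" by (metis surjD)
  then have va: "v = (\<Sum>i<DIM('e). tscale (a \<bullet> b i) (e i))" using L(2)[of a] cvec_crd[OF c v] by simp
  have "g x v (e j) = a \<bullet> b j" if "j < DIM('e)" for j
    using orthonormal_coeff[OF x e that, of "\<lambda>i. a \<bullet> b i"] va by simp
  then show ?thesis using va by simp
qed

text \<open>Supplies the starting vector of a Gram-Schmidt step. If each \<open>cvec c x w\<close>
  were its own projection onto the system, \<open>L\<close> would be surjective and so
  injective.\<close>

lemma orthonormal_not_total:
  assumes x: "x \<in> P" and e: "orthonormal x k e" and k: "k < DIM('e)"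
    and c: "c \<in> atlas M" "x \<in> fst c"
  obtains w where "cvec c x w \<noteq> (\<Sum>i<k. tscale (g x (cvec c x w) (e i)) (e i))"
proof (rule ccontr)
  assume "\<not> thesis"
  then have all: "cvec c x w = (\<Sum>i<k. tscale (g x (cvec c x w) (e i)) (e i))" for w using that by blast
  obtain L b where L: "linear L" "\<And>a. cvec c x (L a) = (\<Sum>i<k. tscale (a \<bullet> b i) (e i))"
    and b: "bij_betw b {..<DIM('e)} (Basis :: 'e set)"
    using orthonormal_linear[OF x c e] k by (metis less_imp_le)
  have bb: "b i \<in> Basis" if "i < DIM('e)" for i using b that by (auto simp: bij_betw_def)
  have bij: "b i \<bullet> b j = (if i = j then 1 else 0)" if "i < DIM('e)" "j < DIM('e)" for i j
    using b that bb by (auto simp: inner_Basis bij_betw_def inj_on_def)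
  have "surj L"
    unfolding surj_def
  proof
    fix w
    define a where "a = (\<Sum>i<k. g x (cvec c x w) (e i) *\<^sub>R b i)"
    have "a \<bullet> b j = g x (cvec c x w) (e j)" if "j < k" for j
      using that k by (simp add: a_def inner_sum_left bij if_distrib cong: if_cong)
    then have "cvec c x (L a) = cvec c x w" using L(2)[of a] all[of w] by simp
    then have "L a = w" using crd_cvec[OF c] by metis
    then show "\<exists>a. w = L a" by blast
  qed
  then have "inj L" using linear_surjective_imp_injective[OF L(1)] by blast
  \<comment> \<open>\<open>b k\<close> is a basis vector beyond the first \<open>k\<close>, hence
    orthogonal to all \<open>b i\<close> that enter \<open>L\<close>.\<close>
  moreover have "cvec c x (L (b k)) = 0"
    unfolding L(2) using k by (simp add: bij)
  then have "L (b k) = 0" using crd_cvec[OF c] cvec_0[OF c] by metis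
  ultimately have "b k = 0" using linear_injective_0[OF L(1)] by blast
  then show False using bb[OF k] nonzero_Basis by metis
qed

definition on_frame :: "'a set \<Rightarrow> nat \<Rightarrow> (nat \<Rightarrow> 'a \<Rightarrow> 'a tvec) \<Rightarrow> bool" where
  "on_frame S k e \<longleftrightarrow> open S \<and> S \<subseteq> P \<and> (\<forall>i<k. vfield_on (atlas M) S (e i))
     \<and> (\<forall>y\<in>S. orthonormal y k (\<lambda>i. e i y))"

text \<open>The last conclusion records the new vector up to a positive factor: the construction of
  adapted frames uses it to control the span of the result.\<close>

lemma gram_schmidt_step:
  assumes e: "on_frame S k e" and Z: "vfield_on (atlas M) S Z"
    and x: "x \<in> S" "Z x \<noteq> (\<Sum>i<k. tscale (g x (Z x) (e i x)) (e i x))"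
  obtains T E where "x \<in> T" "T \<subseteq> S" "on_frame T (Suc k) (e(k := E))"
    "\<And>y. y \<in> T \<Longrightarrow> \<exists>r. r > 0 \<and> E y = tscale (inverse r) (Z y - (\<Sum>i<k. tscale (g y (Z y) (e i y)) (e i y)))"
proof -
  define u where "u y = Z y - (\<Sum>i<k. tscale (g y (Z y) (e i y)) (e i y))" for y
  have S: "open S" "S \<subseteq> P" and ev: "\<And>i. i < k \<Longrightarrow> vfield_on (atlas M) S (e i)"
    and eon: "\<And>y. y \<in> S \<Longrightarrow> orthonormal y k (\<lambda>i. e i y)"
    using e by (auto simp: on_frame_def)
  have "vfield_on (atlas M) S (\<lambda>y. Z y + tscale (-1) (\<Sum>i<k. tscale (g y (Z y) (e i y)) (e i y)))"
    using S ev Z by (intro vfield_on_add vfield_on_scale vfield_on_sum met_smooth smooth_fun_on_const) auto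
  then have uv: "vfield_on (atlas M) S u"
    by (rule vfield_on_cong) (simp add: u_def fun_eq_iff)
  define q where "q y = g y (u y) (u y)" for y
  have q: "smooth_fun_on (atlas M) S q" unfolding q_def by (rule met_smooth[OF uv uv])
  \<comment> \<open>The residual may vanish elsewhere, so the domain shrinks to the open set where
    its squared length is positive; there the normalising factor is smooth.\<close>
  define T where "T = S \<inter> q -` {0<..}"
  have T: "open T" unfolding T_def by (rule continuous_open_preimage[OF smooth_fun_onD(3)[OF q] S(1) open_greaterThan])
  have TS': "T \<subseteq> S" by (auto simp: T_def)
  define E where "E y = tscale (inverse (sqrt (q y))) (u y)" for y
  have xT: "x \<in> T"
  proof -
    have "u x \<noteq> 0" using x(2) by (simp add: u_def)
    then have "q x > 0" unfolding q_def using met_pos x(1) S vfield_onD(3)[OF uv] by blast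
    then show ?thesis using x by (simp add: T_def)
  qed
  have "smooth_fun_on (atlas M) T (\<lambda>y. inverse (sqrt (q y)))"
  proof (rule smooth_fun_on_real_compose[where V="{0<..}" and g="\<lambda>r. inverse (sqrt r)" and u=q])
    show "smooth_on {0<..} (\<lambda>r. inverse (sqrt r))"
    proof (rule smooth_on_compose[where T="{0<..}" and g=inverse and f=sqrt])
      show "smooth_on {0<..} sqrt" by (rule smooth_on_sqrt) auto
      show "smooth_on {0::real<..} inverse" by (rule smooth_on_inverse) auto
    qed auto
    show "smooth_fun_on (atlas M) T q" using smooth_fun_on_subset[OF q T TS'] .
  qed (auto simp: T_def)
  then have Ev: "vfield_on (atlas M) T E"
    unfolding E_def by (intro vfield_on_scale vfield_on_subset[OF uv T TS'])
  have "orthonormal y (Suc k) (\<lambda>i. (e(k := E)) i y)" if y: "y \<in> T" for y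
  proof -
    have yP: "y \<in> P" "y \<in> S" using y S TS' by auto
    have qy: "q y > 0" using y by (simp add: T_def)
    have uT: "u y \<in> TS y" using vfield_onD(3)[OF uv yP(2)] .
    have ET: "E y \<in> TS y" using vfield_onD(3)[OF Ev y] .
    note on = eon[OF yP(2)]
    have ZT: "Z y \<in> TS y" using vfield_onD(3)[OF Z yP(2)] .
    have ue: "g y (u y) (e j y) = 0" if "j < k" for j
      unfolding u_def
      by (subst met_diff_left) (use that yP ZT on orthonormal_TS[OF on] orthonormal_comb_TS[OF yP(1) on]
          orthonormal_coeff[OF yP(1) on that] in auto)
    have Ee: "g y (E y) (e j y) = 0" if "j < k" for j
      unfolding E_def using met_scale_left[OF yP(1) uT orthonormal_TS[OF on that]] ue[OF that] by simp
    moreover have "g y (e j y) (E y) = 0" if "j < k" for j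
      using Ee[OF that] met_sym[OF yP(1) ET orthonormal_TS[OF on that]] by simp
    moreover have "g y (E y) (E y) = 1"
      unfolding E_def using uT yP qy TS_scale[OF yP(1) uT]
      by (simp add: met_scale_left met_scale_right q_def[symmetric] field_simps)
    ultimately show ?thesis
      using on ET by (auto simp: orthonormal_def less_Suc_eq)
  qed
  then have "on_frame T (Suc k) (e(k := E))"
    using T TS' S Ev vfield_on_subset[OF ev T TS'] by (auto simp: on_frame_def less_Suc_eq)
  moreover have "\<exists>r. r > 0 \<and> E y = tscale (inverse r) (Z y - (\<Sum>i<k. tscale (g y (Z y) (e i y)) (e i y)))" if "y \<in> T" for y
    by (rule exI[of _ "sqrt (q y)"]) (use that in \<open>auto simp: T_def E_def u_def\<close>)
  ultimately show ?thesis using that xT TS' by blast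
qed

text \<open>Repeated Gram-Schmidt steps with coordinate fields. The first \<open>k\<close> fields
  are kept unchanged, so a horizontal frame survives completion to a full frame.\<close>

lemma on_frame_extend:
  assumes e: "on_frame S k e" "x \<in> S" "k \<le> DIM('e)"
  obtains T e' where "x \<in> T" "T \<subseteq> S" "on_frame T DIM('e) e'" "\<And>i. i < k \<Longrightarrow> e' i = e i"
proof -
  have "\<exists>T e'. x \<in> T \<and> T \<subseteq> S \<and> on_frame T l e' \<and> (\<forall>i<k. e' i = e i)" if "k \<le> l" "l \<le> DIM('e)" for l
    using that
  proof (induction l rule: dec_induct)
    case base
    then show ?case using e by blast
  next
    case (step l)
    then obtain T e' where T: "x \<in> T" "T \<subseteq> S" "on_frame T l e'" "\<forall>i<k. e' i = e i" by auto
    have TP: "open T" "T \<subseteq> P" "orthonormal x l (\<lambda>i. e' i x)" "x \<in> P" using T by (auto simp: on_frame_def)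
    obtain c where c: "c \<in> atlas M" "x \<in> fst c" using in_pts_chart TP by blast
    obtain w where w: "cvec c x w \<noteq> (\<Sum>i<l. tscale (g x (cvec c x w) (e' i x)) (e' i x))"
      using orthonormal_not_total[OF TP(4,3) _ c] step by auto
    let ?T = "T \<inter> fst c"
    have on: "on_frame ?T l e'"
      unfolding on_frame_def
    proof (intro conjI allI impI ballI)
      show "vfield_on (atlas M) ?T (e' i)" if "i < l" for i
        by (rule vfield_on_subset[where S=T]) (use that T(3) c in \<open>auto simp: on_frame_def\<close>)
    qed (use T(3) c in \<open>auto simp: on_frame_def\<close>)
    obtain T' E where "x \<in> T'" "T' \<subseteq> ?T" "on_frame T' (Suc l) (e'(l := E))"
      by (rule gram_schmidt_step[OF on vfield_on_subset[OF vfield_on_coord[OF c(1), of w]], of x])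
         (use w c T TP in \<open>auto simp: coord_field_eq_cvec\<close>)
    moreover have "(e'(l := E)) i = e i" if "i < k" for i using T(4) step.hyps that by simp
    ultimately show ?case using T(2) by blast
  qed
  then show ?thesis using that e(3) by blast
qed

lemma on_frame_exists:
  assumes "x \<in> P"
  obtains S e where "x \<in> S" "on_frame S DIM('e) e"
proof -
  have "on_frame P 0 (\<lambda>_ _. 0)" by (auto simp: on_frame_def orthonormal_def open_pts)
  then show ?thesis using on_frame_extend[OF _ assms, of 0] that by (metis le0)
qed

lemma on_frameD:
  assumes "on_frame S n e"
  shows "open S" "S \<subseteq> P" "i < n \<Longrightarrow> vfield_on (atlas M) S (e i)" "y \<in> S \<Longrightarrow> orthonormal y n (\<lambda>i. e i y)"
    "y \<in> S \<Longrightarrow> i < n \<Longrightarrow> e i y \<in> TS y"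
  using assms by (auto simp: on_frame_def orthonormal_def)

text \<open>The coefficients in a smooth orthonormal frame are inner products with smooth fields.
  This test reaches fields defined by a separate choice of chart at every point, such as
  \<open>lc_conn\<close>.\<close>

lemma vfield_on_metI:
  assumes S: "open S" "S \<subseteq> P" and X: "\<And>x. x \<in> S \<Longrightarrow> X x \<in> TS x"
    and sm: "\<And>T Z. T \<subseteq> S \<Longrightarrow> vfield_on (atlas M) T Z \<Longrightarrow> smooth_fun_on (atlas M) T (\<lambda>x. g x (X x) (Z x))"
  shows "vfield_on (atlas M) S X"
proof (rule vfield_on_local)
  fix x assume x: "x \<in> S"
  then obtain T e where T: "x \<in> T" "on_frame T DIM('e) e" using on_frame_exists S by blast
  let ?T = "S \<inter> T"
  have op: "open ?T" "?T \<subseteq> P" using S on_frameD[OF T(2)] by auto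
  have ei: "vfield_on (atlas M) ?T (e i)" if "i < DIM('e)" for i
    by (rule vfield_on_subset[OF on_frameD(3)[OF T(2) that] op(1)]) auto
  have "vfield_on (atlas M) ?T (\<lambda>y. \<Sum>i<DIM('e). tscale (g y (X y) (e i y)) (e i y))"
    by (intro vfield_on_sum vfield_on_scale op ei sm) auto
  then have "vfield_on (atlas M) ?T X"
  proof (rule vfield_on_cong)
    show "(\<Sum>i<DIM('e). tscale (g y (X y) (e i y)) (e i y)) = X y" if "y \<in> ?T" for y
      using orthonormal_expand[of y "\<lambda>i. e i y" "X y"] on_frameD(4)[OF T(2)] X that op by auto
  qed
  then show "\<exists>T. x \<in> T \<and> T \<subseteq> S \<and> vfield_on (atlas M) T X" using x T by (intro exI[of _ ?T]) auto
qed

text \<open>The Riesz vector is the sum of the \<open>e i\<close> weighted by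
  \<open>e i x u\<close>; positive definiteness makes it unique, so the \<open>THE\<close> in
  \<open>gradient\<close> is well defined.\<close>

lemma gradient_props:
  assumes x: "x \<in> P"
  shows "gradient M u x \<in> TS x" "v \<in> TS x \<Longrightarrow> g x (gradient M u x) v = v u"
proof -
  obtain S e where S: "x \<in> S" "on_frame S DIM('e) e" using on_frame_exists x by blast
  note on = on_frameD(4)[OF S(2,1)]
  define w where "w = (\<Sum>i<DIM('e). tscale (e i x u) (e i x))"
  have w: "w \<in> TS x" unfolding w_def by (rule orthonormal_comb_TS[OF x on])
  have gw: "g x w v = v u" if v: "v \<in> TS x" for v
  proof -
    have "g x w v = (\<Sum>i<DIM('e). e i x u * g x v (e i x))"
      unfolding w_def
      by (subst met_sum_left)
         (use x v orthonormal_TS[OF on] met_sym[OF x v] in \<open>auto simp: TS_scale met_scale_left\<close>)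
    also have "\<dots> = (\<Sum>i<DIM('e). tscale (g x v (e i x)) (e i x)) u" by (simp add: mult.commute)
    also have "\<dots> = v u" using orthonormal_expand[OF x on v] by simp
    finally show ?thesis .
  qed
  have "gradient M u x = w"
    unfolding gradient_def
  proof (rule the_equality)
    fix w' assume w': "w' \<in> TS x \<and> (\<forall>v\<in>TS x. g x w' v = v u)"
    show "w' = w" by (rule met_eqI[OF x _ w]) (use w' gw in auto)
  qed (use w gw in blast)
  then show "gradient M u x \<in> TS x" "v \<in> TS x \<Longrightarrow> g x (gradient M u x) v = v u" using w gw by auto
qed

end

section \<open>Adapted frames and the projection onto the horizontal bundle\<close>

locale sub_riem_mfd = riem_mfd M
  for M :: "('a::{t2_space,second_countable_topology}, 'e::euclidean_space, 'z) sub_riem_scheme" +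
  assumes subb: "smooth_subbundle (atlas M) (hrank M) (hor M)" and hrank_le: "hrank M \<le> DIM('e)"
begin

lemma hor_local_basis:
  assumes "x \<in> P"
  obtains S E where "x \<in> S" "open S" "S \<subseteq> P" "\<And>i. i < hrank M \<Longrightarrow> vfield_on (atlas M) S (E i)"
    "\<And>y. y \<in> S \<Longrightarrow> hor M y = lin_comb (hrank M) (\<lambda>i. E i y)"
    "\<And>y a. y \<in> S \<Longrightarrow> (\<Sum>i<hrank M. tscale (a i) (E i y)) = 0 \<Longrightarrow> \<forall>i<hrank M. a i = 0"
proof -
  obtain S E where S: "x \<in> S \<and> open S \<and> S \<subseteq> P \<and> (\<forall>i<hrank M. vfield_on (atlas M) S (E i))
     \<and> (\<forall>y\<in>S. hor M y = {\<Sum>i<hrank M. tscale (a i) (E i y) | a. True}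
          \<and> (\<forall>a. (\<Sum>i<hrank M. tscale (a i) (E i y)) = 0 \<longrightarrow> (\<forall>i<hrank M. a i = 0)))"
    using bspec[OF subb[unfolded smooth_subbundle_def] assms] by (elim exE)
  then show ?thesis by (intro that[of S E]) (simp_all add: lin_comb_def)
qed

text \<open>Gram-Schmidt on a local basis \<open>E\<close> of the subbundle, then completion to a
  full orthonormal frame. The completing vectors must be orthogonal to the whole fibre, which is why
  the induction tracks more than the frame itself.\<close>

lemma adapted_frame_exists:
  assumes x: "x \<in> P"
  shows "\<exists>e S. open S \<and> x \<in> S \<and> S \<subseteq> P \<and> adapted_frame_on M S e"
proof -
  let ?m = "hrank M"
  obtain S E where S: "x \<in> S" "open S" "S \<subseteq> P" and E: "\<And>i. i < ?m \<Longrightarrow> vfield_on (atlas M) S (E i)"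
    and hor: "\<And>y. y \<in> S \<Longrightarrow> hor M y = lin_comb ?m (\<lambda>i. E i y)"
    and indep: "\<And>y a. y \<in> S \<Longrightarrow> (\<Sum>i<?m. tscale (a i) (E i y)) = 0 \<Longrightarrow> \<forall>i<?m. a i = 0"
    by (rule hor_local_basis[OF x], rule that)
  have ET: "E i y \<in> TS y" if "i < ?m" "y \<in> S" for i y using vfield_onD(3)[OF E[OF that(1)] that(2)] .
  \<comment> \<open>Two invariants: the \<open>e j\<close> lie in the span of the
    \<open>E i\<close>, hence are horizontal; and orthogonality to all \<open>e i\<close> implies
    orthogonality to all \<open>E j\<close>. The second stands in for the inclusion of spans in the
    other direction and spares inverting the triangular change of basis.\<close>
  have "\<exists>T e. x \<in> T \<and> T \<subseteq> S \<and> on_frame T k e \<and> (\<forall>y\<in>T. \<forall>j<k. e j y \<in> lin_comb k (\<lambda>i. E i y))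
      \<and> (\<forall>y\<in>T. \<forall>j<k. \<forall>v\<in>TS y. (\<forall>i<k. g y v (e i y) = 0) \<longrightarrow> g y v (E j y) = 0)" if "k \<le> ?m" for k
    using that
  proof (induction k)
    case 0
    have "on_frame S 0 (\<lambda>_ _. 0)" using S by (auto simp: on_frame_def orthonormal_def)
    then show ?case using S by blast
  next
    case (Suc k)
    then obtain T e where T: "x \<in> T" "T \<subseteq> S" "on_frame T k e"
      and el: "\<And>y j. y \<in> T \<Longrightarrow> j < k \<Longrightarrow> e j y \<in> lin_comb k (\<lambda>i. E i y)"
      and perp: "\<And>y j v. y \<in> T \<Longrightarrow> j < k \<Longrightarrow> v \<in> TS y \<Longrightarrow> (\<forall>i<k. g y v (e i y) = 0) \<Longrightarrow> g y v (E j y) = 0"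
      by (metis Suc_leD)
    note oT = on_frameD[OF T(3)]
    let ?R = "\<lambda>y. \<Sum>i<k. tscale (g y (E k y) (e i y)) (e i y)"
    have R: "?R y \<in> lin_comb k (\<lambda>i. E i y)" if "y \<in> T" for y
      using el that by (intro lin_comb_sum lin_comb_scale) auto
    have ne: "E k x \<noteq> ?R x"
    proof
      assume "E k x = ?R x"
      then obtain a where a: "E k x = (\<Sum>i<k. tscale (a i) (E i x))" using R[OF T(1)] by (auto simp: lin_comb_def)
      \<comment> \<open>The coefficients of the relation that a vanishing residual would give; the
        entry -1 at \<open>k\<close> contradicts independence.\<close>
      let ?a = "\<lambda>i. if i < k then a i else if i = k then -1 else 0"
      have "(\<Sum>i<?m. tscale (?a i) (E i x)) = (\<Sum>i<Suc k. tscale (?a i) (E i x))"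
        using Suc.prems by (intro sum.mono_neutral_right) auto
      also have "\<dots> = 0" using a by (simp add: fun_eq_iff)
      finally have "\<forall>i<?m. ?a i = 0" by (rule indep[OF S(1)])
      then show False using Suc.prems by (auto dest: spec[of _ k])
    qed
    have Ek: "vfield_on (atlas M) T (E k)"
      using vfield_on_subset[OF E oT(1) T(2)] Suc.prems by simp
    obtain T' F where T': "x \<in> T'" "T' \<subseteq> T" "on_frame T' (Suc k) (e(k := F))"
      and F: "\<And>y. y \<in> T' \<Longrightarrow> \<exists>r. r > 0 \<and> F y = tscale (inverse r) (E k y - ?R y)"
      by (rule gram_schmidt_step[OF T(3) Ek T(1) ne], rule that)
    have A: "(e(k := F)) j y \<in> lin_comb (Suc k) (\<lambda>i. E i y)" if y: "y \<in> T'" and j: "j < Suc k" for y j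
    proof -
      have yT: "y \<in> T" using y T' by auto
      have mono: "lin_comb k (\<lambda>i. E i y) \<subseteq> lin_comb (Suc k) (\<lambda>i. E i y)" by (rule lin_comb_mono) simp
      show ?thesis
      proof (cases "j = k")
        case True
        obtain r where "F y = tscale (inverse r) (E k y - ?R y)" using F[OF y] by blast
        moreover have "E k y \<in> lin_comb (Suc k) (\<lambda>i. E i y)"
          using lin_comb_base[of k "Suc k" "\<lambda>i. E i y"] by simp
        moreover have "?R y \<in> lin_comb (Suc k) (\<lambda>i. E i y)" using R[OF yT] mono by blast
        ultimately show ?thesis using True by (simp only: fun_upd_same lin_comb_scale lin_comb_diff)
      next
        case False
        then show ?thesis using el[OF yT, of j] j mono by auto
      qed
    qed
    have "g y v (E j y) = 0"
      if y: "y \<in> T'" and j: "j < Suc k" and v: "v \<in> TS y" and z: "\<forall>i<Suc k. g y v ((e(k := F)) i y) = 0" for y j v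
    proof (cases "j = k")
      case False
      have "\<forall>i<k. g y v (e i y) = 0"
      proof (intro allI impI)
        fix i assume "i < k"
        then show "g y v (e i y) = 0" using z[rule_format, of i] by simp
      qed
      then show ?thesis using perp[of y j v] T'(2) y False j v by auto
    next
      case True
      have yT: "y \<in> T" "y \<in> P" "y \<in> S" using y T' T S by auto
      have ze: "g y v (e i y) = 0" if "i < k" for i using z[rule_format, of i] that by simp
      obtain r where r: "r > 0" "F y = tscale (inverse r) (E k y - ?R y)" using F[OF y] by blast
      have RT: "?R y \<in> TS y" using orthonormal_comb_TS[OF yT(2) oT(4)[OF yT(1)]] .
      have kT: "E k y \<in> TS y" using ET[OF _ yT(3)] Suc.prems by simp
      have "g y v (?R y) = 0"
        using yT v ze oT(5)[OF yT(1)] by (subst met_sum_right) (auto simp: TS_scale met_scale_right)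
      moreover have "g y v (F y) = 0" using z[rule_format, of k] by simp
      then have "inverse r * (g y v (E k y) - g y v (?R y)) = 0"
        using r(2) met_scale_right[OF yT(2) v TS_diff[OF yT(2) kT RT]] met_diff_right[OF yT(2) kT RT v] by simp
      ultimately show ?thesis using r(1) True by simp
    qed
    note B = this
    show ?case
    proof (intro exI conjI ballI allI impI)
      show "x \<in> T'" "T' \<subseteq> S" "on_frame T' (Suc k) (e(k := F))" using T' T(2) by auto
      show "(e(k := F)) j y \<in> lin_comb (Suc k) (\<lambda>i. E i y)" if "y \<in> T'" "j < Suc k" for y j by (rule A[OF that])
      show "g y v (E j y) = 0" if "y \<in> T'" "j < Suc k" "v \<in> TS y" "\<forall>i<Suc k. g y v ((e(k := F)) i y) = 0" for y j v
        by (rule B[OF that])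
    qed
  qed
  from this[OF order_refl] obtain T e where Te: "x \<in> T \<and> T \<subseteq> S \<and> on_frame T ?m e
      \<and> (\<forall>y\<in>T. \<forall>j<?m. e j y \<in> lin_comb ?m (\<lambda>i. E i y))
      \<and> (\<forall>y\<in>T. \<forall>j<?m. \<forall>v\<in>TS y. (\<forall>i<?m. g y v (e i y) = 0) \<longrightarrow> g y v (E j y) = 0)" by (elim exE)
  then have T: "x \<in> T" "T \<subseteq> S" "on_frame T ?m e" by simp_all
  have el: "e j y \<in> lin_comb ?m (\<lambda>i. E i y)" if "y \<in> T" "j < ?m" for y j
    using Te that by simp
  have perp: "g y v (E j y) = 0" if "y \<in> T" "j < ?m" "v \<in> TS y" "\<forall>i<?m. g y v (e i y) = 0" for y j v
    using Te that by simp
  obtain T' e' where T': "x \<in> T'" "T' \<subseteq> T" "on_frame T' DIM('e) e'" "\<And>i. i < ?m \<Longrightarrow> e' i = e i"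
    using on_frame_extend[OF T(3,1) hrank_le] by metis
  note oT = on_frameD[OF T'(3)]
  have "adapted_frame_on M T' e'"
    unfolding adapted_frame_on_def
  proof (intro conjI ballI allI impI)
    fix y assume y: "y \<in> T'"
    have yS: "y \<in> S" "y \<in> T" "y \<in> P" using y T T' S by auto
    show "e' i y \<in> hor M y" if "i < ?m" for i using el[OF yS(2) that] T'(4)[OF that] hor[OF yS(1)] by simp
    show "g y (e' i y) (e' j y) = (if i = j then 1 else 0)" if "i < DIM('e)" "j < DIM('e)" for i j
      using oT(4)[OF y] that by (simp add: orthonormal_def)
    fix i z assume i: "i \<in> {?m..<DIM('e)}" and z: "z \<in> hor M y"
    then obtain a where a: "z = (\<Sum>i<?m. tscale (a i) (E i y))" using hor[OF yS(1)] by (auto simp: lin_comb_def)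
    have iT: "e' i y \<in> TS y" using oT(5)[OF y] i by simp
    have "g y (e' i y) (E j y) = 0" if j: "j < ?m" for j
    proof (rule perp[OF yS(2) j iT], intro allI impI)
      fix l assume l: "l < ?m"
      have "g y (e' i y) (e' l y) = (if i = l then 1 else 0)"
        using oT(4)[OF y] i l hrank_le by (simp add: orthonormal_def)
      then show "g y (e' i y) (e l y) = 0" using T'(4)[OF l] i l by simp
    qed
    then show "g y (e' i y) z = 0"
      unfolding a using yS iT ET by (subst met_sum_right) (auto simp: TS_scale met_scale_right)
  qed (use oT in auto)
  then show ?thesis using T' oT by blast
qed

lemma frame_adapted:
  "x \<in> P \<Longrightarrow> \<exists>S. open S \<and> x \<in> S \<and> S \<subseteq> P \<and> adapted_frame_on M S (frame M x)"
  unfolding frame_def using adapted_frame_exists[of x] by (rule someI_ex)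

lemma adapted_on_frame:
  "open S \<Longrightarrow> S \<subseteq> P \<Longrightarrow> adapted_frame_on M S e \<Longrightarrow> on_frame S DIM('e) e"
  unfolding on_frame_def adapted_frame_on_def orthonormal_def by (auto dest: vfield_onD(3))

lemma hor_subset_TS:
  assumes "x \<in> P" "z \<in> hor M x"
  shows "z \<in> TS x"
proof -
  obtain S E where S: "x \<in> S" and E: "\<And>i. i < hrank M \<Longrightarrow> vfield_on (atlas M) S (E i)"
    and hor: "hor M x = lin_comb (hrank M) (\<lambda>i. E i x)"
    using hor_local_basis[OF assms(1)] by metis
  then obtain a where "z = (\<Sum>i<hrank M. tscale (a i) (E i x))" using assms by (auto simp: lin_comb_def)
  then show ?thesis using assms vfield_onD(3)[OF E S] by (auto intro!: TS_sum TS_scale)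
qed

lemma hor_comb:
  assumes "x \<in> P" "\<And>i. i < k \<Longrightarrow> e i \<in> hor M x"
  shows "(\<Sum>i<k. tscale (a i) (e i)) \<in> hor M x"
proof -
  obtain E where hor: "hor M x = lin_comb (hrank M) (\<lambda>i. E i x)"
    using hor_local_basis[OF assms(1)] by metis
  then show ?thesis using assms(2) by (auto intro!: lin_comb_sum lin_comb_scale)
qed

lemma adapted_frameD:
  assumes "open S" "S \<subseteq> P" "adapted_frame_on M S e" "y \<in> S"
  shows "i < hrank M \<Longrightarrow> e i y \<in> hor M y" "hrank M \<le> i \<Longrightarrow> i < DIM('e) \<Longrightarrow> z \<in> hor M y \<Longrightarrow> g y (e i y) z = 0"
    "i < DIM('e) \<Longrightarrow> e i y \<in> TS y" "orthonormal y DIM('e) (\<lambda>i. e i y)" "orthonormal y (hrank M) (\<lambda>i. e i y)"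
    "i < hrank M \<Longrightarrow> i < DIM('e)"
  using assms(3,4) hrank_le on_frameD(4,5)[OF adapted_on_frame[OF assms(1-3)]]
  by (auto simp: adapted_frame_on_def orthonormal_def)

lemma hor_expand:
  assumes S: "open S" "S \<subseteq> P" "adapted_frame_on M S e" "y \<in> S" and z: "z \<in> hor M y"
  shows "z = (\<Sum>i<hrank M. tscale (g y z (e i y)) (e i y))"
proof -
  note a = adapted_frameD[OF S]
  have y: "y \<in> P" using S by auto
  have zT: "z \<in> TS y" using hor_subset_TS[OF y z] .
  have "z = (\<Sum>i<DIM('e). tscale (g y z (e i y)) (e i y))"
    using orthonormal_expand[OF y a(4) zT] .
  also have "\<dots> = (\<Sum>i<hrank M. tscale (g y z (e i y)) (e i y))"
    using hrank_le a(2)[OF _ _ z] a(3) met_sym[OF y zT]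
    by (intro sum.mono_neutral_right) auto
  finally show ?thesis .
qed

text \<open>The frame expansion satisfies both defining conditions, and any other candidate has the
  same inner products with the horizontal frame. Thus the \<open>THE\<close> in
  \<open>hor_proj\<close> is well defined and becomes computable.\<close>

lemma hor_proj_eq:
  assumes S: "open S" "S \<subseteq> P" "adapted_frame_on M S e" "y \<in> S" and v: "v \<in> TS y"
  shows "hor_proj M y v = (\<Sum>i<hrank M. tscale (g y v (e i y)) (e i y))"
  unfolding hor_proj_def
proof (rule the_equality)
  note a = adapted_frameD[OF S]
  have y: "y \<in> P" using S by auto
  let ?w = "\<Sum>i<hrank M. tscale (g y v (e i y)) (e i y)"
  have w: "?w \<in> hor M y" by (rule hor_comb[OF y]) (rule a(1))
  note wT = hor_subset_TS[OF y w]
  have perp: "g y (v - ?w) z = 0" if z: "z \<in> hor M y" for z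
  proof -
    have "g y (v - ?w) (e i y) = 0" if "i < hrank M" for i
      using met_diff_left[OF y v wT] a(3)[OF a(6)[OF that]] orthonormal_coeff[OF y a(5) that] by simp
    moreover have "g y (v - ?w) (\<Sum>i<hrank M. tscale (g y z (e i y)) (e i y))
        = (\<Sum>i<hrank M. g y z (e i y) * g y (v - ?w) (e i y))"
      by (subst met_sum_right[OF y])
         (use y TS_diff[OF y v wT] a(3)[OF a(6)] in \<open>auto simp: TS_scale met_scale_right\<close>)
    ultimately show ?thesis using hor_expand[OF S z] by simp
  qed
  then show "?w \<in> hor M y \<and> (\<forall>z\<in>hor M y. g y (v - ?w) z = 0)" using w by blast
  fix w' assume w': "w' \<in> hor M y \<and> (\<forall>z\<in>hor M y. g y (v - w') z = 0)"
  then have w'T: "w' \<in> TS y" using hor_subset_TS[OF y] by blast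
  have "g y w' (e i y) = g y v (e i y)" if "i < hrank M" for i
    using w' a(1)[OF that] met_diff_left[OF y v w'T a(3)[OF a(6)[OF that]]] by auto
  then show "w' = ?w" using hor_expand[OF S, of w'] w' by simp
qed

text \<open>The trace of a bilinear form does not depend on the orthonormal basis: expand one basis
  in the other, swap the sums, contract. It allows the frames that the definitions choose at each
  point to be replaced by one smooth local frame. \<open>L\<close> and \<open>R\<close> ask for
  linearity on horizontal combinations only.\<close>

lemma hor_trace_indep:
  assumes S: "open S" "S \<subseteq> P" "adapted_frame_on M S e" "y \<in> S"
    and T: "open T" "T \<subseteq> P" "adapted_frame_on M T e'" "y \<in> T"
    and L: "\<And>a k. k < hrank M \<Longrightarrow> B (\<Sum>i<hrank M. tscale (a i) (e i y)) (e' k y) = (\<Sum>i<hrank M. a i * B (e i y) (e' k y))"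
    and R: "\<And>a k. k < hrank M \<Longrightarrow> B (e k y) (\<Sum>i<hrank M. tscale (a i) (e' i y)) = (\<Sum>i<hrank M. a i * B (e k y) (e' i y))"
  shows "(\<Sum>i<hrank M. B (e i y) (e i y)) = (\<Sum>i<hrank M. B (e' i y) (e' i y))"
proof -
  note a = adapted_frameD[OF S] and a' = adapted_frameD[OF T]
  have y: "y \<in> P" using S by auto
  have "(\<Sum>i<hrank M. B (e i y) (e i y)) = (\<Sum>i<hrank M. \<Sum>k<hrank M. g y (e i y) (e' k y) * B (e i y) (e' k y))"
    using trans[OF arg_cong[OF hor_expand[OF T a(1)], of _ "B (e _ y)"] R] by (intro sum.cong refl) auto
  also have "\<dots> = (\<Sum>k<hrank M. \<Sum>i<hrank M. g y (e' k y) (e i y) * B (e i y) (e' k y))"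
    by (subst sum.swap, intro sum.cong refl)
       (use met_sym[OF y a(3)[OF a(6)] a'(3)[OF a'(6)]] in auto)
  also have "\<dots> = (\<Sum>i<hrank M. B (e' i y) (e' i y))"
    using trans[OF arg_cong[OF hor_expand[OF S a'(1)], of _ "\<lambda>u. B u (e' _ y)"] L] by (intro sum.cong refl) auto
  finally show ?thesis .
qed

end

section \<open>The Levi-Civita connection\<close>

context riem_mfd
begin

text \<open>The algebra behind metric compatibility: \<open>N i\<close> stands for the covariant
  derivative of the frame vector \<open>F i\<close>, \<open>dg\<close> for the derivative of the
  Gram matrix, \<open>du\<close> and \<open>dw\<close> for those of the coefficients. It is applied
  to \<open>lc_conn\<close>, to the pull-back connection and to the time derivative of the energy
  density.\<close>

lemma met_pointwise_leibniz:
  fixes F N :: "'i \<Rightarrow> 'a tvec"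
  assumes "x \<in> P" "finite I" "\<And>i. i \<in> I \<Longrightarrow> F i \<in> TS x" "\<And>i. i \<in> I \<Longrightarrow> N i \<in> TS x"
    and dg: "\<And>i j. i \<in> I \<Longrightarrow> j \<in> I \<Longrightarrow> dg i j = g x (N i) (F j) + g x (F i) (N j)"
  shows "(\<Sum>i\<in>I. \<Sum>j\<in>I. (du i * w j + u i * dw j) * g x (F i) (F j) + u i * w j * dg i j)
    = g x (\<Sum>i\<in>I. tscale (du i) (F i) + tscale (u i) (N i)) (\<Sum>i\<in>I. tscale (w i) (F i))
    + g x (\<Sum>i\<in>I. tscale (u i) (F i)) (\<Sum>i\<in>I. tscale (dw i) (F i) + tscale (w i) (N i))"
proof -
  have bil: "g x (\<Sum>i\<in>I. U i) (\<Sum>j\<in>I. V j) = (\<Sum>i\<in>I. \<Sum>j\<in>I. g x (U i) (V j))"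
    if "\<And>i. i \<in> I \<Longrightarrow> U i \<in> TS x" "\<And>i. i \<in> I \<Longrightarrow> V i \<in> TS x" for U V
  proof -
    have "g x (\<Sum>i\<in>I. U i) (\<Sum>j\<in>I. V j) = (\<Sum>i\<in>I. g x (U i) (\<Sum>j\<in>I. V j))"
      using that assms(1) by (intro met_sum_left TS_sum) auto
    also have "\<dots> = (\<Sum>i\<in>I. \<Sum>j\<in>I. g x (U i) (V j))"
      using that assms(1) by (intro sum.cong met_sum_right) auto
    finally show ?thesis .
  qed
  show ?thesis
    using assms(1,3,4)
    by (simp add: bil TS_add TS_scale sum.distrib[symmetric])
       (auto intro!: sum.cong simp: met_add_left met_add_right met_scale_left met_scale_right TS_add TS_scale dg algebra_simps)
qed

lemma TS_double_sum_leibniz: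
  assumes v: "v \<in> TS x" and x: "x \<in> P" and n: "\<And>i. i \<in> I \<Longrightarrow> near x (u i)" "\<And>i. i \<in> I \<Longrightarrow> near x (w i)"
    "\<And>i j. i \<in> I \<Longrightarrow> j \<in> I \<Longrightarrow> near x (G i j)"
  shows "v (\<lambda>y. \<Sum>i\<in>I. \<Sum>j\<in>I. u i y * w j y * G i j y)
    = (\<Sum>i\<in>I. \<Sum>j\<in>I. (v (u i) * w j x + u i x * v (w j)) * G i j x + u i x * w j x * v (G i j))"
proof -
  have nn: "near x (\<lambda>y. u i y * w j y)" "near x (\<lambda>y. u i y * w j y * G i j y)" if "i \<in> I" "j \<in> I" for i j
    using n that by (auto intro!: near_mult)
  have "v (\<lambda>y. \<Sum>i\<in>I. \<Sum>j\<in>I. u i y * w j y * G i j y) = (\<Sum>i\<in>I. v (\<lambda>y. \<Sum>j\<in>I. u i y * w j y * G i j y))"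
    using nn assms(1,2) by (intro TS_setsum near_sum)
  also have "\<dots> = (\<Sum>i\<in>I. \<Sum>j\<in>I. v (\<lambda>y. u i y * w j y * G i j y))"
    using nn assms(1,2) by (intro sum.cong refl TS_setsum)
  finally show ?thesis
    using nn n by (auto simp: TS_times[OF v] intro!: sum.cong)
qed

lemma met_smooth_chart: "c \<in> atlas M \<Longrightarrow> smooth_fun_on (atlas M) (fst c) (\<lambda>y. g y (cvec c y a) (cvec c y b))"
proof -
  assume c: "c \<in> atlas M"
  have "smooth_fun_on (atlas M) (fst c) (\<lambda>y. g y (coord_field (atlas M) c a y) (coord_field (atlas M) c b y))"
    by (rule met_smooth[OF vfield_on_coord[OF c] vfield_on_coord[OF c]])
  then show ?thesis by (rule smooth_fun_on_cong) (simp add: coord_field_eq_cvec c)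
qed

lemma met_near_chart: "c \<in> atlas M \<Longrightarrow> x \<in> fst c \<Longrightarrow> near x (\<lambda>y. g y (cvec c y a) (cvec c y b))"
  using met_smooth_chart smooth_fun_nearI by metis

lemma met_chart_expand:
  assumes "c \<in> atlas M" "x \<in> fst c" "u \<in> TS x" "w \<in> TS x"
  shows "g x u w = (\<Sum>a\<in>Basis. \<Sum>b\<in>Basis. u (\<lambda>q. snd c q \<bullet> a) * w (\<lambda>q. snd c q \<bullet> b) * g x (cvec c x a) (cvec c x b))"
proof -
  have x: "x \<in> P" using assms chart_subset_pts by blast
  have "g x u w = g x (\<Sum>a\<in>Basis. tscale (u (\<lambda>q. snd c q \<bullet> a)) (cvec c x a)) (\<Sum>b\<in>Basis. tscale (w (\<lambda>q. snd c q \<bullet> b)) (cvec c x b))"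
    using TS_coord_expand[OF assms(1-3)] TS_coord_expand[OF assms(1,2,4)] by simp
  also have "\<dots> = (\<Sum>a\<in>Basis. g x (tscale (u (\<lambda>q. snd c q \<bullet> a)) (cvec c x a))
      (\<Sum>b\<in>Basis. tscale (w (\<lambda>q. snd c q \<bullet> b)) (cvec c x b)))"
    using x assms by (intro met_sum_left TS_sum TS_scale cvec_in_TS)
  finally show ?thesis
    using x assms by (simp add: met_sum_right TS_sum TS_scale cvec_in_TS met_scale_left met_scale_right
        sum_distrib_left mult_ac)
qed

section \<open>The Koszul formula and a connection built in charts\<close>

definition koszul where
  "koszul X Y Z x = X x (\<lambda>y. g y (Y y) (Z y)) + Y x (\<lambda>y. g y (Z y) (X y)) - Z x (\<lambda>y. g y (X y) (Y y))
    + g x (lie_bracket (atlas M) X Y x) (Z x) - g x (lie_bracket (atlas M) X Z x) (Y x)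
    - g x (lie_bracket (atlas M) Y Z x) (X x)"

text \<open>Stated for any operator \<open>D\<close> that is torsion-free and metric at the single
  point \<open>x\<close>. It is used twice: for \<open>lc_conn\<close>, to prove smoothness, and for
  the connection chosen by \<open>SOME\<close>, to prove locality.\<close>

lemma koszul_formula:
  assumes X: "vfield_on (atlas M) S X" and Y: "vfield_on (atlas M) S Y" and Z: "vfield_on (atlas M) S Z" and x: "x \<in> S"
    and DT: "\<And>v U. v \<in> TS x \<Longrightarrow> vfield_on (atlas M) S U \<Longrightarrow> D v U \<in> TS x"
    and tor: "\<And>U V. vfield_on (atlas M) S U \<Longrightarrow> vfield_on (atlas M) S V \<Longrightarrow>
        D (U x) V - D (V x) U = lie_bracket (atlas M) U V x"
    and met: "\<And>v U V. v \<in> TS x \<Longrightarrow> vfield_on (atlas M) S U \<Longrightarrow> vfield_on (atlas M) S V \<Longrightarrow>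
        v (\<lambda>y. g y (U y) (V y)) = g x (D v U) (V x) + g x (U x) (D v V)"
  shows "2 * g x (D (X x) Y) (Z x) = koszul X Y Z x"
proof -
  have xP: "x \<in> P" using vfield_onD(2)[OF X] x by blast
  have T: "X x \<in> TS x" "Y x \<in> TS x" "Z x \<in> TS x"
    using vfield_onD(3)[OF X x] vfield_onD(3)[OF Y x] vfield_onD(3)[OF Z x] by auto

  show ?thesis
    unfolding koszul_def tor[OF X Y, symmetric] tor[OF X Z, symmetric] tor[OF Y Z, symmetric]
      met[OF T(1) Y Z] met[OF T(2) Z X] met[OF T(3) X Y]
      met_diff_left[OF xP DT[OF T(1) Y] DT[OF T(2) X] T(3)]
      met_diff_left[OF xP DT[OF T(1) Z] DT[OF T(3) X] T(2)]
      met_diff_left[OF xP DT[OF T(2) Z] DT[OF T(3) Y] T(1)]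
      met_sym[OF xP T(1) DT[OF T(3) Y]] met_sym[OF xP T(2) DT[OF T(1) Z]] met_sym[OF xP T(3) DT[OF T(2) X]]
    by simp
qed

text \<open>The same description as in \<open>pullback_conn\<close>, so that both refer to the same
  chart.\<close>

definition chart_at :: "'a \<Rightarrow> ('a, 'e) chart" where
  "chart_at x = (SOME c. c \<in> atlas M \<and> x \<in> fst c)"

lemma chart_at: "x \<in> P \<Longrightarrow> chart_at x \<in> atlas M" "x \<in> P \<Longrightarrow> x \<in> fst (chart_at x)"
proof -
  assume "x \<in> P"
  then have "\<exists>c. c \<in> atlas M \<and> x \<in> fst c" using in_pts_chart by blast
  from someI_ex[OF this] show "chart_at x \<in> atlas M" "x \<in> fst (chart_at x)"
    unfolding chart_at_def by blast+
qed

definition christoffel_low :: "('a, 'e) chart \<Rightarrow> 'a \<Rightarrow> 'e \<Rightarrow> 'e \<Rightarrow> 'e \<Rightarrow> real" where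
  "christoffel_low c x a b d = (cvec c x a (\<lambda>y. g y (cvec c y b) (cvec c y d))
     + cvec c x b (\<lambda>y. g y (cvec c y a) (cvec c y d)) - cvec c x d (\<lambda>y. g y (cvec c y a) (cvec c y b))) / 2"

text \<open>Raising an index: the vector with prescribed inner products \<open>L d\<close> with the \<open>\<partial>\<^sub>d\<close> is the gradient
  of the function \<open>\<Sum>\<^sub>d L d x\<^sub>d\<close>.\<close>

definition christoffel :: "('a, 'e) chart \<Rightarrow> 'a \<Rightarrow> 'e \<Rightarrow> 'e \<Rightarrow> 'a tvec" where
  "christoffel c x a b = gradient M (\<lambda>q. \<Sum>d\<in>Basis. christoffel_low c x a b d * (snd c q \<bullet> d)) x"

text \<open>The classical coordinate formula with Christoffel symbols, evaluated at each point in a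
  chart chosen for that point.\<close>

definition lc_conn :: "'a conn" where
  "lc_conn x u Y = (let c = chart_at x in
     \<Sum>b\<in>Basis. tscale (u (\<lambda>y. Y y (\<lambda>q. snd c q \<bullet> b))) (cvec c x b)
       + tscale (Y x (\<lambda>q. snd c q \<bullet> b)) (\<Sum>a\<in>Basis. tscale (u (\<lambda>q. snd c q \<bullet> a)) (christoffel c x a b)))"

lemma cvec_met_sym:
  assumes c: "c \<in> atlas M" "x \<in> fst c"
  shows "cvec c x d (\<lambda>y. g y (cvec c y a) (cvec c y b)) = cvec c x d (\<lambda>y. g y (cvec c y b) (cvec c y a))"
  by (rule TS_cong[OF cvec_in_TS[OF c], where S="fst c"])
     (use c chart_subset_pts[OF c(1)] met_sym cvec_in_TS[OF c(1)] in auto)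

lemma christoffel_TS:
  assumes c: "c \<in> atlas M" "x \<in> fst c"
  shows "christoffel c x a b \<in> TS x"
  unfolding christoffel_def using gradient_props(1) c chart_subset_pts by blast

lemma met_christoffel:
  assumes c: "c \<in> atlas M" "x \<in> fst c" and d: "d \<in> Basis"
  shows "g x (christoffel c x a b) (cvec c x d) = christoffel_low c x a b d"
proof -
  have x: "x \<in> P" using c chart_subset_pts by blast
  have "g x (christoffel c x a b) (cvec c x d)
      = cvec c x d (\<lambda>q. \<Sum>d\<in>Basis. christoffel_low c x a b d * (snd c q \<bullet> d))"
    unfolding christoffel_def by (rule gradient_props(2)[OF x cvec_in_TS[OF c]])
  also have "\<dots> = (\<Sum>d'\<in>Basis. christoffel_low c x a b d' * (d \<bullet> d'))"
    using c x by (simp add: TS_setsum[OF cvec_in_TS[OF c]] near_mult near_const near_coord TS_cmult[OF cvec_in_TS[OF c]])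
  also have "\<dots> = christoffel_low c x a b d"
    using d by (simp add: inner_Basis if_distrib cong: if_cong)
  finally show ?thesis .
qed

lemma christoffel_sym:
  assumes c: "c \<in> atlas M" "x \<in> fst c"
  shows "christoffel c x a b = christoffel c x b a"
proof -
  have "christoffel_low c x a b = christoffel_low c x b a"
    using cvec_met_sym[OF c, of _ a b] by (auto simp: christoffel_low_def fun_eq_iff)
  then show ?thesis by (simp add: christoffel_def)
qed

text \<open>Exchanging the last two indices in \<open>christoffel_low\<close> and adding cancels all
  but \<open>\<partial>\<^sub>d g\<^sub>a\<^sub>b\<close>; this explains the signs in that
  definition.\<close>

lemma christoffel_metric:
  assumes c: "c \<in> atlas M" "x \<in> fst c" and ab: "a \<in> Basis" "b \<in> Basis" and v: "v \<in> TS x"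
  shows "v (\<lambda>y. g y (cvec c y a) (cvec c y b))
    = g x (\<Sum>d\<in>Basis. tscale (v (\<lambda>q. snd c q \<bullet> d)) (christoffel c x d a)) (cvec c x b)
    + g x (cvec c x a) (\<Sum>d\<in>Basis. tscale (v (\<lambda>q. snd c q \<bullet> d)) (christoffel c x d b))"
proof -
  have x: "x \<in> P" using c chart_subset_pts by blast
  have 1: "g x (\<Sum>d\<in>Basis. tscale (v (\<lambda>q. snd c q \<bullet> d)) (christoffel c x d a)) (cvec c x b)
     = (\<Sum>d\<in>Basis. v (\<lambda>q. snd c q \<bullet> d) * christoffel_low c x d a b)" if "b \<in> Basis" for a b
    using x c that by (simp add: met_sum_left TS_scale christoffel_TS cvec_in_TS met_scale_left met_christoffel)
  have 2: "g x (cvec c x a) (\<Sum>d\<in>Basis. tscale (v (\<lambda>q. snd c q \<bullet> d)) (christoffel c x d b))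
     = (\<Sum>d\<in>Basis. v (\<lambda>q. snd c q \<bullet> d) * christoffel_low c x d b a)"
    using 1[OF ab(1), of b] x c
    by (subst met_sym) (auto intro!: TS_sum TS_scale christoffel_TS cvec_in_TS)
  have "christoffel_low c x d a b + christoffel_low c x d b a = cvec c x d (\<lambda>y. g y (cvec c y a) (cvec c y b))" for d
    using cvec_met_sym[OF c] by (simp add: christoffel_low_def field_simps)
  then show ?thesis
    unfolding 1[OF ab(2)] 2 TS_fun_expand[OF c v, of "\<lambda>y. g y (cvec c y a) (cvec c y b)"]
    by (simp add: sum.distrib[symmetric] distrib_left[symmetric])
qed

lemma lc_conn_TS: "x \<in> P \<Longrightarrow> lc_conn x u Y \<in> TS x"
  unfolding lc_conn_def Let_def using chart_at[of x]
  by (intro TS_sum TS_add TS_scale cvec_in_TS christoffel_TS) auto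

lemma lc_conn_metric:
  assumes Y: "vfield_on (atlas M) S Y" and Z: "vfield_on (atlas M) S Z" and x: "x \<in> S" and v: "v \<in> TS x"
  shows "v (\<lambda>y. g y (Y y) (Z y)) = g x (lc_conn x v Y) (Z x) + g x (Y x) (lc_conn x v Z)"
proof -
  have xP: "x \<in> P" using vfield_onD(2)[OF Y] x by blast
  define c where "c = chart_at x"
  have c: "c \<in> atlas M" "x \<in> fst c" using chart_at xP by (auto simp: c_def)
  note n = vfield_on_near[OF Y x near_coord[OF c]] vfield_on_near[OF Z x near_coord[OF c]]
  have "v (\<lambda>y. g y (Y y) (Z y)) = v (\<lambda>y. \<Sum>a\<in>Basis. \<Sum>b\<in>Basis. Y y (\<lambda>q. snd c q \<bullet> a) * Z y (\<lambda>q. snd c q \<bullet> b)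
      * g y (cvec c y a) (cvec c y b))"
  proof (rule TS_cong[OF v])
    show "open (S \<inter> fst c)" using vfield_onD(1)[OF Y] c by auto
    show "g y (Y y) (Z y) = (\<Sum>a\<in>Basis. \<Sum>b\<in>Basis. Y y (\<lambda>q. snd c q \<bullet> a) * Z y (\<lambda>q. snd c q \<bullet> b)
      * g y (cvec c y a) (cvec c y b))" if "y \<in> S \<inter> fst c" for y
      using that vfield_onD(3)[OF Y] vfield_onD(3)[OF Z] by (intro met_chart_expand[OF c(1)]) auto
  qed (use x c in auto)
  also have "\<dots> = (\<Sum>a\<in>Basis. \<Sum>b\<in>Basis.
      (v (\<lambda>y. Y y (\<lambda>q. snd c q \<bullet> a)) * Z x (\<lambda>q. snd c q \<bullet> b) + Y x (\<lambda>q. snd c q \<bullet> a) * v (\<lambda>y. Z y (\<lambda>q. snd c q \<bullet> b)))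
        * g x (cvec c x a) (cvec c x b)
      + Y x (\<lambda>q. snd c q \<bullet> a) * Z x (\<lambda>q. snd c q \<bullet> b) * v (\<lambda>y. g y (cvec c y a) (cvec c y b)))"
    by (rule TS_double_sum_leibniz[OF v xP]) (use n met_near_chart[OF c] in auto)
  also have "\<dots> = g x (lc_conn x v Y) (\<Sum>b\<in>Basis. tscale (Z x (\<lambda>q. snd c q \<bullet> b)) (cvec c x b))
      + g x (\<Sum>b\<in>Basis. tscale (Y x (\<lambda>q. snd c q \<bullet> b)) (cvec c x b)) (lc_conn x v Z)"
    unfolding lc_conn_def Let_def c_def[symmetric]
    by (rule met_pointwise_leibniz[OF xP finite_Basis])
       (use c xP christoffel_metric[OF c _ _ v] in \<open>auto intro!: cvec_in_TS TS_sum TS_scale christoffel_TS\<close>)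
  finally show ?thesis
    using TS_coord_expand[OF c vfield_onD(3)[OF Y x]] TS_coord_expand[OF c vfield_onD(3)[OF Z x]] by simp
qed

lemma lc_conn_torsion:
  assumes X: "vfield_on (atlas M) S X" and Y: "vfield_on (atlas M) S Y" and x: "x \<in> S"
  shows "lc_conn x (X x) Y - lc_conn x (Y x) X = lie_bracket (atlas M) X Y x"
proof -
  have xP: "x \<in> P" using vfield_onD(2)[OF Y] x by blast
  define c where "c = chart_at x"
  have c: "c \<in> atlas M" "x \<in> fst c" using chart_at xP by (auto simp: c_def)
  let ?X = "\<lambda>b. X x (\<lambda>q. snd c q \<bullet> b)" and ?Y = "\<lambda>b. Y x (\<lambda>q. snd c q \<bullet> b)"
  have "lie_bracket (atlas M) X Y x = (\<Sum>b\<in>Basis. tscale (X x (\<lambda>y. Y y (\<lambda>q. snd c q \<bullet> b)) - Y x (\<lambda>y. X y (\<lambda>q. snd c q \<bullet> b))) (cvec c x b))"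
    by (subst TS_coord_expand[OF c lie_bracket_in_TS[OF X Y x]])
       (simp add: lie_bracket_def near_coord[OF c])
  moreover have "(\<Sum>b\<in>Basis. ?Y b * (\<Sum>a\<in>Basis. ?X a * christoffel c x a b h))
      = (\<Sum>b\<in>Basis. ?X b * (\<Sum>a\<in>Basis. ?Y a * christoffel c x a b h))" for h
    unfolding sum_distrib_left
    by (subst sum.swap, intro sum.cong refl) (simp add: christoffel_sym[OF c] mult.left_commute)
  ultimately show ?thesis
    unfolding lc_conn_def Let_def c_def[symmetric]
    by (simp add: fun_eq_iff sum.distrib left_diff_distrib sum_subtractf)
qed

text \<open>The chart in \<open>lc_conn\<close> jumps from point to point, so smoothness is not read
  off its formula. Its inner products with smooth fields equal half the Koszul expression, in which
  no chart occurs.\<close>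

lemma lc_conn_smooth:
  assumes X: "vfield_on (atlas M) S X" and Y: "vfield_on (atlas M) S Y"
  shows "vfield_on (atlas M) S (\<lambda>x. lc_conn x (X x) Y)"
proof (rule vfield_on_metI)
  show "open S" "S \<subseteq> P" using vfield_onD[OF X] by auto
  then show "lc_conn x (X x) Y \<in> TS x" if "x \<in> S" for x using that lc_conn_TS by auto
  fix T Z assume T: "T \<subseteq> S" and Z: "vfield_on (atlas M) T Z"
  note op = vfield_onD(1,2)[OF Z]
  note XY = vfield_on_subset[OF X op(1) T] vfield_on_subset[OF Y op(1) T]
  have "smooth_fun_on (atlas M) T (\<lambda>x. (1/2) * koszul X Y Z x)"
    unfolding koszul_def
    by (intro smooth_fun_on_add smooth_fun_on_diff smooth_fun_on_mult smooth_fun_on_const op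
        met_smooth vfield_on_lie_bracket XY Z
        vfield_onD(4)[OF XY(1) order_refl] vfield_onD(4)[OF XY(2) order_refl] vfield_onD(4)[OF Z order_refl])
  then show "smooth_fun_on (atlas M) T (\<lambda>x. g x (lc_conn x (X x) Y) (Z x))"
  proof (rule smooth_fun_on_cong)
    fix x assume x: "x \<in> T"
    have "2 * g x (lc_conn x (X x) Y) (Z x) = koszul X Y Z x"
      by (rule koszul_formula[OF XY Z x]) (use op x lc_conn_TS lc_conn_torsion lc_conn_metric in auto)
    then show "1 / 2 * koszul X Y Z x = g x (lc_conn x (X x) Y) (Z x)" by simp
  qed
qed

lemma vfield_near_near: "vfield_near (atlas M) x X \<Longrightarrow> near x h \<Longrightarrow> near x (\<lambda>y. X y h)"
  using vfield_on_near by (auto simp: vfield_near_def)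

lemma vfield_near_TS: "vfield_near (atlas M) x X \<Longrightarrow> X x \<in> TS x"
  using vfield_onD(3) by (auto simp: vfield_near_def)

text \<open>Provides the witness that makes the \<open>SOME\<close> in \<open>levi_civita\<close>
  meaningful.\<close>

lemma lc_conn_is_levi_civita: "is_levi_civita M lc_conn"
  unfolding is_levi_civita_def affine_connection_def
proof (intro conjI allI ballI impI; (elim conjE)?)
  fix x u X assume x: "x \<in> P" and u: "u \<in> TS x" and X: "vfield_near (atlas M) x X"
  define c where "c = chart_at x"
  have c: "c \<in> atlas M" "x \<in> fst c" using chart_at x by (auto simp: c_def)
  note nX = vfield_near_near[OF X near_coord[OF c]]
  show "lc_conn x (tscale r u) X = tscale r (lc_conn x u X)" for r
    unfolding lc_conn_def Let_def
    by (simp add: fun_eq_iff sum_distrib_left sum_distrib_right algebra_simps)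
  show "lc_conn x (u + v) X = lc_conn x u X + lc_conn x v X" for v
    unfolding lc_conn_def Let_def
    by (simp add: fun_eq_iff sum.distrib sum_distrib_left algebra_simps)
  show "lc_conn x u (\<lambda>y. X y + Y y) = lc_conn x u X + lc_conn x u Y" if Y: "vfield_near (atlas M) x Y" for Y
    unfolding lc_conn_def Let_def c_def[symmetric]
    by (simp add: fun_eq_iff TS_plus[OF u nX vfield_near_near[OF Y near_coord[OF c]]] sum.distrib algebra_simps)
  show "lc_conn x u (\<lambda>y. tscale (\<phi> y) (X y)) = tscale (u \<phi>) (X x) + tscale (\<phi> x) (lc_conn x u X)"
    if \<phi>: "near x \<phi>" for \<phi>
  proof
    fix h
    have "X x h = (\<Sum>b\<in>Basis. X x (\<lambda>q. snd c q \<bullet> b) * cvec c x b h)"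
      by (rule TS_fun_expand[OF c vfield_near_TS[OF X]])
    then show "lc_conn x u (\<lambda>y. tscale (\<phi> y) (X y)) h = (tscale (u \<phi>) (X x) + tscale (\<phi> x) (lc_conn x u X)) h"
      unfolding lc_conn_def Let_def c_def[symmetric]
      by (simp add: TS_times[OF u \<phi> nX] sum.distrib sum_distrib_left algebra_simps)
  qed
next
  fix x X Y assume "x \<in> P" "vfield_near (atlas M) x X" "vfield_near (atlas M) x Y"
  then obtain S where "x \<in> S" "vfield_on (atlas M) S X" "vfield_on (atlas M) S Y"
    using vfield_near_common by blast
  then show "lc_conn x (X x) Y - lc_conn x (Y x) X = lie_bracket (atlas M) X Y x"
    "v \<in> TS x \<Longrightarrow> v (\<lambda>y. g y (X y) (Y y)) = g x (lc_conn x v X) (Y x) + g x (X x) (lc_conn x v Y)" for v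
    using lc_conn_torsion lc_conn_metric by blast+
qed (use lc_conn_smooth lc_conn_TS in auto)

section \<open>Rules for the Levi-Civita connection\<close>

abbreviation "D \<equiv> levi_civita M"

lemma levi_civita: "is_levi_civita M D"
  unfolding levi_civita_def by (rule someI[of "is_levi_civita M"], rule lc_conn_is_levi_civita)

lemma D_smooth: "vfield_on (atlas M) S X \<Longrightarrow> vfield_on (atlas M) S Y \<Longrightarrow> vfield_on (atlas M) S (\<lambda>x. D x (X x) Y)"
  using levi_civita unfolding is_levi_civita_def affine_connection_def by blast

lemma D_props:
  assumes "x \<in> P" "u \<in> TS x" "vfield_near (atlas M) x X"
  shows "D x u X \<in> TS x" "D x (tscale r u) X = tscale r (D x u X)"
    "v \<in> TS x \<Longrightarrow> D x (u + v) X = D x u X + D x v X"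
    "vfield_near (atlas M) x Y \<Longrightarrow> D x u (\<lambda>y. X y + Y y) = D x u X + D x u Y"
    "near x \<phi> \<Longrightarrow> D x u (\<lambda>y. tscale (\<phi> y) (X y)) = tscale (u \<phi>) (X x) + tscale (\<phi> x) (D x u X)"
  using levi_civita assms unfolding is_levi_civita_def affine_connection_def by blast+

lemma D_torsion:
  assumes "x \<in> P" "vfield_near (atlas M) x X" "vfield_near (atlas M) x Y"
  shows "D x (X x) Y - D x (Y x) X = lie_bracket (atlas M) X Y x"
  using levi_civita assms unfolding is_levi_civita_def by blast

lemma D_metric:
  assumes "x \<in> P" "vfield_near (atlas M) x X" "vfield_near (atlas M) x Y" "v \<in> TS x"
  shows "v (\<lambda>y. g y (X y) (Y y)) = g x (D x v X) (Y x) + g x (X x) (D x v Y)"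
  using levi_civita assms unfolding is_levi_civita_def by blast

lemma vfield_nearI: "vfield_on (atlas M) S X \<Longrightarrow> x \<in> S \<Longrightarrow> vfield_near (atlas M) x X"
  by (auto simp: vfield_near_def)

lemma vfield_near_coord: "c \<in> atlas M \<Longrightarrow> x \<in> fst c \<Longrightarrow> vfield_near (atlas M) x (coord_field (atlas M) c b)"
  using vfield_nearI[OF vfield_on_coord] .

lemma D_sum_dir:
  assumes x: "x \<in> P" and X: "vfield_near (atlas M) x X" and F: "\<And>i. i \<in> I \<Longrightarrow> F i \<in> TS x" and fin: "finite I"
  shows "D x (\<Sum>i\<in>I. tscale (a i) (F i)) X = (\<Sum>i\<in>I. tscale (a i) (D x (F i) X))"
  using fin F
proof (induction I)
  case empty
  have "D x (tscale 0 0) X = tscale 0 (D x 0 X)" by (rule D_props(2)[OF x TS_0[OF x] X])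
  then show ?case by (simp only: tvs.scale_zero_left sum.empty)
next
  case (insert i I)
  then have F: "F i \<in> TS x" "(\<Sum>i\<in>I. tscale (a i) (F i)) \<in> TS x" using x by (auto intro!: TS_sum TS_scale)
  have IH: "D x (\<Sum>i\<in>I. tscale (a i) (F i)) X = (\<Sum>i\<in>I. tscale (a i) (D x (F i) X))"
    using insert by blast
  show ?case
    unfolding sum.insert[OF insert.hyps] D_props(3)[OF x TS_scale[OF x F(1)] X F(2)] D_props(2)[OF x F(1) X] IH ..
qed

lemma D_sum_field:
  assumes x: "x \<in> P" "u \<in> TS x" and X: "\<And>i. i \<in> I \<Longrightarrow> vfield_on (atlas M) S (X i)" "x \<in> S" and fin: "finite I" "I \<noteq> {}"
  shows "D x u (\<lambda>y. \<Sum>i\<in>I. X i y) = (\<Sum>i\<in>I. D x u (X i))"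
  using fin X
proof (induction I rule: finite_ne_induct)
  case (insert i I)
  have op: "open S" "S \<subseteq> P" using vfield_onD(1,2) insert.prems by blast+
  have "vfield_near (atlas M) x (\<lambda>y. \<Sum>i\<in>I. X i y)" "vfield_near (atlas M) x (X i)"
    using insert.prems op by (auto intro!: vfield_nearI[of S] vfield_on_sum)
  then have "D x u (\<lambda>y. X i y + (\<Sum>i\<in>I. X i y)) = D x u (X i) + D x u (\<lambda>y. \<Sum>i\<in>I. X i y)"
    using D_props(4)[OF x] by blast
  moreover have "D x u (\<lambda>y. \<Sum>i\<in>I. X i y) = (\<Sum>i\<in>I. D x u (X i))" using insert by blast
  ultimately show ?case by (simp only: sum.insert[OF insert.hyps(1,3)])
qed simp

lemma TS_extend:
  assumes "x \<in> P" "u \<in> TS x"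
  obtains S X where "x \<in> S" "vfield_on (atlas M) S X" "X x = u"
proof -
  obtain c where c: "c \<in> atlas M" "x \<in> fst c" using in_pts_chart assms by blast
  show ?thesis
    using that[OF c(2) vfield_on_coord[OF c(1), of "crd c u"]] coord_field_eq_cvec[OF c] cvec_crd[OF c assms(2)] by simp
qed

text \<open>The axioms of a connection do not mention locality, and fields that agree only near
  \<open>x\<close> are different HOL functions. The Koszul formula determines \<open>D x u X\<close>
  by derivatives at \<open>x\<close> of functions of \<open>X\<close>, and these depend only on the
  germ.\<close>

lemma D_cong:
  assumes X: "vfield_on (atlas M) S X" and Y: "vfield_on (atlas M) S Y" and x: "x \<in> S" "u \<in> TS x"
    and eq: "\<And>y. y \<in> S \<Longrightarrow> X y = Y y"
  shows "D x u X = D x u Y"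
proof -
  have xP: "x \<in> P" using vfield_onD(2)[OF X] x by blast
  note nX = vfield_nearI[OF X x(1)] and nY = vfield_nearI[OF Y x(1)]

  have 0: "v (\<lambda>y. g y (X y) (Z y)) = v (\<lambda>y. g y (Y y) (Z y))" if "v \<in> TS x" for v Z
    by (rule TS_cong[OF that vfield_onD(1)[OF X] x(1)]) (simp add: eq)
  \<comment> \<open>The Koszul formula speaks about fields, so the vector \<open>u\<close> is
    extended to a field first.\<close>
  obtain T U where U: "x \<in> T" "vfield_on (atlas M) T U" "U x = u" using TS_extend[OF xP x(2)] by blast
  have kos: "2 * g x (D x (U x) V) (Z x) = koszul U V Z x"
    if V: "vfield_on (atlas M) S V" and Z: "vfield_on (atlas M) R Z" and "x \<in> R" for V Z R
  proof (rule koszul_formula[where S="S \<inter> T \<inter> R"])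
    have op: "open (S \<inter> T \<inter> R)" using vfield_onD(1)[OF V] vfield_onD(1)[OF Z] vfield_onD(1)[OF U(2)] by auto
    show "vfield_on (atlas M) (S \<inter> T \<inter> R) U" "vfield_on (atlas M) (S \<inter> T \<inter> R) V" "vfield_on (atlas M) (S \<inter> T \<inter> R) Z"
      "x \<in> S \<inter> T \<inter> R"
      using vfield_on_subset[OF _ op] U Z V x \<open>x \<in> R\<close> by auto
    then have n: "vfield_on (atlas M) (S \<inter> T \<inter> R) W \<Longrightarrow> vfield_near (atlas M) x W" for W
      using vfield_nearI by blast
    show "\<And>v W. v \<in> TS x \<Longrightarrow> vfield_on (atlas M) (S \<inter> T \<inter> R) W \<Longrightarrow> D x v W \<in> TS x"
      "\<And>V W. vfield_on (atlas M) (S \<inter> T \<inter> R) V \<Longrightarrow> vfield_on (atlas M) (S \<inter> T \<inter> R) W \<Longrightarrow>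
        D x (V x) W - D x (W x) V = lie_bracket (atlas M) V W x"
      "\<And>v V W. v \<in> TS x \<Longrightarrow> vfield_on (atlas M) (S \<inter> T \<inter> R) V \<Longrightarrow> vfield_on (atlas M) (S \<inter> T \<inter> R) W \<Longrightarrow>
        v (\<lambda>y. g y (V y) (W y)) = g x (D x v V) (W x) + g x (V x) (D x v W)"
      using D_props(1)[OF xP] D_torsion[OF xP] D_metric[OF xP] n by blast+
  qed
  show ?thesis
  proof (rule met_eqI[OF xP D_props(1)[OF xP x(2) nX] D_props(1)[OF xP x(2) nY]])
    fix w assume w: "w \<in> TS x"
    obtain R Z where Z: "x \<in> R" "vfield_on (atlas M) R Z" "Z x = w" using TS_extend[OF xP w] by blast
    have UT: "U x \<in> TS x" "Z x \<in> TS x" using U x Z w by auto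
    \<comment> \<open>One locality statement for arbitrary expressions in the field; it serves the
      brackets and the inner products in the Koszul expression alike.\<close>
    have cong: "v (\<lambda>y. F y (X y)) = v (\<lambda>y. F y (Y y))" if "v \<in> TS x" for v and F :: "'a \<Rightarrow> 'a tvec \<Rightarrow> real"
      by (rule TS_cong[OF that vfield_onD(1)[OF X] x(1)]) (simp add: eq)
    have "lie_bracket (atlas M) U X x = lie_bracket (atlas M) U Y x"
      "lie_bracket (atlas M) X Z x = lie_bracket (atlas M) Y Z x"
      using cong[OF UT(1), of "\<lambda>y v. v _"] cong[OF UT(2), of "\<lambda>y v. v _"] eq[OF x(1)]
      by (auto simp: lie_bracket_def fun_eq_iff)
    then have "koszul U X Z x = koszul U Y Z x"
      using cong[OF UT(1), of "\<lambda>y v. g y v (Z y)"] cong[OF UT(2), of "\<lambda>y v. g y (U y) v"] eq[OF x(1)]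
      by (simp add: koszul_def)
    then show "g x (D x u X) w = g x (D x u Y) w"
      using kos[OF X Z(2,1)] kos[OF Y Z(2,1)] U Z by simp
  qed
qed

end

section \<open>Smooth maps and tangent vectors\<close>

context smooth_mfd
begin

lemma TS_compose:
  fixes u :: "'a \<Rightarrow> 'f::euclidean_space" and F :: "'f \<Rightarrow> real"
  assumes v: "v \<in> TS x" and u: "\<And>b. b \<in> Basis \<Longrightarrow> near x (\<lambda>y. u y \<bullet> b)"
    and F: "F differentiable (at (u x))" and n: "near x (\<lambda>y. F (u y))"
  shows "v (\<lambda>y. F (u y)) = (\<Sum>b\<in>Basis. v (\<lambda>y. u y \<bullet> b) * fd F (u x) b)"
proof -
  obtain c where c: "c \<in> A" "x \<in> fst c" using near_pts[OF n] in_pts_chart by blast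
  let ?u = "\<lambda>y. u (cinv c y)"
  let ?u' = "\<lambda>w. \<Sum>b\<in>Basis. fd (\<lambda>y. ?u y \<bullet> b) (snd c x) w *\<^sub>R b"
  have "(?u has_derivative ?u') (at (snd c x))"
  proof (subst has_derivative_componentwise_within, intro ballI)
    fix b :: 'f assume b: "b \<in> Basis"
    have "?u' w \<bullet> b = fd (\<lambda>y. ?u y \<bullet> b) (snd c x) w" for w
      using b by (simp add: inner_sum_left inner_Basis if_distrib cong: if_cong)
    then show "((\<lambda>y. ?u y \<bullet> b) has_derivative (\<lambda>w. ?u' w \<bullet> b)) (at (snd c x))"
      using smooth_fun_near_differentiable[OF u[OF b] c] by (simp only:)
  qed
  from fd_compose_basis[OF this] F c
  have "((\<lambda>y. F (?u y)) has_derivative (\<lambda>w. \<Sum>b\<in>Basis. (?u' w \<bullet> b) *\<^sub>R fd F (u x) b)) (at (snd c x))"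
    by (simp only: cinv_chart)
  from fd_eqI[OF this] have "v (\<lambda>y. F (u y)) = (\<Sum>b\<in>Basis. (?u' (crd c v) \<bullet> b) *\<^sub>R fd F (u x) b)"
    using TS_apply[OF c v n] by simp
  also have "\<dots> = (\<Sum>b\<in>Basis. v (\<lambda>y. u y \<bullet> b) * fd F (u x) b)"
  proof (intro sum.cong refl)
    fix b :: 'f assume b: "b \<in> Basis"
    have "?u' (crd c v) \<bullet> b = v (\<lambda>y. u y \<bullet> b)"
      using b TS_apply[OF c v u[OF b]] by (simp add: inner_sum_left inner_Basis if_distrib cong: if_cong)
    then show "(?u' (crd c v) \<bullet> b) *\<^sub>R fd F (u x) b = v (\<lambda>y. u y \<bullet> b) * fd F (u x) b" by simp
  qed
  finally show ?thesis .
qed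

end

locale mfd_map = A: smooth_mfd A + B: smooth_mfd B
  for A :: "('a::t2_space, 'e::euclidean_space) chart set" and B :: "('b::t2_space, 'f::euclidean_space) chart set" +
  fixes S :: "'a set" and f :: "'a \<Rightarrow> 'b"
  assumes smooth: "smooth_map_on A B S f"
begin

lemmas mapD = A.smooth_map_onD[OF smooth]

lemma f_pts: "x \<in> S \<Longrightarrow> f x \<in> pts B"
  using mapD(3) by auto

lemma near_comp: "x \<in> S \<Longrightarrow> B.near (f x) h \<Longrightarrow> A.near x (\<lambda>y. h (f y))"
proof -
  assume x: "x \<in> S" and "B.near (f x) h"
  then obtain T where T: "f x \<in> T" "smooth_fun_on B T h" by (auto simp: smooth_fun_near_def)
  show ?thesis
    by (rule A.smooth_fun_nearI[OF A.smooth_fun_comp_map[OF B.smooth_mfd_axioms smooth T(2)]]) (use x T in simp)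
qed

text \<open>The differential is defined as precomposition with \<open>f\<close>. Its chart form
  shows that the result is again a velocity.\<close>

lemma tmap_eq_cvec:
  assumes x: "x \<in> S" and v: "v \<in> A.TS x" and k: "k \<in> B" "f x \<in> fst k"
  shows "tmap B f x v = B.cvec k (f x) (\<Sum>b\<in>Basis. v (\<lambda>y. snd k (f y) \<bullet> b) *\<^sub>R b)"
proof
  fix h
  show "tmap B f x v h = B.cvec k (f x) (\<Sum>b\<in>Basis. v (\<lambda>y. snd k (f y) \<bullet> b) *\<^sub>R b) h"
  proof (cases "B.near (f x) h")
    case True
    let ?h = "\<lambda>y. h (cinv k y)"
    have op: "open (S \<inter> f -` fst k)" using continuous_open_preimage[OF mapD(4,1)] k by simp
    have eq: "h (f y) = ?h (snd k (f y))" if "y \<in> S \<inter> f -` fst k" for y using that k by simp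
    have "v (\<lambda>y. h (f y)) = v (\<lambda>y. ?h (snd k (f y)))"
      by (rule A.TS_cong[OF v op]) (use x k eq in auto)
    also have "\<dots> = (\<Sum>b\<in>Basis. v (\<lambda>y. snd k (f y) \<bullet> b) * fd ?h (snd k (f x)) b)"
    proof (rule A.TS_compose[OF v])
      show "A.near x (\<lambda>y. snd k (f y) \<bullet> b)" for b using near_comp[OF x B.near_coord[OF k]] .
      show "?h differentiable (at (snd k (f x)))"
        using B.smooth_fun_near_differentiable[OF True k] by (auto simp: differentiable_def)
      have "A.near x (\<lambda>y. h (f y)) \<longleftrightarrow> A.near x (\<lambda>y. ?h (snd k (f y)))"
        by (rule A.near_cong[OF op _ eq]) (use x k in auto)
      then show "A.near x (\<lambda>y. ?h (snd k (f y)))" using near_comp[OF x True] by simp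
    qed
    also have "\<dots> = fd ?h (snd k (f x)) (\<Sum>b\<in>Basis. v (\<lambda>y. snd k (f y) \<bullet> b) *\<^sub>R b)"
      using has_derivative_linear[OF B.smooth_fun_near_differentiable[OF True k]]
      by (simp add: linear_sum linear_scale)
    finally show ?thesis using True by (simp add: tmap_def B.cvec_def o_def)
  qed (simp add: tmap_def B.cvec_def)
qed

lemma tmap_TS:
  assumes "x \<in> S" "v \<in> A.TS x"
  shows "tmap B f x v \<in> B.TS (f x)"
proof -
  obtain k where k: "k \<in> B" "f x \<in> fst k" using f_pts assms B.in_pts_chart by blast
  then show ?thesis using tmap_eq_cvec[OF assms k] B.cvec_in_TS by simp
qed

lemma tmap_coord:
  "k \<in> B \<Longrightarrow> f x \<in> fst k \<Longrightarrow> tmap B f x v (\<lambda>q. snd k q \<bullet> b) = v (\<lambda>y. snd k (f y) \<bullet> b)"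
  using B.near_coord by (simp add: tmap_def o_def)

end

lemma tmap_scale: "tmap B f x (tscale r v) = tscale r (tmap B f x v)"
  and tmap_sum: "tmap B f x (\<Sum>i\<in>I. F i) = (\<Sum>i\<in>I. tmap B f x (F i))"
  by (auto simp: tmap_def fun_eq_iff)

section \<open>Smooth families of functions\<close>

lemma pts_prod_atlas: "pts (prod_atlas A (interval_atlas \<epsilon>)) = pts A \<times> {- \<epsilon><..<\<epsilon>}"
  by (force simp: pts_def prod_atlas_def interval_atlas_def)

locale mfd_interval = smooth_mfd A for A :: "('a::t2_space, 'e::euclidean_space) chart set" +
  fixes \<epsilon> :: real
begin

abbreviation "I \<equiv> {- \<epsilon><..<\<epsilon>}"
abbreviation "pA \<equiv> prod_atlas A (interval_atlas \<epsilon>)"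
abbreviation pchart :: "('a, 'e) chart \<Rightarrow> ('a \<times> real, 'e \<times> real) chart" where
  "pchart c \<equiv> (fst c \<times> I, map_prod (snd c) (\<lambda>t. t))"

lemma prod_atlas_iff: "C \<in> pA \<longleftrightarrow> (\<exists>c\<in>A. C = pchart c)"
  unfolding prod_atlas_def interval_atlas_def by fastforce

lemma pchart_image: "T \<subseteq> fst c \<Longrightarrow> J \<subseteq> I \<Longrightarrow> snd (pchart c) ` (T \<times> J) = (snd c ` T) \<times> J"
  by auto

lemma cinv_pchart:
  assumes c: "c \<in> A" and p: "q \<in> snd c ` fst c" "t \<in> I"
  shows "cinv (pchart c) (q, t) = (cinv c q, t)"
proof -
  obtain x where x: "x \<in> fst c" "q = snd c x" using p by blast
  have inj: "inj_on (map_prod (snd c) (\<lambda>t. t)) (fst c \<times> I)"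
    using c by (auto simp: inj_on_def) (metis cinv_chart)
  have "cinv (pchart c) (snd (pchart c) (x, t)) = (x, t)"
    using inv_into_f_f[OF inj, of "(x, t)"] x p by simp
  then show ?thesis using x c by simp
qed

lemma smooth_mfd_prod: "smooth_mfd pA"
  unfolding smooth_mfd_def smooth_atlas_def is_chart_def
proof (intro conjI ballI)
  fix C assume "C \<in> pA"
  then obtain c where c: "c \<in> A" "C = pchart c" by (auto simp: prod_atlas_iff)
  have im: "snd C ` fst C = (snd c ` fst c) \<times> I" by (simp add: c(2) map_prod_image[symmetric] map_prod_surj_on)
  show "open (fst C)" using c by (auto intro!: open_Times)
  show "open (snd C ` fst C)" unfolding im using c by (auto intro!: open_Times)
  show "homeomorphism (fst C) (snd C ` fst C) (snd C) (cinv C)"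
    unfolding homeomorphism_def
  proof (intro conjI ballI)
    show "continuous_on (fst C) (snd C)"
      unfolding c(2) using c(1)
      by (auto simp: map_prod_def split_beta intro!: continuous_on_Pair continuous_on_compose2[OF continuous_on_chart[OF c(1) order_refl]] continuous_intros)
    have "continuous_on (snd C ` fst C) (\<lambda>p. (cinv c (fst p), snd p))"
      unfolding im by (auto intro!: continuous_on_Pair continuous_on_compose2[OF continuous_on_cinv[OF c(1)]] continuous_intros)
    then show "continuous_on (snd C ` fst C) (cinv C)"
      by (rule continuous_on_eq) (use cinv_pchart[OF c(1)] c(2) im in auto)
    show inv: "cinv C (snd C p) = p" if "p \<in> fst C" for p
      using that c cinv_pchart[OF c(1), of "snd c (fst p)" "snd p"] by auto
    show inv': "snd C (cinv C p) = p" if "p \<in> snd C ` fst C" for p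
      using that by (rule f_inv_into_f)
    show "cinv C ` snd C ` fst C = fst C" using inv by force
    show "snd C ` fst C = snd C ` fst C" ..
  qed
next
  fix C C' assume "C \<in> pA" "C' \<in> pA"
  then obtain c c' where c: "c \<in> A" "C = pchart c" "c' \<in> A" "C' = pchart c'" by (auto simp: prod_atlas_iff)
  let ?V = "snd c ` (fst c \<inter> fst c')"
  have V: "open ?V" using c by (intro open_image_chart) auto
  have im: "snd C ` (fst C \<inter> fst C') = ?V \<times> I" using c by auto
  have op: "open (?V \<times> I)" using V by (intro open_Times) auto
  have s: "smooth_on (?V \<times> I) (\<lambda>p. snd c' (cinv c (fst p)))"
    by (rule smooth_on_compose[OF op V _ smooth_on_fst smooth_transition[OF c(1,3)]]) auto
  have "smooth_on (?V \<times> I) (\<lambda>p. (snd c' (cinv c (fst p)), snd p))"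
  proof (rule smooth_on_componentwise[OF op])
    fix b :: "'e \<times> real" assume "b \<in> Basis"
    have "smooth_on (?V \<times> I) (\<lambda>p. snd c' (cinv c (fst p)) \<bullet> fst b + snd p \<bullet> snd b)"
      by (intro smooth_on_add smooth_on_inner op s smooth_on_snd smooth_on_const)
    then show "smooth_on (?V \<times> I) (\<lambda>p. (snd c' (cinv c (fst p)), snd p) \<bullet> b)" by (simp add: inner_prod_def)
  qed
  then show "smooth_on (snd C ` (fst C \<inter> fst C')) (snd C' \<circ> cinv C)"
    unfolding im
    by (subst smooth_on_cong[OF op, where g="\<lambda>p. (snd c' (cinv c (fst p)), snd p)"])
       (use c cinv_pchart[OF c(1)] in auto)
qed

sublocale pr: smooth_mfd pA
  by (rule smooth_mfd_prod)

lemma smooth_fun_prod_chart: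
  assumes c: "c \<in> A" and S: "open S" "S \<subseteq> fst c" and J: "open J" "J \<subseteq> I"
  shows "smooth_fun_on pA (S \<times> J) \<psi> \<longleftrightarrow> smooth_on ((snd c ` S) \<times> J) (\<lambda>p. \<psi> (cinv c (fst p), snd p))"
proof -
  have C: "pchart c \<in> pA" using c by (auto simp: prod_atlas_iff)
  have op: "open ((snd c ` S) \<times> J)" using c S J by (intro open_Times open_image_chart) auto
  have "smooth_fun_on pA (S \<times> J) \<psi> \<longleftrightarrow> smooth_on (snd (pchart c) ` (S \<times> J)) (\<lambda>y. \<psi> (cinv (pchart c) y))"
  proof
    assume "smooth_fun_on pA (S \<times> J) \<psi>"
    then show "smooth_on (snd (pchart c) ` (S \<times> J)) (\<lambda>y. \<psi> (cinv (pchart c) y))"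
      by (rule pr.smooth_fun_onD(4)[OF _ C]) (use S J in auto)
  next
    assume "smooth_on (snd (pchart c) ` (S \<times> J)) (\<lambda>y. \<psi> (cinv (pchart c) y))"
    then show "smooth_fun_on pA (S \<times> J) \<psi>"
      by (rule pr.smooth_fun_on_chartI[OF C, rotated -1]) (use S J in \<open>auto intro: open_Times\<close>)
  qed
  also have "snd (pchart c) ` (S \<times> J) = (snd c ` S) \<times> J" using S J by (intro pchart_image)
  also have "smooth_on ((snd c ` S) \<times> J) (\<lambda>y. \<psi> (cinv (pchart c) y))
      \<longleftrightarrow> smooth_on ((snd c ` S) \<times> J) (\<lambda>p. \<psi> (cinv c (fst p), snd p))"
  proof (rule smooth_on_cong[OF op])
    fix p assume "p \<in> (snd c ` S) \<times> J"
    then have "cinv (pchart c) (fst p, snd p) = (cinv c (fst p), snd p)"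
      using S J by (intro cinv_pchart[OF c]) auto
    then show "\<psi> (cinv (pchart c) p) = \<psi> (cinv c (fst p), snd p)" by simp
  qed
  finally show ?thesis .
qed

lemma smooth_fun_prod_local:
  assumes S: "open S" "S \<subseteq> pts A" and J: "open J" "J \<subseteq> I"
    and loc: "\<And>c. c \<in> A \<Longrightarrow> smooth_fun_on pA ((S \<inter> fst c) \<times> J) \<psi>"
  shows "smooth_fun_on pA (S \<times> J) \<psi>"
proof (rule pr.smooth_fun_on_local)
  fix p assume p: "p \<in> S \<times> J"
  then obtain c where "c \<in> A" "fst p \<in> fst c" using in_pts_chart S by (metis mem_Times_iff subsetD)
  then show "\<exists>T. p \<in> T \<and> T \<subseteq> S \<times> J \<and> smooth_fun_on pA T \<psi>"
    using p loc by (intro exI[of _ "(S \<inter> fst c) \<times> J"]) (auto simp: mem_Times_iff)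
qed

lemma smooth_fun_prod_restrict:
  assumes c: "c \<in> A" and S: "open S" and J: "open J" and \<psi>: "smooth_fun_on pA (S \<times> J) \<psi>"
  shows "smooth_fun_on pA ((S \<inter> fst c) \<times> J) \<psi>"
  by (rule pr.smooth_fun_on_subset[OF \<psi>]) (use c S J in \<open>auto intro!: open_Times\<close>)

lemma smooth_fun_prod_fst:
  assumes "smooth_fun_on A S h" and J: "open J" "J \<subseteq> I"
  shows "smooth_fun_on pA (S \<times> J) (\<lambda>p. h (fst p))"
proof (rule smooth_fun_prod_local[OF smooth_fun_onD(1,2)[OF assms(1)] J])
  fix c assume c: "c \<in> A"
  note h = smooth_fun_onD[OF assms(1)]
  have V: "open (snd c ` (S \<inter> fst c))" using c h by (intro open_image_chart) auto
  have "smooth_on (snd c ` (S \<inter> fst c)) (\<lambda>y. h (cinv c y))" using h(4)[OF c] by auto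
  then have "smooth_on ((snd c ` (S \<inter> fst c)) \<times> J) (\<lambda>p. h (cinv c (fst p)))"
    by (rule smooth_on_compose[OF open_Times[OF V J(1)] V _ smooth_on_fst, rotated]) auto
  then show "smooth_fun_on pA ((S \<inter> fst c) \<times> J) (\<lambda>p. h (fst p))"
    using c h J by (subst smooth_fun_prod_chart) auto
qed

text \<open>Space and time derivatives of a family become partial derivatives of the single chart
  expression \<open>\<Psi>\<close> of space and time, where the results on open sets apply.\<close>

lemma family_chart_derivs:
  assumes c: "c \<in> A" and S: "open S" "S \<subseteq> fst c" and J: "open J" "J \<subseteq> I"
    and \<psi>: "smooth_fun_on pA (S \<times> J) \<psi>" and x: "x \<in> S" and t: "t \<in> J"
  defines "\<Psi> \<equiv> \<lambda>p. \<psi> (cinv c (fst p), snd p)"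
  shows "near x (\<lambda>y. \<psi> (y, t))"
    and "cvec c x w (\<lambda>y. \<psi> (y, t)) = fd \<Psi> (snd c x, t) (w, 0)"
    and "((\<lambda>s. \<psi> (x, s)) has_real_derivative fd \<Psi> (snd c x, t) (0, 1)) (at t)"
    and "deriv (\<lambda>s. \<psi> (x, s)) t = fd \<Psi> (snd c x, t) (0, 1)"
    and "smooth_fun_on pA (S \<times> J) (\<lambda>p. fd \<Psi> (snd c (fst p), snd p) z)"
proof -
  let ?V = "snd c ` S"
  have V: "open ?V" "open (?V \<times> J)" using c S J by (auto intro!: open_Times open_image_chart)
  have s: "smooth_on (?V \<times> J) \<Psi>" unfolding \<Psi>_def using \<psi> smooth_fun_prod_chart[OF c S J] by blast
  have xt: "(snd c x, t) \<in> ?V \<times> J" using x t by auto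
  have dP: "(\<Psi> has_derivative fd \<Psi> (snd c x, t)) (at (snd c x, t))" by (rule smooth_on_has_derivative[OF s xt])
  have lin: "linear (fd \<Psi> (snd c x, t))" by (rule smooth_on_linear_fd[OF s xt])
  have xc: "x \<in> fst c" using x S by auto
  have "smooth_on ?V (\<lambda>q. (q, t))"
  proof (rule smooth_on_componentwise[OF V(1)])
    fix b :: "'e \<times> real" assume "b \<in> Basis"
    have "smooth_on ?V (\<lambda>q. q \<bullet> fst b + t \<bullet> snd b)"
      by (intro smooth_on_add smooth_on_inner V smooth_on_ident smooth_on_const)
    then show "smooth_on ?V (\<lambda>q. (q, t) \<bullet> b)" by (simp add: inner_prod_def)
  qed
  from smooth_on_compose[OF V _ this s] t have "smooth_on ?V (\<lambda>q. \<Psi> (q, t))" by auto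
  then have sl: "smooth_fun_on A S (\<lambda>y. \<psi> (y, t))"
    using c S by (intro smooth_fun_on_chartI) (auto simp: \<Psi>_def)
  then show n: "near x (\<lambda>y. \<psi> (y, t))" using x smooth_fun_nearI by blast
  have "((\<lambda>q. (q, t)) has_derivative (\<lambda>w. (w, 0))) (at (snd c x))"
    by (auto intro!: derivative_eq_intros)
  from has_derivative_compose[OF this dP]
  have "((\<lambda>q. \<psi> (cinv c q, t)) has_derivative (\<lambda>w. fd \<Psi> (snd c x, t) (w, 0))) (at (snd c x))"
    by (simp add: \<Psi>_def)
  then show "cvec c x w (\<lambda>y. \<psi> (y, t)) = fd \<Psi> (snd c x, t) (w, 0)"
    using n by (simp add: cvec_def fd_eqI)
  have "((\<lambda>s. (snd c x, s)) has_derivative (\<lambda>d. (0, d))) (at t)"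
    by (auto intro!: derivative_eq_intros)
  from has_derivative_compose[OF this dP]
  have "((\<lambda>s. \<psi> (x, s)) has_derivative (\<lambda>d. fd \<Psi> (snd c x, t) (0, d))) (at t)"
    using c xc by (simp add: \<Psi>_def)
  moreover have "fd \<Psi> (snd c x, t) (0, d) = fd \<Psi> (snd c x, t) (0, 1) * d" for d
    using linear_scale[OF lin, of d "(0, 1)"] by simp
  ultimately show "((\<lambda>s. \<psi> (x, s)) has_real_derivative fd \<Psi> (snd c x, t) (0, 1)) (at t)"
    unfolding has_field_derivative_def by (rule has_derivative_eq_rhs[OF _ ext])
  then show "deriv (\<lambda>s. \<psi> (x, s)) t = fd \<Psi> (snd c x, t) (0, 1)" by (rule DERIV_imp_deriv)
  have "smooth_on (?V \<times> J) (\<lambda>p. fd \<Psi> (snd c (cinv c (fst p)), snd p) z)"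
    by (subst smooth_on_cong[OF V(2), where g="\<lambda>p. fd \<Psi> p z"]) (use S c smooth_on_fd[OF s] in auto)
  then show "smooth_fun_on pA (S \<times> J) (\<lambda>p. fd \<Psi> (snd c (fst p), snd p) z)"
    using smooth_fun_prod_chart[OF c S J] by simp
qed

lemma family_slice_smooth:
  assumes S: "open S" "S \<subseteq> pts A" and J: "open J" "J \<subseteq> I" and \<psi>: "smooth_fun_on pA (S \<times> J) \<psi>" and t: "t \<in> J"
  shows "smooth_fun_on A S (\<lambda>y. \<psi> (y, t))"
proof (rule smooth_fun_on_local)
  fix x assume x: "x \<in> S"
  then obtain c where c: "c \<in> A" "x \<in> fst c" using in_pts_chart S by blast
  have "near x (\<lambda>y. \<psi> (y, t))"
    by (rule family_chart_derivs(1)[OF c(1) _ _ J smooth_fun_prod_restrict[OF c(1) S(1) J(1) \<psi>]])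
       (use c S x t in auto)
  then obtain T where "x \<in> T" "smooth_fun_on A T (\<lambda>y. \<psi> (y, t))" by (auto simp: smooth_fun_near_def)
  then show "\<exists>T. x \<in> T \<and> T \<subseteq> S \<and> smooth_fun_on A T (\<lambda>y. \<psi> (y, t))"
    using S(1) x by (intro exI[of _ "S \<inter> T"]) (auto intro: smooth_fun_on_subset dest: smooth_fun_onD(1))
qed

lemma family_deriv:
  assumes S: "open S" "S \<subseteq> pts A" and J: "open J" "J \<subseteq> I" and \<psi>: "smooth_fun_on pA (S \<times> J) \<psi>"
  shows "x \<in> S \<Longrightarrow> t \<in> J \<Longrightarrow> ((\<lambda>s. \<psi> (x, s)) has_real_derivative deriv (\<lambda>s. \<psi> (x, s)) t) (at t)"
    and "smooth_fun_on pA (S \<times> J) (\<lambda>p. deriv (\<lambda>s. \<psi> (fst p, s)) (snd p))"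
proof -
  assume x: "x \<in> S" and t: "t \<in> J"
  then obtain c where c: "c \<in> A" "x \<in> fst c" using in_pts_chart S by blast
  note f = family_chart_derivs(3,4)[OF c(1) _ _ J smooth_fun_prod_restrict[OF c(1) S(1) J(1) \<psi>], of x t]
  show "((\<lambda>s. \<psi> (x, s)) has_real_derivative deriv (\<lambda>s. \<psi> (x, s)) t) (at t)"
    using f c S x t open_Int[OF S(1) open_chart[OF c(1)]] by simp
next
  show "smooth_fun_on pA (S \<times> J) (\<lambda>p. deriv (\<lambda>s. \<psi> (fst p, s)) (snd p))"
  proof (rule smooth_fun_prod_local[OF S J])
    fix c assume c: "c \<in> A"
    have S': "open (S \<inter> fst c)" "S \<inter> fst c \<subseteq> fst c" using c S by auto
    note f = family_chart_derivs[OF c S' J smooth_fun_prod_restrict[OF c S(1) J(1) \<psi>]]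
    \<comment> \<open>The chart lemma is stated at a sample point of the domain, so the empty domain
      is treated on its own.\<close>
    show "smooth_fun_on pA ((S \<inter> fst c) \<times> J) (\<lambda>p. deriv (\<lambda>s. \<psi> (fst p, s)) (snd p))"
    proof (cases "(S \<inter> fst c) \<times> J = {}")
      case True
      show ?thesis unfolding True by (rule pr.smooth_fun_on_local) simp
    next
      case False
      then obtain x t where "x \<in> S \<inter> fst c" "t \<in> J" by blast
      then show ?thesis
        by (rule pr.smooth_fun_on_cong[OF f(5)[of x t "(0, 1)"]]) (use f(4) in auto)
    qed
  qed
qed

text \<open>In a chart \<open>X\<close> is a combination of spatial partial derivatives, and these
  commute with the time derivative by symmetry of second derivatives.\<close>

lemma family_vfield:
  assumes X: "vfield_on A S X" and J: "open J" "J \<subseteq> I" and \<psi>: "smooth_fun_on pA (S \<times> J) \<psi>"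
  shows "smooth_fun_on pA (S \<times> J) (\<lambda>p. X (fst p) (\<lambda>y. \<psi> (y, snd p)))"
    and "x \<in> S \<Longrightarrow> t \<in> J \<Longrightarrow> ((\<lambda>s. X x (\<lambda>y. \<psi> (y, s))) has_real_derivative X x (\<lambda>y. deriv (\<lambda>s. \<psi> (y, s)) t)) (at t)"
proof -
  note S = vfield_onD(1,2)[OF X]
  have loc: "smooth_fun_on pA ((S \<inter> fst c) \<times> J) (\<lambda>p. X (fst p) (\<lambda>y. \<psi> (y, snd p)))"
    "x \<in> S \<inter> fst c \<Longrightarrow> t \<in> J \<Longrightarrow> ((\<lambda>s. X x (\<lambda>y. \<psi> (y, s))) has_real_derivative X x (\<lambda>y. deriv (\<lambda>s. \<psi> (y, s)) t)) (at t)"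
    if c: "c \<in> A" for c x t
  proof -
    let ?S = "S \<inter> fst c"
    have S': "open ?S" "?S \<subseteq> fst c" using c S by auto
    have \<psi>': "smooth_fun_on pA (?S \<times> J) \<psi>" by (rule smooth_fun_prod_restrict[OF c S(1) J(1) \<psi>])
    let ?\<Psi> = "\<lambda>p. \<psi> (cinv c (fst p), snd p)"
    note f = family_chart_derivs[OF c S' J \<psi>']
    have Xc: "X y h = (\<Sum>b\<in>Basis. X y (\<lambda>q. snd c q \<bullet> b) * cvec c y b h)" if "y \<in> ?S" for y h
      using TS_fun_expand[OF c, of y "X y" h] vfield_onD(3)[OF X] that by auto
    have eq: "X y (\<lambda>y. \<psi> (y, t)) = (\<Sum>b\<in>Basis. X y (\<lambda>q. snd c q \<bullet> b) * fd ?\<Psi> (snd c y, t) (b, 0))"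
      if "y \<in> ?S" "t \<in> J" for y t
      unfolding Xc[OF that(1), of "\<lambda>y. \<psi> (y, t)"] using f(2)[OF that] by simp
    have comp: "smooth_fun_on A ?S (\<lambda>x. X x (\<lambda>q. snd c q \<bullet> b))" for b
      by (rule vfield_onD(4)[OF X]) (use S' smooth_fun_on_subset[OF smooth_fun_on_coord[OF c]] in auto)
    show "smooth_fun_on pA (?S \<times> J) (\<lambda>p. X (fst p) (\<lambda>y. \<psi> (y, snd p)))"
    proof (cases "?S \<times> J = {}")
      case True
      show ?thesis unfolding True by (rule pr.smooth_fun_on_local) simp
    next
      case False
      then obtain x t where xt: "x \<in> ?S" "t \<in> J" by blast
      have "smooth_fun_on pA (?S \<times> J) (\<lambda>p. \<Sum>b\<in>Basis. X (fst p) (\<lambda>q. snd c q \<bullet> b) * fd ?\<Psi> (snd c (fst p), snd p) (b, 0))"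
        by (intro pr.smooth_fun_on_sum pr.smooth_fun_on_mult smooth_fun_prod_fst[OF comp J] f(5)[OF xt])
           (use pr.smooth_fun_onD[OF \<psi>'] in auto)
      then show ?thesis
        by (rule pr.smooth_fun_on_cong) (use eq in auto)
    qed
    assume x: "x \<in> ?S" and t: "t \<in> J"
    let ?V = "(snd c ` ?S) \<times> J"
    have V: "open ?V" using c S' J by (auto intro!: open_Times open_image_chart)
    have s: "smooth_on ?V ?\<Psi>" using \<psi>' smooth_fun_prod_chart[OF c S' J] by blast
    have xt: "(snd c x, t) \<in> ?V" using x t by auto
    define E where "E b p = fd ?\<Psi> (snd c (fst p), snd p) (b, 0)" for b p
    define Z where "Z p = deriv (\<lambda>s. \<psi> (fst p, s)) (snd p)" for p
    have dE: "((\<lambda>s. fd ?\<Psi> (snd c x, s) (b, 0)) has_real_derivative fd (\<lambda>p. fd ?\<Psi> p (b, 0)) (snd c x, t) (0, 1)) (at t)" for b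
    proof -
      have E: "smooth_fun_on pA (?S \<times> J) (E b)" unfolding E_def by (rule f(5)[OF x t])
      have "fd (\<lambda>p. E b (cinv c (fst p), snd p)) (snd c x, t) = fd (\<lambda>p. fd ?\<Psi> p (b, 0)) (snd c x, t)"
        by (rule frechet_derivative_transform_within_open[OF _ V xt, symmetric])
           (use smooth_on_imp_differentiable[OF smooth_on_fd[OF s] xt] c S' in \<open>auto simp: E_def\<close>)
      then show ?thesis
        using family_chart_derivs(3)[OF c S' J E x t] by (simp add: E_def)
    qed
    have Z: "smooth_fun_on pA (?S \<times> J) Z"
      unfolding Z_def by (rule family_deriv(2)[OF S'(1) _ J \<psi>']) (use S in auto)
    have dZ: "cvec c x b (\<lambda>y. Z (y, t)) = fd (\<lambda>p. fd ?\<Psi> p (0, 1)) (snd c x, t) (b, 0)" for b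
    proof -
      have "fd (\<lambda>p. Z (cinv c (fst p), snd p)) (snd c x, t) = fd (\<lambda>p. fd ?\<Psi> p (0, 1)) (snd c x, t)"
      proof (rule frechet_derivative_transform_within_open[OF _ V xt, symmetric])
        show "(\<lambda>p. fd ?\<Psi> p (0, 1)) differentiable at (snd c x, t)"
          by (rule smooth_on_imp_differentiable[OF smooth_on_fd[OF s] xt])
        show "fd ?\<Psi> p (0, 1) = Z (cinv c (fst p), snd p)" if "p \<in> ?V" for p
          using that f(4)[of "cinv c (fst p)" "snd p"] c S' by (auto simp: Z_def)
      qed
      then show ?thesis using family_chart_derivs(2)[OF c S' J Z x t] by simp
    qed
    have "((\<lambda>s. \<Sum>b\<in>Basis. X x (\<lambda>q. snd c q \<bullet> b) * fd ?\<Psi> (snd c x, s) (b, 0)) has_real_derivative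
        (\<Sum>b\<in>Basis. X x (\<lambda>q. snd c q \<bullet> b) * fd (\<lambda>p. fd ?\<Psi> p (b, 0)) (snd c x, t) (0, 1))) (at t)"
      by (intro DERIV_sum DERIV_cmult dE)
    \<comment> \<open>Here the mixed derivatives in the directions \<open>(b, 0)\<close> and
      \<open>(0, 1)\<close> are exchanged.\<close>
    also have "(\<Sum>b\<in>Basis. X x (\<lambda>q. snd c q \<bullet> b) * fd (\<lambda>p. fd ?\<Psi> p (b, 0)) (snd c x, t) (0, 1)) = X x (\<lambda>y. Z (y, t))"
      unfolding Xc[OF x, of "\<lambda>y. Z (y, t)"] dZ fd_fd_commute[OF V xt s, of "(_, 0)" "(0, 1)"] ..
    finally have "((\<lambda>s. \<Sum>b\<in>Basis. X x (\<lambda>q. snd c q \<bullet> b) * fd ?\<Psi> (snd c x, s) (b, 0)) has_real_derivative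
        X x (\<lambda>y. deriv (\<lambda>s. \<psi> (y, s)) t)) (at t)" by (simp add: Z_def)
    then show "((\<lambda>s. X x (\<lambda>y. \<psi> (y, s))) has_real_derivative X x (\<lambda>y. deriv (\<lambda>s. \<psi> (y, s)) t)) (at t)"
      by (rule has_field_derivative_transform_within_open[OF _ J(1) t]) (use eq x in auto)
  qed
  show "smooth_fun_on pA (S \<times> J) (\<lambda>p. X (fst p) (\<lambda>y. \<psi> (y, snd p)))"
    by (rule smooth_fun_prod_local[OF S J loc(1)])
  assume x: "x \<in> S" and t: "t \<in> J"
  then obtain c where c: "c \<in> A" "x \<in> fst c" using in_pts_chart S by blast
  show "((\<lambda>s. X x (\<lambda>y. \<psi> (y, s))) has_real_derivative X x (\<lambda>y. deriv (\<lambda>s. \<psi> (y, s)) t)) (at t)"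
    by (rule loc(2)[OF c(1)]) (use c x t in auto)
qed

end

section \<open>The pointwise first variation formula\<close>

context riem_mfd
begin

lemma smooth_fun_on_near: "open S \<Longrightarrow> (\<And>x. x \<in> S \<Longrightarrow> near x h) \<Longrightarrow> smooth_fun_on (atlas M) S h"
proof (rule smooth_fun_on_local)
  fix x assume S: "open S" and n: "\<And>x. x \<in> S \<Longrightarrow> near x h" and x: "x \<in> S"
  obtain T where T: "x \<in> T" "smooth_fun_on (atlas M) T h" using n[OF x] by (auto simp: smooth_fun_near_def)
  have "open (S \<inter> T)" using S smooth_fun_onD(1)[OF T(2)] by auto
  then have "smooth_fun_on (atlas M) (S \<inter> T) h" by (rule smooth_fun_on_subset[OF T(2)]) auto
  then show "\<exists>T. x \<in> T \<and> T \<subseteq> S \<and> smooth_fun_on (atlas M) T h" using T x by blast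
qed

lemma D_zero_field:
  assumes x: "x \<in> P" "u \<in> TS x"
  shows "D x u (\<lambda>y. 0) = 0"
proof -
  have z: "vfield_near (atlas M) x (\<lambda>y. 0)" using vfield_nearI[OF vfield_on_0[OF open_pts order_refl]] x by simp
  have "D x u (\<lambda>y. tscale 0 0) = tscale (u (\<lambda>y. 0)) 0 + tscale 0 (D x u (\<lambda>y. 0))"
    by (rule D_props(5)[OF x z near_const[OF x(1)], of 0])
  then show ?thesis by (simp only: tvs.scale_zero_left tvs.scale_zero_right add_0)
qed

lemma D_sum_leibniz:
  assumes x: "x \<in> P" "u \<in> TS x" and S: "open S" "S \<subseteq> P" "x \<in> S" and fin: "finite I"
    and X: "\<And>i. i \<in> I \<Longrightarrow> vfield_on (atlas M) S (X i)" and \<phi>: "\<And>i. i \<in> I \<Longrightarrow> smooth_fun_on (atlas M) S (\<phi> i)"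
  shows "D x u (\<lambda>y. \<Sum>i\<in>I. tscale (\<phi> i y) (X i y)) = (\<Sum>i\<in>I. tscale (u (\<phi> i)) (X i x) + tscale (\<phi> i x) (D x u (X i)))"
proof (cases "I = {}")
  case True
  show ?thesis unfolding True sum.empty by (rule D_zero_field[OF x])
next
  case False
  have "D x u (\<lambda>y. \<Sum>i\<in>I. tscale (\<phi> i y) (X i y)) = (\<Sum>i\<in>I. D x u (\<lambda>y. tscale (\<phi> i y) (X i y)))"
    by (rule D_sum_field[OF x _ S(3) fin False]) (use X \<phi> in \<open>auto intro: vfield_on_scale\<close>)
  also have "\<dots> = (\<Sum>i\<in>I. tscale (u (\<phi> i)) (X i x) + tscale (\<phi> i x) (D x u (X i)))"
    using X \<phi> S by (intro sum.cong refl D_props(5)[OF x]) (auto intro: vfield_nearI smooth_fun_nearI)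
  finally show ?thesis .
qed

lemma D_coord_metric:
  assumes c: "c \<in> atlas M" "x \<in> fst c" and v: "v \<in> TS x"
  shows "v (\<lambda>y. g y (cvec c y a) (cvec c y b))
    = g x (D x v (coord_field (atlas M) c a)) (cvec c x b) + g x (cvec c x a) (D x v (coord_field (atlas M) c b))"
proof -
  have x: "x \<in> P" using c chart_subset_pts by blast
  have "v (\<lambda>y. g y (cvec c y a) (cvec c y b)) = v (\<lambda>y. g y (coord_field (atlas M) c a y) (coord_field (atlas M) c b y))"
    by (rule TS_cong[OF v open_chart[OF c(1)] c(2)]) (simp add: coord_field_eq_cvec c)
  then show ?thesis
    using D_metric[OF x vfield_near_coord[OF c] vfield_near_coord[OF c] v] by (simp add: coord_field_eq_cvec c)
qed

lemma D_coord_sym: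
  assumes c: "c \<in> atlas M" "x \<in> fst c"
  shows "D x (cvec c x a) (coord_field (atlas M) c b) = D x (cvec c x b) (coord_field (atlas M) c a)"
proof -
  have x: "x \<in> P" using c chart_subset_pts by blast
  have "D x (cvec c x a) (coord_field (atlas M) c b) - D x (cvec c x b) (coord_field (atlas M) c a) = 0"
    using D_torsion[OF x vfield_near_coord[OF c, of a] vfield_near_coord[OF c, of b]]
    by (simp only: coord_field_eq_cvec[OF c] lie_bracket_coord[OF c])
  then show ?thesis by simp
qed

text \<open>Vanishing torsion on coordinate fields, extended bilinearly to arbitrary vectors. In the
  variation it turns the covariant time derivative of \<open>df(e\<^sub>i)\<close> into the
  covariant derivative of \<open>V\<close> along \<open>e\<^sub>i\<close>.\<close>

lemma D_coord_dir_swap: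
  assumes c: "c \<in> atlas M" "x \<in> fst c" and u: "u \<in> TS x" and w: "w \<in> TS x"
  shows "(\<Sum>a\<in>Basis. tscale (u (\<lambda>q. snd c q \<bullet> a)) (D x w (coord_field (atlas M) c a)))
    = (\<Sum>a\<in>Basis. tscale (w (\<lambda>q. snd c q \<bullet> a)) (D x u (coord_field (atlas M) c a)))"
proof -
  have x: "x \<in> P" using c chart_subset_pts by blast
  have ex: "D x v (coord_field (atlas M) c a)
      = (\<Sum>b\<in>Basis. tscale (v (\<lambda>q. snd c q \<bullet> b)) (D x (cvec c x b) (coord_field (atlas M) c a)))" if "v \<in> TS x" for v a
    by (subst TS_coord_expand[OF c that], rule D_sum_dir[OF x vfield_near_coord[OF c] cvec_in_TS[OF c] finite_Basis])
  show ?thesis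
    unfolding ex[OF u] ex[OF w] tvs.scale_sum_right tvs.scale_scale
    by (subst sum.swap, intro sum.cong refl) (simp only: D_coord_sym[OF c, of _ "_"] mult.commute)
qed

end

section \<open>Horizontal energy density, pull-back connection and the field
  \<open>vf\<close>\<close>

locale energy_map = M: sub_riem_mfd M + N: riem_mfd N + mp: mfd_map "atlas M" "atlas N" "pts (atlas M)" f
  for M :: "('a::{t2_space,second_countable_topology}, 'e::euclidean_space) sub_riem"
    and N :: "('b::{t2_space,second_countable_topology}, 'f::euclidean_space) riem" and f
begin

abbreviation df :: "'a \<Rightarrow> 'a tvec \<Rightarrow> 'b tvec" where
  "df \<equiv> tmap (atlas N) f"

lemma df_sum_scale: "df x (\<Sum>i\<in>J. tscale (a i) (w i)) = (\<Sum>i\<in>J. tscale (a i) (df x (w i)))"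
  by (simp only: tmap_sum tmap_scale)

text \<open>The definition uses another frame at every point, which hides smoothness. As the trace
  of a bilinear form the value can be computed in any local adapted frame.\<close>

lemma dfH_norm2_frame:
  assumes S: "open S" "S \<subseteq> M.P" "adapted_frame_on M S e" "y \<in> S"
  shows "dfH_norm2 M N f y = (\<Sum>i<hrank M. N.g (f y) (df y (e i y)) (df y (e i y)))"
proof -
  have y: "y \<in> M.P" using S by auto
  obtain T where T: "open T" "y \<in> T" "T \<subseteq> M.P" "adapted_frame_on M T (frame M y)"
    using M.frame_adapted[OF y] by blast
  note T' = T(1,3,4,2)
  have TS: "df y (frame M y i y) \<in> N.TS (f y)" "df y (e i y) \<in> N.TS (f y)" if "i < hrank M" for i
    using mp.tmap_TS[OF y] M.adapted_frameD(3,6)[OF T'] M.adapted_frameD(3,6)[OF S] that by auto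
  show ?thesis
    unfolding dfH_norm2_def
  proof (rule M.hor_trace_indep[where B="\<lambda>u w. N.g (f y) (df y u) (df y w)", OF T' S])
    have fy: "f y \<in> N.P" using mp.f_pts[OF y] .
    have bil: "N.g (f y) (df y (\<Sum>i<hrank M. tscale (a i) (F i))) u = (\<Sum>i<hrank M. a i * N.g (f y) (df y (F i)) u)"
      "N.g (f y) u (df y (\<Sum>i<hrank M. tscale (a i) (F i))) = (\<Sum>i<hrank M. a i * N.g (f y) u (df y (F i)))"
      if "\<And>i. i < hrank M \<Longrightarrow> df y (F i) \<in> N.TS (f y)" "u \<in> N.TS (f y)" for F u a
      unfolding df_sum_scale
      by (subst N.met_sum_left N.met_sum_right;
          use that fy in \<open>auto simp: N.TS_scale N.met_scale_left N.met_scale_right\<close>)+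
    show "N.g (f y) (df y (\<Sum>i<hrank M. tscale (a i) (frame M y i y))) (df y (e k y))
        = (\<Sum>i<hrank M. a i * N.g (f y) (df y (frame M y i y)) (df y (e k y)))" if "k < hrank M" for a k
      by (rule bil(1)) (use TS that in auto)
    show "N.g (f y) (df y (frame M y k y)) (df y (\<Sum>i<hrank M. tscale (a i) (e i y)))
        = (\<Sum>i<hrank M. a i * N.g (f y) (df y (frame M y k y)) (df y (e i y)))" if "k < hrank M" for a k
      by (rule bil(2)) (use TS that in auto)
  qed
qed

lemma pullback_conn_eq:
  assumes x: "x \<in> M.P"
  defines "k \<equiv> N.chart_at (f x)"
  shows "pullback_conn N f x v W = (\<Sum>b\<in>Basis. tscale (v (\<lambda>y. W y (\<lambda>q. snd k q \<bullet> b))) (N.cvec k (f x) b)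
       + tscale (W x (\<lambda>q. snd k q \<bullet> b)) (N.D (f x) (df x v) (coord_field (atlas N) k b)))"
  unfolding pullback_conn_def Let_def N.chart_at_def[symmetric] k_def[symmetric]
  using N.coord_field_eq_cvec N.chart_at[OF mp.f_pts[OF x]] by (simp add: k_def)

lemma pullback_conn_TS:
  assumes x: "x \<in> M.P" and v: "v \<in> M.TS x"
  shows "pullback_conn N f x v W \<in> N.TS (f x)"
  unfolding pullback_conn_eq[OF x]
  using N.chart_at[OF mp.f_pts[OF x]] mp.f_pts[OF x] mp.tmap_TS[OF x v]
  by (intro N.TS_sum N.TS_add N.TS_scale N.cvec_in_TS N.D_props(1) N.vfield_near_coord) auto

text \<open>In the chart at \<open>f x\<close> the inner product is a double sum of components times
  the metric coefficients along \<open>f\<close>. The derivative of those coefficients follows from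
  \<open>D_coord_metric\<close> in the direction \<open>df x v\<close>.\<close>

lemma pullback_metric:
  assumes x: "x \<in> M.P" and v: "v \<in> M.TS x" and T: "open T" "x \<in> T" "T \<subseteq> M.P"
    and W: "\<And>y. y \<in> T \<Longrightarrow> W y \<in> N.TS (f y)" "\<And>b. M.near x (\<lambda>y. W y (\<lambda>q. snd (N.chart_at (f x)) q \<bullet> b))"
    and W': "\<And>y. y \<in> T \<Longrightarrow> W' y \<in> N.TS (f y)" "\<And>b. M.near x (\<lambda>y. W' y (\<lambda>q. snd (N.chart_at (f x)) q \<bullet> b))"
  shows "M.near x (\<lambda>y. N.g (f y) (W y) (W' y))"
    and "v (\<lambda>y. N.g (f y) (W y) (W' y)) = N.g (f x) (pullback_conn N f x v W) (W' x) + N.g (f x) (W x) (pullback_conn N f x v W')"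
proof -
  define k where "k = N.chart_at (f x)"
  have k: "k \<in> atlas N" "f x \<in> fst k" using N.chart_at[OF mp.f_pts[OF x]] by (auto simp: k_def)
  let ?S = "T \<inter> (M.P \<inter> f -` fst k)"
  have S: "open ?S" using T continuous_open_preimage[OF mp.mapD(4,1)] k by auto
  have xS: "x \<in> ?S" using T x k by auto
  let ?w = "\<lambda>b y. W y (\<lambda>q. snd k q \<bullet> b)" and ?w' = "\<lambda>b y. W' y (\<lambda>q. snd k q \<bullet> b)"
  let ?G = "\<lambda>a b q. N.g q (N.cvec k q a) (N.cvec k q b)"
  have ex: "N.g (f y) (W y) (W' y) = (\<Sum>a\<in>Basis. \<Sum>b\<in>Basis. ?w a y * ?w' b y * ?G a b (f y))" if "y \<in> ?S" for y
    using that W(1) W'(1) k by (intro N.met_chart_expand) auto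
  have nG: "M.near x (\<lambda>y. ?G a b (f y))" for a b
    using mp.near_comp[OF x N.met_near_chart[OF k]] .
  note n = W(2)[folded k_def] W'(2)[folded k_def]
  have "M.near x (\<lambda>y. \<Sum>a\<in>Basis. \<Sum>b\<in>Basis. ?w a y * ?w' b y * ?G a b (f y))"
    using x n nG by (intro M.near_sum M.near_mult) auto
  moreover have "M.near x (\<lambda>y. N.g (f y) (W y) (W' y))
      \<longleftrightarrow> M.near x (\<lambda>y. \<Sum>a\<in>Basis. \<Sum>b\<in>Basis. ?w a y * ?w' b y * ?G a b (f y))"
    by (rule M.near_cong[OF S xS]) (rule ex)
  ultimately show "M.near x (\<lambda>y. N.g (f y) (W y) (W' y))" by simp
  have fx: "f x \<in> N.P" using mp.f_pts[OF x] .
  have dv: "df x v \<in> N.TS (f x)" using mp.tmap_TS[OF x v] .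
  let ?N = "\<lambda>b. N.D (f x) (df x v) (coord_field (atlas N) k b)"
  have dG: "v (\<lambda>y. ?G a b (f y)) = N.g (f x) (?N a) (N.cvec k (f x) b) + N.g (f x) (N.cvec k (f x) a) (?N b)" for a b
    using N.D_coord_metric[OF k dv, of a b] N.met_near_chart[OF k, of a b] by (simp add: tmap_def o_def)
  have NT: "?N b \<in> N.TS (f x)" for b by (rule N.D_props(1)[OF fx dv N.vfield_near_coord[OF k]])
  have "v (\<lambda>y. N.g (f y) (W y) (W' y)) = v (\<lambda>y. \<Sum>a\<in>Basis. \<Sum>b\<in>Basis. ?w a y * ?w' b y * ?G a b (f y))"
    by (rule M.TS_cong[OF v S xS ex])
  also have "\<dots> = (\<Sum>a\<in>Basis. \<Sum>b\<in>Basis. (v (?w a) * ?w' b x + ?w a x * v (?w' b)) * ?G a b (f x) + ?w a x * ?w' b x * v (\<lambda>y. ?G a b (f y)))"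
    by (rule M.TS_double_sum_leibniz[OF v x]) (use n nG in auto)
  also have "\<dots> = N.g (f x) (pullback_conn N f x v W) (\<Sum>b\<in>Basis. tscale (?w' b x) (N.cvec k (f x) b))
      + N.g (f x) (\<Sum>b\<in>Basis. tscale (?w b x) (N.cvec k (f x) b)) (pullback_conn N f x v W')"
    unfolding pullback_conn_eq[OF x] k_def[symmetric]
    by (rule N.met_pointwise_leibniz[OF fx finite_Basis]) (use NT N.cvec_in_TS[OF k] dG in auto)
  finally show "v (\<lambda>y. N.g (f y) (W y) (W' y)) = N.g (f x) (pullback_conn N f x v W) (W' x) + N.g (f x) (W x) (pullback_conn N f x v W')"
    using N.TS_coord_expand[OF k W(1)[OF T(2)]] N.TS_coord_expand[OF k W'(1)[OF T(2)]] by simp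
qed

lemma df_vfield_near:
  assumes X: "vfield_on (atlas M) S X" and x: "x \<in> S" and k: "k \<in> atlas N" "f x \<in> fst k"
  shows "M.near x (\<lambda>y. df y (X y) (\<lambda>q. snd k q \<bullet> b))"
proof -
  have xP: "x \<in> M.P" using M.vfield_onD(2)[OF X] x by auto
  let ?S = "M.P \<inter> f -` fst k"
  have S: "open ?S" using continuous_open_preimage[OF mp.mapD(4,1)] k by auto
  have "M.near x (\<lambda>y. X y (\<lambda>z. snd k (f z) \<bullet> b))"
    by (rule M.vfield_on_near[OF X x mp.near_comp[OF xP N.near_coord[OF k]]])
  moreover have "X y (\<lambda>z. snd k (f z) \<bullet> b) = df y (X y) (\<lambda>q. snd k q \<bullet> b)" if "y \<in> ?S" for y
    using mp.tmap_coord[OF k(1)] that by simp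
  ultimately show ?thesis
    using M.near_cong[OF S, of x "\<lambda>y. X y (\<lambda>z. snd k (f z) \<bullet> b)" "\<lambda>y. df y (X y) (\<lambda>q. snd k q \<bullet> b)"] xP k by simp
qed

definition divg :: "('a \<Rightarrow> 'a tvec) \<Rightarrow> 'a \<Rightarrow> real" where
  "divg X x = (\<Sum>a<DIM('e). M.g x (M.D x (frame M x a x) X) (frame M x a x))"

text \<open>The field called \<open>Z\<close> in the overview, built from the frame chosen at the
  point itself.\<close>

definition vf :: "('a \<Rightarrow> 'b tvec) \<Rightarrow> 'a \<Rightarrow> 'a tvec" where
  "vf V y = (\<Sum>i<hrank M. tscale (exp (dfH_norm2 M N f y / 2) * N.g (f y) (V y) (df y (frame M y i y))) (frame M y i y))"

text \<open>Tangent vectors are compared on each function \<open>h\<close>; after that evaluation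
  the sum is the trace of a real bilinear form, so the frame can be exchanged.\<close>

lemma vf_frame:
  assumes S: "open S" "S \<subseteq> M.P" "adapted_frame_on M S e" "y \<in> S" and V: "V y \<in> N.TS (f y)"
  shows "vf V y = (\<Sum>i<hrank M. tscale (exp (dfH_norm2 M N f y / 2) * N.g (f y) (V y) (df y (e i y))) (e i y))"
proof
  fix h
  have y: "y \<in> M.P" using S by auto
  obtain T where T: "open T" "y \<in> T" "T \<subseteq> M.P" "adapted_frame_on M T (frame M y)"
    using M.frame_adapted[OF y] by blast
  note T' = T(1,3,4,2)
  have TS: "df y (frame M y i y) \<in> N.TS (f y)" if "i < hrank M" for i
    using mp.tmap_TS[OF y] M.adapted_frameD(3,6)[OF T'] that by auto
  have fy: "f y \<in> N.P" using mp.f_pts[OF y] .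
  let ?B = "\<lambda>(u :: 'a tvec) (w :: 'a tvec). exp (dfH_norm2 M N f y / 2) * N.g (f y) (V y) (df y u) * w h"
  have "(\<Sum>i<hrank M. ?B (frame M y i y) (frame M y i y)) = (\<Sum>i<hrank M. ?B (e i y) (e i y))"
  proof (rule M.hor_trace_indep[where B="?B", OF T' S])
    have "N.g (f y) (V y) (df y (\<Sum>i<hrank M. tscale (a i) (frame M y i y)))
        = (\<Sum>i<hrank M. a i * N.g (f y) (V y) (df y (frame M y i y)))" for a
      unfolding df_sum_scale
      by (subst N.met_sum_right) (use fy TS V in \<open>auto simp: N.TS_scale N.met_scale_right\<close>)
    then show "?B (\<Sum>i<hrank M. tscale (a i) (frame M y i y)) (e k y) = (\<Sum>i<hrank M. a i * ?B (frame M y i y) (e k y))" for a k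
      by (simp add: sum_distrib_left sum_distrib_right mult_ac)
    show "?B (frame M y k y) (\<Sum>i<hrank M. tscale (a i) (e i y)) = (\<Sum>i<hrank M. a i * ?B (frame M y k y) (e i y))" for a k
      by (simp add: sum_distrib_left sum_distrib_right mult_ac)
  qed
  then show "vf V y h = (\<Sum>i<hrank M. tscale (exp (dfH_norm2 M N f y / 2) * N.g (f y) (V y) (df y (e i y))) (e i y)) h"
    by (simp add: vf_def)
qed

lemma dfH_norm2_near:
  assumes x: "x \<in> M.P"
  shows "M.near x (dfH_norm2 M N f)"
proof -
  obtain S where S: "open S" "x \<in> S" "S \<subseteq> M.P" "adapted_frame_on M S (frame M x)"
    using M.frame_adapted[OF x] by blast
  let ?e = "frame M x"
  have k: "N.chart_at (f x) \<in> atlas N" "f x \<in> fst (N.chart_at (f x))" using N.chart_at[OF mp.f_pts[OF x]] by auto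
  have ev: "vfield_on (atlas M) S (?e i)" if "i < hrank M" for i
    using S(4) that M.hrank_le by (simp add: adapted_frame_on_def)
  have "M.near x (\<lambda>y. N.g (f y) (df y (?e i y)) (df y (?e i y)))" if "i < hrank M" for i
    by (rule pullback_metric(1)[OF x M.TS_0[OF x] S(1-3)])
       (use mp.tmap_TS M.vfield_onD(3)[OF ev[OF that]] S df_vfield_near[OF ev[OF that] S(2) k] in auto)
  then have "M.near x (\<lambda>y. \<Sum>i<hrank M. N.g (f y) (df y (?e i y)) (df y (?e i y)))"
    using x by (intro M.near_sum) auto
  then show ?thesis
    using M.near_cong[OF S(1,2), of "dfH_norm2 M N f"] dfH_norm2_frame[OF S(1,3,4)] by simp
qed

text \<open>In one adapted frame the divergence collects \<open>e\<^sub>i\<close> applied to the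
  weighted coefficients, plus terms from differentiating the frame summed over the full frame. In
  the latter, the indices below \<open>hrank M\<close> match the term
  \<open>df\<^sub>H(\<nabla>\<^sub>i e\<^sub>i)\<close> of the second fundamental form, and the
  others match \<open>df(\<zeta>)\<close>.\<close>

lemma div_vf:
  assumes x: "x \<in> M.P" and V: "\<And>y. y \<in> M.P \<Longrightarrow> V y \<in> N.TS (f y)"
    and Vn: "\<And>y k b. y \<in> M.P \<Longrightarrow> k \<in> atlas N \<Longrightarrow> f y \<in> fst k \<Longrightarrow> M.near y (\<lambda>y. V y (\<lambda>q. snd k q \<bullet> b))"
  shows "vfield_on (atlas M) M.P (vf V)"
    and "divg (vf V) x = exp (dfH_norm2 M N f x / 2) *
      ((\<Sum>i<hrank M. N.g (f x) (pullback_conn N f x (frame M x i x) V) (df x (frame M x i x)))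
        + N.g (f x) (V x) (tauH M N f x))"
proof -
  let ?m = "hrank M" and ?n = "DIM('e)"
  define u where "u y = dfH_norm2 M N f y / 2" for y
  have un: "M.near y u" if "y \<in> M.P" for y
    using M.near_mult[OF dfH_norm2_near[OF that] M.near_const[OF that, of "1/2"]] by (simp add: u_def[abs_def])
  have expn: "M.near y (\<lambda>y. exp (u y))" if "y \<in> M.P" for y
    by (rule M.near_real_compose[OF un[OF that] smooth_on_exp open_UNIV]) simp
  have wn: "M.near y (\<lambda>y. N.g (f y) (V y) (df y (X y)))" if X: "vfield_on (atlas M) S X" "y \<in> S" for X S y
  proof -
    have S: "open S" "S \<subseteq> M.P" using M.vfield_onD[OF X(1)] by auto
    then have y: "y \<in> M.P" using X by auto
    have k: "N.chart_at (f y) \<in> atlas N" "f y \<in> fst (N.chart_at (f y))" using N.chart_at[OF mp.f_pts[OF y]] by auto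
    show ?thesis
      by (rule pullback_metric(1)[OF y M.TS_0[OF y] S(1) X(2) S(2)])
         (use V S Vn[OF y k] mp.tmap_TS M.vfield_onD(3)[OF X(1)] df_vfield_near[OF X k] in auto)
  qed
  have local: "vfield_on (atlas M) S (vf V)" if S: "open S" "S \<subseteq> M.P" "adapted_frame_on M S e" for S e
  proof -
    have ev: "vfield_on (atlas M) S (e i)" if "i < ?m" for i
      using S(3) that M.hrank_le by (simp add: adapted_frame_on_def)
    have "vfield_on (atlas M) S (\<lambda>y. \<Sum>i<?m. tscale (exp (u y) * N.g (f y) (V y) (df y (e i y))) (e i y))"
      using S ev by (intro M.vfield_on_sum M.vfield_on_scale M.smooth_fun_on_near M.near_mult expn wn) auto
    then show ?thesis
    proof (rule M.vfield_on_cong)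
      fix y assume y: "y \<in> S"
      show "(\<Sum>i<?m. tscale (exp (u y) * N.g (f y) (V y) (df y (e i y))) (e i y)) = vf V y"
        unfolding u_def by (rule vf_frame[OF S y, symmetric]) (use S y V in auto)
    qed
  qed
  show "vfield_on (atlas M) M.P (vf V)"
  proof (rule M.vfield_on_local)
    fix y assume "y \<in> M.P"
    then show "\<exists>T. y \<in> T \<and> T \<subseteq> M.P \<and> vfield_on (atlas M) T (vf V)"
      using M.adapted_frame_exists[of y] local by blast
  qed
  obtain S where S: "open S" "x \<in> S" "S \<subseteq> M.P" "adapted_frame_on M S (frame M x)"
    using M.frame_adapted[OF x] by blast
  define e where "e = frame M x"
  note Se = S(1,3,4)[folded e_def]
  note a = M.adapted_frameD[OF Se S(2)]
  have ev: "vfield_on (atlas M) S (e i)" if "i < ?n" for i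
    using Se that by (simp add: adapted_frame_on_def)
  have mn: "i < ?m \<Longrightarrow> i < ?n" for i using M.hrank_le by simp
  have fx: "f x \<in> N.P" using mp.f_pts[OF x] .
  note Vx = V[OF x]
  have k: "N.chart_at (f x) \<in> atlas N" "f x \<in> fst (N.chart_at (f x))" using N.chart_at[OF fx] by auto
  have dT: "df x (e i x) \<in> N.TS (f x)" if "i < ?m" for i using mp.tmap_TS[OF x a(3)[OF mn[OF that]]] .
  define w where "w i y = N.g (f y) (V y) (df y (e i y))" for i y
  define C where "C i = M.D x (e i x) (e i)" for i
  define W where "W i y = dfH M N f y (e i y)" for i y
  have CT: "C i \<in> M.TS x" if "i < ?n" for i
    unfolding C_def using M.D_props(1)[OF x a(3)[OF that] M.vfield_nearI[OF ev[OF that] S(2)]] .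
  have proj: "hor_proj M x v = (\<Sum>i<?m. tscale (M.g x v (e i x)) (e i x))" if "v \<in> M.TS x" for v
    using M.hor_proj_eq[OF Se S(2) that] .
  have Vproj: "N.g (f x) (V x) (df x (hor_proj M x v)) = (\<Sum>i<?m. M.g x v (e i x) * w i x)"
    and projT: "df x (hor_proj M x v) \<in> N.TS (f x)" if "v \<in> M.TS x" for v
  proof -
    show "df x (hor_proj M x v) \<in> N.TS (f x)"
      unfolding proj[OF that] df_sum_scale using fx dT by (auto intro!: N.TS_sum N.TS_scale)
    show "N.g (f x) (V x) (df x (hor_proj M x v)) = (\<Sum>i<?m. M.g x v (e i x) * w i x)"
      unfolding proj[OF that] df_sum_scale
      by (subst N.met_sum_right) (use fx Vx dT in \<open>auto simp: N.TS_scale N.met_scale_right w_def\<close>)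
  qed
  have We: "W i y = df y (e i y)" if "i < ?m" "y \<in> S" for i y
  proof -
    note b = M.adapted_frameD[OF Se that(2)]
    have "hor_proj M y (e i y) = e i y"
      using M.hor_proj_eq[OF Se that(2) b(3)[OF mn[OF that(1)]]] M.hor_expand[OF Se that(2) b(1)[OF that(1)]] by simp
    then show ?thesis by (simp add: W_def dfH_def)
  qed
  have Wn: "M.near x (\<lambda>y. W i y (\<lambda>q. snd (N.chart_at (f x)) q \<bullet> b))" if "i < ?m" for i b
    using df_vfield_near[OF ev[OF mn[OF that]] S(2) k, of b]
      M.near_cong[OF S(1,2), of "\<lambda>y. W i y (\<lambda>q. snd (N.chart_at (f x)) q \<bullet> b)"] We[OF that] by simp
  have WT: "W i y \<in> N.TS (f y)" if "i < ?m" "y \<in> S" for i y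
    unfolding We[OF that] using mp.tmap_TS M.adapted_frameD(3)[OF Se that(2) mn[OF that(1)]] that S by auto
  let ?PV = "\<lambda>i. pullback_conn N f x (e i x) V" and ?PW = "\<lambda>i. pullback_conn N f x (e i x) (W i)"
  have ew: "e i x (w i) = N.g (f x) (?PV i) (df x (e i x)) + N.g (f x) (V x) (?PW i)" if i: "i < ?m" for i
  proof -
    have "e i x (w i) = e i x (\<lambda>y. N.g (f y) (V y) (W i y))"
      by (rule M.TS_cong[OF a(3)[OF mn[OF i]] S(1,2)]) (simp add: w_def We[OF i])
    also have "\<dots> = N.g (f x) (?PV i) (W i x) + N.g (f x) (V x) (?PW i)"
      by (rule pullback_metric(2)[OF x a(3)[OF mn[OF i]] S(1-3)])
         (use V S(3) Vn[OF x k] WT[OF i] Wn[OF i] in auto)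
    finally show ?thesis using We[OF i S(2)] by simp
  qed
  have wnear: "M.near x (w i)" if "i < ?m" for i
    unfolding w_def[abs_def] using wn[OF ev[OF mn[OF that]] S(2)] .
  \<comment> \<open>Differentiating the exponential weight is what produces the gradient term of the
    tension field.\<close>
  have ephi: "e i x (\<lambda>y. exp (u y) * w i y) = exp (u x) * (e i x u * w i x + e i x (w i))" if i: "i < ?m" for i
  proof -
    note eT = a(3)[OF mn[OF i]]
    have "e i x (\<lambda>y. exp (u y)) = exp (u x) * e i x u"
      by (rule M.TS_real_compose[OF eT un[OF x] smooth_on_exp open_UNIV]) (auto intro: DERIV_exp)
    then show ?thesis using M.TS_times[OF eT expn[OF x] wnear[OF i]] by (simp add: algebra_simps)
  qed
  have vfS: "vf V y = (\<Sum>i<?m. tscale (exp (u y) * w i y) (e i y))" if "y \<in> S" for y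
    unfolding u_def w_def by (rule vf_frame[OF Se that]) (use S that V in auto)
  have sm: "smooth_fun_on (atlas M) S (\<lambda>y. exp (u y) * w i y)" if "i < ?m" for i
    unfolding w_def using S(1,3) ev[OF mn[OF that]] by (intro M.smooth_fun_on_near M.near_mult expn wn) auto
  have Dvf: "M.D x v (vf V) = (\<Sum>i<?m. tscale (v (\<lambda>y. exp (u y) * w i y)) (e i x) + tscale (exp (u x) * w i x) (M.D x v (e i)))"
    if v: "v \<in> M.TS x" for v
  proof -
    have "M.D x v (vf V) = M.D x v (\<lambda>y. \<Sum>i<?m. tscale (exp (u y) * w i y) (e i y))"
      by (rule M.D_cong[OF local[OF Se] _ S(2) v vfS])
         (use S(1,3) ev mn sm in \<open>auto intro!: M.vfield_on_sum M.vfield_on_scale\<close>)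
    also have "\<dots> = (\<Sum>i<?m. tscale (v (\<lambda>y. exp (u y) * w i y)) (e i x) + tscale (exp (u x) * w i x) (M.D x v (e i)))"
      by (rule M.D_sum_leibniz[OF x v S(1,3,2)]) (use ev mn sm in auto)
    finally show ?thesis .
  qed
  \<comment> \<open>From differentiating the constant \<open>g(e\<^sub>i, e\<^sub>j)\<close> along
    \<open>e\<^sub>j\<close>. All frame derivatives are thereby expressed by the
    \<open>C j\<close>.\<close>
  have gD: "M.g x (M.D x (e j x) (e i)) (e j x) = - M.g x (e i x) (C j)" if i: "i < ?n" and j: "j < ?n" for i j
  proof -
    have "e j x (\<lambda>y. M.g y (e i y) (e j y)) = e j x (\<lambda>y. if i = j then 1 else 0)"
      by (rule M.TS_cong[OF a(3)[OF j] S(1,2)]) (use Se i j in \<open>auto simp: adapted_frame_on_def\<close>)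
    also have "\<dots> = 0" using M.TS_const[OF a(3)[OF j] x] by simp
    finally show ?thesis
      using M.D_metric[OF x M.vfield_nearI[OF ev[OF i] S(2)] M.vfield_nearI[OF ev[OF j] S(2)] a(3)[OF j]]
      by (simp add: C_def)
  qed
  have eij: "M.g x (e i x) (e j x) = (if i = j then 1 else 0)" if "i < ?n" "j < ?n" for i j
    using a(4) that by (simp add: M.orthonormal_def)
  have gDvf: "M.g x (M.D x (e j x) (vf V)) (e j x)
      = (\<Sum>i<?m. (if i = j then e i x (\<lambda>y. exp (u y) * w i y) else 0) - exp (u x) * w i x * M.g x (e i x) (C j))"
    if j: "j < ?n" for j
  proof -
    have DT: "M.D x (e j x) (e i) \<in> M.TS x" if "i < ?m" for i
      using M.D_props(1)[OF x a(3)[OF j] M.vfield_nearI[OF ev[OF mn[OF that]] S(2)]] .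
    have "M.g x (M.D x (e j x) (vf V)) (e j x)
      = (\<Sum>i<?m. M.g x (tscale (e j x (\<lambda>y. exp (u y) * w i y)) (e i x) + tscale (exp (u x) * w i x) (M.D x (e j x) (e i))) (e j x))"
      unfolding Dvf[OF a(3)[OF j]] using x a(3) mn DT j
      by (intro M.met_sum_left) (auto intro!: M.TS_add M.TS_scale)
    also have "\<dots> = (\<Sum>i<?m. (if i = j then e i x (\<lambda>y. exp (u y) * w i y) else 0) - exp (u x) * w i x * M.g x (e i x) (C j))"
      using x a(3) mn DT j
      by (intro sum.cong refl) (auto simp: M.met_add_left M.met_scale_left M.TS_scale eij gD)
    finally show ?thesis .
  qed
  have "divg (vf V) x = (\<Sum>j<?n. \<Sum>i<?m. (if i = j then e i x (\<lambda>y. exp (u y) * w i y) else 0) - exp (u x) * w i x * M.g x (e i x) (C j))"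
    unfolding divg_def e_def[symmetric] using gDvf by (intro sum.cong) auto
  also have "\<dots> = (\<Sum>i<?m. e i x (\<lambda>y. exp (u y) * w i y) - (\<Sum>j<?n. exp (u x) * w i x * M.g x (e i x) (C j)))"
    by (subst sum.swap) (use mn in \<open>auto simp: sum_subtractf intro!: sum.cong\<close>)
  also have "\<dots> = exp (u x) * (\<Sum>i<?m. e i x u * w i x + e i x (w i) - w i x * (\<Sum>j<?n. M.g x (e i x) (C j)))"
    unfolding sum_distrib_left using ephi by (intro sum.cong refl) (simp add: sum_distrib_left algebra_simps)
  also have "(\<Sum>i<?m. e i x u * w i x + e i x (w i) - w i x * (\<Sum>j<?n. M.g x (e i x) (C j)))
      = (\<Sum>i<?m. N.g (f x) (?PV i) (df x (e i x))) + N.g (f x) (V x) (tauH M N f x)"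
  proof -
    have bet: "betaH M N f (e i) (e i) x = ?PW i - df x (hor_proj M x (C i))" for i
      by (simp add: betaH_def W_def[abs_def] dfH_def C_def)
    \<comment> \<open>By definition \<open>zeta\<close> is a horizontal projection, so its image
      under \<open>df\<close> pairs with \<open>V\<close> through \<open>Vproj\<close>, like the
      other terms.\<close>
    have zet: "zeta M x = hor_proj M x (\<Sum>i\<in>{?m..<?n}. C i)"
      by (simp add: zeta_def C_def e_def)
    have sT: "(\<Sum>i\<in>{?m..<?n}. C i) \<in> M.TS x" using x CT by (intro M.TS_sum) auto
    note grT = M.gradient_props(1)[OF x, of u]
    have PWT: "?PW i \<in> N.TS (f x)" if "i < ?m" for i using pullback_conn_TS[OF x a(3)[OF mn[OF that]]] .
    have bT: "?PW i - df x (hor_proj M x (C i)) \<in> N.TS (f x)" if "i < ?m" for i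
      using fx PWT[OF that] projT[OF CT[OF mn[OF that]]] by (rule N.TS_diff)
    have tau: "tauH M N f x = (\<Sum>i<?m. ?PW i - df x (hor_proj M x (C i))) - df x (hor_proj M x (\<Sum>i\<in>{?m..<?n}. C i))
        + df x (hor_proj M x (gradient M u x))"
      unfolding tauH_def e_def[symmetric] bet zet by (simp only: dfH_def u_def[abs_def])
    have "N.g (f x) (V x) (tauH M N f x)
        = (\<Sum>i<?m. N.g (f x) (V x) (?PW i) - (\<Sum>j<?m. M.g x (C i) (e j x) * w j x))
        - (\<Sum>j<?m. M.g x (\<Sum>i\<in>{?m..<?n}. C i) (e j x) * w j x) + (\<Sum>j<?m. e j x u * w j x)"
    proof -
      have 1: "N.g (f x) (V x) (\<Sum>i<?m. ?PW i - df x (hor_proj M x (C i)))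
          = (\<Sum>i<?m. N.g (f x) (V x) (?PW i) - (\<Sum>j<?m. M.g x (C i) (e j x) * w j x))"
        using fx Vx bT PWT projT CT mn Vproj by (subst N.met_sum_right) (auto simp: N.met_diff_right intro!: sum.cong)
      have 2: "N.g (f x) (V x) (df x (hor_proj M x (gradient M u x))) = (\<Sum>j<?m. e j x u * w j x)"
        unfolding Vproj[OF grT] using M.gradient_props(2)[OF x a(3)] mn by (intro sum.cong) auto
      have sumT: "(\<Sum>i<?m. ?PW i - df x (hor_proj M x (C i))) \<in> N.TS (f x)"
        using fx bT by (intro N.TS_sum) auto
      show ?thesis
        unfolding tau N.met_add_right[OF fx N.TS_diff[OF fx sumT projT[OF sT]] projT[OF grT] Vx]
          N.met_diff_right[OF fx sumT projT[OF sT] Vx] 1 2 Vproj[OF sT] ..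
    qed
    also have "\<dots> = (\<Sum>i<?m. N.g (f x) (V x) (?PW i)) - (\<Sum>i<?m. \<Sum>j<?m. M.g x (C i) (e j x) * w j x)
        - (\<Sum>j<?m. M.g x (\<Sum>i\<in>{?m..<?n}. C i) (e j x) * w j x) + (\<Sum>j<?m. e j x u * w j x)"
      by (simp only: sum_subtractf)
    also have "(\<Sum>i<?m. \<Sum>j<?m. M.g x (C i) (e j x) * w j x) = (\<Sum>i<?m. w i x * (\<Sum>j<?m. M.g x (e i x) (C j)))"
    proof -
      have "M.g x (C i) (e j x) = M.g x (e j x) (C i)" if "j < ?m" "i < ?m" for i j
        using x CT a(3) mn that by (intro M.met_sym) auto
      then have "(\<Sum>i<?m. \<Sum>j<?m. M.g x (C i) (e j x) * w j x) = (\<Sum>i<?m. \<Sum>j<?m. w j x * M.g x (e j x) (C i))"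
        by (intro sum.cong refl) simp
      also have "\<dots> = (\<Sum>j<?m. \<Sum>i<?m. w j x * M.g x (e j x) (C i))" by (rule sum.swap)
      finally show ?thesis by (simp only: sum_distrib_left)
    qed
    also have "(\<Sum>j<?m. M.g x (\<Sum>i\<in>{?m..<?n}. C i) (e j x) * w j x)
        = (\<Sum>i<?m. w i x * (\<Sum>j\<in>{?m..<?n}. M.g x (e i x) (C j)))"
    proof (intro sum.cong refl)
      fix j assume "j \<in> {..<?m}"
      then have j: "j < ?m" by simp
      have "M.g x (\<Sum>i\<in>{?m..<?n}. C i) (e j x) = (\<Sum>i\<in>{?m..<?n}. M.g x (C i) (e j x))"
        using x CT a(3) mn[OF j] by (intro M.met_sum_left) auto
      also have "\<dots> = (\<Sum>i\<in>{?m..<?n}. M.g x (e j x) (C i))"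
        using x CT a(3) mn[OF j] by (intro sum.cong refl M.met_sym) auto
      finally show "M.g x (\<Sum>i\<in>{?m..<?n}. C i) (e j x) * w j x = w j x * (\<Sum>i\<in>{?m..<?n}. M.g x (e j x) (C i))"
        by simp
    qed
    finally have gt: "N.g (f x) (V x) (tauH M N f x) = (\<Sum>i<?m. N.g (f x) (V x) (?PW i))
        - (\<Sum>i<?m. w i x * (\<Sum>j<?m. M.g x (e i x) (C j)))
        - (\<Sum>i<?m. w i x * (\<Sum>j\<in>{?m..<?n}. M.g x (e i x) (C j))) + (\<Sum>j<?m. e j x u * w j x)" .
    \<comment> \<open>The trace over the full frame separates into the part met by the second
      fundamental form and the part met by \<open>zeta\<close>.\<close>
    have split: "(\<Sum>j<?n. M.g x (e i x) (C j)) = (\<Sum>j<?m. M.g x (e i x) (C j)) + (\<Sum>j\<in>{?m..<?n}. M.g x (e i x) (C j))" for i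
      using M.hrank_le by (simp add: lessThan_atLeast0 sum.atLeastLessThan_concat)
    have "(\<Sum>i<?m. e i x (w i)) = (\<Sum>i<?m. N.g (f x) (?PV i) (df x (e i x))) + (\<Sum>i<?m. N.g (f x) (V x) (?PW i))"
      unfolding sum.distrib[symmetric] using ew by (intro sum.cong refl) simp
    then show ?thesis
      unfolding gt split by (simp only: sum.distrib sum_subtractf distrib_left)
  qed
  finally show "divg (vf V) x = exp (dfH_norm2 M N f x / 2) *
      ((\<Sum>i<?m. N.g (f x) (pullback_conn N f x (frame M x i x) V) (df x (frame M x i x)))
        + N.g (f x) (V x) (tauH M N f x))"
    by (simp add: u_def e_def)
qed

end

section \<open>Smooth variations and the derivative of the energy density\<close>

locale variation = energy_map M N f
  for M :: "('a::{t2_space,second_countable_topology}, 'e::euclidean_space) sub_riem"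
    and N :: "('b::{t2_space,second_countable_topology}, 'f::euclidean_space) riem" and f +
  fixes \<epsilon> :: real and F :: "real \<Rightarrow> 'a \<Rightarrow> 'b"
  assumes var: "smooth_variation M N f \<epsilon> F"
begin

sublocale fam: mfd_interval "atlas M" \<epsilon>
  by unfold_locales

lemma eps: "\<epsilon> > 0" and F_0: "x \<in> M.P \<Longrightarrow> F 0 x = f x"
  using var by (auto simp: smooth_variation_def)

lemma zero_in_I: "0 \<in> fam.I"
  using eps by simp

sublocale jm: mfd_map fam.pA "atlas N" "M.P \<times> fam.I" "\<lambda>p. F (snd p) (fst p)"
proof -
  have "(\<lambda>(x, t). F t x) = (\<lambda>p. F (snd p) (fst p))" by (simp add: case_prod_beta')
  then show "mfd_map fam.pA (atlas N) (M.P \<times> fam.I) (\<lambda>p. F (snd p) (fst p))"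
    using var by unfold_locales (simp add: smooth_variation_def)
qed

abbreviation "V \<equiv> variation_field N F"

text \<open>Joint continuity of \<open>F\<close> gives a product neighbourhood that is mapped into a
  single chart of \<open>N\<close>. Passing \<open>T\<close> in lets it also fit inside the domain
  of a given frame.\<close>

lemma chart_nbhd:
  assumes "x \<in> M.P" "t \<in> fam.I" and k: "k \<in> atlas N" "F t x \<in> fst k" and T: "open T" "x \<in> T" "T \<subseteq> M.P"
  obtains S J where "open S" "x \<in> S" "S \<subseteq> T" "S \<subseteq> M.P" "open J" "t \<in> J" "J \<subseteq> fam.I"
    "\<And>y s. y \<in> S \<Longrightarrow> s \<in> J \<Longrightarrow> F s y \<in> fst k"
    "\<And>b. smooth_fun_on fam.pA (S \<times> J) (\<lambda>p. snd k (F (snd p) (fst p)) \<bullet> b)"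
    "\<And>a b. smooth_fun_on fam.pA (S \<times> J) (\<lambda>p. N.g (F (snd p) (fst p)) (N.cvec k (F (snd p) (fst p)) a) (N.cvec k (F (snd p) (fst p)) b))"
proof -
  let ?W = "(M.P \<times> fam.I) \<inter> (\<lambda>p. F (snd p) (fst p)) -` fst k"
  have W: "open ?W" using continuous_open_preimage[OF jm.mapD(4,1)] k by simp
  have xt: "(x, t) \<in> ?W" using assms by auto
  obtain S J where SJ: "open S" "open J" "(x, t) \<in> S \<times> J" "S \<times> J \<subseteq> ?W"
    by (rule open_prod_elim[OF W xt], rule that)
  let ?S = "S \<inter> T"
  have sub: "?S \<times> J \<subseteq> ?W" using SJ(4) by auto
  have op: "open (?S \<times> J)" using SJ T by (auto intro!: open_Times)
  show ?thesis
  proof (rule that[of ?S J])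
    show "smooth_fun_on fam.pA (?S \<times> J) (\<lambda>p. snd k (F (snd p) (fst p)) \<bullet> b)" for b
      by (rule fam.pr.smooth_fun_on_subset[OF jm.mapD(5)[OF k(1)] op sub]) (use k in simp)
    show "smooth_fun_on fam.pA (?S \<times> J) (\<lambda>p. N.g (F (snd p) (fst p)) (N.cvec k (F (snd p) (fst p)) a) (N.cvec k (F (snd p) (fst p)) b))" for a b
      by (rule fam.pr.smooth_fun_on_subset[OF fam.pr.smooth_fun_comp_map[OF N.smooth_mfd_axioms jm.smooth N.met_smooth_chart[OF k(1)]] op sub])
    show "J \<subseteq> fam.I" using SJ(3,4) by auto
    show "F s y \<in> fst k" if "y \<in> ?S" "s \<in> J" for y s using sub that by auto
  qed (use SJ T in auto)
qed

lemma F_pts: "x \<in> M.P \<Longrightarrow> t \<in> fam.I \<Longrightarrow> F t x \<in> N.P"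
  using jm.f_pts[of "(x, t)"] by simp

lemma smooth_slice:
  assumes t: "t \<in> fam.I"
  shows "smooth_map_on (atlas M) (atlas N) M.P (F t)"
proof (rule M.smooth_map_on_local[OF N.smooth_mfd_axioms M.open_pts order_refl])
  fix x assume x: "x \<in> M.P"
  have k: "N.chart_at (F t x) \<in> atlas N" "F t x \<in> fst (N.chart_at (F t x))" using N.chart_at[OF F_pts[OF x t]] by auto
  obtain S J where S: "open S" "x \<in> S" "S \<subseteq> M.P" "open J" "t \<in> J" "J \<subseteq> fam.I"
    "\<And>y s. y \<in> S \<Longrightarrow> s \<in> J \<Longrightarrow> F s y \<in> fst (N.chart_at (F t x))"
    "\<And>b. smooth_fun_on fam.pA (S \<times> J) (\<lambda>p. snd (N.chart_at (F t x)) (F (snd p) (fst p)) \<bullet> b)"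
    by (rule chart_nbhd[OF x t k M.open_pts x order_refl], rule that)
  show "\<exists>k\<in>atlas N. \<exists>T. x \<in> T \<and> F t ` T \<subseteq> fst k \<and> (\<forall>b\<in>Basis. smooth_fun_on (atlas M) T (\<lambda>x. snd k (F t x) \<bullet> b))"
    using k(1) S(2,5,7) fam.family_slice_smooth[OF S(1,3,4,6,8,5)]
    by (intro bexI[of _ "N.chart_at (F t x)"] exI[of _ S]) auto
qed

lemma energy_map_slice: "t \<in> fam.I \<Longrightarrow> energy_map M N (F t)"
  by (intro energy_map.intro mfd_map.intro mfd_map_axioms.intro M.sub_riem_mfd_axioms N.riem_mfd_axioms
      M.smooth_mfd_axioms N.smooth_mfd_axioms smooth_slice)

text \<open>One frame and one chart \<open>k\<close> serve all nearby points and times, so the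
  right-hand side is jointly smooth, a fact that the pointwise choices in \<open>dfH_norm2\<close>
  conceal.\<close>

lemma norm2_formula:
  assumes S: "open S" "S \<subseteq> M.P" "adapted_frame_on M S e" "y \<in> S" and t: "t \<in> fam.I" and k: "k \<in> atlas N" "F t y \<in> fst k"
  shows "dfH_norm2 M N (F t) y = (\<Sum>i<hrank M. \<Sum>a\<in>Basis. \<Sum>b\<in>Basis.
    e i y (\<lambda>z. snd k (F t z) \<bullet> a) * e i y (\<lambda>z. snd k (F t z) \<bullet> b) * N.g (F t y) (N.cvec k (F t y) a) (N.cvec k (F t y) b))"
proof -
  interpret Ft: energy_map M N "F t" by (rule energy_map_slice[OF t])
  have y: "y \<in> M.P" using S by auto
  have "N.g (F t y) (Ft.df y (e i y)) (Ft.df y (e i y)) = (\<Sum>a\<in>Basis. \<Sum>b\<in>Basis.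
    e i y (\<lambda>z. snd k (F t z) \<bullet> a) * e i y (\<lambda>z. snd k (F t z) \<bullet> b) * N.g (F t y) (N.cvec k (F t y) a) (N.cvec k (F t y) b))"
    if "i < hrank M" for i
  proof -
    have "Ft.df y (e i y) \<in> N.TS (F t y)"
      using Ft.mp.tmap_TS[OF y] M.adapted_frameD(3,6)[OF S] that by auto
    from N.met_chart_expand[OF k this this] show ?thesis by (simp only: Ft.mp.tmap_coord[OF k])
  qed
  then show ?thesis unfolding Ft.dfH_norm2_frame[OF S] by (intro sum.cong) auto
qed

lemma norm2_smooth: "smooth_fun_on fam.pA (M.P \<times> fam.I) (\<lambda>p. dfH_norm2 M N (F (snd p)) (fst p))"
proof (rule fam.pr.smooth_fun_on_local)
  fix p assume "p \<in> M.P \<times> fam.I"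
  then obtain x t where p: "p = (x, t)" and x: "x \<in> M.P" and t: "t \<in> fam.I" by auto
  define k where "k = N.chart_at (F t x)"
  have k: "k \<in> atlas N" "F t x \<in> fst k" using N.chart_at[OF F_pts[OF x t]] by (auto simp: k_def)
  obtain T e where T: "open T" "x \<in> T" "T \<subseteq> M.P" "adapted_frame_on M T e" using M.adapted_frame_exists[OF x] by blast
  obtain S J where S: "open S" "x \<in> S" "S \<subseteq> T" "S \<subseteq> M.P" and J: "open J" "t \<in> J" "J \<subseteq> fam.I"
    and Fk: "\<And>y s. y \<in> S \<Longrightarrow> s \<in> J \<Longrightarrow> F s y \<in> fst k"
    and sm: "\<And>b. smooth_fun_on fam.pA (S \<times> J) (\<lambda>p. snd k (F (snd p) (fst p)) \<bullet> b)"
    and sG: "\<And>a b. smooth_fun_on fam.pA (S \<times> J) (\<lambda>p. N.g (F (snd p) (fst p)) (N.cvec k (F (snd p) (fst p)) a) (N.cvec k (F (snd p) (fst p)) b))"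
    by (rule chart_nbhd[OF x t k T(1-3)], rule that)
  have ev: "vfield_on (atlas M) S (e i)" if "i < hrank M" for i
    by (rule M.vfield_on_subset[where S=T]) (use T(4) S M.hrank_le that in \<open>auto simp: adapted_frame_on_def\<close>)
  have "smooth_fun_on fam.pA (S \<times> J) (\<lambda>p. \<Sum>i<hrank M. \<Sum>a\<in>Basis. \<Sum>b\<in>Basis.
    e i (fst p) (\<lambda>z. snd k (F (snd p) z) \<bullet> a) * e i (fst p) (\<lambda>z. snd k (F (snd p) z) \<bullet> b) *
      N.g (F (snd p) (fst p)) (N.cvec k (F (snd p) (fst p)) a) (N.cvec k (F (snd p) (fst p)) b))"
    using fam.pr.smooth_fun_onD(1,2)[OF sm] fam.family_vfield(1)[OF ev J(1,3) sm]
    by (intro fam.pr.smooth_fun_on_sum fam.pr.smooth_fun_on_mult sG) auto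
  then have "smooth_fun_on fam.pA (S \<times> J) (\<lambda>p. dfH_norm2 M N (F (snd p)) (fst p))"
  proof (rule fam.pr.smooth_fun_on_cong)
    fix q assume q: "q \<in> S \<times> J"
    show "(\<Sum>i<hrank M. \<Sum>a\<in>Basis. \<Sum>b\<in>Basis.
    e i (fst q) (\<lambda>z. snd k (F (snd q) z) \<bullet> a) * e i (fst q) (\<lambda>z. snd k (F (snd q) z) \<bullet> b) *
      N.g (F (snd q) (fst q)) (N.cvec k (F (snd q) (fst q)) a) (N.cvec k (F (snd q) (fst q)) b))
      = dfH_norm2 M N (F (snd q)) (fst q)"
      by (rule norm2_formula[symmetric, OF T(1,3,4)]) (use q S J Fk k in auto)
  qed
  then show "\<exists>T. p \<in> T \<and> T \<subseteq> M.P \<times> fam.I \<and> smooth_fun_on fam.pA T (\<lambda>p. dfH_norm2 M N (F (snd p)) (fst p))"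
    using p S J by (intro exI[of _ "S \<times> J"]) auto
qed

definition density :: "real \<Rightarrow> 'a \<Rightarrow> real" where
  "density t x = exp (dfH_norm2 M N (F t) x / 2)"

lemma density_smooth: "smooth_fun_on fam.pA (M.P \<times> fam.I) (\<lambda>p. density (snd p) (fst p))"
proof -
  have "smooth_fun_on fam.pA (M.P \<times> fam.I) (\<lambda>p. (1/2) * dfH_norm2 M N (F (snd p)) (fst p))"
    using fam.pr.smooth_fun_onD(1,2)[OF norm2_smooth] norm2_smooth
    by (intro fam.pr.smooth_fun_on_mult fam.pr.smooth_fun_on_const)
  from fam.pr.smooth_fun_on_real_compose[OF this smooth_on_exp open_UNIV subset_UNIV]
  show ?thesis by (simp add: density_def)
qed

lemma V_apply: "x \<in> M.P \<Longrightarrow> N.near (f x) h \<Longrightarrow> V x h = deriv (\<lambda>t. h (F t x)) 0"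
  by (simp add: variation_field_def velocity_def F_0)

lemma V_TS:
  assumes x: "x \<in> M.P"
  shows "V x \<in> N.TS (f x)"
proof -
  define k where "k = N.chart_at (F 0 x)"
  have k: "k \<in> atlas N" "F 0 x \<in> fst k" using N.chart_at[OF F_pts[OF x zero_in_I]] by (auto simp: k_def)
  obtain S J where S: "open S" "x \<in> S" "S \<subseteq> M.P" and J: "open J" "0 \<in> J" "J \<subseteq> fam.I"
    and Fk: "\<And>y s. y \<in> S \<Longrightarrow> s \<in> J \<Longrightarrow> F s y \<in> fst k"
    and sm: "\<And>b. smooth_fun_on fam.pA (S \<times> J) (\<lambda>p. snd k (F (snd p) (fst p)) \<bullet> b)"
    by (rule chart_nbhd[OF x zero_in_I k M.open_pts x order_refl], rule that)
  let ?d = "\<lambda>b. deriv (\<lambda>s. snd k (F s x) \<bullet> b) 0"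
  have "((\<lambda>s. snd k (F s x)) has_vector_derivative (\<Sum>b\<in>Basis. ?d b *\<^sub>R b)) (at 0)"
    unfolding has_vector_derivative_def
  proof (subst has_derivative_componentwise_within, intro ballI)
    fix b :: 'f assume b: "b \<in> Basis"
    have "((\<lambda>s. snd k (F s x) \<bullet> b) has_real_derivative ?d b) (at 0)"
      using fam.family_deriv(1)[OF S(1,3) J(1,3) sm S(2) J(2), of b] by simp
    moreover have "(t *\<^sub>R (\<Sum>b\<in>Basis. ?d b *\<^sub>R b)) \<bullet> b = ?d b * t" for t
      using b by (simp add: inner_sum_left inner_Basis if_distrib cong: if_cong)
    ultimately show "((\<lambda>s. snd k (F s x) \<bullet> b) has_derivative (\<lambda>t. (t *\<^sub>R (\<Sum>b\<in>Basis. ?d b *\<^sub>R b)) \<bullet> b)) (at 0)"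
      by (simp only: has_field_derivative_def)
  qed
  moreover have "\<forall>\<^sub>F t in nhds 0. F t x \<in> fst k"
    using J Fk[OF S(2)] eventually_nhds by blast
  ultimately have "V x = N.cvec k (F 0 x) (\<Sum>b\<in>Basis. ?d b *\<^sub>R b)"
    unfolding variation_field_def by (intro N.velocity_eq_cvec k)
  then show ?thesis using N.cvec_in_TS[OF k] F_0[OF x] by simp
qed

lemma V_near:
  assumes x: "x \<in> M.P" and k: "k \<in> atlas N" "f x \<in> fst k"
  shows "M.near x (\<lambda>y. V y (\<lambda>q. snd k q \<bullet> b))"
proof -
  have k': "F 0 x \<in> fst k" using k F_0[OF x] by simp
  obtain S J where S: "open S" "x \<in> S" "S \<subseteq> M.P" and J: "open J" "0 \<in> J" "J \<subseteq> fam.I"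
    and Fk: "\<And>y s. y \<in> S \<Longrightarrow> s \<in> J \<Longrightarrow> F s y \<in> fst k"
    and sm: "\<And>b. smooth_fun_on fam.pA (S \<times> J) (\<lambda>p. snd k (F (snd p) (fst p)) \<bullet> b)"
    by (rule chart_nbhd[OF x zero_in_I k(1) k' M.open_pts x order_refl], rule that)
  have "smooth_fun_on (atlas M) S (\<lambda>y. deriv (\<lambda>s. snd k (F s y) \<bullet> b) 0)"
    using fam.family_slice_smooth[OF S(1,3) J(1,3) fam.family_deriv(2)[OF S(1,3) J(1,3) sm] J(2)] by simp
  then have "M.near x (\<lambda>y. deriv (\<lambda>s. snd k (F s y) \<bullet> b) 0)" using S(2) M.smooth_fun_nearI by blast
  moreover have "V y (\<lambda>q. snd k q \<bullet> b) = deriv (\<lambda>s. snd k (F s y) \<bullet> b) 0" if "y \<in> S" for y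
    using V_apply[OF _ N.near_coord[OF k(1)]] Fk[OF that J(2)] that S(3) F_0 by auto
  ultimately show ?thesis
    using M.near_cong[OF S(1,2), of "\<lambda>y. V y (\<lambda>q. snd k q \<bullet> b)" "\<lambda>y. deriv (\<lambda>s. snd k (F s y) \<bullet> b) 0"] by simp
qed

text \<open>The coordinate formula is differentiated in \<open>t\<close>: \<open>A'\<close> comes
  from exchanging \<open>e i\<close> with the time derivative, and \<open>G'\<close> is
  \<open>V\<close> applied to the metric coefficients. Symmetry of the metric yields a factor 2,
  which cancels the one half in the exponent.\<close>

lemma density_deriv_0:
  assumes x: "x \<in> M.P"
  shows "((\<lambda>t. density t x) has_real_derivative exp (dfH_norm2 M N f x / 2) *
    (\<Sum>i<hrank M. N.g (f x) (pullback_conn N f x (frame M x i x) V) (df x (frame M x i x)))) (at 0)"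
proof -
  let ?m = "hrank M"
  define k where "k = N.chart_at (f x)"
  have fx: "f x \<in> N.P" using mp.f_pts[OF x] .
  have k: "k \<in> atlas N" "f x \<in> fst k" using N.chart_at[OF fx] by (auto simp: k_def)
  have k': "F 0 x \<in> fst k" using k F_0[OF x] by simp
  define e where "e = frame M x"
  obtain T where T: "open T" "x \<in> T" "T \<subseteq> M.P" "adapted_frame_on M T e" using M.frame_adapted[OF x] e_def by blast
  obtain S J where S: "open S" "x \<in> S" "S \<subseteq> T" "S \<subseteq> M.P" and J: "open J" "0 \<in> J" "J \<subseteq> fam.I"
    and Fk: "\<And>y s. y \<in> S \<Longrightarrow> s \<in> J \<Longrightarrow> F s y \<in> fst k"
    and sm: "\<And>b. smooth_fun_on fam.pA (S \<times> J) (\<lambda>p. snd k (F (snd p) (fst p)) \<bullet> b)"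
    and sG: "\<And>a b. smooth_fun_on fam.pA (S \<times> J) (\<lambda>p. N.g (F (snd p) (fst p)) (N.cvec k (F (snd p) (fst p)) a) (N.cvec k (F (snd p) (fst p)) b))"
    by (rule chart_nbhd[OF x zero_in_I k(1) k' T(1-3)], rule that)
  have ev: "vfield_on (atlas M) S (e i)" if "i < ?m" for i
    by (rule M.vfield_on_subset[where S=T]) (use T(4) S M.hrank_le that in \<open>auto simp: adapted_frame_on_def\<close>)
  define A where "A i a t = e i x (\<lambda>z. snd k (F t z) \<bullet> a)" for i a t
  define G where "G a b t = N.g (F t x) (N.cvec k (F t x) a) (N.cvec k (F t x) b)" for a b t
  define A' where "A' i a = e i x (\<lambda>y. V y (\<lambda>q. snd k q \<bullet> a))" for i a
  define G' where "G' a b = V x (\<lambda>q. N.g q (N.cvec k q a) (N.cvec k q b))" for a b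
  define Nb where "Nb a = N.D (f x) (V x) (coord_field (atlas N) k a)" for a
  have eT: "e i x \<in> M.TS x" if "i < ?m" for i using M.vfield_onD(3)[OF ev[OF that] S(2)] .
  have dA: "(A i a has_real_derivative A' i a) (at 0)" if i: "i < ?m" for i a
  proof -
    have "((\<lambda>s. e i x (\<lambda>y. snd k (F s y) \<bullet> a)) has_real_derivative e i x (\<lambda>y. deriv (\<lambda>s. snd k (F s y) \<bullet> a) 0)) (at 0)"
      using fam.family_vfield(2)[OF ev[OF i] J(1,3) sm S(2) J(2), of a] by simp
    moreover have "e i x (\<lambda>y. deriv (\<lambda>s. snd k (F s y) \<bullet> a) 0) = A' i a"
      unfolding A'_def
    proof (rule M.TS_cong[OF eT[OF i] S(1,2)])
      fix y assume y: "y \<in> S"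
      show "deriv (\<lambda>s. snd k (F s y) \<bullet> a) 0 = V y (\<lambda>q. snd k q \<bullet> a)"
        using V_apply[OF _ N.near_coord[OF k(1)], of y a] Fk[OF y J(2)] y S(4) F_0 by auto
    qed
    ultimately show ?thesis by (simp add: A_def[abs_def])
  qed
  have dG: "(G a b has_real_derivative G' a b) (at 0)" for a b
  proof -
    have "(G a b has_real_derivative deriv (G a b) 0) (at 0)"
      using fam.family_deriv(1)[OF S(1,4) J(1,3) sG S(2) J(2), of a b] by (simp add: G_def[abs_def])
    moreover have "G' a b = deriv (G a b) 0"
      unfolding G'_def V_apply[OF x N.met_near_chart[OF k]] G_def[abs_def] ..
    ultimately show ?thesis by simp
  qed
  have "((\<lambda>t. \<Sum>i<?m. \<Sum>a\<in>Basis. \<Sum>b\<in>Basis. A i a t * A i b t * G a b t) has_real_derivative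
      (\<Sum>i<?m. \<Sum>a\<in>Basis. \<Sum>b\<in>Basis. (A' i a * A i b 0 + A i a 0 * A' i b) * G a b 0 + A i a 0 * A i b 0 * G' a b)) (at 0)"
    by (intro DERIV_sum) (auto intro!: derivative_eq_intros dA dG simp: algebra_simps)
  also have "(\<Sum>i<?m. \<Sum>a\<in>Basis. \<Sum>b\<in>Basis. (A' i a * A i b 0 + A i a 0 * A' i b) * G a b 0 + A i a 0 * A i b 0 * G' a b)
      = (\<Sum>i<?m. 2 * N.g (f x) (pullback_conn N f x (e i x) V) (df x (e i x)))"
  proof (intro sum.cong refl)
    fix i assume "i \<in> {..<?m}"
    then have i: "i < ?m" by simp
    have VT: "V x \<in> N.TS (f x)" using V_TS[OF x] .
    have dT: "df x (e i x) \<in> N.TS (f x)" using mp.tmap_TS[OF x eT[OF i]] .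
    have Ai: "A i a 0 = df x (e i x) (\<lambda>q. snd k q \<bullet> a)" for a
      unfolding mp.tmap_coord[OF k] A_def
      by (rule M.TS_cong[OF eT[OF i] S(1,2)]) (use S F_0 in auto)
    have NT: "Nb a \<in> N.TS (f x)" for a
      unfolding Nb_def by (rule N.D_props(1)[OF fx VT N.vfield_near_coord[OF k]])
    have dfe: "df x (e i x) = (\<Sum>a\<in>Basis. tscale (A i a 0) (N.cvec k (f x) a))"
      unfolding Ai by (rule N.TS_coord_expand[OF k dT])
    \<comment> \<open>Torsion-freeness at work: \<open>Nb\<close> differentiates coordinate fields
      along \<open>V\<close>, whereas the pull-back connection differentiates them along
      \<open>df(e\<^sub>i)\<close>.\<close>
    have pb: "pullback_conn N f x (e i x) V = (\<Sum>a\<in>Basis. tscale (A' i a) (N.cvec k (f x) a) + tscale (A i a 0) (Nb a))"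
      unfolding pullback_conn_eq[OF x] k_def[symmetric] sum.distrib N.D_coord_dir_swap[OF k VT dT] Ai Nb_def A'_def ..
    have pT: "pullback_conn N f x (e i x) V \<in> N.TS (f x)" by (rule pullback_conn_TS[OF x eT[OF i]])
    have "(\<Sum>a\<in>Basis. \<Sum>b\<in>Basis. (A' i a * A i b 0 + A i a 0 * A' i b) * G a b 0 + A i a 0 * A i b 0 * G' a b)
      = N.g (f x) (\<Sum>a\<in>Basis. tscale (A' i a) (N.cvec k (f x) a) + tscale (A i a 0) (Nb a)) (\<Sum>a\<in>Basis. tscale (A i a 0) (N.cvec k (f x) a))
      + N.g (f x) (\<Sum>a\<in>Basis. tscale (A i a 0) (N.cvec k (f x) a)) (\<Sum>a\<in>Basis. tscale (A' i a) (N.cvec k (f x) a) + tscale (A i a 0) (Nb a))"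
      unfolding G_def F_0[OF x]
      by (rule N.met_pointwise_leibniz[OF fx finite_Basis])
         (use N.cvec_in_TS[OF k] NT N.D_coord_metric[OF k VT] in \<open>auto simp: G'_def Nb_def\<close>)
    also have "\<dots> = 2 * N.g (f x) (pullback_conn N f x (e i x) V) (df x (e i x))"
      unfolding pb[symmetric] dfe[symmetric] using N.met_sym[OF fx pT dT] by simp
    finally show "(\<Sum>a\<in>Basis. \<Sum>b\<in>Basis. (A' i a * A i b 0 + A i a 0 * A' i b) * G a b 0 + A i a 0 * A i b 0 * G' a b)
      = 2 * N.g (f x) (pullback_conn N f x (e i x) V) (df x (e i x))" .
  qed
  finally have d: "((\<lambda>t. \<Sum>i<?m. \<Sum>a\<in>Basis. \<Sum>b\<in>Basis. A i a t * A i b t * G a b t) has_real_derivative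
      (\<Sum>i<?m. 2 * N.g (f x) (pullback_conn N f x (e i x) V) (df x (e i x)))) (at 0)" .
  have form: "dfH_norm2 M N (F t) x = (\<Sum>i<?m. \<Sum>a\<in>Basis. \<Sum>b\<in>Basis. A i a t * A i b t * G a b t)" if "t \<in> J" for t
    unfolding A_def G_def by (rule norm2_formula[OF T(1,3,4,2)]) (use that J Fk S k in auto)
  have "((\<lambda>t. dfH_norm2 M N (F t) x) has_real_derivative
      (\<Sum>i<?m. 2 * N.g (f x) (pullback_conn N f x (e i x) V) (df x (e i x)))) (at 0)"
    by (rule has_field_derivative_transform_within_open[OF d J(1,2)]) (simp add: form)
  then have "((\<lambda>t. exp (dfH_norm2 M N (F t) x / 2)) has_real_derivative exp (dfH_norm2 M N (F 0) x / 2) *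
      ((\<Sum>i<?m. 2 * N.g (f x) (pullback_conn N f x (e i x) V) (df x (e i x))) / 2)) (at 0)"
    by (auto intro!: derivative_eq_intros)
  \<comment> \<open>\<open>F 0\<close> and \<open>f\<close> agree on the manifold only, not as HOL
    functions, so their differentials are compared through locality.\<close>
  moreover have "dfH_norm2 M N (F 0) x = dfH_norm2 M N f x"
  proof -
    have "dfH_norm2 M N f x = (\<Sum>i<?m. N.g (f x) (df x (e i x)) (df x (e i x)))"
      by (rule dfH_norm2_frame[OF T(1,3,4,2)])
    moreover have "dfH_norm2 M N (F 0) x = (\<Sum>i<?m. N.g (F 0 x) (tmap (atlas N) (F 0) x (e i x)) (tmap (atlas N) (F 0) x (e i x)))"
      by (rule energy_map.dfH_norm2_frame[OF energy_map_slice[OF zero_in_I] T(1,3,4,2)])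
    moreover have "tmap (atlas N) (F 0) x (e i x) = df x (e i x)" if "i < ?m" for i
    proof
      fix h
      have "e i x (\<lambda>y. h (F 0 y)) = e i x (\<lambda>y. h (f y))"
        by (rule M.TS_cong[OF eT[OF that] S(1,2)]) (use S F_0 in auto)
      then show "tmap (atlas N) (F 0) x (e i x) h = df x (e i x) h" by (simp add: tmap_def o_def F_0[OF x])
    qed
    ultimately show ?thesis by (simp add: F_0[OF x])
  qed
  ultimately show ?thesis by (simp add: density_def e_def sum_distrib_left[symmetric])
qed

end

section \<open>Integration\<close>

text \<open>Dominated convergence for difference quotients along arbitrary null sequences; the mean
  value inequality turns the bound on the derivative into one on the quotients.\<close>

lemma has_real_derivative_integral:
  fixes \<rho> :: "real \<Rightarrow> 'a \<Rightarrow> real"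
  assumes \<delta>: "\<delta> > 0" and int: "\<And>t. \<bar>t\<bar> < \<delta> \<Longrightarrow> integrable \<mu> (\<rho> t)"
    and der: "\<And>x t. x \<in> space \<mu> \<Longrightarrow> \<bar>t\<bar> < \<delta> \<Longrightarrow> ((\<lambda>s. \<rho> s x) has_real_derivative \<rho>' t x) (at t)"
    and bnd: "\<And>x t. x \<in> space \<mu> \<Longrightarrow> \<bar>t\<bar> < \<delta> \<Longrightarrow> \<bar>\<rho>' t x\<bar> \<le> B x" and B: "integrable \<mu> B"
  shows "((\<lambda>t. \<integral>x. \<rho> t x \<partial>\<mu>) has_real_derivative (\<integral>x. \<rho>' 0 x \<partial>\<mu>)) (at 0)" "integrable \<mu> (\<rho>' 0)"
proof -
  have main: "(\<lambda>n. \<integral>x. (\<rho> (X n) x - \<rho> 0 x) / X n \<partial>\<mu>) \<longlonglongrightarrow> (\<integral>x. \<rho>' 0 x \<partial>\<mu>)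
      \<and> integrable \<mu> (\<rho>' 0)"
    if X: "\<And>n. X n \<noteq> 0" "\<And>n. \<bar>X n\<bar> < \<delta>" "X \<longlonglongrightarrow> 0" for X
  proof -
    have lim: "(\<lambda>n. (\<rho> (X n) x - \<rho> 0 x) / X n) \<longlonglongrightarrow> \<rho>' 0 x" if x: "x \<in> space \<mu>" for x
    proof -
      have "((\<lambda>h. (\<rho> (0 + h) x - \<rho> 0 x) / h) \<longlongrightarrow> \<rho>' 0 x) (at 0)"
        using der[OF x, of 0] \<delta> by (simp add: DERIV_def)
      then show ?thesis
        using X(1,3) by (auto simp: tendsto_at_iff_sequentially o_def)
    qed
    have bd: "\<bar>(\<rho> (X n) x - \<rho> 0 x) / X n\<bar> \<le> B x" if x: "x \<in> space \<mu>" for x n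
    proof -
      have seg: "\<bar>s\<bar> < \<delta>" if "s \<in> closed_segment 0 (X n)" for s
        using that X(2)[of n] by (auto simp: closed_segment_eq_real_ivl split: if_splits)
      have "norm (\<rho> (X n) x - \<rho> 0 x) \<le> B x * norm (X n - 0)"
      proof (rule field_differentiable_bound[of "closed_segment 0 (X n)" "\<lambda>s. \<rho> s x" "\<lambda>s. \<rho>' s x"])
        show "((\<lambda>s. \<rho> s x) has_field_derivative \<rho>' z x) (at z within closed_segment 0 (X n))"
          if "z \<in> closed_segment 0 (X n)" for z
          using der[OF x seg[OF that]] by (rule has_field_derivative_at_within)
        show "norm (\<rho>' z x) \<le> B x" if "z \<in> closed_segment 0 (X n)" for z
          using bnd[OF x seg[OF that]] by simp
      qed auto
      then show ?thesis using X(1)[of n] by (simp add: abs_divide pos_divide_le_eq)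
    qed
    have m: "(\<lambda>x. (\<rho> (X n) x - \<rho> 0 x) / X n) \<in> borel_measurable \<mu>" for n
      using int[OF X(2)[of n]] int[of 0] \<delta> by (auto intro!: borel_measurable_divide borel_measurable_diff)
    have m0: "\<rho>' 0 \<in> borel_measurable \<mu>"
      by (rule borel_measurable_LIMSEQ_real[OF lim m])
    have "AE x in \<mu>. (\<lambda>n. (\<rho> (X n) x - \<rho> 0 x) / X n) \<longlonglongrightarrow> \<rho>' 0 x"
      "\<And>n. AE x in \<mu>. norm ((\<rho> (X n) x - \<rho> 0 x) / X n) \<le> B x"
      using lim bd by auto
    from integral_dominated_convergence[OF m0 m B this] integrable_dominated_convergence[OF m0 m B this]
    show ?thesis by blast
  qed
  \<comment> \<open>A concrete null sequence is enough for integrability of the limit; the shift by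
    2 keeps its first member strictly below \<open>\<delta>\<close>.\<close>
  have "\<bar>\<delta> / real (n + 2)\<bar> < \<delta>" "\<delta> / real (n + 2) \<noteq> 0" for n
    using \<delta> by (auto simp: field_simps intro: add_pos_nonneg)
  moreover have "(\<lambda>n. \<delta> / real (n + 2)) \<longlonglongrightarrow> 0"
    by (rule LIMSEQ_ignore_initial_segment[OF lim_const_over_n])
  ultimately show "integrable \<mu> (\<rho>' 0)" using main[of "\<lambda>n. \<delta> / real (n + 2)"] by blast
  show "((\<lambda>t. \<integral>x. \<rho> t x \<partial>\<mu>) has_real_derivative (\<integral>x. \<rho>' 0 x \<partial>\<mu>)) (at 0)"
    unfolding DERIV_def tendsto_at_iff_sequentially o_def
  proof (intro allI impI)
    fix X :: "nat \<Rightarrow> real" assume X: "\<forall>i. X i \<in> UNIV - {0}" "X \<longlonglongrightarrow> 0"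
    have "\<forall>\<^sub>F n in sequentially. \<bar>X n\<bar> < \<delta>"
      using X(2) \<delta> by (auto simp: tendsto_iff dist_real_def)
    then obtain N where N: "\<And>n. n \<ge> N \<Longrightarrow> \<bar>X n\<bar> < \<delta>" by (auto simp: eventually_sequentially)
    have "(\<lambda>n. \<integral>x. (\<rho> (X (n + N)) x - \<rho> 0 x) / X (n + N) \<partial>\<mu>) \<longlonglongrightarrow> (\<integral>x. \<rho>' 0 x \<partial>\<mu>)"
      using main[of "\<lambda>n. X (n + N)"] X N LIMSEQ_ignore_initial_segment[OF X(2)] by auto
    moreover have "(\<integral>x. (\<rho> (X (n + N)) x - \<rho> 0 x) / X (n + N) \<partial>\<mu>)
        = ((\<integral>x. \<rho> (0 + X (n + N)) x \<partial>\<mu>) - (\<integral>x. \<rho> 0 x \<partial>\<mu>)) / X (n + N)" for n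
      using int[OF N[of "n + N"]] int[of 0] \<delta> by simp
    ultimately have "(\<lambda>n. ((\<integral>x. \<rho> (0 + X (n + N)) x \<partial>\<mu>) - (\<integral>x. \<rho> 0 x \<partial>\<mu>)) / X (n + N)) \<longlonglongrightarrow> (\<integral>x. \<rho>' 0 x \<partial>\<mu>)"
      by (simp only:)
    then show "(\<lambda>n. ((\<integral>x. \<rho> (0 + X n) x \<partial>\<mu>) - (\<integral>x. \<rho> 0 x \<partial>\<mu>)) / X n) \<longlonglongrightarrow> (\<integral>x. \<rho>' 0 x \<partial>\<mu>)"
      by (rule LIMSEQ_offset)
  qed
qed

text \<open>By translation invariance of Lebesgue measure the integral of
  \<open>u (y + t *\<^sub>R b)\<close> does not depend on \<open>t\<close>. Differentiating under
  the integral at \<open>t = 0\<close> gives the claim.\<close>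

lemma integral_fd_compact_support:
  fixes u :: "'e::euclidean_space \<Rightarrow> real"
  assumes u: "smooth_on UNIV u" and K: "compact K" "\<And>y. y \<notin> K \<Longrightarrow> u y = 0"
  shows "(\<integral>y. fd u y b \<partial>lborel) = 0"
proof -
  obtain R where R: "K \<subseteq> ball 0 R" using compact_imp_bounded[OF K(1)] bounded_subset_ballD by blast
  \<comment> \<open>The domain of the majorant. For \<open>\<bar>t\<bar> < 1\<close> a point outside
    \<open>C\<close> is moved to norm above \<open>R\<close>, where the derivative vanishes; a point
    of \<open>C\<close> is moved into the ball of radius \<open>\<bar>R\<bar> + 2 * norm b\<close>,
    where \<open>L\<close> bounds it.\<close>
  define C where "C = cball (0::'e) (\<bar>R\<bar> + norm b)"
  have outside: "u y = 0" if "norm y \<ge> R" for y using K(2) R that by (auto simp: subset_iff dist_norm) (meson linorder_not_le)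
  have cu: "continuous_on UNIV u" by (rule smooth_on_imp_continuous_on[OF u])
  have cf: "continuous_on UNIV (\<lambda>y. fd u y b)" by (rule smooth_on_imp_continuous_on[OF smooth_on_fd[OF u]])
  have "compact (cball (0::'e) (\<bar>R\<bar> + 2 * norm b))" by simp
  then have "compact ((\<lambda>y. fd u y b) ` cball 0 (\<bar>R\<bar> + 2 * norm b))"
    by (intro compact_continuous_image continuous_on_subset[OF cf]) auto
  then have "bounded ((\<lambda>y. fd u y b) ` cball 0 (\<bar>R\<bar> + 2 * norm b))" by (rule compact_imp_bounded)
  then obtain L where "\<forall>z\<in>(\<lambda>y. fd u y b) ` cball 0 (\<bar>R\<bar> + 2 * norm b). norm z \<le> L" unfolding bounded_iff by blast
  then have L: "\<bar>fd u y b\<bar> \<le> L" if "norm y \<le> \<bar>R\<bar> + 2 * norm b" for y using that by simp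
  have L0: "L \<ge> 0" using L[of 0] by (smt (verit) norm_ge_zero norm_zero)
  have zero: "fd u y b = 0" if "norm y > R" for y
  proof -
    have "open {y. norm y > R}" by (intro open_Collect_less continuous_intros)
    moreover have "((\<lambda>y. 0) has_derivative (\<lambda>_. 0)) (at y)" by simp
    ultimately have "(u has_derivative (\<lambda>_. 0)) (at y)"
      by (rule_tac has_derivative_transform_within_open[where f="\<lambda>y. 0" and s="{y. norm y > R}"]) (use that outside in auto)
    then show ?thesis by (simp add: fd_eqI)
  qed
  have ui: "integrable lborel u"
  proof -
    have "integrable lborel (\<lambda>y. indicator (cball 0 \<bar>R\<bar>) y *\<^sub>R u y)"
      by (intro borel_integrable_compact continuous_on_subset[OF cu]) auto
    moreover have "indicator (cball 0 \<bar>R\<bar>) y *\<^sub>R u y = u y" for y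
      using outside[of y] by (auto simp: indicator_def)
    ultimately show ?thesis by (simp only:)
  qed
  have shift: "integrable lborel (\<lambda>y. u (y + t *\<^sub>R b))" "(\<integral>y. u (y + t *\<^sub>R b) \<partial>lborel) = (\<integral>y. u y \<partial>lborel)" for t
  proof -
    have d: "distr lborel borel ((+) (t *\<^sub>R b)) = lborel" by (rule lborel_distr_plus)
    have "integrable (distr lborel borel ((+) (t *\<^sub>R b))) u" using ui d by simp
    then show "integrable lborel (\<lambda>y. u (y + t *\<^sub>R b))"
      using borel_measurable_continuous_onI[OF cu] by (subst (asm) integrable_distr_eq) (auto simp: add.commute)
    have "(\<integral>y. u y \<partial>distr lborel borel ((+) (t *\<^sub>R b))) = (\<integral>y. u (t *\<^sub>R b + y) \<partial>lborel)"
      using borel_measurable_continuous_onI[OF cu] by (intro integral_distr) auto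
    then show "(\<integral>y. u (y + t *\<^sub>R b) \<partial>lborel) = (\<integral>y. u y \<partial>lborel)" using d by (simp add: add.commute)
  qed
  have "((\<lambda>t. \<integral>y. u (y + t *\<^sub>R b) \<partial>lborel) has_real_derivative (\<integral>y. fd u (y + 0 *\<^sub>R b) b \<partial>lborel)) (at 0)"
  proof (rule has_real_derivative_integral(1)[where \<delta>=1 and B="\<lambda>y. L * indicator C y"])
    fix y :: 'e and t :: real assume t: "\<bar>t\<bar> < 1"
    have D: "(u has_derivative fd u (y + t *\<^sub>R b)) (at (y + t *\<^sub>R b))" using smooth_on_has_derivative[OF u] by simp
    have "((\<lambda>t. y + t *\<^sub>R b) has_derivative (\<lambda>d. d *\<^sub>R b)) (at t)" by (auto intro!: derivative_eq_intros)
    from has_derivative_compose[OF this D]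
    show "((\<lambda>t. u (y + t *\<^sub>R b)) has_real_derivative fd u (y + t *\<^sub>R b) b) (at t)"
      unfolding has_field_derivative_def
      by (rule has_derivative_eq_rhs) (simp add: fun_eq_iff linear_scale[OF has_derivative_linear[OF D]])
    have tb: "norm (t *\<^sub>R b) \<le> norm b" using t by (simp add: mult_left_le_one_le)
    show "\<bar>fd u (y + t *\<^sub>R b) b\<bar> \<le> L * indicator C y"
    proof (cases "y \<in> C")
      case True
      then have "norm (y + t *\<^sub>R b) \<le> \<bar>R\<bar> + 2 * norm b"
        using norm_triangle_ineq[of y "t *\<^sub>R b"] tb by (simp add: C_def)
      then show ?thesis using L True by simp
    next
      case False
      then have "norm (y + t *\<^sub>R b) > R"
        using norm_triangle_ineq2[of y "- (t *\<^sub>R b)"] tb by (simp add: C_def)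
      then show ?thesis using zero False L0 by simp
    qed
  next
    show "integrable lborel (\<lambda>y. L * indicator C y)"
      by (intro integrable_mult_right integrable_real_indicator) (use emeasure_bounded_finite[OF bounded_cball] in \<open>auto simp: C_def\<close>)
  qed (use shift in auto)
  then have "((\<lambda>t. \<integral>y. u y \<partial>lborel) has_real_derivative (\<integral>y. fd u y b \<partial>lborel)) (at 0)"
    by (simp add: shift(2))
  then show ?thesis using DERIV_const DERIV_unique by blast
qed

text \<open>If the right-hand side is finite it is a gauge integral, to which the change of
  variables applies. If it is infinite, an image of finite measure would make that integral
  finite.\<close>

lemma emeasure_differentiable_image:
  fixes T :: "real^'n::{finite,wellorder} \<Rightarrow> real^'n::_"
  assumes D: "D \<in> sets borel" "T ` D \<in> sets borel"
    and der: "\<And>x. x \<in> D \<Longrightarrow> (T has_derivative T' x) (at x)" and inj: "inj_on T D"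
    and meas: "(\<lambda>x. indicator D x * \<bar>det (matrix (T' x))\<bar>) \<in> borel_measurable borel"
  shows "emeasure lborel (T ` D) = (\<integral>\<^sup>+x. ennreal (indicator D x * \<bar>det (matrix (T' x))\<bar>) \<partial>lborel)"
proof -
  let ?J = "\<lambda>x. \<bar>det (matrix (T' x))\<bar>"
  have leb: "D \<in> sets lebesgue" "T ` D \<in> sets lebesgue" using D by auto
  have der': "(T has_derivative T' x) (at x within D)" if "x \<in> D" for x using der[OF that] by (rule has_derivative_at_withinI)
  note hm = has_measure_differentiable_image[OF leb(1) der' inj]
  have em: "emeasure lborel (T ` D) = emeasure lebesgue (T ` D)" using D(2) by simp
  show ?thesis
  proof (cases "(\<integral>\<^sup>+x. ennreal (indicator D x * ?J x) \<partial>lborel) < \<infinity>")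
    case True
    then obtain r where r: "(\<integral>\<^sup>+x. ennreal (indicator D x * ?J x) \<partial>lborel) = ennreal r" "r \<ge> 0"
      by (cases "\<integral>\<^sup>+x. ennreal (indicator D x * ?J x) \<partial>lborel") auto
    have "((\<lambda>x. indicator D x * ?J x) has_integral r) UNIV"
      by (rule nn_integral_has_integral[OF meas _ r]) simp
    moreover have "(\<lambda>x. indicator D x * ?J x) = (\<lambda>x. if x \<in> D then ?J x else 0)" by (auto simp: indicator_def)
    ultimately have "(?J has_integral r) D" by (simp only: has_integral_restrict_UNIV)
    then have "T ` D \<in> lmeasurable" "measure lebesgue (T ` D) = r" using hm by auto
    then have "emeasure lebesgue (T ` D) = ennreal r" by (simp add: emeasure_eq_measure2)
    then show ?thesis using em r by simp
  next
    case False
    have "\<not> emeasure lborel (T ` D) < \<infinity>"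
    proof
      assume "emeasure lborel (T ` D) < \<infinity>"
      then have "T ` D \<in> lmeasurable" using em leb by (intro fmeasurableI) auto
      then have "(?J has_integral measure lebesgue (T ` D)) D" using hm by blast
      from nn_integral_has_integral_lebesgue[OF _ this] False show False by simp
    qed
    then show ?thesis using False by (simp add: less_top[symmetric])
  qed
qed

text \<open>The image measure under \<open>T\<close> of the Jacobian density on \<open>D\<close> is
  Lebesgue measure on the image of \<open>D\<close>; the formula for functions then follows by
  integrating against both.\<close>

lemma nn_integral_change_of_variables:
  fixes T :: "real^'n::{finite,wellorder} \<Rightarrow> real^'n::_"
  assumes U: "open U" and W: "open W" and hom: "homeomorphism U W T S"
    and der: "\<And>x. x \<in> U \<Longrightarrow> (T has_derivative T' x) (at x)"
    and cont: "continuous_on U (\<lambda>x. det (matrix (T' x)))"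
    and D: "D \<in> sets borel" "D \<subseteq> U" and h: "h \<in> borel_measurable borel"
  shows "(\<integral>\<^sup>+y. h y * indicator (T ` D) y \<partial>lborel)
    = (\<integral>\<^sup>+x. h (T x) * ennreal (indicator D x * \<bar>det (matrix (T' x))\<bar>) \<partial>lborel)"
proof -
  let ?J = "\<lambda>x. \<bar>det (matrix (T' x))\<bar>"
  \<comment> \<open>Both maps are extended by 0 to the whole space, so that they are Borel functions
    everywhere.\<close>
  define T1 where "T1 x = indicator U x *\<^sub>R T x" for x
  define S1 where "S1 y = indicator W y *\<^sub>R S y" for y
  have T1: "T1 \<in> borel_measurable borel" unfolding T1_def
    using U homeomorphism_cont1[OF hom] by (intro borel_measurable_continuous_on_indicator) auto
  have S1: "S1 \<in> borel_measurable borel" unfolding S1_def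
    using W homeomorphism_cont2[OF hom] by (intro borel_measurable_continuous_on_indicator) auto
  have inj: "inj_on T U" using homeomorphism_apply1[OF hom] by (metis inj_onI)
  \<comment> \<open>Images of Borel sets are preimages under the extended inverse.\<close>
  have img: "T ` B \<in> sets borel" if "B \<in> sets borel" "B \<subseteq> U" for B
  proof -
    have "T ` B = W \<inter> S1 -` B"
    proof (intro equalityI subsetI)
      fix y assume "y \<in> T ` B"
      then obtain x where x: "x \<in> B" "y = T x" by blast
      then show "y \<in> W \<inter> S1 -` B"
        using that homeomorphism_apply1[OF hom] homeomorphism_image1[OF hom] by (auto simp: S1_def)
    next
      fix y assume y: "y \<in> W \<inter> S1 -` B"
      then have "S y \<in> B" "T (S y) = y" using homeomorphism_apply2[OF hom] by (auto simp: S1_def)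
      then show "y \<in> T ` B" by (metis imageI)
    qed
    moreover have "S1 -` B \<in> sets borel" using measurable_sets[OF S1 that(1)] by simp
    ultimately show ?thesis using W by auto
  qed
  have JU: "(\<lambda>x. indicator U x *\<^sub>R ?J x) \<in> borel_measurable borel"
    using U cont by (intro borel_measurable_continuous_on_indicator continuous_on_rabs) auto
  have JB: "(\<lambda>x. indicator B x * ?J x) \<in> borel_measurable borel" if "B \<in> sets borel" "B \<subseteq> U" for B
  proof -
    have "(\<lambda>x. indicator B x * (indicator U x *\<^sub>R ?J x)) \<in> borel_measurable borel"
      using that JU by (intro borel_measurable_times borel_measurable_indicator) auto
    moreover have "indicator B x * (indicator U x *\<^sub>R ?J x) = indicator B x * ?J x" for x
      using that by (auto simp: indicator_def)
    ultimately show ?thesis by (simp only:)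
  qed
  have eq: "distr (density lborel (\<lambda>x. ennreal (indicator D x * ?J x))) borel T1 = density lborel (indicator (T ` D))"
  proof (rule measure_eqI)
    fix B assume "B \<in> sets (distr (density lborel (\<lambda>x. ennreal (indicator D x * ?J x))) borel T1)"
    then have B: "B \<in> sets borel" by simp
    define E where "E = D \<inter> T1 -` B"
    have E: "E \<in> sets borel" "E \<subseteq> U" using D measurable_sets[OF T1 B] by (auto simp: E_def)
    have "emeasure (distr (density lborel (\<lambda>x. ennreal (indicator D x * ?J x))) borel T1) B
        = emeasure (density lborel (\<lambda>x. ennreal (indicator D x * ?J x))) (T1 -` B)"
      using T1 B by (subst emeasure_distr) auto
    also have "\<dots> = (\<integral>\<^sup>+x. ennreal (indicator D x * ?J x) * indicator (T1 -` B) x \<partial>lborel)"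
      using JB[OF D] measurable_sets[OF T1 B] by (intro emeasure_density) auto
    also have "\<dots> = (\<integral>\<^sup>+x. ennreal (indicator E x * ?J x) \<partial>lborel)"
      by (intro nn_integral_cong) (auto simp: E_def indicator_def)
    also have "\<dots> = emeasure lborel (T ` E)"
      using E der inj_on_subset[OF inj E(2)] by (intro emeasure_differentiable_image[symmetric] E(1) img JB) auto
    also have "T ` E = T ` D \<inter> B" using D(2) by (auto simp: E_def T1_def)
    also have "emeasure lborel (T ` D \<inter> B) = (\<integral>\<^sup>+y. indicator (T ` D) y * indicator B y \<partial>lborel)"
      using img[OF D] B by (simp add: nn_integral_indicator[symmetric] indicator_inter_arith del: nn_integral_indicator)
    also have "\<dots> = emeasure (density lborel (indicator (T ` D))) B"
      using img[OF D] B by (subst emeasure_density) auto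
    finally show "emeasure (distr (density lborel (\<lambda>x. ennreal (indicator D x * ?J x))) borel T1) B
        = emeasure (density lborel (indicator (T ` D))) B" .
  qed simp
  have "(\<integral>\<^sup>+y. h y * indicator (T ` D) y \<partial>lborel) = (\<integral>\<^sup>+y. h y \<partial>density lborel (indicator (T ` D)))"
    using img[OF D] h by (subst nn_integral_density) (auto simp: mult.commute)
  also have "\<dots> = (\<integral>\<^sup>+x. h (T1 x) \<partial>density lborel (\<lambda>x. ennreal (indicator D x * ?J x)))"
    unfolding eq[symmetric] using T1 h by (intro nn_integral_distr) auto
  also have "\<dots> = (\<integral>\<^sup>+x. ennreal (indicator D x * ?J x) * h (T1 x) \<partial>lborel)"
    using JB[OF D] measurable_compose[OF T1 h] by (intro nn_integral_density) auto
  also have "\<dots> = (\<integral>\<^sup>+x. h (T x) * ennreal (indicator D x * ?J x) \<partial>lborel)"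
    using D(2) by (intro nn_integral_cong) (auto simp: T1_def indicator_def mult.commute)
  finally show ?thesis .
qed

section \<open>The Riemannian volume\<close>

lemma (in smooth_mfd) smooth_fun_on_prod:
  assumes "open S" "S \<subseteq> pts A" "\<And>i. i \<in> I \<Longrightarrow> smooth_fun_on A S (u i)"
  shows "smooth_fun_on A S (\<lambda>x. \<Prod>i\<in>I. u i x)"
  using assms(3)
  by (induction I rule: infinite_finite_induct)
     (use assms(1,2) in \<open>auto intro: smooth_fun_on_mult smooth_fun_on_const\<close>)

lemma (in smooth_mfd) near_prod: "x \<in> pts A \<Longrightarrow> (\<And>i. i \<in> I \<Longrightarrow> near x (u i)) \<Longrightarrow> near x (\<lambda>y. \<Prod>i\<in>I. u i y)"
  by (induction I rule: infinite_finite_induct) (simp_all add: near_const near_mult)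

lemma (in smooth_mfd) TS_prod:
  assumes v: "v \<in> TS x" and x: "x \<in> pts A" and u: "\<And>i. i \<in> I \<Longrightarrow> near x (u i)" and fin: "finite I"
  shows "v (\<lambda>y. \<Prod>i\<in>I. u i y) = (\<Sum>k\<in>I. v (u k) * (\<Prod>i\<in>I - {k}. u i x))"
  using fin u
proof (induction I)
  case empty
  then show ?case using TS_const[OF v x] by simp
next
  case (insert j I)
  have "v (\<lambda>y. u j y * (\<Prod>i\<in>I. u i y)) = v (u j) * (\<Prod>i\<in>I. u i x) + u j x * v (\<lambda>y. \<Prod>i\<in>I. u i y)"
    using insert.prems x by (intro TS_times[OF v] near_prod) auto
  moreover have "u j x * (v (u k) * (\<Prod>i\<in>I - {k}. u i x)) = v (u k) * (\<Prod>i\<in>insert j I - {k}. u i x)" if "k \<in> I" for k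
  proof -
    have "insert j I - {k} = insert j (I - {k})" using insert.hyps that by auto
    then show ?thesis using insert.hyps by simp
  qed
  ultimately show ?case using insert by (simp add: sum_distrib_left cong: sum.cong)
qed

text \<open>Jacobi's formula in algebraic form. Row \<open>k\<close> of \<open>C ** G\<close> is a
  combination of the rows of \<open>G\<close>; after it replaces row \<open>k\<close>, every summand
  but the one with row \<open>k\<close> itself has two equal rows.\<close>

lemma det_row_replace_sum:
  fixes G C :: "real^'n^'n"
  shows "(\<Sum>k\<in>UNIV. \<Sum>p | p permutes UNIV. of_int (sign p) * ((C ** G) $ k $ p k * (\<Prod>i\<in>UNIV - {k}. G $ i $ p i)))
    = trace C * det G"
proof -
  have "(\<Sum>p | p permutes UNIV. of_int (sign p) * ((C ** G) $ k $ p k * (\<Prod>i\<in>UNIV - {k}. G $ i $ p i))) = C $ k $ k * det G" for k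
  proof -
    have "(\<Sum>p | p permutes UNIV. of_int (sign p) * ((C ** G) $ k $ p k * (\<Prod>i\<in>UNIV - {k}. G $ i $ p i)))
      = det (\<chi> i. if i = k then (C ** G) $ k else G $ i)"
      unfolding det_def
    proof (intro sum.cong refl)
      fix p :: "'n \<Rightarrow> 'n"
      have "(\<Prod>i\<in>UNIV. (\<chi> i. if i = k then (C ** G) $ k else G $ i) $ i $ p i)
        = (\<chi> i. if i = k then (C ** G) $ k else G $ i) $ k $ p k * (\<Prod>i\<in>UNIV - {k}. (\<chi> i. if i = k then (C ** G) $ k else G $ i) $ i $ p i)"
        by (rule prod.remove) auto
      then show "of_int (sign p) * ((C ** G) $ k $ p k * (\<Prod>i\<in>UNIV - {k}. G $ i $ p i))
        = of_int (sign p) * (\<Prod>i\<in>UNIV. (\<chi> i. if i = k then (C ** G) $ k else G $ i) $ i $ p i)"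
        by simp
    qed
    also have "\<dots> = det (\<chi> i. if i = k then (\<Sum>m\<in>UNIV. C $ k $ m *s G $ m) else G $ i)"
    proof -
      have "(C ** G) $ k = (\<Sum>m\<in>UNIV. C $ k $ m *s G $ m)"
        by (simp add: vec_eq_iff matrix_matrix_mult_def)
      then show ?thesis by (simp only:)
    qed
    also have "det (\<chi> i. if i = k then (\<Sum>m\<in>UNIV. C $ k $ m *s G $ m) else G $ i)
      = (\<Sum>m\<in>UNIV. det (\<chi> i. if i = k then C $ k $ m *s G $ m else G $ i))"
      by (rule det_linear_row_sum) simp
    also have "\<dots> = (\<Sum>m\<in>UNIV. C $ k $ m * det (\<chi> i. if i = k then G $ m else G $ i))"
      by (simp add: det_row_mul)
    also have "\<dots> = (\<Sum>m\<in>UNIV. if m = k then C $ k $ k * det G else 0)"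
    proof (intro sum.cong refl)
      fix m
      show "C $ k $ m * det (\<chi> i. if i = k then G $ m else G $ i) = (if m = k then C $ k $ k * det G else 0)"
      proof (cases "m = k")
        case True
        then have "(\<chi> i. if i = k then G $ m else G $ i) = G" by (simp add: vec_eq_iff)
        then show ?thesis using True by simp
      next
        case False
        have "det (\<chi> i. if i = k then G $ m else G $ i) = 0"
          by (rule det_identical_rows[of m k]) (use False in \<open>auto simp: row_def vec_eq_iff\<close>)
        then show ?thesis using False by simp
      qed
    qed
    also have "\<dots> = C $ k $ k * det G" by simp
    finally show ?thesis .
  qed
  then show ?thesis by (simp add: trace_def sum_distrib_right)
qed

section \<open>Volume densities in charts\<close>

locale riem_vol = riem_mfd M
  for M :: "('a::{t2_space,second_countable_topology}, real^'n::{finite,wellorder}, 'z) riem_scheme" +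
  assumes compact_P: "compact P"
begin

definition vol :: "('a, (real, 'n) vec) chart \<Rightarrow> 'a \<Rightarrow> real" where
  "vol c x = sqrt (det (gram M c x))"

lemma cvec_axis_expand:
  assumes c: "c \<in> atlas M" "x \<in> fst c"
  shows "cvec c x w = (\<Sum>i\<in>UNIV. tscale (w $ i) (cvec c x (axis i 1)))"
proof -
  have "w = (\<Sum>i\<in>UNIV. w $ i *\<^sub>R axis i 1)"
    using basis_expansion[of w] by (simp add: scalar_mult_eq_scaleR)
  then have "cvec c x w = cvec c x (\<Sum>i\<in>UNIV. w $ i *\<^sub>R axis i 1)" by simp
  then show ?thesis by (simp add: cvec_sum[OF c] cvec_scaleR[OF c])
qed

lemma gram_entry: "c \<in> atlas M \<Longrightarrow> x \<in> fst c \<Longrightarrow> gram M c x $ i $ j = g x (cvec c x (axis i 1)) (cvec c x (axis j 1))"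
  by (simp add: gram_def coord_field_eq_cvec)

lemma met_gram:
  assumes c: "c \<in> atlas M" "x \<in> fst c"
  shows "g x (cvec c x v) (cvec c x w) = (\<Sum>i\<in>UNIV. \<Sum>j\<in>UNIV. v $ i * w $ j * gram M c x $ i $ j)"
proof -
  have x: "x \<in> P" using c chart_subset_pts by blast
  have T: "cvec c x w \<in> TS x" for w by (rule cvec_in_TS[OF c])
  have "g x (cvec c x v) (cvec c x w) = g x (\<Sum>i\<in>UNIV. tscale (v $ i) (cvec c x (axis i 1))) (cvec c x w)"
    using cvec_axis_expand[OF c, of v] by simp
  also have "\<dots> = (\<Sum>i\<in>UNIV. v $ i * g x (cvec c x (axis i 1)) (cvec c x w))"
    using x T by (subst met_sum_left) (auto simp: TS_scale met_scale_left)
  also have "\<dots> = (\<Sum>i\<in>UNIV. v $ i * (\<Sum>j\<in>UNIV. w $ j * gram M c x $ i $ j))"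
  proof (intro sum.cong refl arg_cong2[of _ _ _ _ "(*)"])
    fix i
    have "g x (cvec c x (axis i 1)) (cvec c x w) = g x (cvec c x (axis i 1)) (\<Sum>j\<in>UNIV. tscale (w $ j) (cvec c x (axis j 1)))"
      using cvec_axis_expand[OF c, of w] by simp
    also have "\<dots> = (\<Sum>j\<in>UNIV. w $ j * gram M c x $ i $ j)"
      using x T by (subst met_sum_right) (auto simp: TS_scale met_scale_right gram_entry[OF c])
    finally show "g x (cvec c x (axis i 1)) (cvec c x w) = (\<Sum>j\<in>UNIV. w $ j * gram M c x $ i $ j)" .
  qed
  finally show ?thesis by (simp add: sum_distrib_left mult.assoc)
qed

text \<open>The Gram matrix is \<open>B ** transpose B\<close>, with \<open>B\<close> the components
  of the coordinate vectors in an orthonormal frame. A kernel vector of \<open>transpose B\<close>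
  would be a tangent vector orthogonal to the whole frame.\<close>

lemma det_gram_pos:
  assumes c: "c \<in> atlas M" "x \<in> fst c"
  shows "det (gram M c x) > 0"
proof -
  have x: "x \<in> P" using c chart_subset_pts by blast
  obtain S e where S: "x \<in> S" "on_frame S DIM((real, 'n) vec) e" using on_frame_exists x by blast
  note on = on_frameD(4)[OF S(2,1)]
  \<comment> \<open>Matches the matrix index type with the frame indices, which are natural
    numbers.\<close>
  obtain h :: "'n \<Rightarrow> nat" where h: "bij_betw h UNIV {0..<CARD('n)}"
    using ex_bij_betw_finite_nat[of "UNIV :: 'n set"] by auto
  have hlt: "h i < DIM((real, 'n) vec)" for i using h by (auto simp: bij_betw_def)
  define B :: "((real, 'n) vec, 'n) vec" where "B = (\<chi> i j. g x (cvec c x (axis i 1)) (e (h j) x))"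
  have T: "cvec c x w \<in> TS x" for w by (rule cvec_in_TS[OF c])
  have "gram M c x = B ** transpose B"
  proof (simp add: vec_eq_iff matrix_matrix_mult_def transpose_def, intro allI)
    fix i j
    let ?u = "cvec c x (axis i 1)" and ?v = "cvec c x (axis j 1)"
    have "g x ?u ?v = g x (\<Sum>a<DIM((real, 'n) vec). tscale (g x ?u (e a x)) (e a x)) ?v"
      using orthonormal_expand[OF x on T] by simp
    also have "\<dots> = (\<Sum>a<DIM((real, 'n) vec). g x ?u (e a x) * g x ?v (e a x))"
      using x T orthonormal_TS[OF on] met_sym[OF x T]
      by (subst met_sum_left) (auto simp: TS_scale met_scale_left)
    also have "\<dots> = (\<Sum>k\<in>UNIV. g x ?u (e (h k) x) * g x ?v (e (h k) x))"
      by (rule sum.reindex_bij_betw[symmetric, of h]) (use h in \<open>simp add: lessThan_atLeast0\<close>)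
    finally show "gram M c x $ i $ j = (\<Sum>k\<in>UNIV. B $ i $ k * B $ j $ k)"
      by (simp add: gram_entry[OF c] B_def)
  qed
  then have "det (gram M c x) = (det B)\<^sup>2" by (simp add: det_mul det_transpose power2_eq_square)
  moreover have "det (transpose B) \<noteq> 0"
  proof -
    have "v = 0" if v: "transpose B *v v = 0" for v
    proof -
      have "g x (cvec c x v) (e (h j) x) = 0" for j
      proof -
        have "g x (cvec c x v) (e (h j) x) = g x (\<Sum>i\<in>UNIV. tscale (v $ i) (cvec c x (axis i 1))) (e (h j) x)"
          using cvec_axis_expand[OF c, of v] by simp
        also have "\<dots> = (\<Sum>i\<in>UNIV. v $ i * g x (cvec c x (axis i 1)) (e (h j) x))"
          using x T orthonormal_TS[OF on hlt] by (subst met_sum_left) (auto simp: TS_scale met_scale_left)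
        also have "\<dots> = (transpose B *v v) $ j"
          by (simp add: matrix_vector_mult_def transpose_def B_def mult.commute)
        finally show ?thesis using v by simp
      qed
      then have "g x (cvec c x v) (e a x) = 0" if "a < DIM((real, 'n) vec)" for a
        using h that by (metis atLeastLessThan_iff bij_betw_iff_bijections DIM_cart DIM_real mult.right_neutral zero_le)
      then have "cvec c x v = 0" using orthonormal_expand[OF x on T, of v] by simp
      then show "v = 0" using crd_cvec[OF c, of v] crd_cvec[OF c, of 0] cvec_0[OF c] by simp
    qed
    then show ?thesis
      using invertible_det_nz[of "transpose B"] invertible_left_inverse matrix_left_invertible_ker by blast
  qed
  ultimately show ?thesis by (simp add: det_transpose)
qed

lemma vol_pos: "c \<in> atlas M \<Longrightarrow> x \<in> fst c \<Longrightarrow> vol c x > 0"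
  by (simp add: vol_def det_gram_pos)

lemma det_gram_smooth: "c \<in> atlas M \<Longrightarrow> smooth_fun_on (atlas M) (fst c) (\<lambda>x. det (gram M c x))"
proof -
  assume c: "c \<in> atlas M"
  have e: "smooth_fun_on (atlas M) (fst c) (\<lambda>x. gram M c x $ i $ j)" for i j
    by (rule smooth_fun_on_cong[OF met_smooth_chart[OF c]]) (simp add: gram_entry[OF c])
  show ?thesis
    unfolding det_def using c e
    by (intro smooth_fun_on_sum smooth_fun_on_mult smooth_fun_on_prod smooth_fun_on_const chart_subset_pts open_chart) auto
qed

lemma vol_smooth: "c \<in> atlas M \<Longrightarrow> smooth_fun_on (atlas M) (fst c) (vol c)"
  unfolding vol_def[abs_def]
  by (rule smooth_fun_on_real_compose[OF det_gram_smooth smooth_on_sqrt[OF open_greaterThan order_refl] open_greaterThan])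
     (auto simp: det_gram_pos)

lemma cvec_transition:
  assumes c: "c \<in> atlas M" "x \<in> fst c" and c': "c' \<in> atlas M" "x \<in> fst c'"
  shows "((\<lambda>q. snd c' (cinv c q)) has_derivative fd (\<lambda>q. snd c' (cinv c q)) (snd c x)) (at (snd c x))"
    and "cvec c x w = cvec c' x (fd (\<lambda>q. snd c' (cinv c q)) (snd c x) w)"
proof -
  let ?\<tau> = "\<lambda>q. snd c' (cinv c q)"
  have d: "(?\<tau> has_derivative fd ?\<tau> (snd c x)) (at (snd c x))"
    using smooth_on_has_derivative[OF smooth_transition[OF c(1) c'(1)]] c c' by blast
  then show "(?\<tau> has_derivative fd ?\<tau> (snd c x)) (at (snd c x))" .
  show "cvec c x w = cvec c' x (fd ?\<tau> (snd c x) w)"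
  proof (rule TS_eqI[OF c' cvec_in_TS[OF c] cvec_in_TS[OF c']])
    fix b :: "(real, 'n) vec"
    have "((\<lambda>q. ?\<tau> q \<bullet> b) has_derivative (\<lambda>w. fd ?\<tau> (snd c x) w \<bullet> b)) (at (snd c x))"
      using d by (auto intro!: derivative_eq_intros)
    then have "cvec c x w (\<lambda>q. snd c' q \<bullet> b) = fd ?\<tau> (snd c x) w \<bullet> b"
      using near_coord[OF c'] by (simp add: cvec_def fd_eqI)
    then show "cvec c x w (\<lambda>q. snd c' q \<bullet> b) = cvec c' x (fd ?\<tau> (snd c x) w) (\<lambda>q. snd c' q \<bullet> b)"
      using c' by simp
  qed
qed

text \<open>The Gram matrix transforms by congruence with the Jacobian, so its determinant picks up
  the squared Jacobian determinant.\<close>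

lemma vol_transition:
  assumes c: "c \<in> atlas M" "x \<in> fst c" and c': "c' \<in> atlas M" "x \<in> fst c'"
  shows "vol c x = \<bar>det (matrix (fd (\<lambda>q. snd c' (cinv c q)) (snd c x)))\<bar> * vol c' x"
proof -
  let ?f = "fd (\<lambda>q. snd c' (cinv c q)) (snd c x)"
  let ?J = "matrix ?f"
  have "gram M c x = transpose ?J ** gram M c' x ** ?J"
  proof (simp add: vec_eq_iff, intro allI)
    fix i j
    have "gram M c x $ i $ j = g x (cvec c' x (?f (axis i 1))) (cvec c' x (?f (axis j 1)))"
      using cvec_transition(2)[OF assms] by (simp add: gram_entry[OF c])
    also have "\<dots> = (\<Sum>k\<in>UNIV. \<Sum>l\<in>UNIV. ?J $ k $ i * ?J $ l $ j * gram M c' x $ k $ l)"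
      by (simp add: met_gram[OF c'] matrix_def)
    also have "\<dots> = (transpose ?J ** gram M c' x ** ?J) $ i $ j"
      unfolding matrix_matrix_mult_def transpose_def
      by (simp add: sum_distrib_left sum_distrib_right, subst sum.swap) (auto intro!: sum.cong simp: mult_ac)
    finally show "gram M c x $ i $ j = (transpose ?J ** gram M c' x ** ?J) $ i $ j" .
  qed
  then have "det (gram M c x) = (det ?J)\<^sup>2 * det (gram M c' x)"
    by (simp add: det_mul det_transpose power2_eq_square mult_ac)
  then show ?thesis by (simp add: vol_def real_sqrt_mult)
qed

section \<open>Chart measures and their compatibility\<close>

definition dens :: "('a, (real, 'n) vec) chart \<Rightarrow> (real, 'n) vec \<Rightarrow> real" where
  "dens c q = indicator (snd c ` fst c) q * vol c (cinv c q)"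

text \<open>Total version of the inverse chart. The constant value off the chart image makes it
  Borel measurable, and \<open>dens\<close> vanishes there.\<close>

definition cmap :: "('a, (real, 'n) vec) chart \<Rightarrow> (real, 'n) vec \<Rightarrow> 'a" where
  "cmap c q = (if q \<in> snd c ` fst c then cinv c q else undefined)"

text \<open>The volume measure seen by a single chart, as a Borel measure on the ambient
  type.\<close>

definition cmeas :: "('a, (real, 'n) vec) chart \<Rightarrow> 'a measure" where
  "cmeas c = distr (density lborel (\<lambda>q. ennreal (dens c q))) borel (cmap c)"

lemma dens_nonneg: "c \<in> atlas M \<Longrightarrow> dens c q \<ge> 0"
  by (auto simp: dens_def indicator_def intro!: less_imp_le[OF vol_pos])

lemma dens_measurable: "c \<in> atlas M \<Longrightarrow> dens c \<in> borel_measurable borel"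
proof -
  assume c: "c \<in> atlas M"
  have "smooth_on (snd c ` fst c) (\<lambda>q. vol c (cinv c q))"
    using smooth_fun_onD(4)[OF vol_smooth[OF c] c, of "fst c"] by simp
  then have "(\<lambda>q. indicator (snd c ` fst c) q *\<^sub>R vol c (cinv c q)) \<in> borel_measurable borel"
    using c by (intro borel_measurable_continuous_on_indicator smooth_on_imp_continuous_on) auto
  then show ?thesis by (simp add: dens_def[abs_def])
qed

lemma cmap_measurable: "c \<in> atlas M \<Longrightarrow> cmap c \<in> borel_measurable borel"
proof -
  assume c: "c \<in> atlas M"
  have "cinv c \<in> borel_measurable (restrict_space borel (snd c ` fst c))"
    using continuous_on_cinv[OF c] by (rule borel_measurable_continuous_on_restrict)
  then show ?thesis
    unfolding cmap_def[abs_def] using c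
    by (subst measurable_If_restrict_space_iff) auto
qed

lemma chart_image_borel:
  assumes c: "c \<in> atlas M" and B: "B \<in> sets borel"
  shows "snd c ` (fst c \<inter> B) \<in> sets borel" "snd c ` (fst c \<inter> B) = snd c ` fst c \<inter> cmap c -` B"
proof -
  show eq: "snd c ` (fst c \<inter> B) = snd c ` fst c \<inter> cmap c -` B" using c by (auto simp: cmap_def)
  show "snd c ` (fst c \<inter> B) \<in> sets borel"
    unfolding eq using measurable_sets[OF cmap_measurable[OF c] B] open_chart_image[OF c] by auto
qed

lemma emeasure_cmeas:
  assumes c: "c \<in> atlas M" and B: "B \<in> sets borel"
  shows "emeasure (cmeas c) B = (\<integral>\<^sup>+q. ennreal (dens c q) * indicator (snd c ` (fst c \<inter> B)) q \<partial>lborel)"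
proof -
  have "emeasure (cmeas c) B = emeasure (density lborel (\<lambda>q. ennreal (dens c q))) (cmap c -` B)"
    unfolding cmeas_def using cmap_measurable[OF c] B by (subst emeasure_distr) auto
  also have "\<dots> = (\<integral>\<^sup>+q. ennreal (dens c q) * indicator (cmap c -` B) q \<partial>lborel)"
    using dens_measurable[OF c] measurable_sets[OF cmap_measurable[OF c] B] by (intro emeasure_density) auto
  also have "\<dots> = (\<integral>\<^sup>+q. ennreal (dens c q) * indicator (snd c ` (fst c \<inter> B)) q \<partial>lborel)"
    unfolding chart_image_borel(2)[OF c B] by (intro nn_integral_cong) (auto simp: dens_def indicator_def)
  finally show ?thesis .
qed

text \<open>The compatibility needed for gluing: change of variables under the transition map, whose
  Jacobian is absorbed by \<open>vol_transition\<close>.\<close>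

lemma cmeas_overlap:
  assumes c: "c \<in> atlas M" "c' \<in> atlas M" and B: "B \<in> sets borel" "B \<subseteq> fst c" "B \<subseteq> fst c'"
  shows "emeasure (cmeas c) B = emeasure (cmeas c') B"
proof -
  let ?\<tau> = "\<lambda>q. snd c' (cinv c q)"
  let ?U = "snd c ` (fst c \<inter> fst c')" and ?W = "snd c' ` (fst c \<inter> fst c')"
  have op: "open ?U" "open ?W" using c by (auto intro!: open_image_chart)
  have hom: "homeomorphism ?U ?W ?\<tau> (\<lambda>q. snd c (cinv c' q))"
    unfolding homeomorphism_def
  proof (intro conjI ballI)
    show "continuous_on ?U ?\<tau>" using smooth_on_imp_continuous_on[OF smooth_transition[OF c]] .
    show "continuous_on ?W (\<lambda>q. snd c (cinv c' q))"
      using smooth_on_imp_continuous_on[OF smooth_transition[OF c(2,1)]] by (simp add: Int_commute)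
  qed (use c in \<open>auto simp: image_iff\<close>)
  have sm: "smooth_on ?U ?\<tau>" by (rule smooth_transition[OF c])
  have der: "(?\<tau> has_derivative fd ?\<tau> q) (at q)" if "q \<in> ?U" for q by (rule smooth_on_has_derivative[OF sm that])
  have cont: "continuous_on ?U (\<lambda>q. det (matrix (fd ?\<tau> q)))"
    unfolding det_def matrix_def
    using smooth_on_imp_continuous_on[OF smooth_on_fd[OF sm]]
    by (auto intro!: continuous_on_sum continuous_on_mult continuous_on_prod continuous_on_const continuous_on_component)
  have I: "fst c \<inter> B = B" "fst c' \<inter> B = B" using B by auto
  have D: "snd c ` B \<in> sets borel" "snd c ` B \<subseteq> ?U" using chart_image_borel(1)[OF c(1) B(1)] B I by auto
  have im: "?\<tau> ` (snd c ` B) = snd c' ` B" using B c by (force simp: image_iff)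
  have "emeasure (cmeas c') B = (\<integral>\<^sup>+q. ennreal (dens c' q) * indicator (?\<tau> ` (snd c ` B)) q \<partial>lborel)"
    unfolding im using emeasure_cmeas[OF c(2) B(1)] I by simp
  also have "\<dots> = (\<integral>\<^sup>+q. ennreal (dens c' (?\<tau> q)) * ennreal (indicator (snd c ` B) q * \<bar>det (matrix (fd ?\<tau> q))\<bar>) \<partial>lborel)"
    using dens_measurable[OF c(2)] by (intro nn_integral_change_of_variables[OF op hom der cont D]) auto
  also have "\<dots> = (\<integral>\<^sup>+q. ennreal (dens c q) * indicator (snd c ` B) q \<partial>lborel)"
  proof (intro nn_integral_cong)
    fix q
    show "ennreal (dens c' (?\<tau> q)) * ennreal (indicator (snd c ` B) q * \<bar>det (matrix (fd ?\<tau> q))\<bar>)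
        = ennreal (dens c q) * indicator (snd c ` B) q"
    proof (cases "q \<in> snd c ` B")
      case True
      then obtain x where x: "x \<in> B" "q = snd c x" by blast
      then have xc: "x \<in> fst c" "x \<in> fst c'" using B by auto
      have "dens c q = vol c x" "dens c' (?\<tau> q) = vol c' x" using x xc c by (auto simp: dens_def)
      then show ?thesis
        using True vol_transition[OF c(1) xc(1) c(2) xc(2)] x vol_pos[OF c(2) xc(2)]
        by (simp add: ennreal_mult'[symmetric] mult.commute)
    qed simp
  qed
  also have "\<dots> = emeasure (cmeas c) B" using emeasure_cmeas[OF c(1) B(1)] I by simp
  finally show ?thesis ..
qed

text \<open>Compactness gives finitely many charts, and disjointing them gives Borel pieces. Every
  volume measure is then a finite sum of chart measures restricted to these pieces.\<close>

lemma disjoint_chart_cover: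
  obtains c :: "nat \<Rightarrow> ('a, (real, 'n) vec) chart" and Q :: "nat \<Rightarrow> 'a set" and r :: nat
  where "\<And>i. i < r \<Longrightarrow> c i \<in> atlas M" "\<And>i. i < r \<Longrightarrow> Q i \<in> sets borel" "\<And>i. i < r \<Longrightarrow> Q i \<subseteq> fst (c i)"
    "disjoint_family_on Q {..<r}" "P = (\<Union>i<r. Q i)"
proof -
  obtain C where C: "C \<subseteq> atlas M" "finite C" "P \<subseteq> (\<Union>c\<in>C. fst c)"
    by (rule compactE_image[OF compact_P, of "atlas M" fst]) (auto simp: pts_def)
  obtain c where c: "bij_betw c {0..<card C} C" using ex_bij_betw_nat_finite[OF C(2)] by blast
  define A where "A i = (if i < card C then fst (c i) else {})" for i
  have cA: "c i \<in> atlas M" if "i < card C" for i using c C(1) that by (auto simp: bij_betw_def)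
  have "P = (\<Union>i. A i)"
  proof
    show "P \<subseteq> (\<Union>i. A i)"
    proof
      fix x assume "x \<in> P"
      then obtain k where k: "k \<in> C" "x \<in> fst k" using C(3) by blast
      have "k \<in> c ` {0..<card C}" using k(1) c by (simp add: bij_betw_def)
      then obtain i where "i < card C" "k = c i" by auto
      then show "x \<in> (\<Union>i. A i)" using k(2) by (auto simp: A_def)
    qed
    show "(\<Union>i. A i) \<subseteq> P" using chart_subset_pts[OF cA] by (auto simp: A_def split: if_splits)
  qed
  also have "\<dots> = (\<Union>i. disjointed A i)" by (simp add: UN_disjointed_eq)
  also have "\<dots> = (\<Union>i<card C. disjointed A i)"
  proof -
    have "disjointed A i = {}" if "\<not> i < card C" for i using disjointed_subset[of A i] that by (simp add: A_def)
    then show ?thesis by auto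
  qed
  finally have PU: "P = (\<Union>i<card C. disjointed A i)" .
  have "range A \<subseteq> sets borel" using open_chart[OF cA] by (auto simp: A_def)
  then have "range (disjointed A) \<subseteq> sets borel" by (rule sets.range_disjointed_sets)
  then have "disjointed A i \<in> sets borel" for i by blast
  moreover have "disjointed A i \<subseteq> fst (c i)" if "i < card C" for i
    using disjointed_subset[of A i] that by (simp add: A_def)
  moreover have "disjoint_family_on (disjointed A) {..<card C}"
    using disjoint_family_disjointed[of A] by (rule disjoint_family_on_mono[OF subset_UNIV])
  ultimately show ?thesis using that cA PU by blast
qed

section \<open>Existence, uniqueness and finiteness of the volume measure\<close>

definition is_vol :: "'a measure \<Rightarrow> bool" where
  "is_vol \<mu> \<longleftrightarrow> space \<mu> = P \<and> sets \<mu> = sets (restrict_space borel P)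
     \<and> (\<forall>c\<in>atlas M. \<forall>B\<in>sets borel. B \<subseteq> fst c \<longrightarrow> emeasure \<mu> B = emeasure (cmeas c) B)"

lemma chart_emeasure_iff:
  assumes "c \<in> atlas M" "B \<in> sets borel" "B \<subseteq> fst c"
  shows "emeasure (cmeas c) B = (\<integral>\<^sup>+y\<in>snd c ` B. ennreal (sqrt (det (gram M c (cinv c y)))) \<partial>lborel)"
proof -
  have "fst c \<inter> B = B" using assms by auto
  then show ?thesis
    unfolding emeasure_cmeas[OF assms(1,2)] using assms(3)
    by (intro nn_integral_cong) (auto simp: dens_def vol_def indicator_def)
qed

lemma riem_volume_eq: "riem_volume M = (THE \<mu>. is_vol \<mu>)"
  unfolding riem_volume_def is_vol_def using chart_emeasure_iff
  by (intro arg_cong[of _ _ The] ext) (simp cong: conj_cong ball_cong)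

lemma sets_restrict_P: "sets (restrict_space borel P) = {B \<in> sets borel. B \<subseteq> P}"
  using sets_restrict_space_iff[of P borel] open_pts by auto

text \<open>On each piece of the disjoint cover the value is prescribed by a chart measure, and
  finite additivity fixes the rest.\<close>

lemma is_vol_unique:
  assumes "is_vol \<mu>" "is_vol \<nu>"
  shows "\<mu> = \<nu>"
proof -
  obtain c :: "nat \<Rightarrow> ('a, (real, 'n) vec) chart" and Q r where c: "\<And>i. i < r \<Longrightarrow> c i \<in> atlas M"
    and Qb: "\<And>i. i < r \<Longrightarrow> Q i \<in> sets borel" and Qc: "\<And>i. i < r \<Longrightarrow> Q i \<subseteq> fst (c i)"
    and Qdisj: "disjoint_family_on Q {..<r}" and QP: "P = (\<Union>i<r. Q i)"
    by (rule disjoint_chart_cover, rule that)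
  have form: "emeasure \<kappa> B = (\<Sum>i<r. emeasure (cmeas (c i)) (B \<inter> Q i))" if \<kappa>: "is_vol \<kappa>" and B: "B \<in> sets borel" "B \<subseteq> P" for \<kappa> B
  proof -
    have "emeasure \<kappa> B = emeasure \<kappa> (\<Union>i<r. B \<inter> Q i)"
    proof -
      have "B = (\<Union>i<r. B \<inter> Q i)" using B(2) QP by auto
      then show ?thesis by simp
    qed
    also have "\<dots> = (\<Sum>i<r. emeasure \<kappa> (B \<inter> Q i))"
    proof (rule sum_emeasure[symmetric])
      show "(\<lambda>i. B \<inter> Q i) ` {..<r} \<subseteq> sets \<kappa>"
        using \<kappa> B Qb by (auto simp: is_vol_def sets_restrict_P)
      show "disjoint_family_on (\<lambda>i. B \<inter> Q i) {..<r}" using Qdisj by (auto simp: disjoint_family_on_def)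
    qed simp
    also have "\<dots> = (\<Sum>i<r. emeasure (cmeas (c i)) (B \<inter> Q i))"
    proof (intro sum.cong refl)
      fix i assume "i \<in> {..<r}"
      then have i: "i < r" by simp
      have "B \<inter> Q i \<in> sets borel" "B \<inter> Q i \<subseteq> fst (c i)" using B Qb[OF i] Qc[OF i] by auto
      then show "emeasure \<kappa> (B \<inter> Q i) = emeasure (cmeas (c i)) (B \<inter> Q i)"
        using \<kappa> c[OF i] unfolding is_vol_def by blast
    qed
    finally show ?thesis .
  qed
  show ?thesis
  proof (rule measure_eqI)
    show "sets \<mu> = sets \<nu>" using assms by (simp add: is_vol_def)
    fix B assume "B \<in> sets \<mu>"
    then have "B \<in> sets borel" "B \<subseteq> P" using assms(1) by (auto simp: is_vol_def sets_restrict_P)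
    then show "emeasure \<mu> B = emeasure \<nu> B" using form[OF assms(1)] form[OF assms(2)] by simp
  qed
qed

text \<open>The formula that uniqueness forces is taken as definition. It has the required values in
  every chart, and not only in those of the cover, by \<open>cmeas_overlap\<close>.\<close>

lemma is_vol_exists: "\<exists>\<mu>. is_vol \<mu>"
proof -
  obtain c :: "nat \<Rightarrow> ('a, (real, 'n) vec) chart" and Q r where c: "\<And>i. i < r \<Longrightarrow> c i \<in> atlas M"
    and Qb: "\<And>i. i < r \<Longrightarrow> Q i \<in> sets borel" and Qc: "\<And>i. i < r \<Longrightarrow> Q i \<subseteq> fst (c i)"
    and Qdisj: "disjoint_family_on Q {..<r}" and QP: "P = (\<Union>i<r. Q i)"
    by (rule disjoint_chart_cover, rule that)
  let ?\<A> = "sets (restrict_space borel P)"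
  define m where "m B = (\<Sum>i<r. emeasure (cmeas (c i)) (B \<inter> Q i))" for B
  define \<mu> where "\<mu> = measure_of P ?\<A> m"
  have sa: "sigma_algebra P ?\<A>"
    using sets.sigma_algebra_axioms[of "restrict_space borel P"] by (simp add: space_restrict_space)
  have pos: "positive ?\<A> m" by (simp add: positive_def m_def)
  have sc: "sets (cmeas c) = sets borel" for c by (simp add: cmeas_def)
  have ca: "countably_additive ?\<A> m"
    unfolding countably_additive_def
  proof (intro allI impI)
    fix X :: "nat \<Rightarrow> 'a set"
    assume X: "range X \<subseteq> ?\<A>" "disjoint_family X" "(\<Union>i. X i) \<in> ?\<A>"
    have Xb: "X n \<in> sets borel" for n using X(1) by (auto simp: sets_restrict_P)
    have "(\<Sum>n. m (X n)) = (\<Sum>i<r. \<Sum>n. emeasure (cmeas (c i)) (X n \<inter> Q i))"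
      unfolding m_def by (rule suminf_sum) auto
    also have "\<dots> = (\<Sum>i<r. emeasure (cmeas (c i)) (\<Union>n. X n \<inter> Q i))"
    proof (intro sum.cong refl suminf_emeasure)
      fix i assume "i \<in> {..<r}"
      then show "range (\<lambda>n. X n \<inter> Q i) \<subseteq> sets (cmeas (c i))" using Xb Qb by (auto simp: sc)
      show "disjoint_family (\<lambda>n. X n \<inter> Q i)" using X(2) by (auto simp: disjoint_family_on_def)
    qed
    also have "\<dots> = m (\<Union>n. X n)" unfolding m_def by (intro sum.cong refl arg_cong2[of _ _ _ _ emeasure]) auto
    finally show "(\<Sum>n. m (X n)) = m (\<Union>n. X n)" .
  qed
  have sp: "space \<mu> = P" and se: "sets \<mu> = ?\<A>"
    unfolding \<mu>_def using sigma_algebra.space_measure_of_eq[OF sa] sigma_algebra.sets_measure_of_eq[OF sa] by auto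
  have em: "emeasure \<mu> B = m B" if "B \<in> ?\<A>" for B
    unfolding \<mu>_def by (rule emeasure_measure_of_sigma[OF sa pos ca that])
  have "emeasure \<mu> B = emeasure (cmeas c') B" if c': "c' \<in> atlas M" and B: "B \<in> sets borel" "B \<subseteq> fst c'" for c' B
  proof -
    have BP: "B \<subseteq> P" using B chart_subset_pts[OF c'] by auto
    have "emeasure \<mu> B = (\<Sum>i<r. emeasure (cmeas (c i)) (B \<inter> Q i))"
      using em B BP by (simp add: sets_restrict_P m_def)
    also have "\<dots> = (\<Sum>i<r. emeasure (cmeas c') (B \<inter> Q i))"
    proof (intro sum.cong refl)
      fix i assume "i \<in> {..<r}"
      then have i: "i < r" by simp
      show "emeasure (cmeas (c i)) (B \<inter> Q i) = emeasure (cmeas c') (B \<inter> Q i)"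
        by (rule cmeas_overlap[OF c[OF i] c']) (use B Qb[OF i] Qc[OF i] in auto)
    qed
    also have "\<dots> = emeasure (cmeas c') (\<Union>i<r. B \<inter> Q i)"
    proof (rule sum_emeasure)
      show "disjoint_family_on (\<lambda>i. B \<inter> Q i) {..<r}" using Qdisj unfolding disjoint_family_on_def by blast
    qed (use B Qb in \<open>auto simp: sc\<close>)
    also have "(\<Union>i<r. B \<inter> Q i) = B" using BP QP by auto
    finally show ?thesis .
  qed
  then have "is_vol \<mu>" unfolding is_vol_def using sp se by blast
  then show ?thesis by blast
qed

abbreviation "\<V> \<equiv> riem_volume M"

lemma is_vol_riem_volume: "is_vol \<V>"
  unfolding riem_volume_eq using is_vol_exists is_vol_unique by (metis theI')

lemma space_vol [simp]: "space \<V> = P"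
  and sets_vol: "sets \<V> = sets (restrict_space borel P)"
  and emeasure_vol: "c \<in> atlas M \<Longrightarrow> B \<in> sets borel \<Longrightarrow> B \<subseteq> fst c \<Longrightarrow> emeasure \<V> B = emeasure (cmeas c) B"
  using is_vol_riem_volume unfolding is_vol_def by auto

lemma sets_volI: "B \<in> sets borel \<Longrightarrow> B \<subseteq> P \<Longrightarrow> B \<in> sets \<V>"
  by (simp add: sets_vol sets_restrict_P)

lemma id_measurable_vol: "(\<lambda>x. x) \<in> measurable \<V> borel"
proof (rule measurableI)
  fix B :: "'a set" assume "B \<in> sets borel"
  then have "B \<inter> P \<in> sets borel" using borel_open[OF open_pts] by (rule sets.Int)
  then show "(\<lambda>x. x) -` B \<inter> space \<V> \<in> sets \<V>" using sets_volI[of "B \<inter> P"] by simp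
qed simp

text \<open>Identifies the chart measure with the volume restricted to the chart domain, so that
  integrals over a chart can be computed in coordinates.\<close>

lemma cmeas_eq_distr:
  assumes c: "c \<in> atlas M"
  shows "cmeas c = distr (density \<V> (\<lambda>x. ennreal (indicator (fst c) x))) borel (\<lambda>x. x)"
proof (rule measure_eqI)
  fix B assume "B \<in> sets (cmeas c)"
  then have B: "B \<in> sets borel" by (simp add: cmeas_def)
  have cP: "fst c \<subseteq> P" by (rule chart_subset_pts[OF c])
  have cB: "fst c \<inter> B \<in> sets borel" using B open_chart[OF c] by auto
  have BP: "B \<inter> P \<in> sets \<V>" using B open_pts by (auto intro!: sets_volI)
  have fc: "fst c \<in> sets \<V>" using open_chart[OF c] cP by (auto intro!: sets_volI)
  have "emeasure (distr (density \<V> (\<lambda>x. ennreal (indicator (fst c) x))) borel (\<lambda>x. x)) B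
      = emeasure (density \<V> (\<lambda>x. ennreal (indicator (fst c) x))) (B \<inter> P)"
    using id_measurable_vol B by (subst emeasure_distr) auto
  also have "\<dots> = (\<integral>\<^sup>+x. ennreal (indicator (fst c) x) * indicator (B \<inter> P) x \<partial>\<V>)"
    using BP fc by (intro emeasure_density) auto
  also have "\<dots> = (\<integral>\<^sup>+x. indicator (fst c \<inter> B) x \<partial>\<V>)"
    using cP by (intro nn_integral_cong) (auto simp: indicator_def)
  also have "\<dots> = emeasure \<V> (fst c \<inter> B)" using cB cP by (intro nn_integral_indicator sets_volI) auto
  also have "\<dots> = emeasure (cmeas c) (fst c \<inter> B)" using cB by (intro emeasure_vol[OF c]) auto
  also have "\<dots> = emeasure (cmeas c) B" unfolding emeasure_cmeas[OF c cB] emeasure_cmeas[OF c B] by (simp add: Int_assoc[symmetric])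
  finally show "emeasure (cmeas c) B = emeasure (distr (density \<V> (\<lambda>x. ennreal (indicator (fst c) x))) borel (\<lambda>x. x)) B" ..
qed (simp add: cmeas_def)

lemma integral_chart:
  assumes c: "c \<in> atlas M" and h: "(h :: 'a \<Rightarrow> real) \<in> borel_measurable borel"
  shows "(\<integral>x. indicator (fst c) x * h x \<partial>\<V>) = (\<integral>q. dens c q * h (cinv c q) \<partial>lborel)"
proof -
  have fc: "fst c \<in> sets \<V>" using open_chart[OF c] chart_subset_pts[OF c] by (auto intro!: sets_volI)
  have hV: "h \<in> borel_measurable \<V>" using measurable_compose[OF id_measurable_vol h] .
  have "(\<integral>x. h x \<partial>cmeas c) = (\<integral>q. h (cmap c q) \<partial>density lborel (\<lambda>q. ennreal (dens c q)))"
    unfolding cmeas_def using cmap_measurable[OF c] h by (intro integral_distr) auto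
  also have "\<dots> = (\<integral>q. dens c q *\<^sub>R h (cmap c q) \<partial>lborel)"
    using dens_measurable[OF c] dens_nonneg[OF c] measurable_compose[OF cmap_measurable[OF c] h]
    by (intro integral_density) auto
  also have "\<dots> = (\<integral>q. dens c q * h (cinv c q) \<partial>lborel)"
    by (intro Bochner_Integration.integral_cong) (auto simp: dens_def cmap_def)
  finally have 1: "(\<integral>x. h x \<partial>cmeas c) = (\<integral>q. dens c q * h (cinv c q) \<partial>lborel)" .
  have "(\<integral>x. h x \<partial>cmeas c) = (\<integral>x. h x \<partial>density \<V> (\<lambda>x. ennreal (indicator (fst c) x)))"
    unfolding cmeas_eq_distr[OF c] using id_measurable_vol h by (intro integral_distr) auto
  also have "\<dots> = (\<integral>x. indicator (fst c) x *\<^sub>R h x \<partial>\<V>)"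
    using hV fc by (intro integral_density) auto
  finally show ?thesis using 1 by simp
qed

text \<open>The density is bounded over a closed coordinate ball. With compactness this makes the
  volume finite, hence continuous functions integrable.\<close>

lemma vol_locally_finite:
  assumes x: "x \<in> P"
  obtains U where "open U" "x \<in> U" "U \<subseteq> P" "emeasure \<V> U < \<infinity>"
proof -
  obtain c where c: "c \<in> atlas M" "x \<in> fst c" using in_pts_chart x by blast
  let ?p = "snd c x"
  obtain r where r: "r > 0" "cball ?p r \<subseteq> snd c ` fst c"
    using open_contains_cball open_chart_image[OF c(1)] c(2) by (metis imageI)
  define U where "U = cinv c ` ball ?p r"
  have br: "ball ?p r \<subseteq> snd c ` fst c" using r(2) ball_subset_cball by blast
  have U: "open U" unfolding U_def by (rule open_image_cinv[OF c(1) open_ball br])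
  have Uc: "U \<subseteq> fst c" unfolding U_def using br by auto
  have "(\<lambda>q. snd c (cinv c q)) ` ball ?p r = (\<lambda>q. q) ` ball ?p r" by (rule image_cong) (use br in auto)
  then have im: "snd c ` U = ball ?p r" by (simp add: U_def image_image)
  have xU: "x \<in> U" unfolding U_def using r(1) c by (intro image_eqI[of _ _ ?p]) auto
  have "continuous_on (cball ?p r) (\<lambda>q. vol c (cinv c q))"
    using smooth_on_imp_continuous_on[OF smooth_fun_onD(4)[OF vol_smooth[OF c(1)] c(1), of "fst c"]] r(2)
    by (auto intro: continuous_on_subset)
  then have "bounded ((\<lambda>q. vol c (cinv c q)) ` cball ?p r)"
    by (intro compact_imp_bounded compact_continuous_image) auto
  then obtain L where "\<forall>y\<in>(\<lambda>q. vol c (cinv c q)) ` cball ?p r. norm y \<le> L" unfolding bounded_iff by blast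
  then have L: "\<bar>vol c (cinv c q)\<bar> \<le> L" if "q \<in> cball ?p r" for q using that by simp
  have "emeasure \<V> U = (\<integral>\<^sup>+q. ennreal (dens c q) * indicator (snd c ` (fst c \<inter> U)) q \<partial>lborel)"
    using U Uc emeasure_cmeas[OF c(1)] emeasure_vol[OF c(1)] by simp
  also have "\<dots> \<le> (\<integral>\<^sup>+q. ennreal L * indicator (cball ?p r) q \<partial>lborel)"
  proof (intro nn_integral_mono)
    fix q
    have "fst c \<inter> U = U" using Uc by auto
    then show "ennreal (dens c q) * indicator (snd c ` (fst c \<inter> U)) q \<le> ennreal L * indicator (cball ?p r) q"
      using L[of q] br by (auto simp: im indicator_def dens_def intro!: ennreal_leI)
  qed
  also have "\<dots> = ennreal L * emeasure lborel (cball ?p r)" by (simp add: nn_integral_cmult_indicator)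
  also have "\<dots> < \<infinity>" using emeasure_bounded_finite[OF bounded_cball, of ?p r] by (simp add: ennreal_mult_less_top)
  finally show ?thesis using that U xU Uc chart_subset_pts[OF c(1)] by auto
qed

lemma finite_measure_vol: "finite_measure \<V>"
proof -
  have "\<exists>U. open U \<and> x \<in> U \<and> U \<subseteq> P \<and> emeasure \<V> U < \<infinity>" if "x \<in> P" for x
    using vol_locally_finite[OF that] by metis
  then obtain U where U: "\<And>x. x \<in> P \<Longrightarrow> open (U x) \<and> x \<in> U x \<and> U x \<subseteq> P \<and> emeasure \<V> (U x) < \<infinity>" by metis
  obtain s where s: "s \<subseteq> P" "finite s" "P \<subseteq> (\<Union>x\<in>s. U x)"
    by (rule compactE_image[OF compact_P, of P U]) (use U in auto)
  have "emeasure \<V> P \<le> emeasure \<V> (\<Union>x\<in>s. U x)"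
    using s U by (intro emeasure_mono sets_volI borel_open open_UN) auto
  also have "\<dots> \<le> (\<Sum>x\<in>s. emeasure \<V> (U x))"
    using s U by (intro emeasure_subadditive_finite) (auto intro!: sets_volI)
  also have "\<dots> < \<infinity>"
  proof -
    have "\<forall>x\<in>s. emeasure \<V> (U x) < \<infinity>" using s(1) U by blast
    with s(2) show ?thesis by (induction s rule: finite_induct) (auto simp: ennreal_add_less_top)
  qed
  finally show ?thesis by (intro finite_measureI) simp
qed

lemma measurable_vol: "continuous_on P u \<Longrightarrow> u \<in> borel_measurable \<V>" for u :: "'a \<Rightarrow> real"
  unfolding measurable_cong_sets[OF sets_vol refl] by (rule borel_measurable_continuous_on_restrict)

lemma integrable_vol:
  fixes u :: "'a \<Rightarrow> real"
  assumes "continuous_on P u"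
  shows "integrable \<V> u"
proof -
  have "bounded (u ` P)" using compact_imp_bounded[OF compact_continuous_image[OF assms compact_P]] .
  then obtain L where "\<forall>y\<in>u ` P. norm y \<le> L" unfolding bounded_iff by blast
  then have "AE x in \<V>. norm (u x) \<le> L" by (intro AE_I2) simp
  then show ?thesis
    using measurable_vol[OF assms] by (intro finite_measure.integrable_const_bound[OF finite_measure_vol])
qed

text \<open>In a chart the density is strictly positive and nonempty open sets are not negligible.
  This is what turns a vanishing integral of a nonnegative continuous function into vanishing at a
  point.\<close>

lemma emeasure_vol_open_pos:
  assumes U: "open U" "U \<subseteq> P" "x \<in> U"
  shows "emeasure \<V> U > 0"
proof -
  obtain c where c: "c \<in> atlas M" "x \<in> fst c" using in_pts_chart U by blast
  let ?W = "U \<inter> fst c"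
  have W: "open ?W" using U c by auto
  have WV: "?W \<in> sets borel" "?W \<in> sets \<V>" "U \<in> sets \<V>" using W U by (auto intro!: sets_volI)
  have WF: "fst c \<inter> ?W = ?W" by auto
  let ?Q = "snd c ` ?W"
  have Q: "open ?Q" "?Q \<noteq> {}" using open_image_chart[OF c(1) W] U c by auto
  have "emeasure \<V> ?W \<noteq> 0"
  proof
    assume "emeasure \<V> ?W = 0"
    then have "(\<integral>\<^sup>+q. ennreal (dens c q) * indicator ?Q q \<partial>lborel) = 0"
      using emeasure_cmeas[OF c(1) WV(1)] emeasure_vol[OF c(1) WV(1)] by (simp add: WF)
    then have "AE q in lborel. ennreal (dens c q) * indicator ?Q q = 0"
      using dens_measurable[OF c(1)] Q(1) by (subst (asm) nn_integral_0_iff_AE) auto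
    then have "AE q in lborel. q \<notin> ?Q"
    proof (rule AE_mp, intro AE_I2 impI notI)
      fix q assume z: "ennreal (dens c q) * indicator ?Q q = 0" and q: "q \<in> ?Q"
      then have "dens c q = 0" using dens_nonneg[OF c(1), of q] by simp
      moreover have "dens c q > 0" using q vol_pos[OF c(1)] c(1) by (auto simp: dens_def)
      ultimately show False by simp
    qed
    then have "?Q \<in> null_sets lborel" using AE_iff_null_sets[of ?Q lborel] Q(1) by simp
    then have "negligible ?Q" by (simp add: negligible_iff_null_sets null_sets_completionI)
    then show False using open_not_negligible[OF Q] by blast
  qed
  moreover have "emeasure \<V> ?W \<le> emeasure \<V> U" using WV by (intro emeasure_mono) auto
  ultimately show ?thesis by (metis less_le_trans zero_less_iff_neq_zero)
qed

end

section \<open>The divergence theorem\<close>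

text \<open>Both sides are the trace of the endomorphism sending \<open>u\<close> to
  \<open>D x u X\<close>: expand each frame vector in coordinate vectors, then resum over the
  frame.\<close>

lemma (in riem_mfd) frame_trace_eq_chart_trace:
  assumes x: "x \<in> P" and on: "orthonormal x DIM('e) e" and X: "vfield_near (atlas M) x X"
    and c: "c \<in> atlas M" "x \<in> fst c"
  shows "(\<Sum>a<DIM('e). g x (D x (e a) X) (e a)) = (\<Sum>b\<in>Basis. D x (cvec c x b) X (\<lambda>q. snd c q \<bullet> b))"
proof -
  have cT: "cvec c x b \<in> TS x" for b by (rule cvec_in_TS[OF c])
  have DT: "D x u X \<in> TS x" if "u \<in> TS x" for u by (rule D_props(1)[OF x that X])
  have "(\<Sum>a<DIM('e). g x (D x (e a) X) (e a))
    = (\<Sum>a<DIM('e). \<Sum>b\<in>Basis. e a (\<lambda>q. snd c q \<bullet> b) * g x (D x (cvec c x b) X) (e a))"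
  proof (intro sum.cong refl)
    fix a assume "a \<in> {..<DIM('e)}"
    then have eT: "e a \<in> TS x" using orthonormal_TS[OF on] by simp
    have "D x (e a) X = D x (\<Sum>b\<in>Basis. tscale (e a (\<lambda>q. snd c q \<bullet> b)) (cvec c x b)) X"
      using TS_coord_expand[OF c eT] by simp
    also have "\<dots> = (\<Sum>b\<in>Basis. tscale (e a (\<lambda>q. snd c q \<bullet> b)) (D x (cvec c x b) X))"
      by (rule D_sum_dir[OF x X cT finite_Basis])
    finally have "g x (D x (e a) X) (e a) = g x (\<Sum>b\<in>Basis. tscale (e a (\<lambda>q. snd c q \<bullet> b)) (D x (cvec c x b) X)) (e a)"
      by simp
    then show "g x (D x (e a) X) (e a) = (\<Sum>b\<in>Basis. e a (\<lambda>q. snd c q \<bullet> b) * g x (D x (cvec c x b) X) (e a))"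
      using x eT DT[OF cT] by (subst (asm) met_sum_left) (auto simp: TS_scale met_scale_left)
  qed
  also have "\<dots> = (\<Sum>b\<in>Basis. \<Sum>a<DIM('e). g x (D x (cvec c x b) X) (e a) * e a (\<lambda>q. snd c q \<bullet> b))"
    by (subst sum.swap) (simp add: mult.commute)
  also have "\<dots> = (\<Sum>b\<in>Basis. D x (cvec c x b) X (\<lambda>q. snd c q \<bullet> b))"
  proof (intro sum.cong refl)
    fix b :: 'e
    have "(\<Sum>a<DIM('e). g x (D x (cvec c x b) X) (e a) * e a (\<lambda>q. snd c q \<bullet> b))
      = (\<Sum>a<DIM('e). tscale (g x (D x (cvec c x b) X) (e a)) (e a)) (\<lambda>q. snd c q \<bullet> b)" by simp
    also have "\<dots> = D x (cvec c x b) X (\<lambda>q. snd c q \<bullet> b)"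
      using orthonormal_expand[OF x on DT[OF cT], of b] by simp
    finally show "(\<Sum>a<DIM('e). g x (D x (cvec c x b) X) (e a) * e a (\<lambda>q. snd c q \<bullet> b))
      = D x (cvec c x b) X (\<lambda>q. snd c q \<bullet> b)" .
  qed
  finally show ?thesis .
qed

text \<open>A Euclidean bump transported by the chart and extended by 0. The extension is smooth
  across the chart boundary because it already vanishes off a compact set inside
  \<open>U\<close>.\<close>

lemma (in smooth_mfd) chart_bump:
  assumes x: "x \<in> U" and U: "open U" "U \<subseteq> fst c" and c: "c \<in> A"
  obtains \<psi> K where "smooth_fun_on A (pts A) \<psi>" "\<And>y. \<psi> y \<ge> 0" "\<psi> x > 0" "compact K" "K \<subseteq> U"
    "\<And>y. y \<in> pts A - K \<Longrightarrow> \<psi> y = 0"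
proof -
  let ?p = "snd c x"
  have op: "open (snd c ` U)" by (rule open_image_chart[OF c U])
  obtain r where r: "r > 0" "cball ?p r \<subseteq> snd c ` U"
    using op x open_contains_cball by (metis imageI)
  have imc: "snd c ` U \<subseteq> snd c ` fst c" using U by blast
  obtain \<beta> :: "'e \<Rightarrow> real" where b: "smooth_on UNIV \<beta>" "\<And>y. \<beta> y \<ge> 0" "\<And>y. \<beta> y > 0 \<longleftrightarrow> dist ?p y < r"
    using smooth_bump_euclidean[OF r(1)] by metis
  define \<psi> where "\<psi> y = (if y \<in> fst c then \<beta> (snd c y) else 0)" for y
  define K where "K = cinv c ` cball ?p r"
  have K: "compact K" unfolding K_def
    by (rule compact_continuous_image[OF continuous_on_subset[OF continuous_on_cinv[OF c]]]) (use r imc in auto)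
  have KU: "K \<subseteq> U" unfolding K_def using r(2) U c by (auto simp: image_iff subset_iff)
  have zero: "\<psi> y = 0" if "y \<in> pts A - K" for y
  proof (cases "y \<in> fst c")
    case True
    have "snd c y \<notin> cball ?p r"
    proof
      assume "snd c y \<in> cball ?p r"
      then have "cinv c (snd c y) \<in> K" unfolding K_def by (rule imageI)
      then show False using that True c by simp
    qed
    then have "\<not> \<beta> (snd c y) > 0" using b(3) by auto
    then show ?thesis using b(2)[of "snd c y"] True by (simp add: \<psi>_def)
  qed (simp add: \<psi>_def)
  have "smooth_fun_on A (pts A) \<psi>"
  proof (rule smooth_fun_on_local)
    fix y assume y: "y \<in> pts A"
    show "\<exists>T. y \<in> T \<and> T \<subseteq> pts A \<and> smooth_fun_on A T \<psi>"
    proof (cases "y \<in> fst c")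
      case True
      have "smooth_fun_on A (fst c) (\<lambda>y. \<beta> (snd c y))"
        by (rule smooth_fun_on_compose[where u="snd c", OF smooth_fun_on_coord[OF c] b(1)]) auto
      then have "smooth_fun_on A (fst c) \<psi>" by (rule smooth_fun_on_cong) (simp add: \<psi>_def)
      then show ?thesis using True chart_subset_pts[OF c] by blast
    next
      case False
      \<comment> \<open>Compact sets are closed in a Hausdorff space.\<close>
      have op: "open (pts A - K)" using open_pts compact_imp_closed[OF K] by (rule open_Diff)
      have "smooth_fun_on A (pts A - K) (\<lambda>y. 0)" by (rule smooth_fun_on_const[OF op]) auto
      then have "smooth_fun_on A (pts A - K) \<psi>" by (rule smooth_fun_on_cong) (simp add: zero)
      moreover have "y \<notin> K" using False KU U by auto
      ultimately show ?thesis using y by blast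
    qed
  qed
  moreover have "\<psi> x > 0" using b(3)[of ?p] r(1) x U by (auto simp: \<psi>_def)
  ultimately show ?thesis using that[of \<psi> K] K KU zero b(2) by (auto simp: \<psi>_def)
qed

context riem_vol
begin

text \<open>The divergence as a coordinate trace, the form that suits computation in charts.
  \<open>dv_frame\<close> links it to the frame trace \<open>divg\<close>, and through frames it is
  seen to be smooth.\<close>

definition dv :: "('a \<Rightarrow> 'a tvec) \<Rightarrow> 'a \<Rightarrow> real" where
  "dv X x = (\<Sum>b\<in>Basis. D x (cvec (chart_at x) x b) X (\<lambda>q. snd (chart_at x) q \<bullet> b))"

lemma dv_frame:
  assumes "x \<in> P" "orthonormal x DIM((real, 'n) vec) e" "vfield_near (atlas M) x X"
  shows "dv X x = (\<Sum>a<DIM((real, 'n) vec). g x (D x (e a) X) (e a))"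
  unfolding dv_def using frame_trace_eq_chart_trace[OF assms chart_at[OF assms(1)]] by simp

lemma dv_chart:
  assumes x: "x \<in> P" and X: "vfield_near (atlas M) x X" and c: "c \<in> atlas M" "x \<in> fst c"
  shows "dv X x = (\<Sum>b\<in>Basis. D x (cvec c x b) X (\<lambda>q. snd c q \<bullet> b))"
proof -
  obtain S e where S: "x \<in> S" "on_frame S DIM((real, 'n) vec) e" using on_frame_exists x by blast
  note on = on_frameD(4)[OF S(2,1)]
  show ?thesis
    unfolding dv_def frame_trace_eq_chart_trace[OF x on X c, symmetric]
    by (rule frame_trace_eq_chart_trace[OF x on X chart_at[OF x], symmetric])
qed

lemma dv_smooth:
  assumes X: "vfield_on (atlas M) P X"
  shows "smooth_fun_on (atlas M) P (dv X)"
proof (rule smooth_fun_on_local)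
  fix x assume x: "x \<in> P"
  obtain S e where S: "x \<in> S" "on_frame S DIM((real, 'n) vec) e" using on_frame_exists x by blast
  note f = on_frameD[OF S(2)]
  have "smooth_fun_on (atlas M) S (\<lambda>y. \<Sum>a<DIM((real, 'n) vec). g y (D y (e a y) X) (e a y))"
    by (intro smooth_fun_on_sum f met_smooth D_smooth vfield_on_subset[OF X]) auto
  then have "smooth_fun_on (atlas M) S (dv X)"
  proof (rule smooth_fun_on_cong)
    fix y assume y: "y \<in> S"
    show "(\<Sum>a<DIM((real, 'n) vec). g y (D y (e a y) X) (e a y)) = dv X y"
      by (rule dv_frame[symmetric]) (use y f X in \<open>auto intro: vfield_nearI\<close>)
  qed
  then show "\<exists>T. x \<in> T \<and> T \<subseteq> P \<and> smooth_fun_on (atlas M) T (dv X)" using S(1) f(2) by blast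
qed

lemma dv_sum:
  assumes x: "x \<in> P" and X: "\<And>i. i \<in> I \<Longrightarrow> vfield_on (atlas M) P (X i)" and fin: "finite I" "I \<noteq> {}"
  shows "dv (\<lambda>y. \<Sum>i\<in>I. X i y) x = (\<Sum>i\<in>I. dv (X i) x)"
proof -
  have "D x (cvec (chart_at x) x b) (\<lambda>y. \<Sum>i\<in>I. X i y) = (\<Sum>i\<in>I. D x (cvec (chart_at x) x b) (X i))" for b
    by (rule D_sum_field[OF x cvec_in_TS[OF chart_at[OF x]] X x fin])
  then show ?thesis unfolding dv_def by (simp add: sum.swap[of _ I])
qed

lemma trace_sum: "trace (\<chi> i j. F i j) = (\<Sum>i\<in>UNIV. F i i)"
  by (simp add: trace_def)

text \<open>The matrix \<open>A\<close> of the connection in the coordinate basis gives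
  \<open>v G = transpose A ** G + G ** A\<close>. The derivative of the determinant is therefore
  twice the trace of \<open>A\<close> times the determinant, and the square root halves it.\<close>

lemma jacobi_vol:
  assumes c: "c \<in> atlas M" "x \<in> fst c" and v: "v \<in> TS x"
  shows "v (vol c) = vol c x * (\<Sum>b\<in>Basis. D x v (coord_field (atlas M) c b) (\<lambda>q. snd c q \<bullet> b))"
proof -
  have x: "x \<in> P" using c chart_subset_pts by blast
  let ?G = "gram M c"
  have Tc: "cvec c x w \<in> TS x" for w by (rule cvec_in_TS[OF c])
  define A where "A = (\<chi> m a. D x v (coord_field (atlas M) c (axis a 1)) (\<lambda>q. snd c q \<bullet> axis m 1))"
  define N where "N a = D x v (coord_field (atlas M) c (axis a 1))" for a
  have NT: "N a \<in> TS x" for a unfolding N_def by (rule D_props(1)[OF x v vfield_near_coord[OF c]])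
  have crdN: "crd c (N a) $ m = A $ m $ a" for a m
  proof -
    have "crd c (N a) $ m = crd c (N a) \<bullet> axis m 1" by (simp add: inner_axis)
    also have "\<dots> = N a (\<lambda>q. snd c q \<bullet> axis m 1)" by (rule crd_inner) (simp add: axis_in_Basis_iff)
    finally show ?thesis by (simp add: A_def N_def)
  qed
  have gN: "g x (N a) (cvec c x w) = (\<Sum>i\<in>UNIV. \<Sum>j\<in>UNIV. A $ i $ a * w $ j * ?G x $ i $ j)" for a w
    using met_gram[OF c, of "crd c (N a)" w] cvec_crd[OF c NT] crdN by simp
  have entry_near: "near x (\<lambda>y. ?G y $ i $ j)" for i j
    using near_cong[OF open_chart[OF c(1)] c(2), of "\<lambda>y. ?G y $ i $ j"] gram_entry[OF c(1)] met_near_chart[OF c] by simp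
  have dG: "v (\<lambda>y. ?G y $ a $ b) = (transpose A ** ?G x) $ a $ b + (?G x ** A) $ a $ b" for a b
  proof -
    have "v (\<lambda>y. ?G y $ a $ b) = v (\<lambda>y. g y (cvec c y (axis a 1)) (cvec c y (axis b 1)))"
      by (rule TS_cong[OF v open_chart[OF c(1)] c(2)]) (simp add: gram_entry[OF c(1)])
    also have "\<dots> = g x (N a) (cvec c x (axis b 1)) + g x (cvec c x (axis a 1)) (N b)"
      unfolding N_def by (rule D_coord_metric[OF c v])
    also have "g x (cvec c x (axis a 1)) (N b) = g x (N b) (cvec c x (axis a 1))" by (rule met_sym[OF x Tc NT])
    also have "g x (N a) (cvec c x (axis b 1)) = (transpose A ** ?G x) $ a $ b"
      by (simp add: gN matrix_matrix_mult_def transpose_def axis_def mult_delta_left mult_delta_right)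
    also have "g x (N b) (cvec c x (axis a 1)) = (?G x ** A) $ a $ b"
    proof -
      have "?G x $ i $ a = ?G x $ a $ i" for i using met_sym[OF x Tc Tc] by (simp add: gram_entry[OF c])
      then show ?thesis
        by (simp add: gN matrix_matrix_mult_def axis_def mult_delta_left mult_delta_right)
           (metis mult.commute)
    qed
    finally show ?thesis .
  qed
  have detnz: "det (?G x) > 0" by (rule det_gram_pos[OF c])
  then obtain H where H: "?G x ** H = mat 1" "H ** ?G x = mat 1"
    using invertible_det_nz[of "?G x"] by (auto simp: invertible_def)
  \<comment> \<open>Chosen so that \<open>C ** G\<close> is the derivative of the Gram matrix, as
    \<open>det_row_replace_sum\<close> requires; its trace is twice that of \<open>A\<close> by
    cyclicity.\<close>
  define C where "C = transpose A + ?G x ** A ** H"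
  have CG: "C ** ?G x = transpose A ** ?G x + ?G x ** A"
  proof -
    have "?G x ** A ** H ** ?G x = ?G x ** A ** (H ** ?G x)" by (simp only: matrix_mul_assoc)
    moreover have "(transpose A + B) ** ?G x = transpose A ** ?G x + B ** ?G x" for B
      by (simp add: vec_eq_iff matrix_matrix_mult_def distrib_right sum.distrib)
    ultimately show ?thesis unfolding C_def using H by simp
  qed
  have trC: "trace C = 2 * trace A"
  proof -
    have "trace (?G x ** A ** H) = trace (H ** (?G x ** A))" by (rule trace_mul_sym)
    also have "H ** (?G x ** A) = A" using H by (simp add: matrix_mul_assoc)
    finally show ?thesis unfolding C_def by (simp add: trace_add) (simp add: trace_def transpose_def)
  qed
  have "v (\<lambda>y. det (?G y)) = (\<Sum>p | p permutes UNIV. v (\<lambda>y. of_int (sign p) * (\<Prod>i\<in>UNIV. ?G y $ i $ p i)))"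
    unfolding det_def using x entry_near
    by (intro TS_setsum[OF v x] near_mult near_const near_prod) auto
  also have "\<dots> = (\<Sum>p | p permutes UNIV. of_int (sign p) *
      (\<Sum>k\<in>UNIV. v (\<lambda>y. ?G y $ k $ p k) * (\<Prod>i\<in>UNIV - {k}. ?G x $ i $ p i)))"
    using x entry_near by (intro sum.cong refl) (simp add: TS_cmult[OF v] near_prod TS_prod[OF v x])
  also have "\<dots> = (\<Sum>k\<in>UNIV. \<Sum>p | p permutes UNIV. of_int (sign p) *
      ((C ** ?G x) $ k $ p k * (\<Prod>i\<in>UNIV - {k}. ?G x $ i $ p i)))"
    unfolding sum_distrib_left CG by (subst sum.swap) (simp add: dG)
  also have "\<dots> = 2 * trace A * det (?G x)" unfolding det_row_replace_sum trC ..
  finally have vdet: "v (\<lambda>y. det (?G y)) = 2 * trace A * det (?G x)" .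
  have "v (vol c) = inverse (sqrt (det (?G x))) / 2 * v (\<lambda>y. det (?G y))"
    unfolding vol_def[abs_def]
    by (rule TS_real_compose[OF v smooth_fun_nearI[OF det_gram_smooth[OF c(1)] c(2)]
          smooth_on_sqrt[OF open_greaterThan order_refl] open_greaterThan])
       (use detnz DERIV_real_sqrt[OF detnz] in auto)
  also have "\<dots> = vol c x * trace A"
  proof -
    have "det (?G x) = sqrt (det (?G x)) * sqrt (det (?G x))" using detnz by simp
    then show ?thesis unfolding vdet vol_def using detnz by (simp add: field_simps)
  qed
  also have "trace A = (\<Sum>b\<in>Basis. D x v (coord_field (atlas M) c b) (\<lambda>q. snd c q \<bullet> b))"
  proof -
    have "bij_betw (\<lambda>i. axis i (1::real)) (UNIV :: 'n set) Basis"
      by (auto simp: bij_betw_def inj_on_def axis_eq_axis Basis_vec_def)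
    then show ?thesis unfolding A_def trace_sum by (rule sum.reindex_bij_betw)
  qed
  finally show ?thesis .
qed

text \<open>The Voss-Weyl formula: the density times the divergence is an ordinary divergence in
  coordinates.\<close>

lemma vol_dv_chart:
  assumes X: "vfield_on (atlas M) P X" and c: "c \<in> atlas M" "x \<in> fst c"
  shows "vol c x * dv X x = (\<Sum>b\<in>Basis. cvec c x b (\<lambda>y. vol c y * X y (\<lambda>q. snd c q \<bullet> b)))"
proof -
  let ?X = "\<lambda>b y. X y (\<lambda>q. snd c q \<bullet> b)" and ?N = "\<lambda>b a. D x (cvec c x b) (coord_field (atlas M) c a)"
  have x: "x \<in> P" using c chart_subset_pts by blast
  note op = open_chart[OF c(1)] chart_subset_pts[OF c(1)]
  have Tc: "cvec c x w \<in> TS x" for w by (rule cvec_in_TS[OF c])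
  have Xc: "vfield_on (atlas M) (fst c) X" by (rule vfield_on_subset[OF X op])
  have sX: "smooth_fun_on (atlas M) (fst c) (?X b)" for b
    by (rule vfield_onD(4)[OF Xc order_refl smooth_fun_on_coord[OF c(1)]])
  have "D x (cvec c x b) X = (\<Sum>a\<in>Basis. tscale (cvec c x b (?X a)) (cvec c x a) + tscale (?X a x) (?N b a))" for b
  proof -
    have "D x (cvec c x b) X = D x (cvec c x b) (\<lambda>y. \<Sum>a\<in>Basis. tscale (?X a y) (coord_field (atlas M) c a y))"
    proof (rule D_cong[OF Xc _ c(2) Tc])
      show "vfield_on (atlas M) (fst c) (\<lambda>y. \<Sum>a\<in>Basis. tscale (?X a y) (coord_field (atlas M) c a y))"
        by (intro vfield_on_sum vfield_on_scale op vfield_on_coord c(1) sX)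
      show "X y = (\<Sum>a\<in>Basis. tscale (?X a y) (coord_field (atlas M) c a y))" if "y \<in> fst c" for y
        using TS_coord_expand[OF c(1) that vfield_onD(3)[OF Xc that]] by (simp only: coord_field_eq_cvec[OF c(1) that])
    qed
    also have "\<dots> = (\<Sum>a\<in>Basis. tscale (cvec c x b (?X a)) (coord_field (atlas M) c a x) + tscale (?X a x) (?N b a))"
      by (rule D_sum_leibniz[OF x Tc op c(2) finite_Basis vfield_on_coord[OF c(1)] sX])
    finally show ?thesis by (simp only: coord_field_eq_cvec[OF c])
  qed
  then have "dv X x = (\<Sum>b\<in>Basis. \<Sum>a\<in>Basis. cvec c x b (?X a) * (a \<bullet> b) + ?X a x * ?N b a (\<lambda>q. snd c q \<bullet> b))"
    unfolding dv_chart[OF x vfield_nearI[OF X x] c] using c by simp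
  \<comment> \<open>Symmetry of the connection exchanges the two coordinate indices, so that the sum
    over \<open>b\<close> becomes the trace in \<open>jacobi_vol\<close>.\<close>
  also have "\<dots> = (\<Sum>b\<in>Basis. cvec c x b (?X b)) + (\<Sum>b\<in>Basis. \<Sum>a\<in>Basis. ?X a x * ?N a b (\<lambda>q. snd c q \<bullet> b))"
    unfolding D_coord_sym[OF c, of "_ :: (real, 'n) vec"]
    by (simp add: sum.distrib inner_Basis mult_delta_right)
  also have "(\<Sum>b\<in>Basis. \<Sum>a\<in>Basis. ?X a x * ?N a b (\<lambda>q. snd c q \<bullet> b))
      = (\<Sum>a\<in>Basis. ?X a x * (\<Sum>b\<in>Basis. ?N a b (\<lambda>q. snd c q \<bullet> b)))"
    by (subst sum.swap) (simp add: sum_distrib_left)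
  finally have "vol c x * dv X x = (\<Sum>b\<in>Basis. vol c x * cvec c x b (?X b) + ?X b x * (vol c x * (\<Sum>a\<in>Basis. ?N b a (\<lambda>q. snd c q \<bullet> a))))"
    by (simp add: sum.distrib sum_distrib_left distrib_left mult.left_commute)
  also have "\<dots> = (\<Sum>b\<in>Basis. cvec c x b (\<lambda>y. vol c y * ?X b y))"
    unfolding jacobi_vol[OF c Tc, symmetric]
    using smooth_fun_nearI[OF vol_smooth[OF c(1)] c(2)] smooth_fun_nearI[OF sX c(2)]
    by (simp add: TS_times[OF Tc] mult.commute add.commute)
  finally show ?thesis .
qed

text \<open>For a field supported in one chart the Voss-Weyl formula reduces the integral to partial
  derivatives of compactly supported functions on Euclidean space.\<close>

lemma integral_dv_chart:
  assumes X: "vfield_on (atlas M) P X" and c: "c \<in> atlas M" and K: "compact K" "K \<subseteq> fst c"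
    and zero: "\<And>y. y \<in> P - K \<Longrightarrow> X y = 0"
  shows "(\<integral>x. dv X x \<partial>\<V>) = 0"
proof -
  have op: "open (P - K)" using open_pts compact_imp_closed[OF K(1)] by (rule open_Diff)
  have dz: "dv X x = 0" if x: "x \<in> P - K" for x
  proof -
    have xP: "x \<in> P" using x by auto
    have "D x (cvec (chart_at x) x b) X = D x (cvec (chart_at x) x b) (\<lambda>y. 0)" for b
      by (rule D_cong[OF vfield_on_subset[OF X op] vfield_on_0[OF op] x cvec_in_TS[OF chart_at[OF xP]]])
         (use zero in auto)
    then show ?thesis unfolding dv_def by (simp add: D_zero_field[OF xP cvec_in_TS[OF chart_at[OF xP]]])
  qed
  let ?Q = "snd c ` fst c"

  \<comment> \<open>The components of the weighted field, extended by 0. They vanish off the compact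
    image of \<open>K\<close>, so the extension is smooth on the whole space.\<close>
  define u where "u b q = (if q \<in> ?Q then vol c (cinv c q) * X (cinv c q) (\<lambda>z. snd c z \<bullet> b) else 0)" for b q
  have cK: "compact (snd c ` K)" using continuous_on_chart[OF c K(2)] K(1) by (rule compact_continuous_image)
  have uK: "u b q = 0" if "q \<notin> snd c ` K" for b q
  proof (cases "q \<in> ?Q")
    case True
    then obtain y where y: "y \<in> fst c" "q = snd c y" by blast
    then have "y \<in> P - K" using that chart_subset_pts[OF c] by auto
    then show ?thesis using y c zero by (simp add: u_def)
  qed (simp add: u_def)
  have sm: "smooth_on UNIV (u b)" for b
  proof (rule smooth_on_local)
    fix q :: "(real, 'n) vec"
    show "\<exists>T. open T \<and> q \<in> T \<and> smooth_on T (u b)"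
    proof (cases "q \<in> ?Q")
      case True
      have "smooth_fun_on (atlas M) (fst c) (\<lambda>y. vol c y * X y (\<lambda>z. snd c z \<bullet> b))"
        by (intro smooth_fun_on_mult vol_smooth[OF c] vfield_onD(4)[OF X chart_subset_pts[OF c]] smooth_fun_on_coord[OF c])
      then have "smooth_on ?Q (\<lambda>q. vol c (cinv c q) * X (cinv c q) (\<lambda>z. snd c z \<bullet> b))"
        using smooth_fun_onD(4)[of "fst c" _ c "fst c"] c by simp
      then have "smooth_on ?Q (u b)"
        by (subst smooth_on_cong[OF open_chart_image[OF c]]) (auto simp: u_def)
      then show ?thesis using True open_chart_image[OF c] by blast
    next
      case False
      have "open (- snd c ` K)" using compact_imp_closed[OF cK] by blast
      moreover have "smooth_on (- snd c ` K) (u b)"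
        by (subst smooth_on_cong[OF calculation, where g="\<lambda>_. 0"]) (auto simp: uK)
      moreover have "q \<notin> snd c ` K" using False K by auto
      ultimately show ?thesis by blast
    qed
  qed
  have fdu: "fd (u b) (snd c x) b' = cvec c x b' (\<lambda>y. vol c y * X y (\<lambda>z. snd c z \<bullet> b))" if x: "x \<in> fst c" for x b b'
  proof -
    have n: "near x (\<lambda>y. vol c y * X y (\<lambda>z. snd c z \<bullet> b))"
      using smooth_fun_nearI[OF smooth_fun_on_mult[OF vol_smooth[OF c] vfield_onD(4)[OF X chart_subset_pts[OF c] smooth_fun_on_coord[OF c]]] x] .
    have "fd (u b) (snd c x) = fd (\<lambda>q. vol c (cinv c q) * X (cinv c q) (\<lambda>z. snd c z \<bullet> b)) (snd c x)"
      by (rule frechet_derivative_transform_within_open[OF smooth_on_imp_differentiable[OF sm] open_chart_image[OF c]])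
         (use x in \<open>auto simp: u_def\<close>)
    then show ?thesis using n by (simp add: cvec_def)
  qed
  have cont: "continuous_on P (dv X)" using smooth_fun_onD(3)[OF dv_smooth[OF X]] .
  have hb: "(\<lambda>x. indicator P x *\<^sub>R dv X x) \<in> borel_measurable borel"
    using borel_open[OF open_pts] cont by (rule borel_measurable_continuous_on_indicator)
  have "(\<integral>x. dv X x \<partial>\<V>) = (\<integral>x. indicator (fst c) x * (indicator P x *\<^sub>R dv X x) \<partial>\<V>)"
    by (intro Bochner_Integration.integral_cong) (use dz K in \<open>auto simp: indicator_def\<close>)
  also have "\<dots> = (\<integral>q. dens c q * (indicator P (cinv c q) *\<^sub>R dv X (cinv c q)) \<partial>lborel)"
    by (rule integral_chart[OF c hb])
  also have "\<dots> = (\<integral>q. (\<Sum>b\<in>Basis. fd (u b) q b) \<partial>lborel)"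
  proof (intro Bochner_Integration.integral_cong refl)
    fix q
    show "dens c q * (indicator P (cinv c q) *\<^sub>R dv X (cinv c q)) = (\<Sum>b\<in>Basis. fd (u b) q b)"
    proof (cases "q \<in> ?Q")
      case True
      then obtain x where x: "x \<in> fst c" "q = snd c x" by blast
      then have "x \<in> P" using chart_subset_pts[OF c] by auto
      then show ?thesis using x c vol_dv_chart[OF X c x(1)] fdu[OF x(1)] by (simp add: dens_def)
    next
      case False
      have "fd (u b) q = (\<lambda>_. 0)" for b
      proof -
        have o: "open (- snd c ` K)" "q \<in> - snd c ` K" using compact_imp_closed[OF cK] False K by auto
        have "((\<lambda>q. 0) has_derivative (\<lambda>_. 0)) (at q)" by simp
        then have "(u b has_derivative (\<lambda>_. 0)) (at q)"
          by (rule has_derivative_transform_within_open[OF _ o]) (simp add: uK)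
        then show ?thesis by (rule fd_eqI)
      qed
      then show ?thesis using False by (simp add: dens_def)
    qed
  qed
  also have "\<dots> = (\<Sum>b\<in>Basis. \<integral>q. fd (u b) q b \<partial>lborel)"
  proof (rule Bochner_Integration.integral_sum)
    fix b :: "(real, 'n) vec"
    have z: "fd (u b) q b = 0" if "q \<notin> snd c ` K" for q
    proof -
      have o: "open (- snd c ` K)" "q \<in> - snd c ` K" using compact_imp_closed[OF cK] that by auto
      have "((\<lambda>q. 0) has_derivative (\<lambda>_. 0)) (at q)" by simp
      then have "(u b has_derivative (\<lambda>_. 0)) (at q)"
        by (rule has_derivative_transform_within_open[OF _ o]) (simp add: uK)
      then show ?thesis by (simp add: fd_eqI)
    qed
    have "integrable lborel (\<lambda>q. indicator (snd c ` K) q *\<^sub>R fd (u b) q b)"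
      using smooth_on_imp_continuous_on[OF smooth_on_fd[OF sm]]
      by (intro borel_integrable_compact cK) (auto intro: continuous_on_subset)
    moreover have "indicator (snd c ` K) q *\<^sub>R fd (u b) q b = fd (u b) q b" for q using z by (auto simp: indicator_def)
    ultimately show "integrable lborel (\<lambda>q. fd (u b) q b)" by (simp only:)
  qed
  also have "\<dots> = 0" using integral_fd_compact_support[OF sm cK uK] by simp
  finally show ?thesis .
qed

text \<open>Finitely many bumps have a positive sum \<open>\<Psi>\<close>. Dividing by it gives a
  partition of unity that splits \<open>X\<close> into fields supported in single charts.\<close>

theorem divergence_theorem:
  assumes X: "vfield_on (atlas M) P X"
  shows "(\<integral>x. dv X x \<partial>\<V>) = 0"
proof (cases "P = {}")
  case True
  then have "(\<integral>x. dv X x \<partial>\<V>) = (\<integral>x. 0 \<partial>\<V>)" by (intro Bochner_Integration.integral_cong) auto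
  then show ?thesis by simp
next
  case False
  have "\<exists>\<psi> K c. smooth_fun_on (atlas M) P \<psi> \<and> (\<forall>y. \<psi> y \<ge> 0) \<and> \<psi> x > 0 \<and> compact K \<and> c \<in> atlas M \<and> K \<subseteq> fst c
      \<and> (\<forall>y\<in>P - K. \<psi> y = 0)" if x: "x \<in> P" for x
  proof -
    obtain c where c: "c \<in> atlas M" "x \<in> fst c" using in_pts_chart[OF x] by blast
    obtain \<psi> K where "smooth_fun_on (atlas M) P \<psi>" "\<And>y. \<psi> y \<ge> 0" "\<psi> x > 0" "compact K" "K \<subseteq> fst c"
      "\<And>y. y \<in> P - K \<Longrightarrow> \<psi> y = 0"
      by (rule chart_bump[OF c(2) open_chart[OF c(1)] order_refl c(1)], rule that)
    then show ?thesis using c by blast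
  qed
  then obtain \<psi> K c where pk: "\<And>x. x \<in> P \<Longrightarrow> smooth_fun_on (atlas M) P (\<psi> x) \<and> (\<forall>y. \<psi> x y \<ge> 0) \<and> \<psi> x x > 0
      \<and> compact (K x) \<and> c x \<in> atlas M \<and> K x \<subseteq> fst (c x) \<and> (\<forall>y\<in>P - K x. \<psi> x y = 0)"
    by metis
  have "open (P \<inter> \<psi> x -` {0<..})" if "x \<in> P" for x
    using pk[OF that] by (intro continuous_open_preimage smooth_fun_onD(3) open_pts open_greaterThan) auto
  then obtain s where s: "s \<subseteq> P" "finite s" "P \<subseteq> (\<Union>x\<in>s. P \<inter> \<psi> x -` {0<..})"
    by (rule_tac compactE_image[OF compact_P, of P "\<lambda>x. P \<inter> \<psi> x -` {0<..}"]) (use pk in auto)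
  \<comment> \<open>\<open>dv_sum\<close> is stated for nonempty index sets; the empty manifold was
    treated separately.\<close>
  have sne: "s \<noteq> {}" using s False by auto
  define \<Psi> where "\<Psi> y = (\<Sum>x\<in>s. \<psi> x y)" for y
  have \<Psi>s: "smooth_fun_on (atlas M) P \<Psi>"
    unfolding \<Psi>_def[abs_def] using s(1) pk by (intro smooth_fun_on_sum open_pts order_refl) auto
  have \<Psi>p: "\<Psi> y > 0" if "y \<in> P" for y
  proof -
    have "y \<in> (\<Union>x\<in>s. P \<inter> \<psi> x -` {0<..})" by (rule subsetD[OF s(3) that])
    then obtain x where "x \<in> s" "\<psi> x y > 0" by auto
    then show ?thesis unfolding \<Psi>_def using s pk by (intro sum_pos2[of s x]) auto
  qed
  define Z where "Z x y = tscale (\<psi> x y / \<Psi> y) (X y)" for x y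
  have Zv: "vfield_on (atlas M) P (Z x)" if "x \<in> s" for x
    unfolding Z_def using that s(1) pk \<Psi>p
    by (intro vfield_on_scale X smooth_fun_on_divide \<Psi>s) (auto simp: less_le)
  have Zi: "(\<integral>y. dv (Z x) y \<partial>\<V>) = 0" if "x \<in> s" for x
  proof -
    have p: "compact (K x)" "c x \<in> atlas M" "K x \<subseteq> fst (c x)" "\<forall>y\<in>P - K x. \<psi> x y = 0" using pk that s(1) by auto
    show ?thesis by (rule integral_dv_chart[OF Zv[OF that] p(2,1,3)]) (use p(4) in \<open>auto simp: Z_def\<close>)
  qed
  have "dv X y = (\<Sum>x\<in>s. dv (Z x) y)" if y: "y \<in> P" for y
  proof -
    have ZX: "X z = (\<Sum>x\<in>s. Z x z)" if "z \<in> P" for z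
    proof -
      have "(\<Sum>x\<in>s. Z x z) = tscale (\<Sum>x\<in>s. \<psi> x z / \<Psi> z) (X z)" by (simp only: Z_def tvs.scale_sum_left)
      also have "(\<Sum>x\<in>s. \<psi> x z / \<Psi> z) = 1"
        unfolding sum_divide_distrib[symmetric] \<Psi>_def[symmetric] using \<Psi>p[OF that] by simp
      finally show ?thesis by (simp only: tvs.scale_one)
    qed
    have "D y (cvec (chart_at y) y b) X = D y (cvec (chart_at y) y b) (\<lambda>z. \<Sum>x\<in>s. Z x z)" for b
      by (rule D_cong[OF X vfield_on_sum[OF open_pts order_refl Zv] y cvec_in_TS[OF chart_at[OF y]] ZX])
    then have "dv X y = dv (\<lambda>z. \<Sum>x\<in>s. Z x z) y" by (simp add: dv_def)
    also have "\<dots> = (\<Sum>x\<in>s. dv (Z x) y)" by (rule dv_sum[OF y Zv s(2) sne])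
    finally show ?thesis .
  qed
  then have "(\<integral>y. dv X y \<partial>\<V>) = (\<integral>y. (\<Sum>x\<in>s. dv (Z x) y) \<partial>\<V>)"
    by (intro Bochner_Integration.integral_cong) auto
  also have "\<dots> = (\<Sum>x\<in>s. \<integral>y. dv (Z x) y \<partial>\<V>)"
    using smooth_fun_onD(3)[OF dv_smooth[OF Zv]] by (intro Bochner_Integration.integral_sum integrable_vol)
  also have "\<dots> = 0" using Zi by simp
  finally show ?thesis .
qed

end

section \<open>The first variation and the tension field\<close>

context energy_map
begin

lemma tauH_TS:
  assumes x: "x \<in> M.P"
  shows "tauH M N f x \<in> N.TS (f x)"
proof -
  obtain S where S: "open S" "x \<in> S" "S \<subseteq> M.P" "adapted_frame_on M S (frame M x)"
    using M.frame_adapted[OF x] by blast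
  note Se = S(1,3,4,2)
  note a = M.adapted_frameD[OF Se]
  have fx: "f x \<in> N.P" using mp.f_pts[OF x] .
  have projT: "df x (hor_proj M x v) \<in> N.TS (f x)" if "v \<in> M.TS x" for v
    unfolding M.hor_proj_eq[OF Se that] df_sum_scale
    using fx mp.tmap_TS[OF x a(3)] a(6) by (auto intro!: N.TS_sum N.TS_scale)
  have DT: "M.D x (frame M x i x) (frame M x i) \<in> M.TS x" if "i < DIM('e)" for i
    by (rule M.D_props(1)[OF x a(3)[OF that] M.vfield_nearI]) (use S that in \<open>auto simp: adapted_frame_on_def\<close>)
  have "zeta M x = hor_proj M x (\<Sum>\<alpha>\<in>{hrank M..<DIM('e)}. M.D x (frame M x \<alpha> x) (frame M x \<alpha>))"
    by (simp add: zeta_def)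
  then have "df x (zeta M x) \<in> N.TS (f x)" using x DT by (auto intro!: projT M.TS_sum)
  moreover have "betaH M N f (frame M x i) (frame M x i) x \<in> N.TS (f x)" if "i < hrank M" for i
    unfolding betaH_def dfH_def
    by (intro N.TS_diff fx pullback_conn_TS[OF x] a(3) projT DT) (use a(6)[OF that] in auto)
  ultimately show ?thesis
    unfolding tauH_def dfH_def using M.gradient_props(1)[OF x] fx
    by (intro N.TS_add N.TS_diff N.TS_sum projT) auto
qed

text \<open>In the chart \<open>k\<close> the map is moved with velocity
  \<open>\<psi> x *\<^sub>R w\<close>. The direction \<open>w\<close> is constant in coordinates, so
  smoothness of the variation depends only on that of \<open>f\<close> and
  \<open>\<psi>\<close>.\<close>

lemma local_variation:
  assumes k: "k \<in> atlas N" and K: "compact K" "K \<subseteq> M.P" "f ` K \<subseteq> fst k"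
    and \<psi>: "smooth_fun_on (atlas M) M.P \<psi>" "\<And>y. y \<in> M.P - K \<Longrightarrow> \<psi> y = 0"
  obtains \<epsilon> F where "smooth_variation M N f \<epsilon> F"
    "\<And>x. x \<in> M.P \<Longrightarrow> f x \<in> fst k \<Longrightarrow> variation_field N F x = N.cvec k (f x) (\<psi> x *\<^sub>R w)"
    "\<And>x. x \<in> M.P - K \<Longrightarrow> variation_field N F x = 0"
proof -
  define u where "u x = snd k (f x)" for x
  define O' where "O' = snd k ` fst k"
  define U where "U = M.P \<inter> f -` fst k"
  have O': "open O'" unfolding O'_def using k by simp
  have U: "open U" "U \<subseteq> M.P" "K \<subseteq> U"
    unfolding U_def using continuous_open_preimage[OF mp.mapD(4,1)] k K by auto
  have "continuous_on K u" unfolding u_def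
    by (rule continuous_on_compose2[OF N.continuous_on_chart[OF k order_refl] continuous_on_subset[OF mp.mapD(4) K(2)] K(3)])
  then have "compact (u ` K)" using K(1) by (rule compact_continuous_image)
  moreover have "u ` K \<subseteq> O'" using K(3) by (auto simp: u_def O'_def)
  ultimately obtain r where r: "r > 0" "(\<Union>y\<in>u ` K. ball y r) \<subseteq> O'"
    using compact_subset_open_imp_ball_epsilon_subset[OF _ O'] by metis
  have "bounded (\<psi> ` K)"
    using K(1) by (intro compact_imp_bounded compact_continuous_image continuous_on_subset[OF M.smooth_fun_onD(3)[OF \<psi>(1)] K(2)])
  then obtain B where B: "B > 0" "\<And>y. y \<in> K \<Longrightarrow> \<bar>\<psi> y\<bar> \<le> B" unfolding bounded_pos by auto
  \<comment> \<open>For times below this bound the displacement on \<open>K\<close> stays under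
    \<open>r\<close>; the summand 1 covers \<open>w = 0\<close>.\<close>
  define \<epsilon> where "\<epsilon> = r / (B * norm w + 1)"
  have den: "B * norm w + 1 > 0" using B by (simp add: add_nonneg_pos)
  have \<epsilon>: "\<epsilon> > 0" unfolding \<epsilon>_def using r den by simp
  interpret fam: mfd_interval "atlas M" \<epsilon> by unfold_locales
  \<comment> \<open>The case distinction on \<open>K\<close> is harmless on all of \<open>U\<close>:
    off \<open>K\<close> the function \<open>\<psi>\<close> vanishes and both branches give
    \<open>f x\<close>. Hence \<open>F\<close> is smooth across the boundary of
    \<open>K\<close>.\<close>
  define F where "F t x = (if x \<in> K then cinv k (u x + (t * \<psi> x) *\<^sub>R w) else f x)" for t x
  have in_O: "u x + (t * \<psi> x) *\<^sub>R w \<in> O'" if x: "x \<in> U" and t: "t \<in> fam.I" for x t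
  proof (cases "x \<in> K")
    case True
    have "norm ((t * \<psi> x) *\<^sub>R w) = \<bar>t\<bar> * (\<bar>\<psi> x\<bar> * norm w)" by (simp add: abs_mult)
    also have "\<dots> \<le> \<bar>t\<bar> * (B * norm w + 1)"
      using mult_right_mono[OF B(2)[OF True] norm_ge_zero[of w]] by (intro mult_left_mono) auto
    also have "\<dots> < \<epsilon> * (B * norm w + 1)" using t den by (intro mult_strict_right_mono) auto
    also have "\<dots> = r" using den by (simp add: \<epsilon>_def)
    finally have "u x + (t * \<psi> x) *\<^sub>R w \<in> ball (u x) r" by (simp add: dist_norm)
    then have "u x + (t * \<psi> x) *\<^sub>R w \<in> (\<Union>y\<in>u ` K. ball y r)" using True by blast
    then show ?thesis using r(2) by (rule rev_subsetD)
  next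
    case False
    then show ?thesis using x \<psi>(2) U by (auto simp: U_def u_def O'_def)
  qed
  have FU: "F t x = cinv k (u x + (t * \<psi> x) *\<^sub>R w)" if "x \<in> U" for t x
    using that \<psi>(2)[of x] U N.cinv_chart[OF k] by (auto simp: F_def U_def u_def)
  have Fk: "F t x \<in> fst k" "snd k (F t x) = u x + (t * \<psi> x) *\<^sub>R w" if "x \<in> U" "t \<in> fam.I" for t x
    unfolding FU[OF that(1)] using in_O[OF that] k by (auto simp: O'_def N.cinv_in_chart N.chart_cinv)
  have F0: "F 0 x = f x" if "x \<in> M.P" for x
    using that K(3) N.cinv_chart[OF k] by (auto simp: F_def u_def)
  have s_snd: "smooth_fun_on fam.pA (S \<times> fam.I) (\<lambda>p. snd p)" if S: "open S" "S \<subseteq> M.P" for S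
  proof (rule fam.smooth_fun_prod_local[OF S open_greaterThanLessThan order_refl])
    fix c assume c: "c \<in> atlas M"
    then show "smooth_fun_on fam.pA ((S \<inter> fst c) \<times> fam.I) (\<lambda>p. snd p)"
      using S by (subst fam.smooth_fun_prod_chart) auto
  qed
  have Fsm: "smooth_map_on fam.pA (atlas N) (M.P \<times> fam.I) (\<lambda>p. F (snd p) (fst p))"
  proof (rule fam.pr.smooth_map_on_local[OF N.smooth_mfd_axioms])
    show "open (M.P \<times> fam.I)" by (intro open_Times M.open_pts open_greaterThanLessThan)
    show "M.P \<times> fam.I \<subseteq> pts fam.pA" by (simp add: pts_prod_atlas)
    fix p assume p: "p \<in> M.P \<times> fam.I"
    show "\<exists>k\<in>atlas N. \<exists>T. p \<in> T \<and> (\<lambda>p. F (snd p) (fst p)) ` T \<subseteq> fst k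
        \<and> (\<forall>b\<in>Basis. smooth_fun_on fam.pA T (\<lambda>p. snd k (F (snd p) (fst p)) \<bullet> b))"
    proof (cases "fst p \<in> U")
      case True
      have "smooth_fun_on fam.pA (U \<times> fam.I) (\<lambda>p. snd k (F (snd p) (fst p)) \<bullet> b)" for b
      proof (rule fam.pr.smooth_fun_on_cong)
        have "smooth_fun_on (atlas M) U (\<lambda>x. u x \<bullet> b)"
          unfolding U_def u_def using mp.mapD(5)[OF k] k by simp
        then have "smooth_fun_on fam.pA (U \<times> fam.I) (\<lambda>p. u (fst p) \<bullet> b)"
          by (rule fam.smooth_fun_prod_fst) auto
        moreover have "smooth_fun_on fam.pA (U \<times> fam.I) (\<lambda>p. \<psi> (fst p))"
          by (rule fam.smooth_fun_prod_fst[OF M.smooth_fun_on_subset[OF \<psi>(1) U(1,2)]]) auto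
        ultimately show "smooth_fun_on fam.pA (U \<times> fam.I) (\<lambda>p. u (fst p) \<bullet> b + snd p * \<psi> (fst p) * (w \<bullet> b))"
          using fam.pr.smooth_fun_onD(1,2)[OF s_snd[OF U(1,2)]]
          by (intro fam.pr.smooth_fun_on_add fam.pr.smooth_fun_on_mult fam.pr.smooth_fun_on_const s_snd U) auto
      qed (use Fk in \<open>auto simp: inner_add_left\<close>)
      then show ?thesis using True p Fk k by (intro bexI[of _ k] exI[of _ "U \<times> fam.I"]) auto
    next
      case False
      define k' where "k' = N.chart_at (f (fst p))"
      have k': "k' \<in> atlas N" "f (fst p) \<in> fst k'" using N.chart_at[OF mp.f_pts] p by (auto simp: k'_def)
      let ?S = "(M.P \<inter> f -` fst k') \<inter> - K"
      have op: "open ?S"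
        using continuous_open_preimage[OF mp.mapD(4,1)] k' compact_imp_closed[OF K(1)] by auto
      have "smooth_fun_on (atlas M) ?S (\<lambda>x. snd k' (f x) \<bullet> b)" for b
        by (rule M.smooth_fun_on_subset[OF mp.mapD(5)[OF k'(1)] op]) (use k' in auto)
      then have "smooth_fun_on fam.pA (?S \<times> fam.I) (\<lambda>p. snd k' (f (fst p)) \<bullet> b)" for b
        by (rule fam.smooth_fun_prod_fst) auto
      then have "smooth_fun_on fam.pA (?S \<times> fam.I) (\<lambda>p. snd k' (F (snd p) (fst p)) \<bullet> b)" for b
        by (rule fam.pr.smooth_fun_on_cong) (auto simp: F_def)
      then show ?thesis using False p U k' by (intro bexI[of _ k'] exI[of _ "?S \<times> fam.I"]) (auto simp: F_def)
    qed
  qed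
  have VU: "variation_field N F x = N.cvec k (f x) (\<psi> x *\<^sub>R w)" if x: "x \<in> U" for x
  proof -
    have ev: "\<forall>\<^sub>F t in nhds 0. t \<in> fam.I" using \<epsilon> by (intro eventually_nhds_in_open) auto
    have "((\<lambda>t. u x + (t * \<psi> x) *\<^sub>R w) has_vector_derivative \<psi> x *\<^sub>R w) (at 0)"
      by (auto intro!: derivative_eq_intros simp: has_vector_derivative_def)
    then have "((\<lambda>t. snd k (F t x)) has_vector_derivative \<psi> x *\<^sub>R w) (at 0)"
      by (rule has_vector_derivative_transform_within_open[where S="fam.I"]) (use \<epsilon> Fk x in auto)
    moreover have "\<forall>\<^sub>F t in nhds 0. F t x \<in> fst k" using ev by eventually_elim (use Fk x in auto)
    ultimately have "variation_field N F x = N.cvec k (F 0 x) (\<psi> x *\<^sub>R w)"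
      unfolding variation_field_def by (intro N.velocity_eq_cvec k)
    then show ?thesis using F0 x U by auto
  qed
  have V0: "variation_field N F x = 0" if x: "x \<in> M.P - K" for x
  proof -
    have k': "N.chart_at (f x) \<in> atlas N" "f x \<in> fst (N.chart_at (f x))" using N.chart_at[OF mp.f_pts] x by auto
    have "velocity (atlas N) (\<lambda>t. f x) = N.cvec (N.chart_at (f x)) (f x) 0"
      by (rule N.velocity_eq_cvec[OF k'(1), where \<gamma>="\<lambda>t. f x"]) (use k' in auto)
    then show ?thesis using x k' N.cvec_0 by (simp add: variation_field_def F_def)
  qed
  show ?thesis
  proof (rule that[of \<epsilon> F])
    show "smooth_variation M N f \<epsilon> F"
      unfolding smooth_variation_def using \<epsilon> Fsm F0 K V0 by (auto simp: case_prod_beta')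
  qed (use VU V0 in \<open>auto simp: U_def\<close>)
qed

end

section \<open>First variation of the energy\<close>

locale vol_variation = variation M N f \<epsilon> F + vm: riem_vol M
  for M :: "('a::{t2_space,second_countable_topology}, real^'n::{finite,wellorder}) sub_riem"
    and N :: "('b::{t2_space,second_countable_topology}, 'f::euclidean_space) riem" and f \<epsilon> F
begin

lemma density_deriv:
  assumes "x \<in> M.P" "t \<in> fam.I"
  shows "((\<lambda>s. density s x) has_real_derivative deriv (\<lambda>s. density s x) t) (at t)"
  using fam.family_deriv(1)[OF M.open_pts order_refl open_greaterThanLessThan order_refl density_smooth assms] by simp

lemma deriv_density_smooth: "smooth_fun_on fam.pA (M.P \<times> fam.I) (\<lambda>p. deriv (\<lambda>s. density s (fst p)) (snd p))"
  using fam.family_deriv(2)[OF M.open_pts order_refl open_greaterThanLessThan order_refl density_smooth] by simp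

lemma energy_deriv:
  "((\<lambda>t. hor_exp_energy M N (F t)) has_real_derivative (\<integral>x. deriv (\<lambda>s. density s x) 0 \<partial>riem_volume M)) (at 0)"
proof -
  \<comment> \<open>A closed interval inside the open one makes the domain compact, so that a
    constant dominates the time derivative of the density.\<close>
  let ?K = "M.P \<times> {- (\<epsilon>/2)..\<epsilon>/2}" and ?d = "\<lambda>t x. deriv (\<lambda>s. density s x) t"
  have "?K \<subseteq> M.P \<times> fam.I" using eps by auto
  then have "continuous_on ?K (\<lambda>p. ?d (snd p) (fst p))"
    by (rule continuous_on_subset[OF fam.pr.smooth_fun_onD(3)[OF deriv_density_smooth]])
  then have "bounded ((\<lambda>p. ?d (snd p) (fst p)) ` ?K)"
    by (intro compact_imp_bounded compact_continuous_image compact_Times vm.compact_P compact_Icc)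
  then obtain L where L: "\<And>x t. x \<in> M.P \<Longrightarrow> t \<in> {- (\<epsilon>/2)..\<epsilon>/2} \<Longrightarrow> \<bar>?d t x\<bar> \<le> L"
    unfolding bounded_iff by force
  have "integrable (riem_volume M) (density t)" if "\<bar>t\<bar> < \<epsilon>/2" for t
  proof (rule vm.integrable_vol)
    have t: "t \<in> fam.I" using that eps by auto
    show "continuous_on M.P (density t)"
      using M.smooth_fun_onD(3)[OF fam.family_slice_smooth[OF M.open_pts order_refl open_greaterThanLessThan order_refl density_smooth t]]
      by simp
  qed
  then have "((\<lambda>t. \<integral>x. density t x \<partial>riem_volume M) has_real_derivative (\<integral>x. ?d 0 x \<partial>riem_volume M)) (at 0)"
  proof (rule has_real_derivative_integral(1)[where \<delta>="\<epsilon>/2" and \<rho>'="?d" and B="\<lambda>x. L", rotated])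
    show "integrable (riem_volume M) (\<lambda>x. L)" by (intro vm.integrable_vol continuous_on_const)
    fix x t assume *: "x \<in> space (riem_volume M)" "\<bar>t\<bar> < \<epsilon>/2"
    show "((\<lambda>s. density s x) has_real_derivative ?d t x) (at t)"
      by (rule density_deriv) (use * in \<open>auto simp: abs_less_iff\<close>)
    show "\<bar>?d t x\<bar> \<le> L" by (rule L) (use * in \<open>auto simp: abs_less_iff\<close>)
  qed (use eps in auto)
  then show ?thesis by (simp add: hor_exp_energy_def density_def)
qed

text \<open>The pointwise formula solved for the pairing. Besides the first variation it also yields
  continuity and integrability of the pairing, since both terms on the right are continuous.\<close>

lemma tension_pairing:
  assumes x: "x \<in> M.P"
  shows "exp (dfH_norm2 M N f x / 2) * N.g (f x) (V x) (tauH M N f x)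
    = vm.dv (vf V) x - deriv (\<lambda>s. density s x) 0"
proof -
  note v = div_vf[of x V, OF x V_TS V_near]
  obtain S where S: "open S" "x \<in> S" "S \<subseteq> M.P" "adapted_frame_on M S (frame M x)"
    using M.frame_adapted[OF x] by blast
  have "vm.dv (vf V) x = divg (vf V) x"
    unfolding divg_def
    by (rule vm.dv_frame[OF x M.adapted_frameD(4)[OF S(1,3,4,2)] M.vfield_nearI[OF v(1) x]])
  then show ?thesis
    unfolding DERIV_imp_deriv[OF density_deriv_0[OF x]] using v(2) by (simp add: algebra_simps)
qed

lemma vf_V: "vfield_on (atlas M) M.P (vf V)"
proof (rule M.vfield_on_local)
  fix x assume x: "x \<in> M.P"
  from div_vf(1)[of x V, OF x V_TS V_near] x
  show "\<exists>T. x \<in> T \<and> T \<subseteq> M.P \<and> vfield_on (atlas M) T (vf V)" by blast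
qed

lemma continuous_deriv_density: "continuous_on M.P (\<lambda>x. deriv (\<lambda>s. density s x) 0)"
  using M.smooth_fun_onD(3)[OF fam.family_slice_smooth[OF M.open_pts order_refl open_greaterThanLessThan order_refl
    deriv_density_smooth zero_in_I]] by simp

lemma continuous_tension_pairing:
  "continuous_on M.P (\<lambda>x. exp (dfH_norm2 M N f x / 2) * N.g (f x) (V x) (tauH M N f x))"
proof -
  have "continuous_on M.P (\<lambda>x. vm.dv (vf V) x - deriv (\<lambda>s. density s x) 0)"
    by (intro continuous_on_diff continuous_deriv_density M.smooth_fun_onD(3)[OF vm.dv_smooth[OF vf_V]])
  then show ?thesis by (subst continuous_on_cong[OF refl tension_pairing])
qed

theorem first_variation:
  "((\<lambda>t. hor_exp_energy M N (F t)) has_real_derivative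
    - (\<integral>x. exp (dfH_norm2 M N f x / 2) * N.g (f x) (V x) (tauH M N f x) \<partial>riem_volume M)) (at 0)"
proof -
  have "(\<integral>x. exp (dfH_norm2 M N f x / 2) * N.g (f x) (V x) (tauH M N f x) \<partial>riem_volume M)
      = (\<integral>x. vm.dv (vf V) x - deriv (\<lambda>s. density s x) 0 \<partial>riem_volume M)"
    by (intro Bochner_Integration.integral_cong refl tension_pairing) simp
  also have "\<dots> = (\<integral>x. vm.dv (vf V) x \<partial>riem_volume M) - (\<integral>x. deriv (\<lambda>s. density s x) 0 \<partial>riem_volume M)"
    by (intro Bochner_Integration.integral_diff vm.integrable_vol continuous_deriv_density
        M.smooth_fun_onD(3)[OF vm.dv_smooth[OF vf_V]])
  finally show ?thesis using energy_deriv by (simp add: vm.divergence_theorem[OF vf_V])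
qed

end

section \<open>Critical points and the tension field\<close>

locale vol_energy_map = energy_map M N f + vm: riem_vol M
  for M :: "('a::{t2_space,second_countable_topology}, real^'n::{finite,wellorder}) sub_riem"
    and N :: "('b::{t2_space,second_countable_topology}, 'f::euclidean_space) riem" and f
begin

lemma vol_variationI: "smooth_variation M N f \<epsilon> F \<Longrightarrow> vol_variation M N f \<epsilon> F"
  by (intro vol_variation.intro variation.intro variation_axioms.intro energy_map_axioms vm.riem_vol_axioms)

abbreviation pairing :: "('a \<Rightarrow> 'b tvec) \<Rightarrow> 'a \<Rightarrow> real" where
  "pairing W x \<equiv> exp (dfH_norm2 M N f x / 2) * N.g (f x) (W x) (tauH M N f x)"

text \<open>The first variation serves only to produce a continuous function \<open>q\<close> that
  is positive at \<open>x0\<close>. The second has pairing \<open>\<theta> * q\<close>, which is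
  nonnegative everywhere and positive near \<open>x0\<close>, so its integral cannot vanish.\<close>

lemma tauH_eq_0_if_harmonic:
  assumes har: "exp_subelliptic_harmonic M N f" and x0: "x0 \<in> M.P"
  shows "tauH M N f x0 = 0"
proof (rule ccontr)
  assume nz: "tauH M N f x0 \<noteq> 0"
  have fx: "f x0 \<in> N.P" using mp.f_pts[OF x0] .
  obtain k where k: "k \<in> atlas N" "f x0 \<in> fst k" using N.in_pts_chart[OF fx] by blast
  obtain c where c: "c \<in> atlas M" "x0 \<in> fst c" using M.in_pts_chart[OF x0] by blast
  define U where "U = fst c \<inter> (M.P \<inter> f -` fst k)"
  have U: "open U" "x0 \<in> U" "U \<subseteq> fst c" "U \<subseteq> M.P" "f ` U \<subseteq> fst k"
    unfolding U_def using continuous_open_preimage[OF mp.mapD(4,1)] k c x0 by auto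
  \<comment> \<open>Coordinates of the tension field at the single point \<open>x0\<close>; they are
    kept constant over the chart.\<close>
  define w where "w = N.crd k (tauH M N f x0)"
  have w: "N.cvec k (f x0) w = tauH M N f x0" unfolding w_def by (rule N.cvec_crd[OF k tauH_TS[OF x0]])
  obtain \<psi> K where \<psi>: "smooth_fun_on (atlas M) M.P \<psi>" "\<psi> x0 > 0" "compact K" "K \<subseteq> U" "\<And>y. y \<in> M.P - K \<Longrightarrow> \<psi> y = 0"
    by (rule M.chart_bump[OF U(2,1,3) c(1)], rule that)
  have K: "K \<subseteq> M.P" "f ` K \<subseteq> fst k" using \<psi>(4) U(4,5) by blast+
  obtain \<epsilon> F where F: "smooth_variation M N f \<epsilon> F"
    "\<And>x. x \<in> M.P \<Longrightarrow> f x \<in> fst k \<Longrightarrow> variation_field N F x = N.cvec k (f x) (\<psi> x *\<^sub>R w)"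
    by (rule local_variation[OF k(1) \<psi>(3) K \<psi>(1,5), where w=w], assumption, rule that)
  \<comment> \<open>Away from \<open>x0\<close> the vector \<open>w\<close> need not point along the
    tension field, so the sign of \<open>q\<close> is known only near \<open>x0\<close>.\<close>
  define q where "q = pairing (variation_field N F)"
  have qc: "continuous_on M.P q"
    unfolding q_def by (rule vol_variation.continuous_tension_pairing[OF vol_variationI[OF F(1)]])
  have "q x0 = exp (dfH_norm2 M N f x0 / 2) * (\<psi> x0 * N.g (f x0) (tauH M N f x0) (tauH M N f x0))"
    unfolding q_def F(2)[OF x0 k(2)] N.cvec_scaleR[OF k] w
    using N.met_scale_left[OF fx tauH_TS[OF x0] tauH_TS[OF x0]] by simp
  then have q0: "q x0 > 0" using \<psi>(2) N.met_pos[OF fx tauH_TS[OF x0] nz] by simp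
  \<comment> \<open>The second bump is supported where \<open>q\<close> is positive.\<close>
  define W where "W = U \<inter> (M.P \<inter> q -` {0<..})"
  have W: "open W" "x0 \<in> W" "W \<subseteq> fst c" "W \<subseteq> U"
    unfolding W_def using U x0 q0 continuous_open_preimage[OF qc M.open_pts open_greaterThan] by auto
  obtain \<theta> L where \<theta>: "smooth_fun_on (atlas M) M.P \<theta>" "\<And>y. \<theta> y \<ge> 0" "\<theta> x0 > 0" "compact L" "L \<subseteq> W" "\<And>y. y \<in> M.P - L \<Longrightarrow> \<theta> y = 0"
    by (rule M.chart_bump[OF W(2,1,3) c(1)], rule that)
  have L: "L \<subseteq> M.P" "f ` L \<subseteq> fst k" using \<theta>(5) W(4) U(4,5) by blast+
  obtain \<epsilon>' F' where F': "smooth_variation M N f \<epsilon>' F'"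
    "\<And>x. x \<in> M.P \<Longrightarrow> f x \<in> fst k \<Longrightarrow> variation_field N F' x = N.cvec k (f x) ((\<theta> x * \<psi> x) *\<^sub>R w)"
    "\<And>x. x \<in> M.P - L \<Longrightarrow> variation_field N F' x = 0"
    by (rule local_variation[OF k(1) \<theta>(4) L M.smooth_fun_on_mult[OF \<theta>(1) \<psi>(1)], where w=w])
       (use \<theta>(6) in simp, rule that)
  \<comment> \<open>The pairing is linear in the variation vector, so the factor
    \<open>\<theta>\<close> comes out; off \<open>L\<close> both sides are 0.\<close>
  have q': "pairing (variation_field N F') x = \<theta> x * q x" if x: "x \<in> M.P" for x
  proof (cases "x \<in> L")
    case True
    then have kx: "f x \<in> fst k" using L by auto
    show ?thesis
      unfolding q_def F(2)[OF x kx] F'(2)[OF x kx] N.cvec_scaleR[OF k(1) kx]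
      using N.met_scale_left[OF mp.f_pts[OF x] N.cvec_in_TS[OF k(1) kx] tauH_TS[OF x]] by simp
  next
    case False
    then show ?thesis using x F'(3)[of x] \<theta>(6)[of x] N.met_0_left[OF mp.f_pts[OF x] tauH_TS[OF x]] by simp
  qed
  have ge: "\<theta> x * q x \<ge> 0" if "x \<in> M.P" for x
    using \<theta>(2)[of x] \<theta>(5) \<theta>(6)[of x] that by (cases "x \<in> L") (auto simp: W_def)
  have cont: "continuous_on M.P (\<lambda>x. \<theta> x * q x)"
    by (intro continuous_on_mult qc M.smooth_fun_onD(3)[OF \<theta>(1)])
  have "((\<lambda>t. hor_exp_energy M N (F' t)) has_real_derivative 0) (at 0)"
    using har F'(1) by (simp add: exp_subelliptic_harmonic_def)
  from DERIV_unique[OF this vol_variation.first_variation[OF vol_variationI[OF F'(1)]]]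
  have "(\<integral>x. pairing (variation_field N F') x \<partial>riem_volume M) = 0" by simp
  also have "(\<integral>x. pairing (variation_field N F') x \<partial>riem_volume M) = (\<integral>x. \<theta> x * q x \<partial>riem_volume M)"
    by (intro Bochner_Integration.integral_cong refl q') simp
  finally have "(\<integral>x. \<theta> x * q x \<partial>riem_volume M) = 0" .
  moreover have "AE x in riem_volume M. 0 \<le> \<theta> x * q x" by (rule AE_I2) (use ge in simp)
  ultimately have "AE x in riem_volume M. \<theta> x * q x = 0"
    using integral_nonneg_eq_0_iff_AE[OF vm.integrable_vol[OF cont]] by blast
  moreover define Z where "Z = M.P \<inter> (\<lambda>x. \<theta> x * q x) -` {0<..}"
  have Z: "open Z" "Z \<subseteq> M.P" "x0 \<in> Z"
    unfolding Z_def using continuous_open_preimage[OF cont M.open_pts open_greaterThan] x0 \<theta>(3) q0 by auto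
  have "{x \<in> space (riem_volume M). \<not> \<theta> x * q x = 0} = Z"
    unfolding Z_def using ge by (auto simp: less_le)
  ultimately have "emeasure (riem_volume M) Z = 0"
    using AE_iff_measurable[of Z "riem_volume M" "\<lambda>x. \<theta> x * q x = 0"] vm.sets_volI[OF borel_open[OF Z(1)] Z(2)] by simp
  then show False using vm.emeasure_vol_open_pos[OF Z] by simp
qed

lemma harmonic_if_tauH_eq_0:
  assumes "\<forall>x\<in>M.P. tauH M N f x = 0"
  shows "exp_subelliptic_harmonic M N f"
  unfolding exp_subelliptic_harmonic_def smooth_map_def
proof (intro conjI allI impI mp.smooth)
  fix \<epsilon> F assume "smooth_variation M N f \<epsilon> F"
  then interpret vv: vol_variation M N f \<epsilon> F by (rule vol_variationI)
  have "(\<integral>x. pairing vv.V x \<partial>riem_volume M) = (\<integral>x. 0 \<partial>riem_volume M)"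
    by (intro Bochner_Integration.integral_cong refl) (use assms N.met_0_right[OF mp.f_pts vv.V_TS] in simp)
  then show "((\<lambda>t. hor_exp_energy M N (F t)) has_real_derivative 0) (at 0)"
    using vv.first_variation by simp
qed

end

theorem theorem2p3:
  fixes M :: "('a::{t2_space,second_countable_topology}, real^'n::{finite,wellorder}) sub_riem"
    and N :: "('b::{t2_space,second_countable_topology}, 'f::euclidean_space) riem"
    and f :: "'a \<Rightarrow> 'b"
    and m d :: nat
  assumes M: "sub_riemannian_manifold M" "hrank M = m" "CARD('n) = m + d"
    and "compact (pts (atlas M))" "connected (pts (atlas M))"
    and N: "riemannian_manifold N"
    and f: "smooth_map M N f"
  shows "(\<forall>\<epsilon> F. smooth_variation M N f \<epsilon> F \<longrightarrow>
            ((\<lambda>t. hor_exp_energy M N (F t)) has_real_derivative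
              - (\<integral>x. exp (dfH_norm2 M N f x / 2) * met N (f x) (variation_field N F x) (tauH M N f x)
                   \<partial>riem_volume M)) (at 0))
       \<and> (exp_subelliptic_harmonic M N f \<longleftrightarrow> (\<forall>x\<in>pts (atlas M). tauH M N f x = 0))"
proof -
  have riemM: "riemannian_manifold M" and subb: "smooth_subbundle (atlas M) (hrank M) (hor M)"
    using M(1) by (auto simp: sub_riemannian_manifold_def)
  interpret Mr: riem_mfd M
    by unfold_locales (use riemM in \<open>auto simp: riemannian_manifold_def\<close>)
  interpret Ms: sub_riem_mfd M
    by unfold_locales (use subb M(2,3) in auto)
  interpret Nr: riem_mfd N
    by unfold_locales (use N in \<open>auto simp: riemannian_manifold_def\<close>)
  interpret E: vol_energy_map M N f
    by unfold_locales (use f assms(4) in \<open>auto simp: smooth_map_def\<close>)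
  show ?thesis
    using vol_variation.first_variation[OF E.vol_variationI] E.tauH_eq_0_if_harmonic E.harmonic_if_tauH_eq_0 by blast
qed

end
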